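(* Let $n\ge2$. If $K\subset\mathbb{R}^n$ is compact and the strip energy $E_K(t)$ is finite for some $t>0$, then $E_K(t)$ is continuously differentiable for all $t>0$, with $$\big(t\,E_K(t)\big)'=2a_n\int_{S(t)}\left(\frac{\partial U_t}{\partial z}\right)^{2}dx\,dz ,$$ where $U_t(\hat x)=\int_K G_t(\hat x,\hat y)\,d\mu_t(\hat y)$ is the unique equilibrium potential of $K$ on the strip $S(t)$ and $a_n=\dfrac{1}{(n-1)|\mathbb{S}^n|}$.
   Context: $|\mathbb{S}^n|$ is the surface area of the unit sphere in $\mathbb{R}^{n+1}$. For $t>0$ let $S(t)=\mathbb{R}^n\times(-t,t)\subset\mathbb{R}^{n+1}$, with points $\hat x=(x,z)$, $\hat y=(y,w)$; $\mathbb{R}^n$ is identified with $\mathbb{R}^n\times\{0\}$. For $j\in\mathbb{Z}$ put $\rho_j(y,w)=(y,\,2tj+(-1)^jw)$. The Neumann strip kernel on $\overline{S(t)}$ is $$G_t(\hat x,\hat y)=\sum_{j\in\mathbb{Z}}\frac{1}{|\hat x-\rho_j(\hat y)|^{n-1}}\quad(n\ge3),$$ $$G_t(\hat x,\hat y)=\frac{1}{|\hat x-\hat y|}+\sum_{j\ne0}\left(\frac{1}{|\hat x-\rho_j(\hat y)|}-\frac{1}{|2tj|}\right)+\frac1t\big(\gamma-\log(4t)\big)\quad(n=2),$$ with $\gamma$ the Euler–Mascheroni constant. For a nonempty compact $K\subset S(t)$ the strip energy is $E_K(t)=\min_\mu\int_K\int_K G_t(\hat x,\hat y)\,d\mu(\hat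 x)\,d\mu(\hat y)$, the minimum being over Borel probability measures $\mu$ on $K$ ($E_\emptyset(t)=+\infty$). A minimizing measure is called an equilibrium measure and denoted $\mu_t$; it is unique when $K\subset\mathbb{R}^n$ and $E_K(t)<\infty$. *)

theory Defs
  imports "HOL-Probability.Probability"
begin

(* Points of R^(n+1) are pairs (x, z) :: (real^'n) \<times> real with CARD('n) = n; the norm and
   distance of the product type are the Euclidean ones. *)

definition strip :: "real \<Rightarrow> ((real^'n) \<times> real) set" where
  "strip t = UNIV \<times> {-t<..<t}"

definition strip_refl :: "real \<Rightarrow> int \<Rightarrow> (real^'n) \<times> real \<Rightarrow> (real^'n) \<times> real" where
  "strip_refl t j p = (fst p, 2 * t * of_int j + (-1) powi j * snd p)"

(* A vanishing denominator means the value \<infinity>; it is treated separately because 1 / 0 = 0 on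
   the reals.  Off these singularities every series converges absolutely when CARD('n) \<ge> 2. *)
definition strip_kernel :: "real \<Rightarrow> (real^'n) \<times> real \<Rightarrow> (real^'n) \<times> real \<Rightarrow> ereal" where
  "strip_kernel t p q =
     (if \<exists>j. p = strip_refl t j q then \<infinity>
      else if CARD('n) = 2 then
        ereal (1 / dist p q
          + (\<Sum>\<^sub>\<infinity>j\<in>- {0}. 1 / dist p (strip_refl t j q) - 1 / \<bar>2 * t * of_int j\<bar>)
          + (euler_mascheroni - ln (4 * t)) / t)
      else ereal (\<Sum>\<^sub>\<infinity>j\<in>UNIV. 1 / dist p (strip_refl t j q) ^ (CARD('n) - 1)))"

(* The integral of an extended real function as the difference of the integrals of its positive
   and negative parts.  It is used for functions that are bounded below, so \<infinity> - \<infinity> does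
   not occur. *)
definition ereal_integral :: "'a measure \<Rightarrow> ('a \<Rightarrow> ereal) \<Rightarrow> ereal" where
  "ereal_integral M f =
     enn2ereal (\<integral>\<^sup>+ x. e2ennreal (f x) \<partial>M) - enn2ereal (\<integral>\<^sup>+ x. e2ennreal (- f x) \<partial>M)"

definition borel_prob_measures :: "'a::topological_space set \<Rightarrow> 'a measure set" where
  "borel_prob_measures K = {\<mu>. prob_space \<mu> \<and> sets \<mu> = sets (restrict_space borel K)}"

definition measure_energy :: "real \<Rightarrow> ((real^'n) \<times> real) measure \<Rightarrow> ereal" where
  "measure_energy t \<mu> = ereal_integral \<mu> (\<lambda>q. ereal_integral \<mu> (\<lambda>p. strip_kernel t p q))"

(* For K = {} this is \<infinity>. *)
definition strip_energy :: "real \<Rightarrow> ((real^'n) \<times> real) set \<Rightarrow> ereal" where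
  "strip_energy t K = (INF \<mu>\<in>borel_prob_measures K. measure_energy t \<mu>)"

definition is_equilibrium_measure ::
    "real \<Rightarrow> ((real^'n) \<times> real) set \<Rightarrow> ((real^'n) \<times> real) measure \<Rightarrow> bool" where
  "is_equilibrium_measure t K \<mu> \<longleftrightarrow>
     \<mu> \<in> borel_prob_measures K \<and> measure_energy t \<mu> = strip_energy t K"

definition equilibrium_measure ::
    "real \<Rightarrow> ((real^'n) \<times> real) set \<Rightarrow> ((real^'n) \<times> real) measure" where
  "equilibrium_measure t K = (THE \<mu>. is_equilibrium_measure t K \<mu>)"

definition equilibrium_potential ::
    "real \<Rightarrow> ((real^'n) \<times> real) set \<Rightarrow> (real^'n) \<times> real \<Rightarrow> ereal" where
  "equilibrium_potential t K p = ereal_integral (equilibrium_measure t K) (\<lambda>q. strip_kernel t p q)"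

(* The classical derivative in the last variable.  For K \<subseteq> R^n \<times> {0} the equilibrium
   potential is smooth on the strip off the Lebesgue null set K. *)
definition dz :: "((real^'n) \<times> real \<Rightarrow> ereal) \<Rightarrow> (real^'n) \<times> real \<Rightarrow> real" where
  "dz U p = deriv (\<lambda>s. real_of_ereal (U (fst p, s))) (snd p)"

(* Surface area of the unit sphere in R^(n+1); see the two lemmas below. *)
definition sphere_area :: "nat \<Rightarrow> real" where
  "sphere_area n = 2 * pi powr (real (n + 1) / 2) / Gamma (real (n + 1) / 2)"

lemma sphere_area_eq_ball_volume: "sphere_area n = real (n + 1) * unit_ball_vol (real (n + 1))"
proof -
  define a where "a = real (n + 1) / 2"
  have "a > 0" by (simp add: a_def)
  then have "Gamma (a + 1) = a * Gamma a" "Gamma a > 0"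
    by (auto intro!: Gamma_plus1 dest: nonpos_Ints_nonpos)
  moreover have "real (n + 1) = 2 * a" by (simp add: a_def)
  ultimately show ?thesis
    using \<open>a > 0\<close> unfolding sphere_area_def unit_ball_vol_def by simp
qed

lemma sphere_area_eq_ball_volume_derivative:
  assumes "DIM('a::euclidean_space) = n + 1"
  shows "((\<lambda>r. measure lborel (cball (0::'a) r)) has_real_derivative sphere_area n) (at 1)"
proof -
  have "((\<lambda>r::real. unit_ball_vol (real (n + 1)) * r ^ (n + 1)) has_real_derivative sphere_area n) (at 1)"
    unfolding sphere_area_eq_ball_volume by (auto intro!: derivative_eq_intros)
  moreover have "eventually (\<lambda>r::real. unit_ball_vol (real (n + 1)) * r ^ (n + 1)
      = measure lborel (cball (0::'a) r)) (nhds 1)"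
    by (rule eventually_nhds_in_open[of "{0<..}", THEN eventually_mono])
       (auto simp: content_cball assms)
  ultimately show ?thesis
    by (subst (asm) DERIV_cong_ev) auto
qed

end

(*
  Put m = n - 1.  On the plane z = 0 the strip kernel is |x - y|^(-m) + H_t(|x - y|) with H_t
  continuous, also in t.  The Poisson kernels pois m r s = s / (r^2 + s^2)^((m+2)/2) form a
  convolution semigroup up to the factor |S^n| / 2, and |x - y|^(-m) is the integral of
  m * pois m |x - y| s over s > 0; hence the energy is a superposition of squares of L^2 norms of
  Poisson integrals, strictly convex, and the minimiser mu_t is unique.  By weak compactness the
  double integrals of continuous kernels against mu_t are continuous in t, and the envelope argument
  gives E'(t) as the double integral of dH_t/dt.

  For the other side, dU_t/dz at height z > 0 is -m times the sum over j of the Poisson integrals of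
  mu_t at heights 2tj + z (j >= 0) minus those at heights 2tj - z (j >= 1).  By the semigroup law the
  product of two terms integrates over R^n to a value of phi(s), the double integral of
  pois m |x - y| s, at a height that depends only on i + j and z.  In the Cauchy product the
  z-integrals of phi over consecutive intervals telescope, and what remains is the energy of
  |x - y|^(-m) plus the double integral of d(t H_t)/dt, which is (t E(t))'.
*)
theory Submission
  imports Defs "HOL-Complex_Analysis.Great_Picard"
begin

subsection \<open>Gaussian integrals and the Poisson kernel\<close>

text \<open>Three points shape the argument. The semigroup law is proved by subordination instead of
  Fourier transforms: a Poisson kernel is a Gamma mixture of Gaussians, Gaussians convolve
  explicitly, and the integral that remains, over the ratio of the two mixing parameters, is of
  Cauchy-Schloemilch type. For n = 2 the kernel decays only like 1/s: the image series must be
  regularised, and a single Poisson integral at height s has L^2 norm of order 1/s, too slow to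
  square the series for dU/dz term by term. Pairing the heights 2tj + z and 2tj - z gains a factor
  1/j and makes the Cauchy product absolutely summable in L^1. The telescoping also leaves boundary
  terms of the form p F(2tp), with F(h) the double integral of the kernel at height h; for n = 2
  they do not vanish, and together they tend to -1/t, the derivative of gamma - log(4t). Finally,
  the regular part H_t is bounded on compact sets, so finiteness of the energy of a measure does not
  depend on t, and the minimisation runs over one fixed class of measures.\<close>

lemma gaussian_nn_integral:
  fixes k c :: real assumes k: "k > 0"
  shows "(\<integral>\<^sup>+x. ennreal (exp (- k * (x - c)\<^sup>2)) \<partial>lborel) = ennreal (sqrt (pi / k))"
proof -
  define \<sigma> where "\<sigma> = sqrt (1 / (2 * k))"
  have s: "\<sigma> > 0" "\<sigma>\<^sup>2 = 1 / (2 * k)" using k by (auto simp: \<sigma>_def)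
  have eq: "exp (- k * (x - c)\<^sup>2) = sqrt (pi / k) * normal_density c \<sigma> x" for x
    using s k by (simp add: normal_density_def)
  have "(\<integral>\<^sup>+x. ennreal (normal_density c \<sigma> x) \<partial>lborel) = 1"
    using integrable_normal_density[OF s(1), of c] integral_normal_density[OF s(1), of c]
    by (subst nn_integral_eq_integral) (auto simp: normal_density_nonneg)
  then show ?thesis
    unfolding eq using k
    by (subst ennreal_mult) (auto simp: normal_density_nonneg nn_integral_cmult)
qed

text \<open>The squared norm splits over an orthonormal basis, and each coordinate is a Gaussian
  after completing the square. The case \<open>k = 0\<close> is included because it gives the plain
  Gaussian integral needed for the mass of the Poisson kernel.\<close>

lemma gaussian_convolution:
  fixes x :: "'a::euclidean_space" and l k :: real
  assumes l: "l > 0" and k: "k \<ge> 0"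
  shows "(\<integral>\<^sup>+y. ennreal (exp (- l * (norm (x - y))\<^sup>2 - k * (norm y)\<^sup>2)) \<partial>lborel)
    = ennreal ((pi / (l + k)) powr (DIM('a) / 2) * exp (- (l * k / (l + k)) * (norm x)\<^sup>2))"
proof -
  have lk: "l + k > 0" using l k by simp
  have nsq: "(norm z)\<^sup>2 = (\<Sum>b\<in>Basis. (z \<bullet> b)\<^sup>2)" for z :: 'a
    unfolding power2_norm_eq_inner by (subst euclidean_inner) (simp add: power2_eq_square)
  define f where "f b t = ennreal (exp (- l * (x \<bullet> b - t)\<^sup>2 - k * t\<^sup>2))" for b t
  have eq: "ennreal (exp (- l * (norm (x - y))\<^sup>2 - k * (norm y)\<^sup>2)) = (\<Prod>b\<in>Basis. f b (y \<bullet> b))" for y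
    unfolding f_def nsq
    by (simp add: prod_ennreal sum_distrib_left exp_sum[symmetric] sum_subtractf[symmetric] inner_diff_left
        flip: sum_negf)
  have 1: "(\<integral>\<^sup>+t. f b t \<partial>lborel) = ennreal (sqrt (pi / (l + k)) * exp (- (l * k / (l + k)) * (x \<bullet> b)\<^sup>2))" for b
  proof -
    let ?a = "x \<bullet> b"
    \<comment> \<open>Completing the square in \<open>t\<close>; the centre is the mean of
      \<open>?a\<close> and 0 with weights \<open>l\<close> and \<open>k\<close>.\<close>
    have *: "- l * (?a - t)\<^sup>2 - k * t\<^sup>2
        = - (l * k / (l + k)) * ?a\<^sup>2 + - (l + k) * (t - l * ?a / (l + k))\<^sup>2" for t
    proof -
      define d where "d = l + k"
      define c where "c = l * ?a / d"
      have d: "d > 0" and dc: "d * c = l * ?a" using lk by (auto simp: d_def c_def)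
      have e1: "l * k / d * ?a\<^sup>2 = k * ?a * c" by (simp add: c_def power2_eq_square)
      have e2: "k * ?a * c = d * ?a * c - l * ?a * c" by (simp add: d_def algebra_simps)
      have "- (l * k / d) * ?a\<^sup>2 + - d * (t - c)\<^sup>2
          = - (d * c) * ?a + l * ?a * c - d * t\<^sup>2 + 2 * (d * c) * t - (d * c) * c"
        unfolding mult_minus_left e1 e2 by (simp add: algebra_simps power2_eq_square)
      also have "\<dots> = - l * (?a - t)\<^sup>2 - k * t\<^sup>2"
        unfolding dc by (simp add: d_def algebra_simps power2_eq_square)
      finally show ?thesis by (simp add: d_def c_def)
    qed
    have "(\<integral>\<^sup>+t. f b t \<partial>lborel) = (\<integral>\<^sup>+t. ennreal (exp (- (l * k / (l + k)) * ?a\<^sup>2)) *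
        ennreal (exp (- (l + k) * (t - l * ?a / (l + k))\<^sup>2)) \<partial>lborel)"
      unfolding f_def * exp_add by (simp add: ennreal_mult)
    also have "\<dots> = ennreal (exp (- (l * k / (l + k)) * ?a\<^sup>2)) * ennreal (sqrt (pi / (l + k)))"
      by (subst nn_integral_cmult) (simp_all only: gaussian_nn_integral[OF lk], measurable)
    finally show ?thesis using lk by (simp add: ennreal_mult mult.commute)
  qed
  have "(\<integral>\<^sup>+y. ennreal (exp (- l * (norm (x - y))\<^sup>2 - k * (norm y)\<^sup>2)) \<partial>lborel)
      = (\<Prod>b\<in>Basis. \<integral>\<^sup>+t. f b t \<partial>lborel)"
    unfolding eq by (rule nn_integral_lborel_prod) (auto simp: f_def)
  also have "\<dots> = ennreal (\<Prod>b\<in>(Basis::'a set). sqrt (pi / (l + k)) * exp (- (l * k / (l + k)) * (x \<bullet> b)\<^sup>2))"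
    unfolding 1 using lk by (subst prod_ennreal) auto
  also have "(\<Prod>b\<in>(Basis::'a set). sqrt (pi / (l + k)) * exp (- (l * k / (l + k)) * (x \<bullet> b)\<^sup>2))
     = (pi / (l + k)) powr (DIM('a) / 2) * exp (- (l * k / (l + k)) * (norm x)\<^sup>2)"
    using lk by (simp add: prod.distrib nsq exp_sum[symmetric] sum_distrib_left powr_half_sqrt[symmetric]
        powr_realpow[symmetric] powr_powr del: powr_realpow flip: sum_negf)
  finally show ?thesis .
qed

lemma gamma_nn_integral:
  fixes p X :: real assumes p: "p > 0" and X: "X > 0"
  shows "(\<integral>\<^sup>+l. ennreal (l powr (p - 1) * exp (- l * X)) * indicator {0<..} l \<partial>lborel)
    = ennreal (Gamma p * X powr (- p))"
proof -
  have "ennreal (Gamma p) = (\<integral>\<^sup>+t. ennreal (indicator {0..} t * t powr (p - 1) / exp t) \<partial>lborel)"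
    by (rule Gamma_conv_nn_integral_real[OF p])
  also have "\<dots> = ennreal \<bar>X\<bar> * (\<integral>\<^sup>+l. ennreal (indicator {0..} (0 + X * l) * (0 + X * l) powr (p - 1) / exp (0 + X * l)) \<partial>lborel)"
    using X by (intro nn_integral_real_affine) auto
  also have "(\<integral>\<^sup>+l. ennreal (indicator {0..} (0 + X * l) * (0 + X * l) powr (p - 1) / exp (0 + X * l)) \<partial>lborel)
    = (\<integral>\<^sup>+l. ennreal (X powr (p - 1)) * (ennreal (l powr (p - 1) * exp (- l * X)) * indicator {0<..} l) \<partial>lborel)"
  proof (intro nn_integral_cong)
    fix l :: real
    show "ennreal (indicator {0..} (0 + X * l) * (0 + X * l) powr (p - 1) / exp (0 + X * l))
      = ennreal (X powr (p - 1)) * (ennreal (l powr (p - 1) * exp (- l * X)) * indicator {0<..} l)"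
      using X by (cases "l > 0"; cases "l = 0")
        (auto simp: powr_mult ennreal_mult[symmetric] exp_minus field_simps indicator_def zero_le_mult_iff)
  qed
  also have "\<dots> = ennreal (X powr (p - 1)) * (\<integral>\<^sup>+l. (ennreal (l powr (p - 1) * exp (- l * X)) * indicator {0<..} l) \<partial>lborel)"
    by (rule nn_integral_cmult) measurable
  finally have *: "ennreal (Gamma p) = ennreal \<bar>X\<bar> * (ennreal (X powr (p - 1)) * (\<integral>\<^sup>+l. (ennreal (l powr (p - 1) * exp (- l * X)) * indicator {0<..} l) \<partial>lborel))" (is "_ = _ * (_ * ?I)") .
  have "ennreal (X powr (-p)) * ennreal (Gamma p) = ennreal (X powr (-p) * X * X powr (p - 1)) * ?I"
    unfolding * using X by (simp add: ennreal_mult mult.assoc)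
  also have "X powr (-p) * X * X powr (p - 1) = 1"
    using X by (simp add: powr_minus powr_diff field_simps)
  finally show ?thesis using X Gamma_real_pos[OF p] by (simp add: ennreal_mult mult.commute)
qed

text \<open>The map \<open>g v = u * sqrt v - s / sqrt v\<close> is a bijection of (0, oo) onto the
  line with (g v)^2 = s^2/v + u^2 v - 2 s u, so substitution turns the integral into a Gaussian one.
  Its derivative produces only the combination (u v + s) v^(-3/2). The two summands have equal
  integrals, because an involution of (0, oo) exchanges them; hence they may be reweighted by 1/u
  and 1/s.\<close>

lemma cauchy_schloemilch:
  fixes k s u :: real
  assumes k: "k > 0" and s: "s > 0" and u: "u > 0"
  shows "(\<integral>\<^sup>+v. ennreal ((1 + v) * v powr (-3/2) * exp (- k * (s\<^sup>2 / v + u\<^sup>2 * v))) * indicator {0<..} v \<partial>lborel)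
    = ennreal (sqrt (pi / k) * (1 / u + 1 / s) * exp (- 2 * k * s * u))"
proof -
  define S where "S = {0::real<..}"
  define e where "e v = exp (- k * (s\<^sup>2 / v + u\<^sup>2 * v))" for v
  define g where "g v = u * sqrt v - s / sqrt v" for v
  define g' where "g' v = (u * v + s) * v powr (-3/2) / 2" for v
  have p32: "v powr (-(3/2)) = 1 / (v * sqrt v)" if "v > 0" for v
  proof -
    have "v powr (-(3/2)) = v powr (-1) * v powr (-(1/2))" by (subst powr_add[symmetric]) simp
    then show ?thesis using that by (simp add: powr_minus powr_half_sqrt field_simps)
  qed
  have S: "S \<in> sets lebesgue" by (auto simp: S_def)
  have dg: "(g has_field_derivative g' v) (at v within S)" if "v \<in> S" for v
    using that unfolding g_def g'_def
    by (auto simp: S_def p32 intro!: derivative_eq_intros) (simp add: field_simps)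
  have inj: "inj_on g S"
  proof
    fix a b assume ab: "a \<in> S" "b \<in> S" "g a = g b"
    have "(p - q) * (u + s / (p * q)) = (u * p - s / p) - (u * q - s / q)" if "p > 0" "q > 0" for p q
      using that by (simp add: field_simps)
    from this[of "sqrt a" "sqrt b"] have "(sqrt a - sqrt b) * (u + s / (sqrt a * sqrt b)) = g a - g b"
      using ab by (simp add: g_def S_def)
    moreover have "u + s / (sqrt a * sqrt b) > 0" using ab u s by (intro add_pos_pos) (auto simp: S_def)
    ultimately show "a = b" using ab(3) by auto
  qed
  have img: "g ` S = UNIV"
  proof (intro set_eqI iffI UNIV_I)
    fix y :: real
    \<comment> \<open>The positive root of u w^2 - y w - s = 0, which is the equation
      \<open>g (w^2) = y\<close> cleared of its denominator.\<close>
    define w where "w = (y + sqrt (y\<^sup>2 + 4 * u * s)) / (2 * u)"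
    have "\<bar>y\<bar> < sqrt (y\<^sup>2 + 4 * u * s)" using u s by (intro real_less_rsqrt) auto
    then have w: "w > 0" unfolding w_def using u by auto
    have q: "u * w\<^sup>2 - y * w - s = 0"
    proof -
      have "(2 * u * w - y)\<^sup>2 = y\<^sup>2 + 4 * u * s" using u s by (simp add: w_def)
      then have "4 * u * (u * w\<^sup>2 - y * w - s) = 0" by (simp add: algebra_simps power2_eq_square)
      then show ?thesis using u by simp
    qed
    have "g (w\<^sup>2) = y" using w q by (simp add: g_def field_simps power2_eq_square)
    then show "y \<in> g ` S" using w by (auto simp: S_def intro!: image_eqI[of _ _ "w\<^sup>2"])
  qed
  have gauss: "(\<lambda>x. exp (- k * x\<^sup>2)) absolutely_integrable_on UNIV"
      "integral UNIV (\<lambda>x. exp (- k * x\<^sup>2)) = sqrt (pi / k)"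
  proof -
    have "has_bochner_integral lborel (\<lambda>x. exp (- k * x\<^sup>2)) (sqrt (pi / k))"
      using gaussian_nn_integral[OF k, of 0] k by (intro has_bochner_integral_nn_integral) auto
    then have "integrable lborel (\<lambda>x. exp (- k * x\<^sup>2))" "integral\<^sup>L lborel (\<lambda>x. exp (- k * x\<^sup>2)) = sqrt (pi / k)"
      by (auto simp: has_bochner_integral_iff)
    then show "(\<lambda>x. exp (- k * x\<^sup>2)) absolutely_integrable_on UNIV"
      "integral UNIV (\<lambda>x. exp (- k * x\<^sup>2)) = sqrt (pi / k)"
      by (auto simp: set_integrable_def integrable_completion integral_lborel[symmetric])
  qed
  have cov: "(\<lambda>v. \<bar>g' v\<bar> * exp (- k * (g v)\<^sup>2)) absolutely_integrable_on S \<and>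
      integral S (\<lambda>v. \<bar>g' v\<bar> * exp (- k * (g v)\<^sup>2)) = sqrt (pi / k)"
    using gauss by (subst has_absolute_integral_change_of_variables_1'[OF S dg inj]) (auto simp: img)
  have eq: "\<bar>g' v\<bar> * exp (- k * (g v)\<^sup>2) = exp (2 * k * s * u) / 2 * ((u * v + s) * v powr (-3/2) * e v)" if "v \<in> S" for v
  proof -
    have gv: "(g v)\<^sup>2 = u\<^sup>2 * v + s\<^sup>2 / v - 2 * s * u"
      using that by (simp add: g_def S_def power2_diff power_divide power_mult_distrib)
    have *: "- k * (g v)\<^sup>2 = 2 * k * s * u + (- k * (s\<^sup>2 / v + u\<^sup>2 * v))"
      unfolding gv by (simp add: algebra_simps)
    show ?thesis unfolding * exp_add e_def using that u s by (simp add: g'_def S_def)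
  qed
  define F where "F v = (u * v + s) * v powr (-3/2) * e v" for v
  define c where "c = 2 * sqrt (pi / k) * exp (- 2 * k * s * u)"
  have "(\<lambda>v. exp (2 * k * s * u) / 2 * F v) absolutely_integrable_on S \<and>
      integral S (\<lambda>v. exp (2 * k * s * u) / 2 * F v) = sqrt (pi / k)"
    using cov eq unfolding F_def
    by (metis (no_types, lifting) Henstock_Kurzweil_Integration.integral_cong set_integrable_cong)
  then have F: "F absolutely_integrable_on S" and Fi: "integral S F = c"
    by (auto simp: c_def exp_minus field_simps)
  define A where "A v = u * v powr (-1/2) * e v" for v
  define B where "B v = s * v powr (-3/2) * e v" for v
  have FAB: "F v = A v + B v" if "v \<in> S" for v
  proof -
    have "v powr (-1/2) = v * v powr (-3/2)" using that by (simp add: S_def powr_mult_base)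
    then show ?thesis by (simp add: F_def A_def B_def algebra_simps)
  qed
  have Abnn: "A v \<ge> 0" "B v \<ge> 0" for v using u s by (auto simp: A_def B_def e_def)
  have Bi: "B absolutely_integrable_on S"
  proof (rule measurable_bounded_by_integrable_imp_absolutely_integrable[OF _ S set_lebesgue_integral_eq_integral(1)[OF F]])
    show "B \<in> borel_measurable (lebesgue_on S)"
    proof -
      have "B \<in> borel_measurable borel" unfolding B_def e_def by measurable
      then show ?thesis by (simp add: measurable_completion measurable_restrict_space1)
    qed
    show "norm (B v) \<le> F v" if "v \<in> S" for v using FAB[OF that] Abnn[of v] by auto
  qed
  \<comment> \<open>This involution fixes \<open>e\<close>, and with its Jacobian it carries
    \<open>B\<close> to \<open>A\<close>. So \<open>A\<close> and \<open>B\<close> each have half of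
    the integral of \<open>F\<close>.\<close>
  define h where "h v = s\<^sup>2 / (u\<^sup>2 * v)" for v
  have hder: "(h has_field_derivative (- s\<^sup>2 / (u\<^sup>2 * v\<^sup>2))) (at v within S)" if "v \<in> S" for v
    using that u unfolding h_def S_def by (auto intro!: derivative_eq_intros simp: power2_eq_square)
  have hinj: "inj_on h S" using u s by (auto simp: inj_on_def h_def S_def)
  have himg: "h ` S = S"
  proof -
    have "h (h v) = v" "h v \<in> S" if "v \<in> S" for v using that u s by (auto simp: h_def S_def)
    then show ?thesis by (metis image_eqI image_subsetI subsetI subset_antisym)
  qed
  have hB: "\<bar>- s\<^sup>2 / (u\<^sup>2 * v\<^sup>2)\<bar> * B (h v) = A v" if "v \<in> S" for v
  proof -
    have v: "v > 0" using that by (simp add: S_def)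
    have "e (h v) = e v" using v u s by (simp add: e_def h_def field_simps)
    moreover have "h v > 0" using v u s by (simp add: h_def)
    moreover have "sqrt (h v) = s / (u * sqrt v)" using v u s by (simp add: h_def real_sqrt_divide real_sqrt_mult)
    moreover have "v powr (-1/2) = 1 / sqrt v" using v by (simp add: powr_minus powr_half_sqrt[symmetric] field_simps)
    ultimately show ?thesis unfolding A_def B_def using v u s
      by (simp add: p32) (simp add: h_def power2_eq_square field_simps)
  qed
  have AB: "A absolutely_integrable_on S \<and> integral S A = integral S B"
  proof -
    have "(\<lambda>v. \<bar>- s\<^sup>2 / (u\<^sup>2 * v\<^sup>2)\<bar> * B (h v)) absolutely_integrable_on S \<and>
      integral S (\<lambda>v. \<bar>- s\<^sup>2 / (u\<^sup>2 * v\<^sup>2)\<bar> * B (h v)) = integral S B"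
      by (subst has_absolute_integral_change_of_variables_1'[OF S hder hinj]) (auto simp: himg Bi)
    then show ?thesis using hB
      by (metis (no_types, lifting) Henstock_Kurzweil_Integration.integral_cong set_integrable_cong)
  qed
  have Ai: "A integrable_on S" and Bi': "B integrable_on S"
    using AB Bi by (auto intro: set_lebesgue_integral_eq_integral)
  have "integral S F = integral S A + integral S B"
    using FAB Ai Bi' by (simp add: Henstock_Kurzweil_Integration.integral_add[symmetric] cong: Henstock_Kurzweil_Integration.integral_cong)
  then have "integral S A = c / 2" "integral S B = c / 2" using AB Fi by auto
  then have "(A has_integral c / 2) S" "(B has_integral c / 2) S"
    using Ai Bi' by (metis integrable_integral)+
  then have "((\<lambda>v. A v / u + B v / s) has_integral (c / 2 / u + c / 2 / s)) S"
    by (intro has_integral_add has_integral_divide)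
  then have "(\<integral>\<^sup>+v. ennreal (indicator S v * (A v / u + B v / s)) \<partial>lborel) = ennreal (c / 2 / u + c / 2 / s)"
    by (intro nn_integral_has_integral_lebesgue) (use Abnn u s in auto)
  also have "(\<integral>\<^sup>+v. ennreal (indicator S v * (A v / u + B v / s)) \<partial>lborel) =
     (\<integral>\<^sup>+v. ennreal ((1 + v) * v powr (-3/2) * exp (- k * (s\<^sup>2 / v + u\<^sup>2 * v))) * indicator {0<..} v \<partial>lborel)"
  proof (intro nn_integral_cong)
    fix v :: real
    have "v powr (-1/2) = v * v powr (-3/2)" if "v > 0" using that by (simp add: powr_mult_base)
    then show "ennreal (indicator S v * (A v / u + B v / s)) =
      ennreal ((1 + v) * v powr (-3/2) * exp (- k * (s\<^sup>2 / v + u\<^sup>2 * v))) * indicator {0<..} v"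
      using u s by (cases "v > 0") (auto simp: S_def A_def B_def e_def algebra_simps)
  qed
  finally show ?thesis by (simp add: c_def algebra_simps)
qed

section \<open>Poisson kernels as Gaussian mixtures and their semigroup law\<close>

definition newt :: "nat \<Rightarrow> real \<Rightarrow> real \<Rightarrow> real" where
  "newt m r s = 1 / sqrt (r\<^sup>2 + s\<^sup>2) ^ m"

text \<open>The Poisson kernel of the half space over R^(m+1) without its normalising constant. It
  is -1/m times the derivative of \<open>newt\<close> in the height, and it is odd in the
  height.\<close>

definition pois :: "nat \<Rightarrow> real \<Rightarrow> real \<Rightarrow> real" where
  "pois m r s = s / sqrt (r\<^sup>2 + s\<^sup>2) ^ (m + 2)"

lemma measurable_newt [measurable (raw)]:
  assumes [measurable]: "f \<in> borel_measurable M" "g \<in> borel_measurable M"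
  shows "(\<lambda>x. newt m (f x) (g x)) \<in> borel_measurable M"
  unfolding newt_def by measurable

lemma measurable_pois [measurable (raw)]:
  assumes [measurable]: "f \<in> borel_measurable M" "g \<in> borel_measurable M"
  shows "(\<lambda>x. pois m (f x) (g x)) \<in> borel_measurable M"
  unfolding pois_def by measurable

lemma pois_nonneg: "s \<ge> 0 \<Longrightarrow> pois m r s \<ge> 0"
  by (simp add: pois_def)

text \<open>Subordination: the Gamma integral writes a negative power of r^2 + s^2 as a mixture of
  exponentials. This separates \<open>r\<close> from \<open>s\<close> and reduces convolutions of
  Poisson kernels to convolutions of Gaussians.\<close>

lemma pois_gaussian:
  assumes s: "s > 0"
  shows "ennreal (pois m r s) = ennreal (s / Gamma ((real m + 2) / 2)) *
    (\<integral>\<^sup>+l. ennreal (l powr (m / 2) * exp (- l * (r\<^sup>2 + s\<^sup>2))) * indicator {0<..} l \<partial>lborel)"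
proof -
  define X where "X = r\<^sup>2 + s\<^sup>2"
  have X: "X > 0" using s by (simp add: X_def add_nonneg_pos)
  have sq: "sqrt X ^ (m + 2) = X powr ((real m + 2) / 2)"
  proof -
    have "sqrt X ^ (m + 2) = sqrt X powr real (m + 2)"
      using X by (intro powr_realpow[symmetric]) simp
    also have "\<dots> = (X powr (1/2)) powr real (m + 2)" using X by (simp only: powr_half_sqrt)
    also have "\<dots> = X powr ((real m + 2) / 2)" by (simp only: powr_powr) (simp add: add.commute)
    finally show ?thesis .
  qed
  have "pois m r s = s * X powr (- ((real m + 2) / 2))"
    unfolding pois_def X_def[symmetric] sq powr_minus divide_inverse ..
  then have *: "pois m r s = s / Gamma ((real m + 2) / 2) * (Gamma ((real m + 2) / 2) * X powr (- ((real m + 2) / 2)))"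
    using less_imp_neq[OF Gamma_real_pos[of "(real m + 2) / 2"]] by simp
  have "ennreal (pois m r s) = ennreal (s / Gamma ((real m + 2) / 2)) * ennreal (Gamma ((real m + 2) / 2) * X powr (- ((real m + 2) / 2)))"
    unfolding * using s Gamma_real_pos[of "(real m + 2) / 2"] by (intro ennreal_mult) auto
  also have "ennreal (Gamma ((real m + 2) / 2) * X powr (- ((real m + 2) / 2))) =
     (\<integral>\<^sup>+l. ennreal (l powr ((real m + 2) / 2 - 1) * exp (- l * X)) * indicator {0<..} l \<partial>lborel)"
    by (rule gamma_nn_integral[symmetric]) (use X in auto)
  finally show ?thesis by (simp add: X_def add_divide_distrib)
qed

text \<open>Tonelli on the Gaussian mixture: the integral in \<open>y\<close> is Gaussian, and what
  is left is Gamma(1/2). The mass does not depend on the height, and this half area is also the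
  constant of the semigroup law.\<close>

lemma pois_nn_integral:
  assumes u: "u > 0" and n: "DIM('a::euclidean_space) = m + 1"
  shows "(\<integral>\<^sup>+y. ennreal (pois m (norm (y::'a)) u) \<partial>lborel) = ennreal (sphere_area (m + 1) / 2)"
proof -
  define c where "c = ennreal (u / Gamma ((real m + 2) / 2))"
  have "(\<integral>\<^sup>+y. ennreal (pois m (norm (y::'a)) u) \<partial>lborel)
    = c * (\<integral>\<^sup>+(y::'a). (\<integral>\<^sup>+l. ennreal (l powr (m / 2) * exp (- l * ((norm y)\<^sup>2 + u\<^sup>2))) * indicator {0<..} l \<partial>lborel) \<partial>lborel)"
    unfolding pois_gaussian[OF u] c_def[symmetric] by (intro nn_integral_cmult) measurable
  also have "(\<integral>\<^sup>+(y::'a). (\<integral>\<^sup>+l. ennreal (l powr (m / 2) * exp (- l * ((norm y)\<^sup>2 + u\<^sup>2))) * indicator {0<..} l \<partial>lborel) \<partial>lborel)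
     = (\<integral>\<^sup>+l. (\<integral>\<^sup>+(y::'a). ennreal (l powr (m / 2) * exp (- l * ((norm y)\<^sup>2 + u\<^sup>2))) * indicator {0<..} l \<partial>lborel) \<partial>lborel)"
    by (rule lborel_pair.Fubini') measurable
  also have "\<dots> = (\<integral>\<^sup>+l. ennreal (pi powr ((m + 1) / 2)) * (ennreal (l powr (1/2 - 1) * exp (- l * u\<^sup>2)) * indicator {0<..} l) \<partial>lborel)"
  proof (rule nn_integral_cong)
    fix l :: real
    show "(\<integral>\<^sup>+(y::'a). ennreal (l powr (m / 2) * exp (- l * ((norm y)\<^sup>2 + u\<^sup>2))) * indicator {0<..} l \<partial>lborel)
      = ennreal (pi powr ((m + 1) / 2)) * (ennreal (l powr (1/2 - 1) * exp (- l * u\<^sup>2)) * indicator {0<..} l)"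
    proof (cases "l > 0")
      case True
      have "(\<integral>\<^sup>+(y::'a). ennreal (l powr (m / 2) * exp (- l * ((norm y)\<^sup>2 + u\<^sup>2))) * indicator {0<..} l \<partial>lborel)
        = (\<integral>\<^sup>+(y::'a). ennreal (l powr (m / 2) * exp (- l * u\<^sup>2)) * ennreal (exp (- l * (norm (0 - y))\<^sup>2 - 0 * (norm y)\<^sup>2)) \<partial>lborel)"
        using True by (intro nn_integral_cong) (simp add: ennreal_mult[symmetric] exp_add[symmetric] algebra_simps)
      also have "\<dots> = ennreal (l powr (m / 2) * exp (- l * u\<^sup>2)) * ennreal ((pi / (l + 0)) powr (DIM('a) / 2) * exp (- (l * 0 / (l + 0)) * (norm (0::'a))\<^sup>2))"
        using True by (subst nn_integral_cmult) (auto simp only: gaussian_convolution[OF True order_refl], measurable)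
      also have "\<dots> = ennreal (l powr (m / 2) * exp (- l * u\<^sup>2) * (pi / l) powr ((m + 1) / 2))"
        by (simp add: ennreal_mult n)
      also have "l powr (m / 2) * exp (- l * u\<^sup>2) * (pi / l) powr ((m + 1) / 2) = pi powr ((m + 1) / 2) * (l powr (1/2 - 1) * exp (- l * u\<^sup>2))"
      proof -
        have "l powr (m / 2) * (pi / l) powr ((m + 1) / 2) = pi powr ((m + 1) / 2) * (l powr (m / 2) / l powr ((m + 1) / 2))"
          using True by (simp add: powr_divide)
        also have "l powr (m / 2) / l powr ((m + 1) / 2) = l powr (1/2 - 1)"
          by (subst powr_diff[symmetric]) (simp add: field_simps)
        finally show ?thesis by simp
      qed
      finally show ?thesis using True by (simp add: ennreal_mult)
    qed simp
  qed
  also have "\<dots> = ennreal (pi powr ((m + 1) / 2)) * (\<integral>\<^sup>+l. (ennreal (l powr (1/2 - 1) * exp (- l * u\<^sup>2)) * indicator {0<..} l) \<partial>lborel)"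
    by (intro nn_integral_cmult) measurable
  also have "\<dots> = ennreal (pi powr ((m + 1) / 2)) * ennreal (Gamma (1/2) * (u\<^sup>2) powr - (1/2))"
    using u by (subst gamma_nn_integral) auto
  also have "c * \<dots> = ennreal (u / Gamma ((real m + 2) / 2) * (pi powr ((m + 1) / 2) * (Gamma (1/2) * (u\<^sup>2) powr - (1/2))))"
    unfolding c_def using u Gamma_real_pos[of "(real m + 2) / 2"]
    by (simp add: ennreal_mult[symmetric] Gamma_one_half_real)
  also have "u / Gamma ((real m + 2) / 2) * (pi powr ((m + 1) / 2) * (Gamma (1/2) * (u\<^sup>2) powr - (1/2))) = sphere_area (m + 1) / 2"
  proof -
    have "(u\<^sup>2) powr - (1/2) = 1 / u"
      using u by (simp add: powr_minus powr_half_sqrt field_simps)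
    moreover have "pi powr ((m + 1) / 2) * sqrt pi = pi powr ((m + 2) / 2)"
      by (simp add: powr_half_sqrt[symmetric] powr_add[symmetric] add_divide_distrib)
    ultimately show ?thesis using u Gamma_real_pos[of "(real m + 2) / 2"]
      by (simp add: sphere_area_def Gamma_one_half_real field_simps)
  qed
  finally show ?thesis .
qed

text \<open>If the two Gaussian parameters are \<open>l\<close> and \<open>l * v\<close>, the
  convolved Gaussian has parameter l (l v) / (l + l v), which is named \<open>k\<close>; this is
  where l = k (1 + v) / v comes from. The factors \<open>l\<close> and (1 + v) / v on the left are
  the Jacobians of the two substitutions. In the new variables the integrand of
  \<open>cauchy_schloemilch\<close> splits off.\<close>

lemma pois_convolution_aux:
  fixes k v s u X :: real
  assumes k: "k > 0" and v: "v > 0"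
  defines "l \<equiv> k * (1 + v) / v"
  shows "(1 + v) / v * l * ((l * (l * v)) powr (real m / 2) * exp (- l * s\<^sup>2 - l * v * u\<^sup>2) *
       ((pi / (l + l * v)) powr (real (m + 1) / 2) * exp (- (l * (l * v) / (l + l * v)) * X)))
    = pi powr (real (m + 1) / 2) * k powr (real (m + 1) / 2) * exp (- k * (X + s\<^sup>2 + u\<^sup>2)) *
      ((1 + v) * v powr (-3/2) * exp (- k * (s\<^sup>2 / v + u\<^sup>2 * v)))"
proof -
  have l: "l > 0" using k v by (simp add: l_def)
  have lv: "l * v = k * (1 + v)" using v by (simp add: l_def)
  have sp: "l + l * v > 0" using l v by (intro add_pos_pos mult_pos_pos)
  have lk: "l * (l * v) / (l + l * v) = k"
  proof -
    have "l * (l * v) = l * (k * (1 + v))" by (simp only: lv)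
    also have "\<dots> = k * (l + l * v)" by (simp add: algebra_simps)
    finally show ?thesis using sp by simp
  qed
  have ex: "exp (- l * s\<^sup>2 - l * v * u\<^sup>2) * exp (- k * X)
      = exp (- k * (X + s\<^sup>2 + u\<^sup>2)) * exp (- k * (s\<^sup>2 / v + u\<^sup>2 * v))"
  proof -
    have "- l * s\<^sup>2 = - k * s\<^sup>2 - k * (s\<^sup>2 / v)" using v by (simp add: l_def field_simps)
    then have "- l * s\<^sup>2 - l * v * u\<^sup>2 + - k * X = - k * (X + s\<^sup>2 + u\<^sup>2) + - k * (s\<^sup>2 / v + u\<^sup>2 * v)"
      unfolding lv by (simp add: algebra_simps)
    then show ?thesis unfolding exp_add[symmetric] by simp
  qed
  \<comment> \<open>The powers are compared through logarithms: in terms of ln k, ln (1 + v) and ln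
    v the identity of the exponents is linear.\<close>
  define L where "L = ln k"
  define W where "W = ln (1 + v)"
  define V where "V = ln v"
  have lnl: "ln l = L + W - V" using k v by (simp add: l_def L_def W_def V_def ln_mult ln_div)
  have lnlv: "ln (l * v) = L + W" using k v by (simp add: lv L_def W_def ln_mult)
  have sum: "l + l * v = l * (1 + v)" by (simp add: algebra_simps)
  have lnsum: "ln (pi / (l + l * v)) = ln pi - (L + 2 * W - V)"
    unfolding sum using l v lnl by (subst ln_div) (auto simp: ln_mult W_def)
  have pw: "(1 + v) / v * l * ((l * (l * v)) powr (real m / 2) * (pi / (l + l * v)) powr (real (m + 1) / 2))
     = pi powr (real (m + 1) / 2) * k powr (real (m + 1) / 2) * ((1 + v) * v powr (-3/2))"
  proof -
    have e: "1 + v = exp W" "v = exp V" "l = exp (L + W - V)"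
      using v exp_ln[OF l] unfolding lnl by (simp_all add: W_def V_def)
    have "(1 + v) / v * l * ((l * (l * v)) powr (real m / 2) * (pi / (l + l * v)) powr (real (m + 1) / 2))
       = exp (W - V + (L + W - V) + real m / 2 * (L + W - V + (L + W)) + real (m + 1) / 2 * (ln pi - (L + 2 * W - V)))"
    proof -
      have f1: "(1 + v) / v = exp (W - V)" using v by (simp add: exp_diff W_def V_def)
      have f2: "(l * (l * v)) powr (real m / 2) = exp (real m / 2 * (L + W - V + (L + W)))"
      proof -
        have "ln (l * (l * v)) = ln l + ln (l * v)"
          using l v by (intro ln_mult_pos) auto
        then have "ln (l * (l * v)) = L + W - V + (L + W)" unfolding lnlv lnl .
        then show ?thesis using l v by (simp add: powr_def)
      qed
      have f3: "(pi / (l + l * v)) powr (real (m + 1) / 2) = exp (real (m + 1) / 2 * (ln pi - (L + 2 * W - V)))"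
        unfolding powr_def lnsum using sp by simp
      have f4: "exp (W - V) * exp (L + W - V) * (exp A * exp B) = exp (W - V + (L + W - V) + A + B)" for A B :: real
        by (simp only: exp_add mult.assoc)
      show ?thesis unfolding f1 f2 f3 f4[symmetric] e(3)[symmetric] ..
    qed
    also have "W - V + (L + W - V) + real m / 2 * (L + W - V + (L + W)) + real (m + 1) / 2 * (ln pi - (L + 2 * W - V))
       = real (m + 1) / 2 * ln pi + real (m + 1) / 2 * L + W + (-3/2) * V"
      by (simp add: field_simps)
    also have "exp \<dots> = pi powr (real (m + 1) / 2) * k powr (real (m + 1) / 2) * ((1 + v) * v powr (-3/2))"
    proof -
      have W: "exp W = 1 + v" using v by (simp add: W_def)
      show ?thesis using k v unfolding exp_add W powr_def L_def V_def by simp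
    qed
    finally show ?thesis .
  qed
  show ?thesis unfolding lk
    using arg_cong2[OF pw ex, of times] by (simp only: mult_ac)
qed

lemma nn_integral_scale_pos:
  assumes [measurable]: "f \<in> borel_measurable borel" and c: "c > (0::real)"
  shows "(\<integral>\<^sup>+x. f x * indicator {0<..} x \<partial>lborel) = (\<integral>\<^sup>+x. ennreal c * f (c * x) * indicator {0<..} x \<partial>lborel)"
proof -
  have "(\<integral>\<^sup>+x. f x * indicator {0<..} x \<partial>lborel) = ennreal \<bar>c\<bar> * (\<integral>\<^sup>+x. f (0 + c * x) * indicator {0<..} (0 + c * x) \<partial>lborel)"
    using c by (intro nn_integral_real_affine) auto
  also have "\<dots> = (\<integral>\<^sup>+x. ennreal \<bar>c\<bar> * (f (0 + c * x) * indicator {0<..} (0 + c * x)) \<partial>lborel)"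
    by (intro nn_integral_cmult[symmetric]) measurable
  also have "\<dots> = (\<integral>\<^sup>+x. ennreal c * f (c * x) * indicator {0<..} x \<partial>lborel)"
    using c by (intro nn_integral_cong) (auto simp: indicator_def zero_less_mult_iff)
  finally show ?thesis .
qed

text \<open>Both kernels are written as Gaussian mixtures and the integral in \<open>y\<close> is
  carried out. In the coordinates given by the ratio \<open>v\<close> of the parameters and the
  parameter \<open>k\<close> of the convolved Gaussian, the integral in \<open>v\<close> contributes
  (1/u + 1/s) exp(-2 k s u). The exponential completes s^2 + u^2 to (s + u)^2, and the mixture at
  height \<open>s + u\<close> remains.\<close>

lemma pois_convolution:
  fixes x :: "'a::euclidean_space"
  assumes s: "s > 0" and u: "u > 0" and n: "DIM('a) = m + 1"
  shows "(\<integral>\<^sup>+y. ennreal (pois m (norm (x - y)) s * pois m (norm y) u) \<partial>lborel)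
    = ennreal (sphere_area (m + 1) / 2 * pois m (norm x) (s + u))"
proof -
  define G where "G = Gamma ((real m + 2) / 2)"
  have G: "G > 0" unfolding G_def by (intro Gamma_real_pos) auto
  define c where "c = ennreal (s / G * (u / G))"
  define h where "h l k = (l * k) powr (m / 2) * exp (- l * s\<^sup>2 - k * u\<^sup>2) *
     ((pi / (l + k)) powr (real (m + 1) / 2) * exp (- (l * k / (l + k)) * (norm x)\<^sup>2))" for l k
  have hnn: "h l k \<ge> 0" for l k by (simp add: h_def)
  define F where "F l k y = ennreal (l powr (m / 2) * exp (- l * ((norm (x - y))\<^sup>2 + s\<^sup>2))) * indicator {0<..} l *
      (ennreal (k powr (m / 2) * exp (- k * ((norm y)\<^sup>2 + u\<^sup>2))) * indicator {0<..} k)" for l k y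
  have [measurable]: "(\<lambda>z. F (f z) (g z) (k z)) \<in> borel_measurable M"
    if [measurable]: "f \<in> borel_measurable M" "g \<in> borel_measurable M" "k \<in> borel_measurable M" for f g k and M :: "'z measure"
    unfolding F_def by measurable
  have [measurable]: "(\<lambda>z. h (f z) (g z)) \<in> borel_measurable M"
    if [measurable]: "f \<in> borel_measurable M" "g \<in> borel_measurable M" for f g and M :: "'z measure"
    unfolding h_def by measurable
  have "ennreal (pois m (norm (x - y)) s * pois m (norm y) u) = c * (\<integral>\<^sup>+l. \<integral>\<^sup>+k. F l k y \<partial>lborel \<partial>lborel)" for y
  proof -
    have "ennreal (pois m (norm (x - y)) s * pois m (norm y) u) = c *
       ((\<integral>\<^sup>+l. ennreal (l powr (m / 2) * exp (- l * ((norm (x - y))\<^sup>2 + s\<^sup>2))) * indicator {0<..} l \<partial>lborel) *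
        (\<integral>\<^sup>+k. ennreal (k powr (m / 2) * exp (- k * ((norm y)\<^sup>2 + u\<^sup>2))) * indicator {0<..} k \<partial>lborel))"
    proof -
      have c: "c = ennreal (s / G) * ennreal (u / G)" unfolding c_def using s u G by (intro ennreal_mult) auto
      have "ennreal (pois m (norm (x - y)) s * pois m (norm y) u) = ennreal (pois m (norm (x - y)) s) * ennreal (pois m (norm y) u)"
        using s u by (intro ennreal_mult) (auto simp: pois_nonneg)
      then show ?thesis unfolding pois_gaussian[OF s] pois_gaussian[OF u] c G_def[symmetric] by (simp only: mult_ac)
    qed
    also have "\<dots> = c * (\<integral>\<^sup>+l. \<integral>\<^sup>+k. F l k y \<partial>lborel \<partial>lborel)"
      unfolding F_def by (simp add: nn_integral_multc nn_integral_cmult)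
    finally show ?thesis .
  qed
  then have "(\<integral>\<^sup>+y. ennreal (pois m (norm (x - y)) s * pois m (norm y) u) \<partial>lborel)
     = c * (\<integral>\<^sup>+y. (\<integral>\<^sup>+l. \<integral>\<^sup>+k. F l k y \<partial>lborel \<partial>lborel) \<partial>lborel)"
    by (simp add: nn_integral_cmult)
  also have "(\<integral>\<^sup>+y. (\<integral>\<^sup>+l. \<integral>\<^sup>+k. F l k y \<partial>lborel \<partial>lborel) \<partial>lborel) = (\<integral>\<^sup>+l. (\<integral>\<^sup>+y. \<integral>\<^sup>+k. F l k y \<partial>lborel \<partial>lborel) \<partial>lborel)"
    by (rule lborel_pair.Fubini') measurable
  also have "\<dots> = (\<integral>\<^sup>+l. (\<integral>\<^sup>+k. \<integral>\<^sup>+y. F l k y \<partial>lborel \<partial>lborel) \<partial>lborel)"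
    by (intro nn_integral_cong lborel_pair.Fubini') measurable
  also have "\<dots> = (\<integral>\<^sup>+l. (\<integral>\<^sup>+k. ennreal (h l k) * indicator {0<..} k \<partial>lborel) * indicator {0<..} l \<partial>lborel)"
  proof (rule nn_integral_cong)
    fix l :: real
    show "(\<integral>\<^sup>+k. \<integral>\<^sup>+y. F l k y \<partial>lborel \<partial>lborel) = (\<integral>\<^sup>+k. ennreal (h l k) * indicator {0<..} k \<partial>lborel) * indicator {0<..} l"
    proof (cases "l > 0")
      case l: True
      have "(\<integral>\<^sup>+y. F l k y \<partial>lborel) = ennreal (h l k) * indicator {0<..} k" for k
      proof (cases "k > 0")
        case k: True
        have "(\<integral>\<^sup>+y. F l k y \<partial>lborel) = (\<integral>\<^sup>+y. ennreal ((l * k) powr (m / 2) * exp (- l * s\<^sup>2 - k * u\<^sup>2)) *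
           ennreal (exp (- l * (norm (x - y))\<^sup>2 - k * (norm y)\<^sup>2)) \<partial>lborel)"
          using l k unfolding F_def
          by (intro nn_integral_cong)
             (simp add: ennreal_mult[symmetric] powr_mult mult_ac exp_add[symmetric] ring_distribs exp_diff exp_minus field_simps)
        also have "\<dots> = ennreal (h l k)"
          by (subst nn_integral_cmult, measurable)
             (simp only: gaussian_convolution[OF l less_imp_le[OF k]] h_def n ennreal_mult[symmetric] exp_ge_zero powr_ge_zero mult_nonneg_nonneg)
        finally show ?thesis using k by simp
      qed (simp add: F_def)
      then show ?thesis using l by simp
    qed (simp add: F_def)
  qed
  \<comment> \<open>The second parameter becomes \<open>l * v\<close>, with Jacobian
    \<open>l\<close>; afterwards \<open>l\<close> can be exchanged for the convolved parameter at
    fixed ratio.\<close>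
  also have "\<dots> = (\<integral>\<^sup>+l. \<integral>\<^sup>+v. ennreal (l * h l (l * v)) * indicator {0<..} v * indicator {0<..} l \<partial>lborel \<partial>lborel)"
  proof (rule nn_integral_cong)
    fix l :: real
    show "(\<integral>\<^sup>+k. ennreal (h l k) * indicator {0<..} k \<partial>lborel) * indicator {0<..} l
      = (\<integral>\<^sup>+v. ennreal (l * h l (l * v)) * indicator {0<..} v * indicator {0<..} l \<partial>lborel)"
    proof (cases "l > 0")
      case l: True
      have "(\<integral>\<^sup>+k. ennreal (h l k) * indicator {0<..} k \<partial>lborel)
          = (\<integral>\<^sup>+v. ennreal l * ennreal (h l (l * v)) * indicator {0<..} v \<partial>lborel)"
        by (rule nn_integral_scale_pos[OF _ l]) measurable
      then show ?thesis using l by (simp add: ennreal_mult hnn)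
    qed simp
  qed
  also have "\<dots> = (\<integral>\<^sup>+v. \<integral>\<^sup>+l. ennreal (l * h l (l * v)) * indicator {0<..} v * indicator {0<..} l \<partial>lborel \<partial>lborel)"
    by (rule lborel_pair.Fubini') measurable
  also have "\<dots> = (\<integral>\<^sup>+v. \<integral>\<^sup>+k. ennreal (pi powr (real (m + 1) / 2) * k powr (real (m + 1) / 2) * exp (- k * ((norm x)\<^sup>2 + s\<^sup>2 + u\<^sup>2)) *
      ((1 + v) * v powr (-3/2) * exp (- k * (s\<^sup>2 / v + u\<^sup>2 * v)))) * indicator {0<..} k * indicator {0<..} v \<partial>lborel \<partial>lborel)"
  proof (rule nn_integral_cong)
    fix v :: real
    show "(\<integral>\<^sup>+l. ennreal (l * h l (l * v)) * indicator {0<..} v * indicator {0<..} l \<partial>lborel)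
     = (\<integral>\<^sup>+k. ennreal (pi powr (real (m + 1) / 2) * k powr (real (m + 1) / 2) * exp (- k * ((norm x)\<^sup>2 + s\<^sup>2 + u\<^sup>2)) *
      ((1 + v) * v powr (-3/2) * exp (- k * (s\<^sup>2 / v + u\<^sup>2 * v)))) * indicator {0<..} k * indicator {0<..} v \<partial>lborel)"
    proof (cases "v > 0")
      case v: True
      have "(\<integral>\<^sup>+l. ennreal (l * h l (l * v)) * indicator {0<..} l \<partial>lborel)
        = (\<integral>\<^sup>+k. ennreal ((1 + v) / v) * ennreal ((1 + v) / v * k * h ((1 + v) / v * k) ((1 + v) / v * k * v)) * indicator {0<..} k \<partial>lborel)"
        using v by (intro nn_integral_scale_pos) (auto simp: add_pos_pos)
      also have "\<dots> = (\<integral>\<^sup>+k. ennreal (pi powr (real (m + 1) / 2) * k powr (real (m + 1) / 2) * exp (- k * ((norm x)\<^sup>2 + s\<^sup>2 + u\<^sup>2)) *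
      ((1 + v) * v powr (-3/2) * exp (- k * (s\<^sup>2 / v + u\<^sup>2 * v)))) * indicator {0<..} k \<partial>lborel)"
      proof (rule nn_integral_cong)
        fix k :: real
        show "ennreal ((1 + v) / v) * ennreal ((1 + v) / v * k * h ((1 + v) / v * k) ((1 + v) / v * k * v)) * indicator {0<..} k
          = ennreal (pi powr (real (m + 1) / 2) * k powr (real (m + 1) / 2) * exp (- k * ((norm x)\<^sup>2 + s\<^sup>2 + u\<^sup>2)) *
      ((1 + v) * v powr (-3/2) * exp (- k * (s\<^sup>2 / v + u\<^sup>2 * v)))) * indicator {0<..} k"
        proof (cases "k > 0")
          case k: True
          have eq: "(1 + v) / v * k = k * (1 + v) / v" by simp
          have "ennreal ((1 + v) / v) * ennreal ((1 + v) / v * k * h ((1 + v) / v * k) ((1 + v) / v * k * v))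
            = ennreal ((1 + v) / v * ((1 + v) / v * k) * h ((1 + v) / v * k) ((1 + v) / v * k * v))"
            using v k by (subst ennreal_mult[symmetric]) (auto simp: hnn mult.assoc)
          also have "(1 + v) / v * ((1 + v) / v * k) * h ((1 + v) / v * k) ((1 + v) / v * k * v)
            = pi powr (real (m + 1) / 2) * k powr (real (m + 1) / 2) * exp (- k * ((norm x)\<^sup>2 + s\<^sup>2 + u\<^sup>2)) *
             ((1 + v) * v powr (-3/2) * exp (- k * (s\<^sup>2 / v + u\<^sup>2 * v)))"
            unfolding h_def eq by (rule pois_convolution_aux[OF k v])
          finally show ?thesis by simp
        qed simp
      qed
      finally show ?thesis using v by simp
    qed simp
  qed
  also have "\<dots> = (\<integral>\<^sup>+k. \<integral>\<^sup>+v. ennreal (pi powr (real (m + 1) / 2) * k powr (real (m + 1) / 2) * exp (- k * ((norm x)\<^sup>2 + s\<^sup>2 + u\<^sup>2)) *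
      ((1 + v) * v powr (-3/2) * exp (- k * (s\<^sup>2 / v + u\<^sup>2 * v)))) * indicator {0<..} k * indicator {0<..} v \<partial>lborel \<partial>lborel)"
    by (rule lborel_pair.Fubini') measurable
  also have "\<dots> = (\<integral>\<^sup>+k. ennreal (pi powr (real (m + 2) / 2) * (1 / u + 1 / s)) * (ennreal (k powr (m / 2) * exp (- k * ((norm x)\<^sup>2 + (s + u)\<^sup>2))) * indicator {0<..} k) \<partial>lborel)"
  proof (rule nn_integral_cong)
    fix k :: real
    show "(\<integral>\<^sup>+v. ennreal (pi powr (real (m + 1) / 2) * k powr (real (m + 1) / 2) * exp (- k * ((norm x)\<^sup>2 + s\<^sup>2 + u\<^sup>2)) *
      ((1 + v) * v powr (-3/2) * exp (- k * (s\<^sup>2 / v + u\<^sup>2 * v)))) * indicator {0<..} k * indicator {0<..} v \<partial>lborel)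
      = ennreal (pi powr (real (m + 2) / 2) * (1 / u + 1 / s)) * (ennreal (k powr (m / 2) * exp (- k * ((norm x)\<^sup>2 + (s + u)\<^sup>2))) * indicator {0<..} k)"
    proof (cases "k > 0")
      case k: True
      define a where "a = pi powr (real (m + 1) / 2) * k powr (real (m + 1) / 2) * exp (- k * ((norm x)\<^sup>2 + s\<^sup>2 + u\<^sup>2))"
      have a: "a \<ge> 0" by (simp add: a_def)
      have "(\<integral>\<^sup>+v. ennreal (a * ((1 + v) * v powr (-3/2) * exp (- k * (s\<^sup>2 / v + u\<^sup>2 * v)))) * indicator {0<..} k * indicator {0<..} v \<partial>lborel)
        = (\<integral>\<^sup>+v. ennreal a * (ennreal ((1 + v) * v powr (-3/2) * exp (- k * (s\<^sup>2 / v + u\<^sup>2 * v))) * indicator {0<..} v) \<partial>lborel)"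
      proof (rule nn_integral_cong)
        fix v :: real
        show "ennreal (a * ((1 + v) * v powr (-3/2) * exp (- k * (s\<^sup>2 / v + u\<^sup>2 * v)))) * indicator {0<..} k * indicator {0<..} v
          = ennreal a * (ennreal ((1 + v) * v powr (-3/2) * exp (- k * (s\<^sup>2 / v + u\<^sup>2 * v))) * indicator {0<..} v)"
          using a k by (cases "v > 0") (simp_all add: ennreal_mult)
      qed
      also have "\<dots> = ennreal a * ennreal (sqrt (pi / k) * (1 / u + 1 / s) * exp (- 2 * k * s * u))"
        by (subst nn_integral_cmult) (measurable, simp only: cauchy_schloemilch[OF k s u])
      also have "\<dots> = ennreal (a * (sqrt (pi / k) * (1 / u + 1 / s) * exp (- 2 * k * s * u)))"
        using a k s u by (subst ennreal_mult) auto
      also have "a * (sqrt (pi / k) * (1 / u + 1 / s) * exp (- 2 * k * s * u)) =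
         pi powr (real (m + 2) / 2) * (1 / u + 1 / s) * (k powr (m / 2) * exp (- k * ((norm x)\<^sup>2 + (s + u)\<^sup>2)))"
      proof -
        have p1: "k powr (real (m + 1) / 2) * sqrt (pi / k) * pi powr (real (m + 1) / 2) = k powr (m / 2) * pi powr (real (m + 2) / 2)"
        proof -
          have "k powr (real (m + 1) / 2) = k powr (m / 2) * sqrt k"
            using k by (simp add: powr_half_sqrt[symmetric] powr_add[symmetric] add_divide_distrib add.commute)
          moreover have "pi powr (real (m + 2) / 2) = pi powr (real (m + 1) / 2) * sqrt pi"
            by (simp add: powr_half_sqrt[symmetric] powr_add[symmetric] add_divide_distrib)
          ultimately show ?thesis using k by (simp add: real_sqrt_divide)
        qed
        have p2: "exp (- k * ((norm x)\<^sup>2 + s\<^sup>2 + u\<^sup>2)) * exp (- 2 * k * s * u) = exp (- k * ((norm x)\<^sup>2 + (s + u)\<^sup>2))"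
          unfolding exp_add[symmetric] by (simp add: power2_eq_square algebra_simps)
        have ac: "P * K * E1 * (R * I * E2) = (K * R * P) * I * (E1 * E2)" for P K E1 R I E2 :: real
          by (simp only: mult_ac)
        have ac': "K * P * I * E = P * I * (K * E)" for K P I E :: real
          by (simp only: mult_ac)
        show ?thesis unfolding a_def by (subst ac, subst p1, subst p2, rule ac')
      qed
      finally show ?thesis unfolding a_def[symmetric] using k s u by (simp add: ennreal_mult)
    qed simp
  qed
  also have "\<dots> = ennreal (pi powr (real (m + 2) / 2) * (1 / u + 1 / s)) * (\<integral>\<^sup>+k. (ennreal (k powr (m / 2) * exp (- k * ((norm x)\<^sup>2 + (s + u)\<^sup>2))) * indicator {0<..} k) \<partial>lborel)"
    by (rule nn_integral_cmult) measurable
  \<comment> \<open>The prefactors combine through s u (1/u + 1/s) = s + u, the new height.\<close>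
  also have "c * \<dots> = ennreal (sphere_area (m + 1) / 2) * (ennreal ((s + u) / Gamma ((real m + 2) / 2)) * (\<integral>\<^sup>+k. (ennreal (k powr (m / 2) * exp (- k * ((norm x)\<^sup>2 + (s + u)\<^sup>2))) * indicator {0<..} k) \<partial>lborel))"
  proof -
    have eq: "s / G * (u / G) * (pi powr (real (m + 2) / 2) * (1 / u + 1 / s)) = sphere_area (m + 1) / 2 * ((s + u) / G)"
      using s u G by (simp add: sphere_area_def G_def[symmetric] field_simps)
    have sa: "sphere_area (m + 1) \<ge> 0" using G by (simp add: sphere_area_def G_def add.commute)
    have "c * ennreal (pi powr (real (m + 2) / 2) * (1 / u + 1 / s)) = ennreal (sphere_area (m + 1) / 2 * ((s + u) / G))"
      unfolding c_def eq[symmetric] using s u G by (intro ennreal_mult[symmetric]) auto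
    also have "\<dots> = ennreal (sphere_area (m + 1) / 2) * ennreal ((s + u) / G)"
      using s u G sa by (intro ennreal_mult) auto
    finally show ?thesis unfolding G_def[symmetric] mult.assoc[symmetric] by simp
  qed
  also have "\<dots> = ennreal (sphere_area (m + 1) / 2) * ennreal (pois m (norm x) (s + u))"
    using s u by (subst pois_gaussian) auto
  also have "\<dots> = ennreal (sphere_area (m + 1) / 2 * pois m (norm x) (s + u))"
    using s u G by (subst ennreal_mult) (auto simp: pois_nonneg sphere_area_def G_def add.commute)
  finally show ?thesis .
qed

subsection \<open>Weak compactness of probability measures on a compact set\<close>

text \<open>\<open>T\<close> is a random point and \<open>\<tau>\<close> its cell in a finite
  partition. If the kernel is within \<open>e\<close> of a constant on every product of two cells,
  its double integral is within \<open>e\<close> of a polynomial in the cell masses. A general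
  \<open>T\<close> lets the estimate serve the given measures, where \<open>T\<close> is the
  identity, and the limit, which is the law of a constructed variable.\<close>

lemma (in prob_space) double_integral_step:
  fixes g :: "'b::{second_countable_topology, metric_space} \<Rightarrow> 'b \<Rightarrow> real"
  assumes g: "continuous_on UNIV (\<lambda>(x, y). g x y)" and T [measurable]: "T \<in> borel_measurable M"
    and \<tau>: "\<tau> \<in> measurable M (count_space L)" and L: "finite L"
    and close: "\<And>u v. u \<in> space M \<Longrightarrow> v \<in> space M \<Longrightarrow> \<bar>g (T u) (T v) - G (\<tau> u) (\<tau> v)\<bar> \<le> e"
  shows "\<bar>(LINT v|M. LINT u|M. g (T u) (T v))
      - (\<Sum>w'\<in>L. \<Sum>w\<in>L. G w w' * prob {u \<in> space M. \<tau> u = w} * prob {u \<in> space M. \<tau> u = w'})\<bar> \<le> e"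
proof -
  note \<tau> [measurable]
  have [measurable]: "{u \<in> space M. \<tau> u = w} \<in> sets M" if "w \<in> L" for w
    using \<tau> that by measurable
  have g' [measurable]: "(\<lambda>(x, y). g x y) \<in> borel_measurable (borel \<Otimes>\<^sub>M borel)"
    using borel_measurable_continuous_onI[OF g] by (simp add: borel_prod)
  have gT [measurable]: "(\<lambda>(v, u). g (T u) (T v)) \<in> borel_measurable (M \<Otimes>\<^sub>M M)"
    using measurable_compose[OF _ g', of "\<lambda>(v, u). (T u, T v)" "M \<Otimes>\<^sub>M M"] by (simp add: case_prod_beta')
  have \<tau>L: "\<tau> u \<in> L" if "u \<in> space M" for u using measurable_space[OF \<tau> that] by simp
  have fin: "emeasure M X < \<top>" for X
    using emeasure_finite[of X] by (metis infinity_ennreal_def top.not_eq_extremum)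
  have e0: "0 \<le> e"
  proof -
    obtain u where "u \<in> space M" using not_empty by auto
    then show ?thesis using close[of u u] by linarith
  qed
  define C where "C = (\<Sum>w\<in>L. \<Sum>w'\<in>L. \<bar>G w w'\<bar>)"
  have C: "\<bar>G w w'\<bar> \<le> C" if "w \<in> L" "w' \<in> L" for w w'
  proof -
    have "\<bar>G w w'\<bar> \<le> (\<Sum>w'\<in>L. \<bar>G w w'\<bar>)"
      using member_le_sum[of w' L "\<lambda>w'. \<bar>G w w'\<bar>"] that L by auto
    also have "\<dots> \<le> C"
      unfolding C_def using member_le_sum[of w L "\<lambda>w. \<Sum>w'\<in>L. \<bar>G w w'\<bar>"] that L by (auto intro: sum_nonneg)
    finally show ?thesis .
  qed
  have bd: "\<bar>g (T u) (T v)\<bar> \<le> C + e" if "u \<in> space M" "v \<in> space M" for u v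
    using close[OF that] C[OF \<tau>L[OF that(1)] \<tau>L[OF that(2)]] by linarith
  have int: "integrable M (\<lambda>u. g (T u) (T v))" if "v \<in> space M" for v
  proof (rule integrable_const_bound)
    show "AE x in M. norm (g (T x) (T v)) \<le> C + e" using bd that by auto
    show "(\<lambda>u. g (T u) (T v)) \<in> borel_measurable M"
      using measurable_compose[OF _ gT, of "\<lambda>u. (v, u)" M] that by simp
  qed
  have ind: "integrable M (\<lambda>u. indicator {u \<in> space M. \<tau> u = w} u :: real)" if "w \<in> L" for w
    using that by (auto intro!: integrable_real_indicator simp: fin)
  have Gsum: "G (\<tau> u) y = (\<Sum>w\<in>L. G w y * indicator {u \<in> space M. \<tau> u = w} u)" if "u \<in> space M" for u y
    using \<tau>L[OF that] L that by (simp add: indicator_def if_distrib[of "\<lambda>t. _ * t"] sum.delta' cong: if_cong)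
  have Gsum': "G y (\<tau> u) = (\<Sum>w\<in>L. G y w * indicator {u \<in> space M. \<tau> u = w} u)" if "u \<in> space M" for u y
    using \<tau>L[OF that] L that by (simp add: indicator_def if_distrib[of "\<lambda>t. _ * t"] sum.delta' cong: if_cong)
  have Gint: "has_bochner_integral M (\<lambda>u. G (\<tau> u) y) (\<Sum>w\<in>L. G w y * prob {u \<in> space M. \<tau> u = w})" for y
  proof -
    have "has_bochner_integral M (\<lambda>u. \<Sum>w\<in>L. G w y * indicator {u \<in> space M. \<tau> u = w} u) (\<Sum>w\<in>L. G w y * prob {u \<in> space M. \<tau> u = w})"
      by (intro has_bochner_integral_sum has_bochner_integral_mult_right has_bochner_integral_real_indicator) (auto simp: fin)
    then show ?thesis by (subst has_bochner_integral_cong[OF refl Gsum refl]) auto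
  qed
  have Gint': "has_bochner_integral M (\<lambda>u. G y (\<tau> u)) (\<Sum>w\<in>L. G y w * prob {u \<in> space M. \<tau> u = w})" for y
  proof -
    have "has_bochner_integral M (\<lambda>u. \<Sum>w\<in>L. G y w * indicator {u \<in> space M. \<tau> u = w} u) (\<Sum>w\<in>L. G y w * prob {u \<in> space M. \<tau> u = w})"
      by (intro has_bochner_integral_sum has_bochner_integral_mult_right has_bochner_integral_real_indicator) (auto simp: fin)
    then show ?thesis by (subst has_bochner_integral_cong[OF refl Gsum' refl]) auto
  qed
  define A where "A v = (LINT u|M. g (T u) (T v))" for v
  define B where "B v = (\<Sum>w\<in>L. G w (\<tau> v) * prob {u \<in> space M. \<tau> u = w})" for v
  have AB: "\<bar>A v - B v\<bar> \<le> e" if "v \<in> space M" for v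
  proof -
    have "A v - B v = (LINT u|M. g (T u) (T v) - G (\<tau> u) (\<tau> v))"
      unfolding A_def B_def using int[OF that] Gint[of "\<tau> v"]
      by (subst Bochner_Integration.integral_diff) (auto simp: has_bochner_integral_iff)
    also have "\<bar>\<dots>\<bar> \<le> (LINT u|M. e)"
      using int[OF that] Gint[of "\<tau> v"] close that
      by (intro order.trans[OF integral_abs_bound] integral_mono_AE) (auto simp: has_bochner_integral_iff)
    finally show ?thesis by (simp add: prob_space)
  qed
  have Bi: "has_bochner_integral M B (\<Sum>w\<in>L. (\<Sum>w'\<in>L. G w w' * prob {u \<in> space M. \<tau> u = w'}) * prob {u \<in> space M. \<tau> u = w})"
    unfolding B_def by (intro has_bochner_integral_sum has_bochner_integral_mult_left Gint')
  have Ai: "integrable M A"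
  proof (rule integrable_const_bound)
    have "\<bar>A v\<bar> \<le> \<bar>B v\<bar> + e" if "v \<in> space M" for v using AB[OF that] by linarith
    moreover have "\<bar>B v\<bar> \<le> (\<Sum>w\<in>L. C * 1)" if "v \<in> space M" for v
    proof -
      have "\<bar>G w (\<tau> v) * prob {u \<in> space M. \<tau> u = w}\<bar> \<le> C * 1" if "w \<in> L" for w
        unfolding abs_mult using C[OF that \<tau>L[OF \<open>v \<in> space M\<close>]] by (intro mult_mono) auto
      then show ?thesis unfolding B_def by (intro order.trans[OF sum_abs] sum_mono)
    qed
    ultimately show "AE x in M. norm (A x) \<le> (\<Sum>w\<in>L. C * 1) + e" by (intro AE_I2) force
    show "A \<in> borel_measurable M" unfolding A_def by measurable
  qed
  have "(LINT v|M. A v) - (LINT v|M. B v) = (LINT v|M. A v - B v)"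
    using Ai Bi by (subst Bochner_Integration.integral_diff) (auto simp: has_bochner_integral_iff)
  also have "\<bar>\<dots>\<bar> \<le> (LINT u|M. e)"
    using Ai Bi AB
    by (intro order.trans[OF integral_abs_bound] integral_mono_AE) (auto simp: has_bochner_integral_iff)
  finally have "\<bar>(LINT v|M. A v) - (LINT v|M. B v)\<bar> \<le> e" by (simp add: prob_space)
  moreover have "(LINT v|M. B v) = (\<Sum>w'\<in>L. \<Sum>w\<in>L. G w w' * prob {u \<in> space M. \<tau> u = w} * prob {u \<in> space M. \<tau> u = w'})"
    unfolding has_bochner_integral_integral_eq[OF Bi] by (subst sum.swap) (simp add: sum_distrib_right sum_distrib_left mult_ac)
  ultimately show ?thesis by (simp add: A_def)
qed

section \<open>Construction of weak limits on a compact set\<close>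

lemma borel_prob_measuresD:
  assumes "\<mu> \<in> borel_prob_measures K"
  shows "prob_space \<mu>" "sets \<mu> = sets (restrict_space borel K)" "space \<mu> = K"
proof -
  show s: "prob_space \<mu>" "sets \<mu> = sets (restrict_space borel K)"
    using assms by (auto simp: borel_prob_measures_def)
  show "space \<mu> = K" using sets_eq_imp_space_eq[OF s(2)] by (simp add: space_restrict_space)
qed

lemma measurable_borel_prob_measures:
  "\<mu> \<in> borel_prob_measures K \<Longrightarrow> f \<in> measurable borel N \<Longrightarrow> f \<in> measurable \<mu> N"
  using measurable_cong_sets[OF borel_prob_measuresD(2) refl] measurable_restrict_space1 by blast

text \<open>Given the masses of the cells of a binary tree of sets, the uniform variable \<open>U\<close> on
  \<open>[0, 1)\<close> selects a branch: the cell with address \<open>w\<close> is hit exactly when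
  \<open>tree_left p w \<le> U < tree_left p w + p w\<close>.\<close>

primrec tree_walk :: "(bool list \<Rightarrow> real) \<Rightarrow> real \<Rightarrow> nat \<Rightarrow> bool list \<times> real" where
  "tree_walk p U 0 = ([], 0)"
| "tree_walk p U (Suc k) = (let (w, l) = tree_walk p U k in
     if U < l + p (w @ [False]) then (w @ [False], l) else (w @ [True], l + p (w @ [False])))"

definition tree_left :: "(bool list \<Rightarrow> real) \<Rightarrow> bool list \<Rightarrow> real" where
  "tree_left p w = (\<Sum>i<length w. if w ! i then p (take i w @ [False]) else 0)"

lemma tree_left_snoc: "tree_left p (w @ [b]) = tree_left p w + (if b then p (w @ [False]) else 0)"
  unfolding tree_left_def by (simp add: nth_append) (rule sum.cong, auto)

lemma tree_walk_length: "length (fst (tree_walk p U k)) = k"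
  by (induction k) (auto simp: Let_def split: prod.splits)

lemma tree_walk_snd: "snd (tree_walk p U k) = tree_left p (fst (tree_walk p U k))"
proof (induction k)
  case 0
  then show ?case by (simp add: tree_left_def)
next
  case (Suc k)
  then show ?case by (auto simp: Let_def tree_left_snoc split: prod.splits)
qed

lemma tree_walk_take: "k \<le> l \<Longrightarrow> take k (fst (tree_walk p U l)) = fst (tree_walk p U k)"
proof (induction l)
  case (Suc l)
  then show ?case
    using tree_walk_length[of p U l] tree_walk_length[of p U "Suc l"]
    by (cases "k = Suc l") (auto simp: Let_def take_all_iff split: prod.splits)
qed simp

lemma tree_walk_fst_Suc:
  "fst (tree_walk p U (Suc k)) = w @ [b] \<longleftrightarrow>
    fst (tree_walk p U k) = w \<and> (b \<longleftrightarrow> \<not> U < tree_left p w + p (w @ [False]))"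
  using tree_walk_snd[of p U k] by (auto simp: Let_def split: prod.splits)

text \<open>Induction on the depth: the interval of \<open>w\<close> is cut at distance
  \<open>p (w @ [False])\<close> from its left end, and additivity of the masses makes the right
  piece have length \<open>p (w @ [True])\<close>.\<close>

lemma tree_walk_interval:
  assumes nn: "\<And>w. p w \<ge> 0" and p0: "p [] = 1" and split: "\<And>w. p w = p (w @ [True]) + p (w @ [False])"
  shows "length w = k \<Longrightarrow> {U \<in> {0..<1}. fst (tree_walk p U k) = w} = {tree_left p w ..< tree_left p w + p w}"
proof (induction k arbitrary: w)
  case 0
  then show ?case using p0 by (auto simp: tree_left_def)
next
  case (Suc k)
  then obtain v b where w: "w = v @ [b]" "length v = k" by (metis length_Suc_conv_rev)
  have "{U \<in> {0..<1}. fst (tree_walk p U (Suc k)) = w}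
     = {U \<in> {0..<1}. fst (tree_walk p U k) = v} \<inter> {U. b \<longleftrightarrow> \<not> U < tree_left p v + p (v @ [False])}"
    unfolding w(1) tree_walk_fst_Suc by auto
  also have "\<dots> = {tree_left p w ..< tree_left p w + p w}"
    unfolding Suc.IH[OF w(2)] w(1) tree_left_snoc
    using split[of v] nn[of "v @ [True]"] nn[of "v @ [False]"] by auto
  finally show ?case .
qed

text \<open>The limit is built as the law of a random variable on [0, 1). Cells of \<open>K\<close>
  are cut out by the first k sets of a countable base; along a diagonal subsequence all cell masses
  converge, and the limits are additive on the binary tree of cells. The uniform variable picks a
  branch with these masses, and points chosen in the cells along the branch converge. Only double
  integrals of continuous kernels are claimed to converge, which is the form in which energies use
  it.\<close>

lemma weak_compactness:
  fixes K :: "'a::{second_countable_topology, metric_space} set"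
  assumes K: "compact K" and mu: "\<And>i::nat. \<mu> i \<in> borel_prob_measures K"
  obtains r \<nu> where "strict_mono (r :: nat \<Rightarrow> nat)" "\<nu> \<in> borel_prob_measures K"
    "\<And>g :: 'a \<Rightarrow> 'a \<Rightarrow> real. continuous_on UNIV (\<lambda>(x, y). g x y) \<Longrightarrow>
       (\<lambda>i. LINT y|\<mu> (r i). LINT x|\<mu> (r i). g x y) \<longlonglongrightarrow> (LINT y|\<nu>. LINT x|\<nu>. g x y)"
proof -
  obtain B :: "'a set set" where B: "countable B" "topological_basis B" using ex_countable_basis by blast
  have Bne: "B \<noteq> {}" using topological_basisE[OF B(2) open_UNIV UNIV_I] by blast
  define A where "A = from_nat_into B"
  have rA: "range A = B" unfolding A_def by (intro range_from_nat_into Bne B(1))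
  have Ao [measurable]: "A k \<in> sets borel" for k
  proof -
    have "A k \<in> B" using rA by auto
    from topological_basis_open[OF B(2) this] show ?thesis by simp
  qed
  \<comment> \<open>The record of \<open>x\<close> in the first k basic sets. Refining k to k + 1
    splits each cell in two, either of which may be empty.\<close>
  define bl where "bl k x = map (\<lambda>i. x \<in> A i) [0..<k]" for k x
  define cell where "cell w = {x \<in> K. bl (length w) x = w}" for w
  have Km [measurable]: "K \<in> sets borel" using K by (simp add: compact_imp_closed)
  have blm: "{x. bl k x = w} \<in> sets borel" for k w
  proof -
    have "{x. bl k x = w} = (if length w = k then {x \<in> space borel. \<forall>i<k. x \<in> A i \<longleftrightarrow> w ! i} else {})"
      by (auto simp: bl_def list_eq_iff_nth_eq)
    also have "\<dots> \<in> sets borel"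
    proof -
      have "{x. x \<in> A i \<longleftrightarrow> w ! i} \<in> sets borel" for i
        using Ao[of i] by (cases "w ! i") (auto simp: Compl_eq[symmetric])
      then have "(\<Inter>i\<in>{..<k}. {x. x \<in> A i \<longleftrightarrow> w ! i}) \<in> sets borel"
        by (cases "k = 0") (auto intro!: sets.finite_INT)
      moreover have "(\<Inter>i\<in>{..<k}. {x. x \<in> A i \<longleftrightarrow> w ! i}) = {x \<in> space borel. \<forall>i<k. x \<in> A i \<longleftrightarrow> w ! i}" by auto
      ultimately show ?thesis by simp
    qed
    finally show ?thesis .
  qed
  have cellm: "cell w \<in> sets borel" for w
  proof -
    have "cell w = K \<inter> {x. bl (length w) x = w}" by (auto simp: cell_def)
    then show ?thesis using blm Km by auto
  qed
  note D = borel_prob_measuresD[OF mu]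
  have cellmu: "cell w \<in> sets (\<mu> i)" for w i
    using cellm[of w] unfolding D(2) sets_restrict_space by (auto simp: cell_def)
  \<comment> \<open>There are countably many words, so one diagonal subsequence makes the masses of
    all cells converge.\<close>
  obtain r where r: "strict_mono (r :: nat \<Rightarrow> nat)" "\<And>w. w \<in> (UNIV :: bool list set) \<Longrightarrow> \<exists>l. (\<lambda>n. measure (\<mu> (r n)) (cell w)) \<longlonglongrightarrow> l"
  proof (rule function_convergent_subsequence[of "UNIV :: bool list set" "\<lambda>n w. measure (\<mu> n) (cell w)" 1])
    show "norm (measure (\<mu> n) (cell w)) \<le> 1" for n w
      using prob_space.prob_le_1[OF D(1)] by simp
  qed auto
  define p where "p w = lim (\<lambda>n. measure (\<mu> (r n)) (cell w))" for w
  have plim: "(\<lambda>n. measure (\<mu> (r n)) (cell w)) \<longlonglongrightarrow> p w" for w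
  proof -
    obtain l where l: "(\<lambda>n. measure (\<mu> (r n)) (cell w)) \<longlonglongrightarrow> l" using r(2)[OF UNIV_I] by blast
    then show ?thesis unfolding p_def limI[OF l] .
  qed
  have pnn: "p w \<ge> 0" for w by (rule LIMSEQ_le_const[OF plim]) auto
  have p0: "p [] = 1"
  proof -
    have "cell [] = K" by (auto simp: cell_def bl_def)
    then have "measure (\<mu> (r n)) (cell []) = 1" for n
      using prob_space.prob_space[OF D(1)[of "r n"]] by (simp add: D(3))
    then have "(\<lambda>n. 1) \<longlonglongrightarrow> p []" using plim[of "[]"] by simp
    from LIMSEQ_unique[OF tendsto_const this] show ?thesis by simp
  qed
  have split: "p w = p (w @ [True]) + p (w @ [False])" for w
  proof -
    have un: "cell w = cell (w @ [True]) \<union> cell (w @ [False])" and dj: "cell (w @ [True]) \<inter> cell (w @ [False]) = {}"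
      by (auto simp: cell_def bl_def)
    have "measure (\<mu> (r n)) (cell w) = measure (\<mu> (r n)) (cell (w @ [True])) + measure (\<mu> (r n)) (cell (w @ [False]))" for n
    proof -
      interpret prob_space "\<mu> (r n)" by (rule D)
      show ?thesis unfolding un by (rule finite_measure_Union[OF cellmu cellmu dj])
    qed
    then have "(\<lambda>n. measure (\<mu> (r n)) (cell w)) \<longlonglongrightarrow> p (w @ [True]) + p (w @ [False])"
      using tendsto_add[OF plim[of "w @ [True]"] plim[of "w @ [False]"]] by simp
    from LIMSEQ_unique[OF plim this] show ?thesis .
  qed
  note interval = tree_walk_interval[of p, OF pnn p0 split]
  define W where "W U k = fst (tree_walk p U k)" for U k
  have Wl: "length (W U k) = k" for U k by (simp add: W_def tree_walk_length)
  \<comment> \<open>A branch taken by some \<open>U\<close> occupies an interval of positive length,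
    so its limit mass is positive and its cell cannot be empty.\<close>
  have ne: "cell (W U k) \<noteq> {}" if "U \<in> {0..<1}" for U k
  proof -
    have "U \<in> {V \<in> {0..<1}. fst (tree_walk p V k) = W U k}" using that by (simp add: W_def)
    then have "U \<in> {tree_left p (W U k) ..< tree_left p (W U k) + p (W U k)}" unfolding interval[OF Wl] .
    then have "p (W U k) > 0" by auto
    moreover have "p (W U k) = 0" if "cell (W U k) = {}"
    proof -
      have "(\<lambda>n. 0) \<longlonglongrightarrow> p (W U k)" using plim[of "W U k"] unfolding that by simp
      from LIMSEQ_unique[OF tendsto_const this] show ?thesis by simp
    qed
    ultimately show ?thesis by auto
  qed
  define c where "c w = (SOME x. x \<in> cell w)" for w
  have c: "c w \<in> cell w" if "cell w \<noteq> {}" for w unfolding c_def using that by (simp add: some_in_eq)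
  \<comment> \<open>By compactness finitely many basic sets contained in balls of radius e / 2 cover
    \<open>K\<close>. Once k exceeds their indices, two points with equal records lie in a common
    one of them.\<close>
  have fine: "\<exists>k0. \<forall>k\<ge>k0. \<forall>x\<in>K. \<forall>y\<in>K. bl k x = bl k y \<longrightarrow> dist x y < e" if e: "e > 0" for e
  proof -
    have "K \<subseteq> \<Union>{b \<in> B. \<exists>x. b \<subseteq> ball x (e / 2)}"
    proof
      fix x assume "x \<in> K"
      obtain b where "b \<in> B" "x \<in> b" "b \<subseteq> ball x (e / 2)"
        by (rule topological_basisE[OF B(2), of "ball x (e / 2)" x]) (use e in auto)
      then show "x \<in> \<Union>{b \<in> B. \<exists>x. b \<subseteq> ball x (e / 2)}" by auto
    qed
    then obtain D where D: "D \<subseteq> {b \<in> B. \<exists>x. b \<subseteq> ball x (e / 2)}" "finite D" "K \<subseteq> \<Union>D"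
      by (rule compactE[OF K]) (use topological_basis_open[OF B(2)] in auto)
    have "\<forall>b\<in>D. \<exists>i. A i = b" using D(1) rA by blast
    then obtain idx where idx: "\<forall>b\<in>D. A (idx b) = b" by metis
    show ?thesis
    proof (intro exI allI impI ballI)
      fix k x y assume k: "k \<ge> Suc (Max (insert 0 (idx ` D)))" and xy: "x \<in> K" "y \<in> K" "bl k x = bl k y"
      obtain b where b: "b \<in> D" "x \<in> b" using D(3) xy by auto
      have "idx b \<le> Max (insert 0 (idx ` D))" using b D(2) by (intro Max_ge) auto
      then have "idx b < k" using k by simp
      have "(x \<in> A (idx b)) = (y \<in> A (idx b))" using xy(3) \<open>idx b < k\<close> by (simp add: bl_def)
      then have "y \<in> b" using b idx by auto
      obtain z where "b \<subseteq> ball z (e / 2)" using b D(1) by auto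
      then have "dist z x < e / 2" "dist z y < e / 2" using b \<open>y \<in> b\<close> by auto
      then show "dist x y < e" using dist_triangle3[of x y z] by simp
    qed
  qed
  define X where "X k U = c (W U k)" for k U
  have Xcell: "X k U \<in> K \<and> bl k (X k U) = W U k" if "U \<in> {0..<1}" for k U
    using c[OF ne[OF that, of k]] Wl[of U k] by (simp add: X_def cell_def)
  have bltake: "bl k x = take k (bl l x)" if "k \<le> l" for k l x
    using that by (simp add: bl_def take_map)
  have Xbl: "bl k (X l U) = W U k" if "U \<in> {0..<1}" "k \<le> l" for k l U
    using Xcell[OF that(1), of l] bltake[OF that(2)] tree_walk_take[OF that(2), of p U] by (simp add: W_def)
  have Cau: "Cauchy (\<lambda>k. X k U)" if U: "U \<in> {0..<1}" for U
  proof (rule metric_CauchyI)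
    fix e :: real assume "e > 0"
    from fine[OF this] obtain k0 where k0: "\<And>k x y. k \<ge> k0 \<Longrightarrow> x \<in> K \<Longrightarrow> y \<in> K \<Longrightarrow> bl k x = bl k y \<Longrightarrow> dist x y < e" by blast
    show "\<exists>M. \<forall>m\<ge>M. \<forall>n\<ge>M. dist (X m U) (X n U) < e"
      using k0[of k0] Xcell[OF U] Xbl[OF U] by (intro exI[of _ k0]) auto
  qed
  have Xconv: "\<exists>l\<in>K. (\<lambda>k. X k U) \<longlonglongrightarrow> l" if U: "U \<in> {0..<1}" for U
    using K[THEN compact_imp_complete] Cau[OF U] Xcell[OF U] unfolding complete_def by (metis (no_types, lifting))
  \<comment> \<open>The limit point may leave the cells of its branch, so the law of
    \<open>Y\<close> need not give the cells their limit masses. Below only the distance of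
    \<open>Y\<close> to the chosen points enters, and the masses belong to the branches.\<close>
  define Y where "Y U = lim (\<lambda>k. X k U)" for U
  have Y: "(\<lambda>k. X k U) \<longlonglongrightarrow> Y U" "Y U \<in> K" if U: "U \<in> {0..<1}" for U
  proof -
    obtain l where "l \<in> K" "(\<lambda>k. X k U) \<longlonglongrightarrow> l" using Xconv[OF U] by blast
    then show "(\<lambda>k. X k U) \<longlonglongrightarrow> Y U" "Y U \<in> K" unfolding Y_def using limI[of "\<lambda>k. X k U" l] by simp_all
  qed
  have Yfine: "\<exists>k0. \<forall>k\<ge>k0. (\<forall>U\<in>{0..<1}. dist (Y U) (X k U) < e) \<and> (\<forall>x\<in>K. dist x (c (bl k x)) < e)" if e: "e > 0" for e
  proof -
    obtain k0 where k0: "\<And>k x y. k \<ge> k0 \<Longrightarrow> x \<in> K \<Longrightarrow> y \<in> K \<Longrightarrow> bl k x = bl k y \<Longrightarrow> dist x y < e / 2"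
      using fine[of "e / 2"] e by auto
    show ?thesis
    proof (intro exI allI impI conjI ballI)
      fix k U assume k: "k \<ge> k0" and U: "U \<in> {0..<1::real}"
      have "eventually (\<lambda>l. dist (X l U) (X k U) \<le> e / 2) sequentially"
        using eventually_ge_at_top[of k] by eventually_elim (use k0[OF k] Xcell[OF U] Xbl[OF U] in \<open>auto intro: less_imp_le\<close>)
      then have "dist (Y U) (X k U) \<le> e / 2"
        by (intro tendsto_upperbound[OF tendsto_dist[OF Y(1)[OF U] tendsto_const]]) auto
      then show "dist (Y U) (X k U) < e" using e by simp
    next
      fix k x assume k: "k \<ge> k0" and x: "x \<in> K"
      have "x \<in> cell (bl k x)" using x by (simp add: cell_def) (simp add: bl_def)
      then have "c (bl k x) \<in> cell (bl k x)" using c by auto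
      then have "c (bl k x) \<in> K" "bl k (c (bl k x)) = bl k x" by (auto simp: cell_def) (simp add: bl_def)
      then have "dist x (c (bl k x)) < e / 2" using k0[OF k x] by simp
      then show "dist x (c (bl k x)) < e" using e by simp
    qed
  qed
  define P where "P = restrict_space lborel {0..<1::real}"
  interpret P: prob_space P
    by (rule prob_spaceI) (simp add: P_def space_restrict_space emeasure_restrict_space)
  have spP: "space P = {0..<1}" by (simp add: P_def space_restrict_space)
  define L where "L k = {w :: bool list. length w = k}" for k
  have Lfin: "finite (L k)" for k
    unfolding L_def using finite_lists_length_eq[of "UNIV :: bool set" k] by simp
  have WP: "{U \<in> space P. W U k = w} = {tree_left p w ..< tree_left p w + p w}" if "w \<in> L k" for w k
    using interval[of w k] that by (simp add: L_def spP W_def)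
  have sub: "{tree_left p w ..< tree_left p w + p w} \<subseteq> {0..<1}" for w
    using interval[OF refl, of w] by blast
  have Wm [measurable]: "(\<lambda>U. W U k) \<in> measurable P (count_space (L k))" for k
  proof (subst measurable_count_space_eq2[OF Lfin], intro conjI ballI)
    show "(\<lambda>U. W U k) \<in> space P \<rightarrow> L k" by (auto simp: L_def Wl)
    fix w assume w: "w \<in> L k"
    have "(\<lambda>U. W U k) -` {w} \<inter> space P = {U \<in> space P. W U k = w}" by auto
    also have "\<dots> \<in> sets P" unfolding WP[OF w] unfolding P_def using sub[of w]
      by (subst sets_restrict_space_iff) auto
    finally show "(\<lambda>U. W U k) -` {w} \<inter> space P \<in> sets P" .
  qed
  have Wprob: "measure P {U \<in> space P. W U k = w} = p w" if "w \<in> L k" for w k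
    unfolding WP[OF that] unfolding P_def using sub[of w] pnn[of w]
    by (subst measure_restrict_space) auto
  have Xm: "X k \<in> borel_measurable P" for k
    unfolding X_def by (rule measurable_compose[OF Wm]) simp
  have Ym: "Y \<in> borel_measurable P"
    by (rule borel_measurable_LIMSEQ_metric[where f=X]) (use Xm Y(1) spP in auto)
  have YmK: "Y \<in> measurable P (restrict_space borel K)"
    by (rule measurable_restrict_space2) (use Ym Y(2) spP in auto)
  define \<nu> where "\<nu> = distr P (restrict_space borel K) Y"
  have \<nu>: "\<nu> \<in> borel_prob_measures K"
    unfolding borel_prob_measures_def \<nu>_def using P.prob_space_distr[OF YmK] by simp
  have blmK: "bl k \<in> measurable (\<mu> i) (count_space (L k))" for k i
  proof (subst measurable_count_space_eq2[OF Lfin], intro conjI ballI)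
    show "bl k \<in> space (\<mu> i) \<rightarrow> L k" by (auto simp: L_def bl_def)
    fix w assume w: "w \<in> L k"
    have "bl k -` {w} \<inter> space (\<mu> i) = cell w" using w by (auto simp: D(3) cell_def L_def)
    then show "bl k -` {w} \<inter> space (\<mu> i) \<in> sets (\<mu> i)" using cellmu by simp
  qed
  have blprob: "{x \<in> space (\<mu> i). bl k x = w} = cell w" if "w \<in> L k" for w k i
    using that by (auto simp: D(3) cell_def L_def)
  show thesis
  proof (rule that[OF r(1) \<nu>])
    fix g :: "'a \<Rightarrow> 'a \<Rightarrow> real" assume g: "continuous_on UNIV (\<lambda>(x, y). g x y)"
    have g' [measurable]: "(\<lambda>(x, y). g x y) \<in> borel_measurable (borel \<Otimes>\<^sub>M borel)"
      using borel_measurable_continuous_onI[OF g] by (simp add: borel_prod)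
    have YY: "(LINT y|\<nu>. LINT x|\<nu>. g x y) = (LINT v|P. LINT u|P. g (Y u) (Y v))"
    proof -
      have [measurable]: "Y \<in> measurable P (restrict_space borel K)" by (rule YmK)
      have gm: "(\<lambda>x. g x y) \<in> borel_measurable (restrict_space borel K)" for y
        by (rule measurable_restrict_space1) measurable
      have gK: "(\<lambda>z. g (snd z) (fst z)) \<in> borel_measurable (restrict_space borel K \<Otimes>\<^sub>M \<nu>)"
      proof -
        have "(\<lambda>z. (snd z, fst z)) \<in> measurable (restrict_space borel K \<Otimes>\<^sub>M \<nu>) (borel \<Otimes>\<^sub>M borel)"
        proof (rule measurable_Pair)
          show "(\<lambda>x. snd x) \<in> restrict_space borel K \<Otimes>\<^sub>M \<nu> \<rightarrow>\<^sub>M borel"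
            using measurable_compose[OF measurable_snd measurable_borel_prob_measures[OF \<nu> measurable_ident]] by simp
          show "(\<lambda>x. fst x) \<in> restrict_space borel K \<Otimes>\<^sub>M \<nu> \<rightarrow>\<^sub>M borel"
            using measurable_compose[OF measurable_fst measurable_restrict_space1[OF measurable_ident]] by simp
        qed
        from measurable_compose[OF this g'] show ?thesis by simp
      qed
      interpret n: prob_space \<nu> using borel_prob_measuresD[OF \<nu>] by simp
      have m2: "(\<lambda>y. LINT x|\<nu>. g x y) \<in> borel_measurable (restrict_space borel K)"
        using gK by (intro n.borel_measurable_lebesgue_integral) (simp add: case_prod_beta')
      have "(LINT x|\<nu>. g x y) = (LINT u|P. g (Y u) y)" for y
        unfolding \<nu>_def by (rule integral_distr[OF YmK gm])
      moreover have "(LINT y|\<nu>. LINT x|\<nu>. g x y) = (LINT v|P. LINT x|\<nu>. g x (Y v))"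
        using integral_distr[OF YmK m2] by (simp add: \<nu>_def[symmetric])
      ultimately show ?thesis by simp
    qed
    show "(\<lambda>i. LINT y|\<mu> (r i). LINT x|\<mu> (r i). g x y) \<longlonglongrightarrow> (LINT y|\<nu>. LINT x|\<nu>. g x y)"
    proof (rule LIMSEQ_I)
      fix e0 :: real assume e0: "0 < e0"
      \<comment> \<open>Three errors of size \<open>e\<close> have to fit: each double integral
        against its own cell sum, and one cell sum against the other.\<close>
      define e where "e = e0 / 4"
      have e: "e > 0" using e0 by (simp add: e_def)
      have "uniformly_continuous_on (K \<times> K) (\<lambda>(x, y). g x y)"
        using compact_uniformly_continuous[OF continuous_on_subset[OF g] compact_Times[OF K K]] by auto
      then obtain d where d: "d > 0" "\<And>z z'. z \<in> K \<times> K \<Longrightarrow> z' \<in> K \<times> K \<Longrightarrow> dist z' z < d \<Longrightarrow> dist (case z' of (x, y) \<Rightarrow> g x y) (case z of (x, y) \<Rightarrow> g x y) < e"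
        unfolding uniformly_continuous_on_def using e by blast
      obtain k where k: "\<forall>U\<in>{0..<1}. dist (Y U) (X k U) < d / 2" "\<forall>x\<in>K. dist x (c (bl k x)) < d / 2"
        using Yfine[of "d / 2"] d(1) by auto
      have near: "\<bar>g x y - g x' y'\<bar> \<le> e" if "x \<in> K" "y \<in> K" "x' \<in> K" "y' \<in> K" "dist x x' < d / 2" "dist y y' < d / 2" for x y x' y'
      proof -
        have "dist (x, y) (x', y') \<le> dist x x' + dist y y'"
          unfolding dist_Pair_Pair by (rule sqrt_sum_squares_le_sum) auto
        then have "dist (x, y) (x', y') < d" using that by linarith
        then show ?thesis using d(2)[of "(x', y')" "(x, y)"] that by (auto simp: dist_real_def)
      qed
      define S where "S q = (\<Sum>w'\<in>L k. \<Sum>w\<in>L k. g (c w) (c w') * q w * q w')" for q :: "bool list \<Rightarrow> real"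
      have 1: "\<bar>(LINT y|\<nu>. LINT x|\<nu>. g x y) - S p\<bar> \<le> e"
      proof -
        have "\<bar>(LINT v|P. LINT u|P. g (Y u) (Y v)) - (\<Sum>w'\<in>L k. \<Sum>w\<in>L k. g (c w) (c w') * measure P {U \<in> space P. W U k = w} * measure P {U \<in> space P. W U k = w'})\<bar> \<le> e"
        proof (rule P.double_integral_step[OF g Ym Wm Lfin, where G = "\<lambda>w w'. g (c w) (c w')"])
          show "\<bar>g (Y u) (Y v) - g (c (W u k)) (c (W v k))\<bar> \<le> e" if "u \<in> space P" "v \<in> space P" for u v
            using that k(1) Y(2) Xcell unfolding spP X_def by (intro near) auto
        qed
        then show ?thesis unfolding YY S_def by (simp add: Wprob cong: sum.cong)
      qed
      have 2: "\<bar>(LINT y|\<mu> i. LINT x|\<mu> i. g x y) - S (\<lambda>w. measure (\<mu> i) (cell w))\<bar> \<le> e" for i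
      proof -
        interpret M: prob_space "\<mu> i" by (rule D)
        have cK: "c (bl k x) \<in> K" if "x \<in> K" for x
        proof -
          have "x \<in> cell (bl k x)" using that by (simp add: cell_def) (simp add: bl_def)
          then show ?thesis using c by (auto simp: cell_def)
        qed
        have "\<bar>(LINT v|\<mu> i. LINT u|\<mu> i. g u v) - (\<Sum>w'\<in>L k. \<Sum>w\<in>L k. g (c w) (c w') * measure (\<mu> i) {x \<in> space (\<mu> i). bl k x = w} * measure (\<mu> i) {x \<in> space (\<mu> i). bl k x = w'})\<bar> \<le> e"
        proof (rule M.double_integral_step[OF g _ blmK Lfin, where T = "\<lambda>x. x" and G = "\<lambda>w w'. g (c w) (c w')"])
          show "(\<lambda>x. x) \<in> borel_measurable (\<mu> i)"
            by (rule measurable_borel_prob_measures[OF mu]) simp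
          show "\<bar>g u v - g (c (bl k u)) (c (bl k v))\<bar> \<le> e" if "u \<in> space (\<mu> i)" "v \<in> space (\<mu> i)" for u v
            using that k(2) unfolding D(3) by (intro near cK) auto
        qed
        then show ?thesis unfolding S_def by (simp add: blprob cong: sum.cong)
      qed
      have "(\<lambda>i. S (\<lambda>w. measure (\<mu> (r i)) (cell w))) \<longlonglongrightarrow> S p"
        unfolding S_def by (intro tendsto_intros plim)
      then obtain n0 where n0: "\<And>n. n \<ge> n0 \<Longrightarrow> norm (S (\<lambda>w. measure (\<mu> (r n)) (cell w)) - S p) < e"
        by (metis LIMSEQ_D e)
      show "\<exists>no. \<forall>n\<ge>no. norm ((LINT y|\<mu> (r n). LINT x|\<mu> (r n). g x y) - (LINT y|\<nu>. LINT x|\<nu>. g x y)) < e0"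
      proof (intro exI allI impI)
        fix n assume "n \<ge> n0"
        then show "norm ((LINT y|\<mu> (r n). LINT x|\<mu> (r n). g x y) - (LINT y|\<nu>. LINT x|\<nu>. g x y)) < e0"
          using n0[of n] 1 2[of "r n"] unfolding real_norm_def e_def by linarith
      qed
    qed
  qed
qed

subsection \<open>The kernels of the strip\<close>

text \<open>By the mean value theorem a Lipschitz derivative gives each term a second order
  remainder, and these are summed. Explicit remainders are preferred to a derivative of the series
  because their constants do not depend on the distance \<open>r\<close>, so that they can be
  integrated against measures.\<close>

lemma series_remainder:
  fixes f f' :: "nat \<Rightarrow> real \<Rightarrow> real"
  assumes S: "convex S" and xy: "x \<in> S" "y \<in> S"
    and der: "\<And>k z. z \<in> S \<Longrightarrow> (f k has_real_derivative f' k z) (at z)"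
    and lip: "\<And>k z w. z \<in> S \<Longrightarrow> w \<in> S \<Longrightarrow> \<bar>f' k z - f' k w\<bar> \<le> L k * \<bar>z - w\<bar>"
    and sm: "summable L" "summable (\<lambda>k. f k x)" "summable (\<lambda>k. f k y)" "summable (\<lambda>k. f' k x)" "summable (\<lambda>k. f' k y)"
  shows "\<bar>(\<Sum>k. f k y) - (\<Sum>k. f k x) - (y - x) * (\<Sum>k. f' k x)\<bar> \<le> (\<Sum>k. L k) * (y - x)\<^sup>2"
    and "\<bar>(\<Sum>k. f' k y) - (\<Sum>k. f' k x)\<bar> \<le> (\<Sum>k. L k) * \<bar>y - x\<bar>"
proof -
  have I: "is_interval S" using S by (simp add: is_interval_convex_1)
  have tm: "\<bar>f k y - f k x - (y - x) * f' k x\<bar> \<le> L k * (y - x)\<^sup>2" for k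
  proof -
    have "\<exists>z\<in>S. f k y - f k x = (y - x) * f' k z \<and> \<bar>z - x\<bar> \<le> \<bar>y - x\<bar>"
    proof (cases x y rule: linorder_cases)
      case less
      have "\<exists>z. z > x \<and> z < y \<and> f k y - f k x = (y - x) * f' k z"
      proof (rule MVT2[OF less])
        fix z assume "x \<le> z" "z \<le> y"
        then have "z \<in> S" using xy by (intro mem_is_interval_1_I[OF I, of x y z]) auto
        then show "(f k has_real_derivative f' k z) (at z)" by (rule der)
      qed
      then obtain z where z: "z > x" "z < y" "f k y - f k x = (y - x) * f' k z" by blast
      then have "z \<in> S" using xy by (intro mem_is_interval_1_I[OF I, of x y z]) auto
      then show ?thesis using z by (intro bexI[of _ z]) auto
    next
      case greater
      have "\<exists>z. z > y \<and> z < x \<and> f k x - f k y = (x - y) * f' k z"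
      proof (rule MVT2[OF greater])
        fix z assume "y \<le> z" "z \<le> x"
        then have "z \<in> S" using xy by (intro mem_is_interval_1_I[OF I, of y x z]) auto
        then show "(f k has_real_derivative f' k z) (at z)" by (rule der)
      qed
      then obtain z where z: "z > y" "z < x" "f k x - f k y = (x - y) * f' k z" by blast
      then have "z \<in> S" using xy by (intro mem_is_interval_1_I[OF I, of y x z]) auto
      moreover have "f k y - f k x = (y - x) * f' k z" using z(3) by (simp add: algebra_simps)
      ultimately show ?thesis using z by (intro bexI[of _ z]) auto
    qed (use xy in auto)
    then obtain z where z: "z \<in> S" "f k y - f k x = (y - x) * f' k z" "\<bar>z - x\<bar> \<le> \<bar>y - x\<bar>" by auto
    have "\<bar>f k y - f k x - (y - x) * f' k x\<bar> = \<bar>y - x\<bar> * \<bar>f' k z - f' k x\<bar>"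
      unfolding z(2) by (simp add: abs_mult[symmetric] algebra_simps)
    also have "\<dots> \<le> \<bar>y - x\<bar> * (L k * \<bar>z - x\<bar>)" by (intro mult_left_mono lip z xy) auto
    also have "\<dots> \<le> \<bar>y - x\<bar> * (L k * \<bar>y - x\<bar>)"
    \<comment> \<open>The hypothesis \<open>lip\<close> forces \<open>L k\<close> to be nonnegative
      only through two distinct points.\<close>
    proof (cases "y = x")
      case False
      have "0 \<le> L k * \<bar>y - x\<bar>" using lip[OF xy(2,1), of k] by linarith
      then have "L k \<ge> 0" using False by (simp add: zero_le_mult_iff)
      then show ?thesis using z(3) by (intro mult_left_mono) auto
    qed simp
    also have "\<dots> = L k * (y - x)\<^sup>2" by (simp add: power2_eq_square abs_mult[symmetric])
    finally show ?thesis .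
  qed
  have s1: "summable (\<lambda>k. L k * (y - x)\<^sup>2)" by (intro summable_mult2 sm)
  have "(\<Sum>k. f k y) - (\<Sum>k. f k x) - (y - x) * (\<Sum>k. f' k x) = (\<Sum>k. f k y - f k x - (y - x) * f' k x)"
    using sm by (simp add: suminf_diff[symmetric] suminf_mult[symmetric] summable_diff summable_mult)
  also have "\<bar>\<dots>\<bar> \<le> (\<Sum>k. L k * (y - x)\<^sup>2)"
  proof -
    have s0: "summable (\<lambda>k. \<bar>f k y - f k x - (y - x) * f' k x\<bar>)"
      by (rule summable_comparison_test[OF _ s1]) (use tm in auto)
    show ?thesis
      by (rule order.trans[OF summable_rabs[OF s0]]) (intro suminf_le tm s0 s1)
  qed
  finally show "\<bar>(\<Sum>k. f k y) - (\<Sum>k. f k x) - (y - x) * (\<Sum>k. f' k x)\<bar> \<le> (\<Sum>k. L k) * (y - x)\<^sup>2"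
    using suminf_mult2[OF sm(1), of "(y - x)\<^sup>2"] by simp
  have s2: "summable (\<lambda>k. L k * \<bar>y - x\<bar>)" by (intro summable_mult2 sm)
  have s3: "summable (\<lambda>k. \<bar>f' k y - f' k x\<bar>)"
    by (rule summable_comparison_test[OF _ s2]) (use lip xy in auto)
  have "(\<Sum>k. f' k y) - (\<Sum>k. f' k x) = (\<Sum>k. f' k y - f' k x)"
    using sm by (simp add: suminf_diff)
  also have "\<bar>\<dots>\<bar> \<le> (\<Sum>k. L k * \<bar>y - x\<bar>)"
    by (rule order.trans[OF summable_rabs[OF s3]]) (intro suminf_le lip xy s2 s3)
  finally show "\<bar>(\<Sum>k. f' k y) - (\<Sum>k. f' k x)\<bar> \<le> (\<Sum>k. L k) * \<bar>y - x\<bar>"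
    using suminf_mult2[OF sm(1), of "\<bar>y - x\<bar>"] by simp
qed

section \<open>Derivatives and decay of the kernels in the height\<close>

lemma sqrt_ge_right: "s \<le> sqrt (r\<^sup>2 + s\<^sup>2)" for r s :: real
  by (rule real_le_rsqrt) simp

lemma newt_deriv:
  assumes "s \<noteq> 0"
  shows "(newt m r has_real_derivative (- real m * pois m r s)) (at s)"
proof -
  define q where "q = sqrt (r\<^sup>2 + s\<^sup>2)"
  have q: "q > 0" using assms by (simp add: q_def add_nonneg_pos)
  have pos: "r\<^sup>2 + s\<^sup>2 > 0" using assms by (simp add: sum_power2_gt_zero_iff)
  have d: "((\<lambda>s. sqrt (r\<^sup>2 + s\<^sup>2)) has_real_derivative s / q) (at s)"
    unfolding q_def using assms pos
    by (auto intro!: derivative_eq_intros simp: field_simps)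
  have "((\<lambda>s. inverse (sqrt (r\<^sup>2 + s\<^sup>2) ^ m)) has_real_derivative
      - (inverse (q ^ m) * (real m * q ^ (m - 1) * (s / q)) * inverse (q ^ m))) (at s)"
  proof -
    have "((\<lambda>s. sqrt (r\<^sup>2 + s\<^sup>2) ^ m) has_real_derivative real m * (s / q * q ^ (m - 1))) (at s)"
      using DERIV_power[OF d, of m] by (simp add: q_def)
    from DERIV_inverse'[OF this] show ?thesis using q unfolding q_def[symmetric] by (simp add: mult_ac)
  qed
  also have "- (inverse (q ^ m) * (real m * q ^ (m - 1) * (s / q)) * inverse (q ^ m)) = - real m * pois m r s"
    unfolding pois_def q_def[symmetric] using q by (cases m) (auto simp: field_simps)
  finally show ?thesis by (simp add: newt_def[abs_def] inverse_eq_divide)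
qed

definition dpois :: "nat \<Rightarrow> real \<Rightarrow> real \<Rightarrow> real" where
  "dpois m r s = 1 / sqrt (r\<^sup>2 + s\<^sup>2) ^ (m + 2) - real (m + 2) * s\<^sup>2 / sqrt (r\<^sup>2 + s\<^sup>2) ^ (m + 4)"

lemma pois_deriv:
  assumes "s \<noteq> 0"
  shows "(pois m r has_real_derivative dpois m r s) (at s)"
proof -
  define q where "q = sqrt (r\<^sup>2 + s\<^sup>2)"
  have q: "q > 0" using assms by (simp add: q_def add_nonneg_pos)
  have "((\<lambda>s. s * newt (m + 2) r s) has_real_derivative 1 * newt (m + 2) r s + (- real (m + 2) * pois (m + 2) r s) * s) (at s)"
    by (rule DERIV_mult[OF DERIV_ident newt_deriv[OF assms]])
  also have "1 * newt (m + 2) r s + (- real (m + 2) * pois (m + 2) r s) * s = dpois m r s"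
    unfolding dpois_def newt_def pois_def q_def[symmetric]
    using q by (simp add: power2_eq_square power_add power4_eq_xxxx field_simps)
  also have "(\<lambda>s. s * newt (m + 2) r s) = pois m r" by (auto simp: newt_def pois_def)
  finally show ?thesis .
qed

lemma dpois_bound:
  assumes "0 < c" "c \<le> s"
  shows "\<bar>dpois m r s\<bar> \<le> real (m + 3) / sqrt (r\<^sup>2 + c\<^sup>2) ^ (m + 2)"
proof -
  define q where "q = sqrt (r\<^sup>2 + s\<^sup>2)"
  define p where "p = sqrt (r\<^sup>2 + c\<^sup>2)"
  have p: "p > 0" using assms by (simp add: p_def add_nonneg_pos)
  have pq: "p \<le> q" using assms by (auto simp: p_def q_def intro!: power_mono)
  have sq: "s \<le> q" unfolding q_def by (rule sqrt_ge_right)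
  have q: "q > 0" using p pq by simp
  have "\<bar>dpois m r s\<bar> \<le> 1 / q ^ (m + 2) + real (m + 2) * s\<^sup>2 / q ^ (m + 4)"
    unfolding dpois_def q_def[symmetric] using q by (intro order.trans[OF abs_triangle_ineq4]) auto
  also have "real (m + 2) * s\<^sup>2 / q ^ (m + 4) \<le> real (m + 2) * q\<^sup>2 / q ^ (m + 4)"
    using q assms sq by (intro divide_right_mono mult_left_mono power_mono) auto
  also have "1 / q ^ (m + 2) + real (m + 2) * q\<^sup>2 / q ^ (m + 4) = real (m + 3) / q ^ (m + 2)"
    using q by (simp add: power_add field_simps power2_eq_square power4_eq_xxxx)
  also have "\<dots> \<le> real (m + 3) / p ^ (m + 2)"
    using p pq by (intro divide_left_mono power_mono mult_pos_pos zero_less_power) auto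
  finally show ?thesis by (simp add: p_def)
qed

text \<open>The constant keeps the decay in \<open>r\<close>: it is a multiple of
  \<open>pois m r c / c\<close>. A difference of two Poisson kernels is therefore dominated by a
  Poisson kernel at the lower height, divided by that height.\<close>

lemma pois_lipschitz:
  assumes "0 < c" "c \<le> a" "c \<le> b"
  shows "\<bar>pois m r a - pois m r b\<bar> \<le> real (m + 3) / sqrt (r\<^sup>2 + c\<^sup>2) ^ (m + 2) * \<bar>a - b\<bar>"
proof -
  have "norm (pois m r a - pois m r b) \<le> real (m + 3) / sqrt (r\<^sup>2 + c\<^sup>2) ^ (m + 2) * norm (a - b)"
  proof (rule field_differentiable_bound[of "{c..}"])
    show "(pois m r has_field_derivative dpois m r z) (at z within {c..})" if "z \<in> {c..}" for z
      using that assms by (intro has_field_derivative_at_within[OF pois_deriv]) auto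
    show "norm (dpois m r z) \<le> real (m + 3) / sqrt (r\<^sup>2 + c\<^sup>2) ^ (m + 2)" if "z \<in> {c..}" for z
      using that assms dpois_bound[of c z] by auto
  qed (use assms in auto)
  then show ?thesis by simp
qed

lemma newt_nonneg: "newt m r s \<ge> 0"
  by (simp add: newt_def)

lemma newt_le: "s > 0 \<Longrightarrow> newt m r s \<le> 1 / s ^ m"
  unfolding newt_def using sqrt_ge_right[of s r]
  by (intro divide_left_mono power_mono mult_pos_pos zero_less_power) (auto simp: add_nonneg_pos)

lemma pois_le: "s > 0 \<Longrightarrow> pois m r s \<le> 1 / s ^ (m + 1)"
proof -
  assume s: "s > 0"
  have "pois m r s = s * newt (m + 2) r s" by (simp add: pois_def newt_def)
  also have "\<dots> \<le> s * (1 / s ^ (m + 2))" using s by (intro mult_left_mono newt_le) auto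
  also have "\<dots> = 1 / s ^ (m + 1)" using s by simp
  finally show ?thesis .
qed

text \<open>In the plane the kernel decays only like \<open>1 / s\<close>, so that the series have to be
  regularised; this is the weight of the regularising terms.\<close>

definition reg :: "nat \<Rightarrow> real" where
  "reg m = (if m = 1 then 1 else 0)"

lemma pow_decay:
  fixes s s0 :: real
  assumes "0 < s0" "s0 \<le> s" "m \<ge> 2"
  shows "1 / s ^ m \<le> (1 / s0 ^ (m - 2)) / s\<^sup>2"
proof -
  have "1 / s ^ m = 1 / s ^ (m - 2) * (1 / s\<^sup>2)"
  proof -
    obtain k where "m = 2 + k" using le_Suc_ex[OF assms(3)] by blast
    then show ?thesis by (simp add: power_add power2_eq_square)
  qed
  also have "\<dots> \<le> 1 / s0 ^ (m - 2) * (1 / s\<^sup>2)"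
    using assms by (intro mult_right_mono divide_left_mono power_mono mult_pos_pos zero_less_power) auto
  finally show ?thesis by simp
qed

text \<open>For m = 1 the distance differs from \<open>s\<close> by at most R + Z, by the triangle
  inequality, so subtracting 1/s gains one order; for larger m the kernel itself is of order s^(-2).
  The shift \<open>z\<close> serves points off the plane.\<close>

lemma newt_reg_bound:
  assumes m: "m \<ge> 1" and s0: "s0 > 0" and R: "R \<ge> 0" and Z: "Z \<ge> 0"
  obtains C where "C \<ge> 0" "\<And>r s z. \<lbrakk>0 \<le> r; r \<le> R; s0 \<le> s; \<bar>z\<bar> \<le> Z; \<bar>z\<bar> \<le> s / 2\<rbrakk> \<Longrightarrow>
    \<bar>newt m r (s + z) - reg m / s\<bar> \<le> C / s\<^sup>2"
proof (cases "m = 1")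
  case True
  show ?thesis
  proof (rule that[of "2 * (R + Z)"])
    fix r s z :: real assume h: "0 \<le> r" "r \<le> R" "s0 \<le> s" "\<bar>z\<bar> \<le> Z" "\<bar>z\<bar> \<le> s / 2"
    define q where "q = sqrt (r\<^sup>2 + (s + z)\<^sup>2)"
    have s: "s > 0" using h s0 by simp
    have sz: "s + z \<ge> s / 2" using h by (auto simp: abs_le_iff)
    have "s + z \<le> q" unfolding q_def by (rule sqrt_ge_right)
    moreover have "q \<le> r + (s + z)" unfolding q_def using h sz s by (intro sqrt_sum_squares_le_sum) auto
    ultimately have qs: "\<bar>s - q\<bar> \<le> R + Z" "q \<ge> s / 2" using h sz by (auto simp: abs_le_iff)
    have "newt m r (s + z) - reg m / s = (s - q) / (q * s)"
      using s qs by (simp add: newt_def reg_def True q_def[symmetric] field_simps)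
    also have "\<bar>\<dots>\<bar> = \<bar>s - q\<bar> / (q * s)" using s qs by (simp add: abs_mult)
    also have "\<dots> \<le> (R + Z) / (s / 2 * s)" using s qs R Z by (intro frac_le mult_right_mono) auto
    finally show "\<bar>newt m r (s + z) - reg m / s\<bar> \<le> 2 * (R + Z) / s\<^sup>2"
      by (simp add: power2_eq_square algebra_simps)
  qed (use R Z in auto)
next
  case False
  then have m2: "m \<ge> 2" using m by simp
  show ?thesis
  proof (rule that[of "2 ^ m / s0 ^ (m - 2)"])
    fix r s z :: real assume h: "0 \<le> r" "r \<le> R" "s0 \<le> s" "\<bar>z\<bar> \<le> Z" "\<bar>z\<bar> \<le> s / 2"
    have s: "s > 0" using h s0 by simp
    have sz: "s + z \<ge> s / 2" using h by (auto simp: abs_le_iff)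
    have "newt m r (s + z) \<le> 1 / (s + z) ^ m" using s sz by (intro newt_le) auto
    also have "\<dots> \<le> 1 / (s / 2) ^ m" using s sz by (intro divide_left_mono power_mono mult_pos_pos zero_less_power) auto
    also have "\<dots> = 2 ^ m * (1 / s ^ m)" by (simp add: power_divide)
    also have "\<dots> \<le> 2 ^ m * ((1 / s0 ^ (m - 2)) / s\<^sup>2)"
      using pow_decay[OF s0 h(3) m2] by (intro mult_left_mono) auto
    finally show "\<bar>newt m r (s + z) - reg m / s\<bar> \<le> 2 ^ m / s0 ^ (m - 2) / s\<^sup>2"
      using False newt_nonneg[of m r "s + z"] by (simp add: reg_def)
  qed (use s0 in auto)
qed

text \<open>This is the derivative of \<open>t * newt m r (2 * t * j)\<close> in \<open>t\<close>, at \<open>s = 2 * t * j\<close>.\<close>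

definition enewt :: "nat \<Rightarrow> real \<Rightarrow> real \<Rightarrow> real" where
  "enewt m r s = newt m r s - s * (real m * pois m r s)"

text \<open>For m = 1 the terms of order 1/s cancel: with q the distance, the value is r^2 / q^3. So
  this series converges without a regularising term in every dimension.\<close>

lemma enewt_bound:
  assumes m: "m \<ge> 1" and s0: "s0 > 0" and R: "R \<ge> 0"
  obtains C where "C \<ge> 0" "\<And>r s. \<lbrakk>0 \<le> r; r \<le> R; s0 \<le> s\<rbrakk> \<Longrightarrow> \<bar>enewt m r s\<bar> \<le> C / s\<^sup>2"
proof (cases "m = 1")
  case True
  show ?thesis
  proof (rule that[of "R\<^sup>2 / s0"])
    fix r s :: real assume h: "0 \<le> r" "r \<le> R" "s0 \<le> s"
    define q where "q = sqrt (r\<^sup>2 + s\<^sup>2)"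
    have s: "s > 0" using h s0 by simp
    have q: "q \<ge> s" unfolding q_def by (rule sqrt_ge_right)
    have q2: "q\<^sup>2 = r\<^sup>2 + s\<^sup>2" by (simp add: q_def)
    have "enewt m r s = (q\<^sup>2 - s\<^sup>2) / q ^ 3"
      unfolding enewt_def newt_def pois_def q_def[symmetric] using q s by (simp add: True field_simps power2_eq_square power3_eq_cube)
    also have "\<bar>\<dots>\<bar> = r\<^sup>2 / q ^ 3" using q s unfolding q2 by simp
    also have "\<dots> \<le> R\<^sup>2 / s ^ 3" using q s h by (intro frac_le power_mono) auto
    also have "\<dots> = R\<^sup>2 / s\<^sup>2 * (1 / s)" by (simp add: power2_eq_square power3_eq_cube)
    also have "\<dots> \<le> R\<^sup>2 / s\<^sup>2 * (1 / s0)" using s h s0 by (intro mult_left_mono divide_left_mono) auto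
    finally show "\<bar>enewt m r s\<bar> \<le> R\<^sup>2 / s0 / s\<^sup>2" by (simp add: mult.commute)
  qed (use s0 in auto)
next
  case False
  then have m2: "m \<ge> 2" using m by simp
  show ?thesis
  proof (rule that[of "real (m + 1) / s0 ^ (m - 2)"])
    fix r s :: real assume h: "0 \<le> r" "r \<le> R" "s0 \<le> s"
    have s: "s > 0" using h s0 by simp
    have "\<bar>enewt m r s\<bar> \<le> newt m r s + s * (real m * pois m r s)"
      unfolding enewt_def using newt_nonneg[of m r s] pois_nonneg[of s m r] s by (intro order.trans[OF abs_triangle_ineq4]) auto
    also have "\<dots> \<le> 1 / s ^ m + s * (real m * (1 / s ^ (m + 1)))"
      using s by (intro add_mono mult_left_mono newt_le pois_le) auto
    also have "\<dots> = real (m + 1) * (1 / s ^ m)" using s by (simp add: field_simps)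
    also have "\<dots> \<le> real (m + 1) * ((1 / s0 ^ (m - 2)) / s\<^sup>2)"
      by (intro mult_left_mono pow_decay s0 h m2) auto
    finally show "\<bar>enewt m r s\<bar> \<le> real (m + 1) / s0 ^ (m - 2) / s\<^sup>2" by simp
  qed (use s0 in auto)
qed

text \<open>The derivative is of order s^(-3). At s = 2 t j a change of t moves s by a multiple of
  j, and the Lipschitz constants in t are of order j^(-2), which is summable.\<close>

lemma enewt_lipschitz:
  assumes m: "m \<ge> 1" and s0: "s0 > 0" and R: "R \<ge> 0"
  obtains C where "C \<ge> 0" "\<And>r c s s'. \<lbrakk>0 \<le> r; r \<le> R; s0 \<le> c; c \<le> s; c \<le> s'\<rbrakk> \<Longrightarrow>
    \<bar>enewt m r s - enewt m r s'\<bar> \<le> C / c ^ 3 * \<bar>s - s'\<bar>"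
proof -
  define d where "d r s = - real m * pois m r s - (real m * pois m r s + s * (real m * dpois m r s))" for r s
  have der: "(enewt m r has_real_derivative d r s) (at s)" if "s \<noteq> 0" for r s
    unfolding enewt_def[abs_def] d_def using that
    by (auto intro!: derivative_eq_intros newt_deriv pois_deriv)
  have "\<exists>C\<ge>0. \<forall>r s. 0 \<le> r \<longrightarrow> r \<le> R \<longrightarrow> s0 \<le> s \<longrightarrow> \<bar>d r s\<bar> \<le> C / s ^ 3"
  proof (cases "m = 1")
    case True
    show ?thesis
    proof (intro exI[of _ "3 * R\<^sup>2 / s0"] conjI allI impI)
      fix r s :: real assume h: "0 \<le> r" "r \<le> R" "s0 \<le> s"
      define q where "q = sqrt (r\<^sup>2 + s\<^sup>2)"
      have s: "s > 0" using h s0 by simp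
      have q: "q \<ge> s" unfolding q_def by (rule sqrt_ge_right)
      have q2: "q\<^sup>2 = r\<^sup>2 + s\<^sup>2" by (simp add: q_def)
      have q0: "q > 0" using q s by simp
      have e1: "pois m r s = s * q\<^sup>2 / q ^ 5"
        unfolding pois_def q_def[symmetric] using q0 by (simp add: True eval_nat_numeral)
      have e2: "dpois m r s = (q\<^sup>2 - 3 * s\<^sup>2) / q ^ 5"
        unfolding dpois_def q_def[symmetric] using q0 by (simp add: True field_simps eval_nat_numeral)
      have "d r s = - 3 * s * (q\<^sup>2 - s\<^sup>2) / q ^ 5"
        unfolding d_def e1 e2 using q0 by (simp add: True field_simps)
      also have "\<dots> = - (3 * s * r\<^sup>2 / q ^ 5)" unfolding q2 by simp
      finally have "\<bar>d r s\<bar> = 3 * s * r\<^sup>2 / q ^ 5" using s q0 by simp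
      also have "\<dots> \<le> 3 * s * R\<^sup>2 / s ^ 5" using q s h by (intro frac_le power_mono mult_left_mono) auto
      also have "\<dots> = 3 * R\<^sup>2 / s ^ 3 * (1 / s)" using s by (simp add: field_simps eval_nat_numeral)
      also have "\<dots> \<le> 3 * R\<^sup>2 / s ^ 3 * (1 / s0)" using s h s0 by (intro mult_left_mono divide_left_mono) auto
      finally show "\<bar>d r s\<bar> \<le> 3 * R\<^sup>2 / s0 / s ^ 3" by (simp add: mult.commute)
    qed (use s0 in auto)
  next
    case False
    then have m2: "m \<ge> 2" using m by simp
    define A where "A = real m * (2 + real (m + 3))"
    show ?thesis
    proof (intro exI[of _ "A / s0 ^ (m - 2)"] conjI allI impI)
      fix r s :: real assume h: "0 \<le> r" "r \<le> R" "s0 \<le> s"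
      have s: "s > 0" using h s0 by simp
      have "d r s = - (2 * real m * pois m r s + s * real m * dpois m r s)" by (simp add: d_def)
      also have "\<bar>\<dots>\<bar> \<le> 2 * real m * pois m r s + s * real m * \<bar>dpois m r s\<bar>"
      proof -
        have "\<bar>- (a + b)\<bar> \<le> a + \<bar>b\<bar>" if "a \<ge> 0" for a b :: real using that by linarith
        moreover have "\<bar>s * real m * dpois m r s\<bar> = s * real m * \<bar>dpois m r s\<bar>" using s by (simp add: abs_mult)
        ultimately show ?thesis using s pois_nonneg[of s m r]
          by (metis less_imp_le mult_nonneg_nonneg of_nat_0_le_iff zero_le_numeral)
      qed
      also have "\<dots> \<le> 2 * real m * (1 / s ^ (m + 1)) + s * real m * (real (m + 3) / s ^ (m + 2))"
      proof (intro add_mono mult_left_mono pois_le s)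
        have "\<bar>dpois m r s\<bar> \<le> real (m + 3) / sqrt (r\<^sup>2 + s\<^sup>2) ^ (m + 2)" by (rule dpois_bound[OF s order_refl])
        also have "\<dots> = real (m + 3) * newt (m + 2) r s" by (simp add: newt_def)
        also have "\<dots> \<le> real (m + 3) * (1 / s ^ (m + 2))" by (intro mult_left_mono newt_le s) auto
        finally show "\<bar>dpois m r s\<bar> \<le> real (m + 3) / s ^ (m + 2)" by simp
      qed (use s in auto)
      also have "\<dots> = A * (1 / s ^ m) * (1 / s)" using s by (simp add: A_def field_simps)
      also have "\<dots> \<le> A * ((1 / s0 ^ (m - 2)) / s\<^sup>2) * (1 / s)"
        using s by (intro mult_left_mono mult_right_mono pow_decay s0 h m2) (auto simp: A_def)
      finally show "\<bar>d r s\<bar> \<le> A / s0 ^ (m - 2) / s ^ 3" by (simp add: power2_eq_square power3_eq_cube mult.assoc)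
    qed (use s0 in \<open>auto simp: A_def\<close>)
  qed
  then obtain C where C: "C \<ge> 0" "\<And>r s. 0 \<le> r \<Longrightarrow> r \<le> R \<Longrightarrow> s0 \<le> s \<Longrightarrow> \<bar>d r s\<bar> \<le> C / s ^ 3" by blast
  show ?thesis
  proof (rule that[OF C(1)])
    fix r c s s' :: real assume h: "0 \<le> r" "r \<le> R" "s0 \<le> c" "c \<le> s" "c \<le> s'"
    have c: "c > 0" using h s0 by simp
    have "norm (enewt m r s - enewt m r s') \<le> C / c ^ 3 * norm (s - s')"
    proof (rule field_differentiable_bound[of "{c..}"])
      show "(enewt m r has_field_derivative d r z) (at z within {c..})" if "z \<in> {c..}" for z
        using that c by (intro has_field_derivative_at_within[OF der]) auto
      show "norm (d r z) \<le> C / c ^ 3" if "z \<in> {c..}" for z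
      proof -
        have "\<bar>d r z\<bar> \<le> C / z ^ 3" using that h by (intro C) auto
        also have "\<dots> \<le> C / c ^ 3" using that c C(1) by (intro divide_left_mono power_mono mult_pos_pos zero_less_power) auto
        finally show ?thesis by simp
      qed
    qed (use h in auto)
    then show "\<bar>enewt m r s - enewt m r s'\<bar> \<le> C / c ^ 3 * \<bar>s - s'\<bar>" by simp
  qed
qed

section \<open>Regular part of the kernel on the plane and its dependence on t\<close>

lemma summable_inverse_Suc_squares: "summable (\<lambda>k. c / (real (Suc k))\<^sup>2)"
  using summable_mult[OF inverse_squares_sums[THEN sums_summable], of c] by (simp add: field_simps)

lemma newt_abs: "newt m \<bar>r\<bar> s = newt m r s" "newt m r (- s) = newt m r s" "newt m r \<bar>s\<bar> = newt m r s"
  by (simp_all add: newt_def)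

lemma pois_abs: "pois m \<bar>r\<bar> s = pois m r s" "pois m r (- s) = - pois m r s"
  by (simp_all add: pois_def)

lemma continuous_newt: "s \<noteq> 0 \<Longrightarrow> continuous_on A (\<lambda>r. newt m r s)"
  unfolding newt_def by (intro continuous_intros) (auto simp: sum_power2_eq_zero_iff)

lemma continuous_pois: "s \<noteq> 0 \<Longrightarrow> continuous_on A (\<lambda>r. pois m r s)"
  unfolding pois_def by (intro continuous_intros) (auto simp: sum_power2_eq_zero_iff)

lemma continuous_on_series:
  fixes f :: "nat \<Rightarrow> real \<Rightarrow> real"
  assumes cont: "\<And>k. continuous_on UNIV (f k)"
    and bd: "\<And>R. R > 0 \<Longrightarrow> \<exists>M. summable M \<and> (\<forall>k r. \<bar>r\<bar> \<le> R \<longrightarrow> \<bar>f k r\<bar> \<le> M k)"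
  shows "continuous_on UNIV (\<lambda>r. \<Sum>k. f k r)"
proof -
  have "isCont (\<lambda>r. \<Sum>k. f k r) x" for x
  proof -
    define R where "R = \<bar>x\<bar> + 1"
    have "R > 0" by (simp add: R_def)
    from bd[OF this] obtain M where M: "summable M" "\<And>k r. \<bar>r\<bar> \<le> R \<Longrightarrow> \<bar>f k r\<bar> \<le> M k" by blast
    have "uniform_limit {-R<..<R} (\<lambda>n r. \<Sum>k<n. f k r) (\<lambda>r. \<Sum>k. f k r) sequentially"
      by (rule Weierstrass_m_test[OF _ M(1)]) (auto intro!: M(2))
    then have "continuous_on {-R<..<R} (\<lambda>r. \<Sum>k. f k r)"
      by (rule uniform_limit_theorem[rotated])
         (auto intro!: always_eventually continuous_intros continuous_on_subset[OF cont])
    moreover have "x \<in> {-R<..<R}" by (auto simp: R_def)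
    ultimately show ?thesis by (simp add: continuous_on_eq_continuous_at)
  qed
  then show ?thesis by (simp add: continuous_at_imp_continuous_on)
qed

text \<open>This is t H_t. The factor 2 counts the images at heights 2tj and -2tj, and
  multiplication by t frees the regularising terms 1/(2tj) of t, so that only the logarithm
  contributes to \<open>stripT'\<close> besides the kernels.\<close>

definition stripT :: "nat \<Rightarrow> real \<Rightarrow> real \<Rightarrow> real" where
  "stripT m t r = 2 * (\<Sum>k. t * newt m r (2 * t * real (Suc k)) - reg m / (2 * real (Suc k)))
     + reg m * (euler_mascheroni - ln (4 * t))"

definition stripT' :: "nat \<Rightarrow> real \<Rightarrow> real \<Rightarrow> real" where
  "stripT' m t r = 2 * (\<Sum>k. enewt m r (2 * t * real (Suc k))) - reg m / t"

lemma stripT_term_bound: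
  assumes m: "m \<ge> 1" and R: "R \<ge> 0" and a: "0 < a"
  obtains C where "C \<ge> 0"
    "\<And>t r k. \<lbrakk>a \<le> t; \<bar>r\<bar> \<le> R\<rbrakk> \<Longrightarrow> \<bar>t * newt m r (2 * t * real (Suc k)) - reg m / (2 * real (Suc k))\<bar> \<le> C / (real (Suc k))\<^sup>2"
    "\<And>t r k. \<lbrakk>a \<le> t; \<bar>r\<bar> \<le> R\<rbrakk> \<Longrightarrow> \<bar>enewt m r (2 * t * real (Suc k))\<bar> \<le> C / (real (Suc k))\<^sup>2"
    "\<And>t s r k. \<lbrakk>a \<le> t; a \<le> s; \<bar>r\<bar> \<le> R\<rbrakk> \<Longrightarrow> \<bar>enewt m r (2 * t * real (Suc k)) - enewt m r (2 * s * real (Suc k))\<bar> \<le> C / (real (Suc k))\<^sup>2 * \<bar>t - s\<bar>"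
proof -
  have a2: "2 * a > 0" using a by simp
  obtain C1 where C1: "C1 \<ge> 0" "\<And>r s z. \<lbrakk>0 \<le> r; r \<le> R; 2 * a \<le> s; \<bar>z\<bar> \<le> 0; \<bar>z\<bar> \<le> s / 2\<rbrakk> \<Longrightarrow>
    \<bar>newt m r (s + z) - reg m / s\<bar> \<le> C1 / s\<^sup>2" using newt_reg_bound[OF m a2 R order_refl] by metis
  obtain C2 where C2: "C2 \<ge> 0" "\<And>r s. \<lbrakk>0 \<le> r; r \<le> R; 2 * a \<le> s\<rbrakk> \<Longrightarrow> \<bar>enewt m r s\<bar> \<le> C2 / s\<^sup>2"
    using enewt_bound[OF m a2 R] by metis
  obtain C3 where C3: "C3 \<ge> 0" "\<And>r c s s'. \<lbrakk>0 \<le> r; r \<le> R; 2 * a \<le> c; c \<le> s; c \<le> s'\<rbrakk> \<Longrightarrow>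
    \<bar>enewt m r s - enewt m r s'\<bar> \<le> C3 / c ^ 3 * \<bar>s - s'\<bar>" using enewt_lipschitz[OF m a2 R] by metis
  have ea: "enewt m \<bar>r\<bar> s = enewt m r s" for r s by (simp add: enewt_def newt_abs pois_abs)
  define C where "C = C1 / (4 * a) + C2 / (4 * a\<^sup>2) + C3 / (4 * a ^ 3)"
  have Cge: "C1 / (4 * a) \<le> C" "C2 / (4 * a\<^sup>2) \<le> C" "C3 / (4 * a ^ 3) \<le> C" "C \<ge> 0"
    using C1(1) C2(1) C3(1) a by (auto simp: C_def)
  show thesis
  proof (rule that[OF Cge(4)])
    fix t r :: real and k assume t: "a \<le> t" and r: "\<bar>r\<bar> \<le> R"
    define j where "j = real (Suc k)"
    have j: "j \<ge> 1" by (simp add: j_def)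
    have t0: "t > 0" using t a by simp
    have s: "2 * a \<le> 2 * t * j" using mult_mono[OF t j] t0 a by simp
    have "\<bar>t * newt m r (2 * t * j) - reg m / (2 * j)\<bar> = t * \<bar>newt m \<bar>r\<bar> (2 * t * j + 0) - reg m / (2 * t * j)\<bar>"
    proof -
      have "t * newt m r (2 * t * j) - reg m / (2 * j) = t * (newt m \<bar>r\<bar> (2 * t * j + 0) - reg m / (2 * t * j))"
        using t0 j by (simp add: newt_abs field_simps)
      then show ?thesis using t0 by (simp add: abs_mult)
    qed
    also have "\<dots> \<le> t * (C1 / (2 * t * j)\<^sup>2)"
      using t0 r s a by (intro mult_left_mono C1(2)) auto
    also have "\<dots> = C1 / (4 * t) * (1 / j\<^sup>2)" using t0 by (simp add: power2_eq_square field_simps)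
    also have "\<dots> \<le> C1 / (4 * a) * (1 / j\<^sup>2)" using t t0 a C1(1) by (intro mult_right_mono divide_left_mono) auto
    also have "\<dots> \<le> C * (1 / j\<^sup>2)" by (intro mult_right_mono Cge) auto
    finally show "\<bar>t * newt m r (2 * t * real (Suc k)) - reg m / (2 * real (Suc k))\<bar> \<le> C / (real (Suc k))\<^sup>2"
      by (simp add: j_def)
    have "\<bar>enewt m r (2 * t * j)\<bar> \<le> C2 / (2 * t * j)\<^sup>2" using C2(2)[of "\<bar>r\<bar>"] r s by (simp add: ea)
    also have "\<dots> \<le> C2 / (2 * a * j)\<^sup>2" using t t0 a j C2(1) by (intro divide_left_mono power_mono mult_mono mult_pos_pos zero_less_power) auto
    also have "\<dots> = C2 / (4 * a\<^sup>2) * (1 / j\<^sup>2)" by (simp add: power_mult_distrib)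
    also have "\<dots> \<le> C * (1 / j\<^sup>2)" by (intro mult_right_mono Cge) auto
    finally show "\<bar>enewt m r (2 * t * real (Suc k))\<bar> \<le> C / (real (Suc k))\<^sup>2" by (simp add: j_def)
  next
    fix t s r :: real and k assume t: "a \<le> t" "a \<le> s" and r: "\<bar>r\<bar> \<le> R"
    define j where "j = real (Suc k)"
    have j: "j \<ge> 1" by (simp add: j_def)
    have "\<bar>enewt m r (2 * t * j) - enewt m r (2 * s * j)\<bar> \<le> C3 / (2 * a * j) ^ 3 * \<bar>2 * t * j - 2 * s * j\<bar>"
      using C3(2)[of "\<bar>r\<bar>" "2 * a * j" "2 * t * j" "2 * s * j"] t r a j by (simp add: ea)
    also have "\<bar>2 * t * j - 2 * s * j\<bar> = 2 * j * \<bar>t - s\<bar>"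
    proof -
      have "2 * t * j - 2 * s * j = 2 * j * (t - s)" by (simp add: algebra_simps)
      then show ?thesis using j by (simp add: abs_mult)
    qed
    also have "C3 / (2 * a * j) ^ 3 * (2 * j * \<bar>t - s\<bar>) = C3 / (4 * a ^ 3) * (1 / j\<^sup>2) * \<bar>t - s\<bar>"
      using j a by (simp add: field_simps power2_eq_square power3_eq_cube)
    also have "\<dots> \<le> C * (1 / j\<^sup>2) * \<bar>t - s\<bar>" by (intro mult_right_mono Cge) auto
    finally show "\<bar>enewt m r (2 * t * real (Suc k)) - enewt m r (2 * s * real (Suc k))\<bar> \<le> C / (real (Suc k))\<^sup>2 * \<bar>t - s\<bar>"
      by (simp add: j_def)
  qed
qed

lemma enewt_summable:
  assumes "m \<ge> 1" "t > 0"
  shows "summable (\<lambda>k. enewt m r (2 * t * real (Suc k)))"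
proof -
  obtain C where "\<And>k. \<bar>enewt m r (2 * t * real (Suc k))\<bar> \<le> C / (real (Suc k))\<^sup>2"
    using stripT_term_bound[OF assms(1) abs_ge_zero assms(2), of r] by (metis order_refl)
  then show ?thesis by (intro summable_comparison_test'[OF summable_inverse_Suc_squares, of 0]) auto
qed

text \<open>An application of \<open>series_remainder\<close> in t. The constant depends on
  \<open>R\<close>, \<open>a\<close> and \<open>b\<close> only; uniformity in \<open>r\<close> is
  what allows the bounds to hold for double integrals against all measures on a compact set at
  once.\<close>

lemma stripT_bounds:
  assumes m: "m \<ge> 1" and R: "R \<ge> 0" and ab: "0 < a" "a \<le> b"
  obtains C where "C \<ge> 0"
    "\<And>s t r. \<lbrakk>s \<in> {a..b}; t \<in> {a..b}; \<bar>r\<bar> \<le> R\<rbrakk> \<Longrightarrow> \<bar>stripT m s r - stripT m t r - (s - t) * stripT' m t r\<bar> \<le> C * (s - t)\<^sup>2"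
    "\<And>s t r. \<lbrakk>s \<in> {a..b}; t \<in> {a..b}; \<bar>r\<bar> \<le> R\<rbrakk> \<Longrightarrow> \<bar>stripT' m s r - stripT' m t r\<bar> \<le> C * \<bar>s - t\<bar>"
    "\<And>t r. \<lbrakk>t \<in> {a..b}; \<bar>r\<bar> \<le> R\<rbrakk> \<Longrightarrow> \<bar>stripT m t r\<bar> \<le> C"
    "\<And>t r. \<lbrakk>t \<in> {a..b}; \<bar>r\<bar> \<le> R\<rbrakk> \<Longrightarrow> \<bar>stripT' m t r\<bar> \<le> C"
proof -
  obtain B where B: "B \<ge> 0"
    "\<And>t r k. \<lbrakk>a \<le> t; \<bar>r\<bar> \<le> R\<rbrakk> \<Longrightarrow> \<bar>t * newt m r (2 * t * real (Suc k)) - reg m / (2 * real (Suc k))\<bar> \<le> B / (real (Suc k))\<^sup>2"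
    "\<And>t r k. \<lbrakk>a \<le> t; \<bar>r\<bar> \<le> R\<rbrakk> \<Longrightarrow> \<bar>enewt m r (2 * t * real (Suc k))\<bar> \<le> B / (real (Suc k))\<^sup>2"
    "\<And>t s r k. \<lbrakk>a \<le> t; a \<le> s; \<bar>r\<bar> \<le> R\<rbrakk> \<Longrightarrow> \<bar>enewt m r (2 * t * real (Suc k)) - enewt m r (2 * s * real (Suc k))\<bar> \<le> B / (real (Suc k))\<^sup>2 * \<bar>t - s\<bar>"
    using stripT_term_bound[OF m R ab(1)] by blast
  define L where "L k = B / (real (Suc k))\<^sup>2" for k
  have L: "summable L" unfolding L_def by (rule summable_inverse_Suc_squares)
  define f where "f r k t = t * newt m r (2 * t * real (Suc k)) - reg m / (2 * real (Suc k))" for r k t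
  define f' where "f' r k t = enewt m r (2 * t * real (Suc k))" for r k t
  have sf: "summable (\<lambda>k. f r k t)" "\<bar>\<Sum>k. f r k t\<bar> \<le> suminf L" if "a \<le> t" "\<bar>r\<bar> \<le> R" for t r
  proof -
    have s: "summable (\<lambda>k. \<bar>f r k t\<bar>)"
      by (rule summable_comparison_test'[OF L, of 0]) (use B(2) that in \<open>auto simp: f_def L_def\<close>)
    then show "summable (\<lambda>k. f r k t)" by (rule summable_rabs_cancel)
    show "\<bar>\<Sum>k. f r k t\<bar> \<le> suminf L"
      by (rule order.trans[OF summable_rabs[OF s]]) (use B(2) that L s in \<open>auto intro!: suminf_le simp: f_def L_def\<close>)
  qed
  have sf': "summable (\<lambda>k. f' r k t)" "\<bar>\<Sum>k. f' r k t\<bar> \<le> suminf L" if "a \<le> t" "\<bar>r\<bar> \<le> R" for t r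
  proof -
    have s: "summable (\<lambda>k. \<bar>f' r k t\<bar>)"
      by (rule summable_comparison_test'[OF L, of 0]) (use B(3) that in \<open>auto simp: f'_def L_def\<close>)
    then show "summable (\<lambda>k. f' r k t)" by (rule summable_rabs_cancel)
    show "\<bar>\<Sum>k. f' r k t\<bar> \<le> suminf L"
      by (rule order.trans[OF summable_rabs[OF s]]) (use B(3) that L s in \<open>auto intro!: suminf_le simp: f'_def L_def\<close>)
  qed
  have der: "(f r k has_real_derivative f' r k t) (at t)" if "t \<in> {a..b}" for r k t
  proof -
    define j where "j = real (Suc k)"
    have nz: "2 * t * j \<noteq> 0" using that ab by (simp add: j_def)
    have "((\<lambda>t. newt m r (2 * t * j)) has_real_derivative (- real m * pois m r (2 * t * j)) * (2 * j)) (at t)"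
      by (rule DERIV_chain2[where f = "newt m r" and g = "\<lambda>t. 2 * t * j", OF newt_deriv[OF nz]]) (auto intro!: derivative_eq_intros)
    then have "((\<lambda>t. t * newt m r (2 * t * j) - reg m / (2 * j)) has_real_derivative
        (1 * newt m r (2 * t * j) + (- real m * pois m r (2 * t * j)) * (2 * j) * t) - 0) (at t)"
      by (intro DERIV_diff DERIV_mult DERIV_ident DERIV_const)
    then show ?thesis
      unfolding f_def f'_def j_def[symmetric] enewt_def by (simp add: mult_ac)
  qed
  have lip: "\<bar>f' r k t - f' r k s\<bar> \<le> L k * \<bar>t - s\<bar>" if "t \<in> {a..b}" "s \<in> {a..b}" "\<bar>r\<bar> \<le> R" for r k t s
    using B(4) that by (auto simp: f'_def L_def)
  have reg: "0 \<le> reg m" "reg m \<le> 1" by (auto simp: reg_def)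
  define lb where "lb = \<bar>euler_mascheroni\<bar> + \<bar>ln (4 * a)\<bar> + \<bar>ln (4 * b)\<bar>"
  define C where "C = 2 * suminf L + 1 / a\<^sup>2 + lb + 1 / a"
  have Lnn: "suminf L \<ge> 0" by (intro suminf_nonneg L) (auto simp: L_def B(1))
  have Cn: "C \<ge> 0" "2 * suminf L + 1 / a\<^sup>2 \<le> C" "2 * suminf L + lb \<le> C" "2 * suminf L + 1 / a \<le> C"
    using Lnn ab by (auto simp: C_def lb_def)
  show thesis
  proof (rule that[OF Cn(1)])
    fix s t r :: real assume h: "s \<in> {a..b}" "t \<in> {a..b}" "\<bar>r\<bar> \<le> R"
    have st: "s > 0" "t > 0" using h ab by auto
    have sta: "a\<^sup>2 \<le> s * t" using h ab by (simp add: power2_eq_square mult_mono)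
    note rem = series_remainder[where S="{a..b}" and f="f r" and f'="f' r" and L=L and x=t and y=s, OF convex_real_interval(5) h(2,1) der lip[OF _ _ h(3)] L]
    have r1: "\<bar>(\<Sum>k. f r k s) - (\<Sum>k. f r k t) - (s - t) * (\<Sum>k. f' r k t)\<bar> \<le> suminf L * (s - t)\<^sup>2"
      and r2: "\<bar>(\<Sum>k. f' r k s) - (\<Sum>k. f' r k t)\<bar> \<le> suminf L * \<bar>s - t\<bar>"
      using rem sf sf' h by auto
    \<comment> \<open>The inequality ln x <= x - 1 at s/t and at t/s bounds the remainder of the
      logarithm from both sides.\<close>
    have l1: "\<bar>ln (4 * t) - ln (4 * s) + (s - t) / t\<bar> \<le> (s - t)\<^sup>2 / a\<^sup>2"
    proof -
      have e: "ln (4 * t) - ln (4 * s) = ln t - ln s" using st by (simp add: ln_mult)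
      have "ln (s / t) \<le> s / t - 1" "ln (t / s) \<le> t / s - 1" using st by (intro ln_le_minus_one; simp)+
      then have "ln s - ln t \<le> (s - t) / t" "ln t - ln s \<le> (t - s) / s"
        using st by (auto simp: ln_div diff_divide_distrib)
      moreover have "(s - t) / t + (t - s) / s = (s - t)\<^sup>2 / (s * t)"
        using st by (simp add: field_simps power2_eq_square)
      ultimately have "0 \<le> ln t - ln s + (s - t) / t" "ln t - ln s + (s - t) / t \<le> (s - t)\<^sup>2 / (s * t)" by linarith+
      moreover have "(s - t)\<^sup>2 / (s * t) \<le> (s - t)\<^sup>2 / a\<^sup>2"
        using sta ab st by (intro divide_left_mono) auto
      ultimately show ?thesis unfolding e by linarith
    qed
    have l1': "reg m * \<bar>ln (4 * t) - ln (4 * s) + (s - t) / t\<bar> \<le> 1 * ((s - t)\<^sup>2 / a\<^sup>2)"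
      using l1 reg by (intro mult_mono) auto
    have "stripT m s r - stripT m t r - (s - t) * stripT' m t r
      = 2 * ((\<Sum>k. f r k s) - (\<Sum>k. f r k t) - (s - t) * (\<Sum>k. f' r k t)) + reg m * (ln (4 * t) - ln (4 * s) + (s - t) / t)"
      unfolding stripT_def stripT'_def f_def[symmetric] f'_def[symmetric] by (simp add: algebra_simps)
    also have "\<bar>\<dots>\<bar> \<le> 2 * (suminf L * (s - t)\<^sup>2) + 1 * ((s - t)\<^sup>2 / a\<^sup>2)"
      by (rule order.trans[OF abs_triangle_ineq], rule add_mono)
         (use r1 l1' reg in \<open>auto simp: abs_mult\<close>)
    also have "\<dots> = (2 * suminf L + 1 / a\<^sup>2) * (s - t)\<^sup>2" by (simp add: algebra_simps)
    also have "\<dots> \<le> C * (s - t)\<^sup>2" by (intro mult_right_mono Cn) auto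
    finally show "\<bar>stripT m s r - stripT m t r - (s - t) * stripT' m t r\<bar> \<le> C * (s - t)\<^sup>2" .
    have l2: "\<bar>1 / t - 1 / s\<bar> \<le> \<bar>s - t\<bar> / a\<^sup>2"
    proof -
      have "\<bar>1 / t - 1 / s\<bar> = \<bar>(s - t) / (s * t)\<bar>" using st by (simp add: field_simps)
      also have "\<dots> = \<bar>s - t\<bar> / (s * t)" using st by (simp add: abs_mult)
      also have "\<dots> \<le> \<bar>s - t\<bar> / a\<^sup>2" using sta ab st by (intro divide_left_mono) auto
      finally show ?thesis .
    qed
    have l2': "reg m * \<bar>1 / t - 1 / s\<bar> \<le> 1 * (\<bar>s - t\<bar> / a\<^sup>2)"
      using l2 reg by (intro mult_mono) auto
    have "stripT' m s r - stripT' m t r = 2 * ((\<Sum>k. f' r k s) - (\<Sum>k. f' r k t)) + reg m * (1 / t - 1 / s)"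
      unfolding stripT'_def f'_def[symmetric] by (simp add: algebra_simps)
    also have "\<bar>\<dots>\<bar> \<le> 2 * (suminf L * \<bar>s - t\<bar>) + 1 * (\<bar>s - t\<bar> / a\<^sup>2)"
      by (rule order.trans[OF abs_triangle_ineq], rule add_mono)
         (use r2 l2' reg in \<open>auto simp: abs_mult\<close>)
    also have "\<dots> = (2 * suminf L + 1 / a\<^sup>2) * \<bar>s - t\<bar>" by (simp add: algebra_simps)
    also have "\<dots> \<le> C * \<bar>s - t\<bar>" by (intro mult_right_mono Cn) auto
    finally show "\<bar>stripT' m s r - stripT' m t r\<bar> \<le> C * \<bar>s - t\<bar>" .
  next
    fix t r :: real assume h: "t \<in> {a..b}" "\<bar>r\<bar> \<le> R"
    have t: "t > 0" using h ab by auto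
    have "ln (4 * a) \<le> ln (4 * t)" "ln (4 * t) \<le> ln (4 * b)" using h ab t by auto
    then have "\<bar>euler_mascheroni - ln (4 * t)\<bar> \<le> lb" unfolding lb_def by linarith
    then have "reg m * \<bar>euler_mascheroni - ln (4 * t)\<bar> \<le> 1 * lb" using reg by (intro mult_mono) auto
    moreover have "\<bar>stripT m t r\<bar> \<le> 2 * \<bar>\<Sum>k. f r k t\<bar> + reg m * \<bar>euler_mascheroni - ln (4 * t)\<bar>"
      unfolding stripT_def f_def[symmetric] using reg by (intro order.trans[OF abs_triangle_ineq]) (simp add: abs_mult)
    ultimately show "\<bar>stripT m t r\<bar> \<le> C" using sf(2)[of t r] h Cn(3) by auto
    have "reg m / t \<le> 1 / a" using reg h ab by (intro frac_le) auto
    moreover have "\<bar>stripT' m t r\<bar> \<le> 2 * \<bar>\<Sum>k. f' r k t\<bar> + reg m / t"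
      unfolding stripT'_def f'_def[symmetric] using reg t by (intro order.trans[OF abs_triangle_ineq4]) (simp add: abs_mult)
    ultimately show "\<bar>stripT' m t r\<bar> \<le> C" using sf'(2)[of t r] h Cn(4) by auto
  qed
qed

lemma continuous_stripT: assumes m: "m \<ge> 1" and t: "t > 0" shows "continuous_on UNIV (stripT m t)" "continuous_on UNIV (stripT' m t)"
proof -
  have c: "continuous_on UNIV (\<lambda>r. \<Sum>k. t * newt m r (2 * t * real (Suc k)) - reg m / (2 * real (Suc k)))"
  proof (rule continuous_on_series)
    fix R :: real assume "R > 0"
    then obtain C where "\<And>r k. \<bar>r\<bar> \<le> R \<Longrightarrow> \<bar>t * newt m r (2 * t * real (Suc k)) - reg m / (2 * real (Suc k))\<bar> \<le> C / (real (Suc k))\<^sup>2"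
      using stripT_term_bound[OF m less_imp_le t, of R] by (metis order_refl)
    then show "\<exists>M. summable M \<and> (\<forall>k r. \<bar>r\<bar> \<le> R \<longrightarrow> \<bar>t * newt m r (2 * t * real (Suc k)) - reg m / (2 * real (Suc k))\<bar> \<le> M k)"
      using summable_inverse_Suc_squares by blast
  qed (use t in \<open>intro continuous_intros continuous_newt; simp\<close>)
  have c': "continuous_on UNIV (\<lambda>r. \<Sum>k. enewt m r (2 * t * real (Suc k)))"
  proof (rule continuous_on_series)
    fix R :: real assume "R > 0"
    then obtain C where "\<And>r k. \<bar>r\<bar> \<le> R \<Longrightarrow> \<bar>enewt m r (2 * t * real (Suc k))\<bar> \<le> C / (real (Suc k))\<^sup>2"
      using stripT_term_bound[OF m less_imp_le t, of R] by (metis order_refl)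
    then show "\<exists>M. summable M \<and> (\<forall>k r. \<bar>r\<bar> \<le> R \<longrightarrow> \<bar>enewt m r (2 * t * real (Suc k))\<bar> \<le> M k)"
      using summable_inverse_Suc_squares by blast
  qed (use t in \<open>unfold enewt_def, intro continuous_intros continuous_newt continuous_pois; simp\<close>)
  show "continuous_on UNIV (stripT m t)" unfolding stripT_def[abs_def] by (intro continuous_intros c)
  show "continuous_on UNIV (stripT' m t)" unfolding stripT'_def[abs_def] by (intro continuous_intros c')
qed

text \<open>The series version with a single nonzero term.\<close>

lemma lipschitz_remainder:
  fixes f f' :: "real \<Rightarrow> real"
  assumes S: "convex S" and xy: "x \<in> S" "y \<in> S"
    and der: "\<And>z. z \<in> S \<Longrightarrow> (f has_real_derivative f' z) (at z)"
    and lip: "\<And>z w. z \<in> S \<Longrightarrow> w \<in> S \<Longrightarrow> \<bar>f' z - f' w\<bar> \<le> L * \<bar>z - w\<bar>"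
  shows "\<bar>f y - f x - (y - x) * f' x\<bar> \<le> L * (y - x)\<^sup>2"
proof -
  define F where "F k z = (if k = 0 then f z else 0)" for k :: nat and z
  define F' where "F' k z = (if k = 0 then f' z else 0)" for k :: nat and z
  define M where "M k = (if k = 0 then L else 0)" for k :: nat
  have s: "F k sums 0 \<or> True" for k by simp
  have s: "(\<lambda>k. F k z) sums f z" "(\<lambda>k. F' k z) sums f' z" "M sums L" for z
    using sums_single[of 0 "\<lambda>_. f z"] sums_single[of 0 "\<lambda>_. f' z"] sums_single[of 0 "\<lambda>_. L"]
    by (simp_all add: F_def F'_def M_def[abs_def])
  have "\<bar>(\<Sum>k. F k y) - (\<Sum>k. F k x) - (y - x) * (\<Sum>k. F' k x)\<bar> \<le> (\<Sum>k. M k) * (y - x)\<^sup>2"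
    by (rule series_remainder(1)[OF S xy, where f'=F'])
       (use der lip s in \<open>auto simp: F_def[abs_def] F'_def[abs_def] M_def[abs_def] sums_iff\<close>)
  then show ?thesis using s by (simp add: sums_iff)
qed

lemma deriv_from_remainder:
  fixes f :: "real \<Rightarrow> real"
  assumes d: "d > 0" and rem: "\<And>y. \<bar>y - x\<bar> < d \<Longrightarrow> \<bar>f y - f x - (y - x) * D\<bar> \<le> C * (y - x)\<^sup>2"
  shows "(f has_real_derivative D) (at x)"
proof -
  have "((\<lambda>h. (f (x + h) - f x) / h - D) \<longlongrightarrow> 0) (at 0)"
  proof (rule Lim_null_comparison)
    have "eventually (\<lambda>h. h \<noteq> 0 \<and> \<bar>h\<bar> < d) (at (0::real))"
      unfolding eventually_at using d by (intro exI[of _ d]) auto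
    then show "eventually (\<lambda>h. norm ((f (x + h) - f x) / h - D) \<le> C * \<bar>h\<bar>) (at 0)"
    proof eventually_elim
      case (elim h)
      have "(f (x + h) - f x) / h - D = (f (x + h) - f x - h * D) / h" using elim by (simp add: field_simps)
      also have "\<bar>\<dots>\<bar> \<le> C * h\<^sup>2 / \<bar>h\<bar>"
        unfolding abs_divide using rem[of "x + h"] elim by (intro divide_right_mono) auto
      also have "\<dots> = C * \<bar>h\<bar>" using elim by (simp add: power2_eq_square field_simps abs_if)
      finally show ?case by simp
    qed
    have "((\<lambda>h. C * \<bar>h\<bar>) \<longlongrightarrow> C * \<bar>0\<bar>) (at (0::real))" by (intro tendsto_intros)
    then show "((\<lambda>h. C * \<bar>h\<bar>) \<longlongrightarrow> 0) (at (0::real))" by simp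
  qed
  then show ?thesis unfolding DERIV_def by (simp add: LIM_zero_iff)
qed

text \<open>Leads from the unordered sum over nonzero integers in the definition of the kernel to a
  series over j >= 1 of paired images.\<close>

lemma infsum_int_nonzero:
  fixes f :: "int \<Rightarrow> real"
  assumes p: "summable (\<lambda>k. \<bar>f (int (Suc k))\<bar>)" and n: "summable (\<lambda>k. \<bar>f (- int (Suc k))\<bar>)"
  shows "(f has_sum (\<Sum>k. f (int (Suc k)) + f (- int (Suc k)))) (- {0})"
proof -
  have p': "summable (\<lambda>k. f (int (Suc k)))" and n': "summable (\<lambda>k. f (- int (Suc k)))"
    using p n by (auto intro: summable_rabs_cancel)
  have "((\<lambda>k. f (int (Suc k))) has_sum (\<Sum>k. f (int (Suc k)))) UNIV"
    using p p' by (intro norm_summable_imp_has_sum) (auto intro: summable_sums)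
  then have 1: "(f has_sum (\<Sum>k. f (int (Suc k)))) (range (\<lambda>k. int (Suc k)))"
    by (subst has_sum_reindex) (auto simp: o_def inj_on_def)
  have "((\<lambda>k. f (- int (Suc k))) has_sum (\<Sum>k. f (- int (Suc k)))) UNIV"
    using n n' by (intro norm_summable_imp_has_sum) (auto intro: summable_sums)
  then have 2: "(f has_sum (\<Sum>k. f (- int (Suc k)))) (range (\<lambda>k. - int (Suc k)))"
    by (subst has_sum_reindex) (auto simp: o_def inj_on_def)
  have "- {0} = range (\<lambda>k. int (Suc k)) \<union> range (\<lambda>k. - int (Suc k))"
  proof (intro set_eqI iffI)
    fix x :: int assume "x \<in> - {0}"
    then have "x = int (Suc (nat x - 1)) \<or> x = - int (Suc (nat (- x) - 1))" by auto
    then show "x \<in> range (\<lambda>k. int (Suc k)) \<union> range (\<lambda>k. - int (Suc k))" by blast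
  qed auto
  moreover have "range (\<lambda>k. int (Suc k)) \<inter> range (\<lambda>k. - int (Suc k)) = {}" by auto
  ultimately show ?thesis using has_sum_Un_disjoint[OF 1 2] unfolding suminf_add[OF p' n'] by metis
qed

section \<open>The kernel at height z against a point of the plane\<close>

definition stripK :: "nat \<Rightarrow> real \<Rightarrow> real \<Rightarrow> real \<Rightarrow> real" where
  "stripK m t z r = (\<Sum>k. newt m r (2 * t * real (Suc k) - z) + newt m r (2 * t * real (Suc k) + z) - 2 * (reg m / (2 * t * real (Suc k))))
     + reg m * (euler_mascheroni - ln (4 * t)) / t"

text \<open>Times -m, this is the derivative in z of the whole kernel
  \<open>newt m r z + stripK m t z r\<close>. The images above the point enter with the opposite
  sign.\<close>

definition stripV :: "nat \<Rightarrow> real \<Rightarrow> real \<Rightarrow> real \<Rightarrow> real" where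
  "stripV m t z r = pois m r z + (\<Sum>k. pois m r (2 * t * real (Suc k) + z) - pois m r (2 * t * real (Suc k) - z))"

lemma stripK_term_bound:
  assumes m: "m \<ge> 1" and R: "R \<ge> 0" and t: "0 < t"
  obtains C where "C \<ge> 0"
    "\<And>z r k. \<lbrakk>\<bar>z\<bar> \<le> t; \<bar>r\<bar> \<le> R\<rbrakk> \<Longrightarrow> \<bar>newt m r (2 * t * real (Suc k) + z) - reg m / (2 * t * real (Suc k))\<bar> \<le> C / (real (Suc k))\<^sup>2"
    "\<And>z w r k. \<lbrakk>\<bar>z\<bar> \<le> t; \<bar>w\<bar> \<le> t\<rbrakk> \<Longrightarrow> \<bar>pois m r (2 * t * real (Suc k) + z) - pois m r (2 * t * real (Suc k) + w)\<bar> \<le> C / (real (Suc k))\<^sup>2 * \<bar>z - w\<bar>"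
proof -
  have t2: "2 * t > 0" using t by simp
  obtain C1 where C1: "C1 \<ge> 0" "\<And>r s z. \<lbrakk>0 \<le> r; r \<le> R; 2 * t \<le> s; \<bar>z\<bar> \<le> t; \<bar>z\<bar> \<le> s / 2\<rbrakk> \<Longrightarrow>
    \<bar>newt m r (s + z) - reg m / s\<bar> \<le> C1 / s\<^sup>2" using newt_reg_bound[OF m t2 R less_imp_le[OF t]] by metis
  define C where "C = C1 / (4 * t\<^sup>2) + real (m + 3) / t ^ (m + 2)"
  have Cge: "C1 / (4 * t\<^sup>2) \<le> C" "real (m + 3) / t ^ (m + 2) \<le> C" "C \<ge> 0" using C1(1) t by (auto simp: C_def)
  show thesis
  proof (rule that[OF Cge(3)])
    fix z r :: real and k assume h: "\<bar>z\<bar> \<le> t" "\<bar>r\<bar> \<le> R"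
    define j where "j = real (Suc k)"
    have j: "j \<ge> 1" by (simp add: j_def)
    have s: "2 * t \<le> 2 * t * j" using j t by simp
    have "\<bar>newt m \<bar>r\<bar> (2 * t * j + z) - reg m / (2 * t * j)\<bar> \<le> C1 / (2 * t * j)\<^sup>2"
      using h s by (intro C1(2)) auto
    also have "\<dots> = C1 / (4 * t\<^sup>2) * (1 / j\<^sup>2)" by (simp add: power_mult_distrib)
    also have "\<dots> \<le> C * (1 / j\<^sup>2)" by (intro mult_right_mono Cge) auto
    finally show "\<bar>newt m r (2 * t * real (Suc k) + z) - reg m / (2 * t * real (Suc k))\<bar> \<le> C / (real (Suc k))\<^sup>2"
      by (simp add: newt_abs j_def)
  next
    fix z w r :: real and k assume h: "\<bar>z\<bar> \<le> t" "\<bar>w\<bar> \<le> t"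
    define j where "j = real (Suc k)"
    have j: "j \<ge> 1" by (simp add: j_def)
    have tj: "t \<le> t * j" "t * j > 0" using j t by auto
    have "\<bar>pois m r (2 * t * j + z) - pois m r (2 * t * j + w)\<bar> \<le> real (m + 3) / sqrt (r\<^sup>2 + (t * j)\<^sup>2) ^ (m + 2) * \<bar>(2 * t * j + z) - (2 * t * j + w)\<bar>"
    proof (rule pois_lipschitz)
      have "2 * t * j = t * j + t * j" by simp
      then show "t * j \<le> 2 * t * j + z" "t * j \<le> 2 * t * j + w" using h tj by linarith+
    qed (rule tj)
    also have "\<dots> \<le> C * (1 / j\<^sup>2) * \<bar>z - w\<bar>"
    proof -
      have "real (m + 3) / sqrt (r\<^sup>2 + (t * j)\<^sup>2) ^ (m + 2) = real (m + 3) * newt (m + 2) r (t * j)"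
        by (simp add: newt_def)
      also have "\<dots> \<le> real (m + 3) * (1 / (t * j) ^ (m + 2))" by (intro mult_left_mono newt_le tj) auto
      also have "\<dots> = real (m + 3) / t ^ (m + 2) * (1 / j ^ (m + 2))" by (simp add: power_mult_distrib)
      also have "\<dots> \<le> C * (1 / j\<^sup>2)"
        using j t Cge by (intro mult_mono divide_left_mono power_increasing mult_pos_pos zero_less_power) auto
      finally have "real (m + 3) / sqrt (r\<^sup>2 + (t * j)\<^sup>2) ^ (m + 2) \<le> C * (1 / j\<^sup>2)" .
      then have "real (m + 3) / sqrt (r\<^sup>2 + (t * j)\<^sup>2) ^ (m + 2) * \<bar>z - w\<bar> \<le> C * (1 / j\<^sup>2) * \<bar>z - w\<bar>"
        by (rule mult_right_mono) simp
      then show ?thesis by simp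
    qed
    finally show "\<bar>pois m r (2 * t * real (Suc k) + z) - pois m r (2 * t * real (Suc k) + w)\<bar> \<le> C / (real (Suc k))\<^sup>2 * \<bar>z - w\<bar>"
      by (simp add: j_def mult_right_mono)
  qed
qed

lemma stripK_zero: "t > 0 \<Longrightarrow> m \<ge> 1 \<Longrightarrow> stripK m t 0 r = stripT m t r / t"
proof -
  assume t: "t > 0" and m: "m \<ge> 1"
  obtain C where C: "\<And>k. \<bar>t * newt m r (2 * t * real (Suc k)) - reg m / (2 * real (Suc k))\<bar> \<le> C / (real (Suc k))\<^sup>2"
    using stripT_term_bound[OF m abs_ge_zero t, of r] by (metis order_refl)
  have s: "summable (\<lambda>k. t * newt m r (2 * t * real (Suc k)) - reg m / (2 * real (Suc k)))"
    by (rule summable_comparison_test'[OF summable_inverse_Suc_squares[of C], of 0]) (use C in auto)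
  have "newt m r (2 * t * real (Suc k) - 0) + newt m r (2 * t * real (Suc k) + 0) - 2 * (reg m / (2 * t * real (Suc k)))
     = 2 / t * (t * newt m r (2 * t * real (Suc k)) - reg m / (2 * real (Suc k)))" for k
  proof -
    have "newt m r (s - 0) + newt m r (s + 0) - 2 * (b / (2 * t * j)) = 2 / t * (t * newt m r s - b / (2 * j))" for s b j :: real
      using t by (simp add: field_simps)
    then show ?thesis .
  qed
  then show ?thesis unfolding stripK_def stripT_def
    using suminf_mult[OF s, of "2 / t"] by (simp add: add_divide_distrib)
qed

text \<open>The images stay at distance at least t from heights |z| <= t, so bounds and remainders
  are uniform up to z = 0. The term \<open>newt m r z\<close> of the point itself has no such bound
  and is kept apart.\<close>

lemma stripK_props:
  assumes m: "m \<ge> 1" and R: "R \<ge> 0" and t: "0 < t"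
  obtains C where "C \<ge> 0"
    "\<And>z r. \<lbrakk>\<bar>z\<bar> \<le> t; \<bar>r\<bar> \<le> R\<rbrakk> \<Longrightarrow> \<bar>stripK m t z r\<bar> \<le> C"
    "\<And>z r. \<lbrakk>\<bar>z\<bar> \<le> t; \<bar>r\<bar> \<le> R\<rbrakk> \<Longrightarrow> \<bar>stripV m t z r - pois m r z\<bar> \<le> C"
    "\<And>z w r. \<lbrakk>\<bar>z\<bar> < t; \<bar>w\<bar> < t; \<bar>r\<bar> \<le> R\<rbrakk> \<Longrightarrow>
       \<bar>stripK m t w r - stripK m t z r - (w - z) * (- real m * (stripV m t z r - pois m r z))\<bar> \<le> C * (w - z)\<^sup>2"
proof -
  obtain B where B: "B \<ge> 0"
    "\<And>z r k. \<lbrakk>\<bar>z\<bar> \<le> t; \<bar>r\<bar> \<le> R\<rbrakk> \<Longrightarrow> \<bar>newt m r (2 * t * real (Suc k) + z) - reg m / (2 * t * real (Suc k))\<bar> \<le> B / (real (Suc k))\<^sup>2"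
    "\<And>z w r k. \<lbrakk>\<bar>z\<bar> \<le> t; \<bar>w\<bar> \<le> t\<rbrakk> \<Longrightarrow> \<bar>pois m r (2 * t * real (Suc k) + z) - pois m r (2 * t * real (Suc k) + w)\<bar> \<le> B / (real (Suc k))\<^sup>2 * \<bar>z - w\<bar>"
    using stripK_term_bound[OF m R t] by metis
  \<comment> \<open>One majorant, large enough for the terms, for their derivatives and for the
    Lipschitz constants of the derivatives.\<close>
  define L where "L k = 2 * real (m + 1) * B * (1 + 2 * t) / (real (Suc k))\<^sup>2" for k
  have L: "summable L" unfolding L_def by (rule summable_inverse_Suc_squares)
  have Lge: "2 * B / (real (Suc k))\<^sup>2 \<le> L k" "2 * real m * B / (real (Suc k))\<^sup>2 \<le> L k" "2 * t * B / (real (Suc k))\<^sup>2 \<le> L k"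
    "2 * t * real m * B / (real (Suc k))\<^sup>2 \<le> L k" for k
    unfolding L_def using B(1) t by (intro divide_right_mono; simp add: algebra_simps mult_mono)+
  define f where "f r k z = newt m r (2 * t * real (Suc k) - z) + newt m r (2 * t * real (Suc k) + z) - 2 * (reg m / (2 * t * real (Suc k)))" for r k z
  define g where "g r k z = pois m r (2 * t * real (Suc k) + z) - pois m r (2 * t * real (Suc k) - z)" for r k z
  have fb: "\<bar>f r k z\<bar> \<le> L k" if "\<bar>z\<bar> \<le> t" "\<bar>r\<bar> \<le> R" for r k z
  proof -
    have "\<bar>f r k z\<bar> \<le> B / (real (Suc k))\<^sup>2 + B / (real (Suc k))\<^sup>2"
    proof -
      have "\<bar>newt m r (2 * t * real (Suc k) + - z) - reg m / (2 * t * real (Suc k))\<bar> \<le> B / (real (Suc k))\<^sup>2"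
        using that by (intro B(2)) auto
      note this[unfolded add_uminus_conv_diff]
      then show ?thesis using B(2)[OF that, of k] unfolding f_def by linarith
    qed
    also have "\<dots> = 2 * B / (real (Suc k))\<^sup>2" by simp
    finally show ?thesis using Lge(1)[of k] by linarith
  qed
  have gb: "\<bar>g r k z\<bar> \<le> L k" "real m * \<bar>g r k z\<bar> \<le> L k" if "\<bar>z\<bar> \<le> t" for r k z
  proof -
    have "\<bar>g r k z\<bar> \<le> B / (real (Suc k))\<^sup>2 * \<bar>z - (-z)\<bar>"
      using B(3)[of z "-z" r k] that unfolding g_def by (simp del: of_nat_Suc)
    also have "\<dots> \<le> B / (real (Suc k))\<^sup>2 * (2 * t)" using that B(1) by (intro mult_left_mono) auto
    finally have 1: "\<bar>g r k z\<bar> \<le> 2 * t * B / (real (Suc k))\<^sup>2" by (simp add: mult_ac)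
    then show "\<bar>g r k z\<bar> \<le> L k" using Lge(3)[of k] by linarith
    have "real m * \<bar>g r k z\<bar> \<le> real m * (2 * t * B / (real (Suc k))\<^sup>2)" using 1 by (intro mult_left_mono) auto
    then show "real m * \<bar>g r k z\<bar> \<le> L k" using Lge(4)[of k] by (simp add: mult_ac)
  qed
  have der: "(f r k has_real_derivative (- real m * g r k z)) (at z)" if "z \<in> {-t<..<t}" for r k z
  proof -
    have "t * 1 \<le> t * real (Suc k)" using t by (intro mult_left_mono) auto
    moreover have "2 * t * real (Suc k) = t * real (Suc k) + t * real (Suc k)" by simp
    ultimately have nz: "2 * t * real (Suc k) - z \<noteq> 0" "2 * t * real (Suc k) + z \<noteq> 0"
      using that t unfolding greaterThanLessThan_iff by linarith+
    have 1: "((\<lambda>z. newt m r (2 * t * real (Suc k) - z)) has_real_derivative (- real m * pois m r (2 * t * real (Suc k) - z)) * (- 1)) (at z)"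
      by (rule DERIV_chain2[where f = "newt m r" and g = "\<lambda>z. 2 * t * real (Suc k) - z", OF newt_deriv[OF nz(1)]]) (auto intro!: derivative_eq_intros)
    have 2: "((\<lambda>z. newt m r (2 * t * real (Suc k) + z)) has_real_derivative (- real m * pois m r (2 * t * real (Suc k) + z)) * 1) (at z)"
      by (rule DERIV_chain2[where f = "newt m r" and g = "\<lambda>z. 2 * t * real (Suc k) + z", OF newt_deriv[OF nz(2)]]) (auto intro!: derivative_eq_intros)
    have "(f r k has_real_derivative ((- real m * pois m r (2 * t * real (Suc k) - z)) * (- 1) + (- real m * pois m r (2 * t * real (Suc k) + z)) * 1) - 0) (at z)"
      unfolding f_def[abs_def] by (intro DERIV_diff DERIV_add 1 2 DERIV_const)
    then show ?thesis by (simp add: g_def algebra_simps)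
  qed
  have lip: "\<bar>(- real m * g r k z) - (- real m * g r k w)\<bar> \<le> L k * \<bar>z - w\<bar>" if "z \<in> {-t<..<t}" "w \<in> {-t<..<t}" for r k z w
  proof -
    have "\<bar>g r k z - g r k w\<bar> \<le> B / (real (Suc k))\<^sup>2 * \<bar>z - w\<bar> + B / (real (Suc k))\<^sup>2 * \<bar>(-z) - (-w)\<bar>"
    proof -
      have "\<bar>pois m r (2 * t * real (Suc k) + - z) - pois m r (2 * t * real (Suc k) + - w)\<bar> \<le> B / (real (Suc k))\<^sup>2 * \<bar>(-z) - (-w)\<bar>"
        "\<bar>pois m r (2 * t * real (Suc k) + z) - pois m r (2 * t * real (Suc k) + w)\<bar> \<le> B / (real (Suc k))\<^sup>2 * \<bar>z - w\<bar>"
        using that by (intro B(3); auto)+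
      note this[unfolded add_uminus_conv_diff]
      then show ?thesis unfolding g_def by linarith
    qed
    also have "\<dots> = 2 * B / (real (Suc k))\<^sup>2 * \<bar>z - w\<bar>" by (simp add: algebra_simps abs_minus_commute)
    finally have "real m * \<bar>g r k z - g r k w\<bar> \<le> real m * (2 * B / (real (Suc k))\<^sup>2 * \<bar>z - w\<bar>)" by (intro mult_left_mono) auto
    also have "\<dots> = 2 * real m * B / (real (Suc k))\<^sup>2 * \<bar>z - w\<bar>" by simp
    also have "\<dots> \<le> L k * \<bar>z - w\<bar>" by (intro mult_right_mono Lge) auto
    also have "real m * \<bar>g r k z - g r k w\<bar> = \<bar>(- real m * g r k z) - (- real m * g r k w)\<bar>"
    proof -
      have "(- real m * g r k z) - (- real m * g r k w) = - (real m * (g r k z - g r k w))" by (simp add: algebra_simps)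
      then show ?thesis by (simp add: abs_mult)
    qed
    finally show ?thesis .
  qed
  have sa: "summable (\<lambda>k. \<bar>h k\<bar>)" "\<bar>\<Sum>k. h k\<bar> \<le> suminf L" if "\<And>k. \<bar>h k\<bar> \<le> L k" for h :: "nat \<Rightarrow> real"
  proof -
    show s: "summable (\<lambda>k. \<bar>h k\<bar>)" by (rule summable_comparison_test'[OF L, of 0]) (use that in auto)
    show "\<bar>\<Sum>k. h k\<bar> \<le> suminf L" by (rule order.trans[OF summable_rabs[OF s]]) (intro suminf_le that s L)
  qed
  define A where "A = \<bar>reg m * (euler_mascheroni - ln (4 * t)) / t\<bar>"
  have Lnn: "suminf L \<ge> 0" using sa(2)[of "\<lambda>_. 0"] fb[of 0 0] R t by (auto intro: order.trans[OF abs_ge_zero])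
  show thesis
  proof (rule that[of "suminf L + A"])
    fix z r :: real assume h: "\<bar>z\<bar> \<le> t" "\<bar>r\<bar> \<le> R"
    show "\<bar>stripK m t z r\<bar> \<le> suminf L + A"
      unfolding stripK_def f_def[symmetric] A_def
      by (rule order.trans[OF abs_triangle_ineq add_right_mono]) (use sa(2)[of "\<lambda>k. f r k z"] fb h in auto)
    show "\<bar>stripV m t z r - pois m r z\<bar> \<le> suminf L + A"
    proof -
      have "\<bar>\<Sum>k. g r k z\<bar> \<le> suminf L" by (rule sa(2)) (rule gb(1)[OF h(1)])
      moreover have "A \<ge> 0" by (simp add: A_def)
      ultimately show ?thesis unfolding stripV_def g_def[symmetric] by simp
    qed
  next
    fix z w r :: real assume h: "\<bar>z\<bar> < t" "\<bar>w\<bar> < t" "\<bar>r\<bar> \<le> R"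
    have hz: "z \<in> {-t<..<t}" "w \<in> {-t<..<t}" "\<bar>z\<bar> \<le> t" "\<bar>w\<bar> \<le> t" using h by auto
    have sg: "summable (\<lambda>k. - real m * g r k x)" if "\<bar>x\<bar> \<le> t" for x
      by (intro summable_mult summable_rabs_cancel[OF sa(1)] gb(1) that)
    have e1: "\<bar>(\<Sum>k. f r k w) - (\<Sum>k. f r k z) - (w - z) * (\<Sum>k. - real m * g r k z)\<bar> \<le> suminf L * (w - z)\<^sup>2"
      by (rule series_remainder(1)[OF convex_real_interval(8) hz(1,2) der lip L
          summable_rabs_cancel[OF sa(1)[OF fb[OF hz(3) h(3)]]] summable_rabs_cancel[OF sa(1)[OF fb[OF hz(4) h(3)]]] sg[OF hz(3)] sg[OF hz(4)]])
    have e2: "(\<Sum>k. - real m * g r k z) = - real m * (stripV m t z r - pois m r z)"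
      unfolding stripV_def g_def[symmetric]
      using suminf_mult[OF summable_rabs_cancel[OF sa(1)[OF gb(1)[OF hz(3), of r]]], of "- real m"] by simp
    have e3: "stripK m t w r - stripK m t z r = (\<Sum>k. f r k w) - (\<Sum>k. f r k z)"
      unfolding stripK_def f_def[symmetric] by simp
    have e4: "suminf L * (w - z)\<^sup>2 \<le> (suminf L + A) * (w - z)\<^sup>2" by (intro mult_right_mono) (auto simp: A_def)
    show "\<bar>stripK m t w r - stripK m t z r - (w - z) * (- real m * (stripV m t z r - pois m r z))\<bar> \<le> (suminf L + A) * (w - z)\<^sup>2"
      unfolding e3 using e1[unfolded e2] e4 by (rule order.trans)
  qed (use Lnn in \<open>auto simp: A_def\<close>)
qed

text \<open>The images of a point of the plane lie at the heights 2tj, and only j = 0 satisfies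
  |2tj| < t; hence the kernel is infinite only on the diagonal. Both cases of the definition take
  the same form because \<open>reg m\<close> is 1 for n = 2 and 0 otherwise.\<close>

lemma strip_kernel_eq:
  fixes p q :: "(real^'n) \<times> real"
  assumes n: "CARD('n) = m + 1" and m: "m \<ge> 1" and z: "\<bar>snd p\<bar> < t" and q: "snd q = 0"
  shows "strip_kernel t p q = (if p = q then \<infinity> else
    ereal (newt m (norm (fst p - fst q)) (snd p) + stripK m t (snd p) (norm (fst p - fst q))))"
proof -
  define r where "r = norm (fst p - fst q)"
  define z where "z = snd p"
  have t: "t > 0" and zt: "\<bar>z\<bar> \<le> t" "\<bar>z\<bar> < t" using assms(3) by (auto simp: z_def)
  have refl: "strip_refl t j q = (fst q, 2 * t * of_int j)" for j by (simp add: strip_refl_def q)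
  have ex: "(\<exists>j. p = strip_refl t j q) \<longleftrightarrow> p = q"
  proof
    assume "\<exists>j. p = strip_refl t j q"
    then obtain j where j: "p = (fst q, 2 * t * of_int j)" using refl by auto
    then have "\<bar>2 * t * real_of_int j\<bar> < t" using zt by (simp add: z_def)
    then have "\<bar>2 * real_of_int j\<bar> < 1" using t by (simp add: abs_mult)
    then have "j = 0" by linarith
    then show "p = q" using j q by (simp add: prod_eq_iff)
  next
    assume "p = q"
    then show "\<exists>j. p = strip_refl t j q" using refl[of 0] q by (intro exI[of _ 0]) (simp add: prod_eq_iff)
  qed
  have dist: "1 / dist p (strip_refl t j q) ^ m = newt m r (z - 2 * t * of_int j)" for j
    unfolding refl newt_def r_def z_def by (simp add: dist_prod_def dist_norm)
  obtain C where C: "C \<ge> 0" "\<And>z r' k. \<lbrakk>\<bar>z\<bar> \<le> t; \<bar>r'\<bar> \<le> r\<rbrakk> \<Longrightarrow> \<bar>newt m r' (2 * t * real (Suc k) + z) - reg m / (2 * t * real (Suc k))\<bar> \<le> C / (real (Suc k))\<^sup>2"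
    using stripK_term_bound[OF m norm_ge_zero t, of "fst p - fst q"] unfolding r_def by metis
  define f where "f j = newt m r (z - 2 * t * real_of_int j) - reg m / \<bar>2 * t * of_int j\<bar>" for j :: int
  have fp: "f (int (Suc k)) = newt m r (2 * t * real (Suc k) - z) - reg m / (2 * t * real (Suc k))" for k
    using t newt_abs(2)[of m r "2 * t * real (Suc k) - z"] by (simp add: f_def abs_mult)
  have fn: "f (- int (Suc k)) = newt m r (2 * t * real (Suc k) + z) - reg m / (2 * t * real (Suc k))" for k
  proof -
    have e: "real_of_int (- int (Suc k)) = - real (Suc k)" by simp
    show ?thesis unfolding f_def e using t by (simp add: abs_mult add.commute del: of_nat_Suc)
  qed
  have sum: "(f has_sum (\<Sum>k. f (int (Suc k)) + f (- int (Suc k)))) (- {0})"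
  proof (rule infsum_int_nonzero)
    have r: "\<bar>r\<bar> \<le> r" by (simp add: r_def)
    show "summable (\<lambda>k. \<bar>f (int (Suc k))\<bar>)"
      by (rule summable_comparison_test'[OF summable_inverse_Suc_squares[of C], of 0])
         (unfold fp, use C(2)[of "-z" r] zt r in auto)
    show "summable (\<lambda>k. \<bar>f (- int (Suc k))\<bar>)"
      by (rule summable_comparison_test'[OF summable_inverse_Suc_squares[of C], of 0])
         (unfold fn, use C(2)[of z r] zt r in auto)
  qed
  have sK: "(\<Sum>k. f (int (Suc k)) + f (- int (Suc k))) + reg m * (euler_mascheroni - ln (4 * t)) / t = stripK m t z r"
    unfolding fp fn stripK_def by (simp add: algebra_simps)
  have g0: "1 / dist p q ^ m = newt m r z"
  proof -
    have "strip_refl t 0 q = q" unfolding refl using q by (simp add: prod_eq_iff)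
    then show ?thesis using dist[of 0] by simp
  qed
  show ?thesis
  proof (cases "p = q")
    case True
    then show ?thesis using ex by (simp add: strip_kernel_def)
  next
    case False
    show ?thesis
    proof (cases "m = 1")
      case m1: True
      have "1 / dist p (strip_refl t j q) - 1 / \<bar>2 * t * of_int j\<bar> = f j" for j
        using dist[of j] by (simp add: f_def m1 reg_def)
      then have "(\<Sum>\<^sub>\<infinity>j\<in>- {0}. 1 / dist p (strip_refl t j q) - 1 / \<bar>2 * t * of_int j\<bar>) = (\<Sum>k. f (int (Suc k)) + f (- int (Suc k)))"
        using infsumI[OF sum] by simp
      then have "strip_kernel t p q = ereal (newt m r z + (\<Sum>k. f (int (Suc k)) + f (- int (Suc k))) + (euler_mascheroni - ln (4 * t)) / t)"
        using False ex g0 n m1 by (simp add: strip_kernel_def)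
      then show ?thesis using False sK unfolding r_def[symmetric] z_def[symmetric] by (simp add: m1 reg_def)
    next
      case m1: False
      have "((\<lambda>j. newt m r (z - 2 * t * real_of_int j)) has_sum (\<Sum>k. f (int (Suc k)) + f (- int (Suc k)))) (- {0})"
        using sum m1 by (simp add: f_def[abs_def] reg_def)
      then have "((\<lambda>j. newt m r (z - 2 * t * real_of_int j)) has_sum (newt m r z + (\<Sum>k. f (int (Suc k)) + f (- int (Suc k))))) ({0} \<union> (- {0}))"
        by (intro has_sum_Un_disjoint) (auto intro: has_sum_finiteI)
      moreover have "{0} \<union> (- {0}) = (UNIV :: int set)" by auto
      ultimately have "(\<Sum>\<^sub>\<infinity>j\<in>UNIV. newt m r (z - 2 * t * real_of_int j)) = newt m r z + (\<Sum>k. f (int (Suc k)) + f (- int (Suc k)))"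
        using infsumI by metis
      then have "strip_kernel t p q = ereal (newt m r z + (\<Sum>k. f (int (Suc k)) + f (- int (Suc k))))"
        using False ex n m1 by (simp add: strip_kernel_def dist)
      moreover have "reg m = 0" using m1 by (simp add: reg_def)
      ultimately show ?thesis using False sK[symmetric] unfolding r_def[symmetric] z_def[symmetric] by simp
    qed
  qed
qed

text \<open>With \<open>P\<close> and \<open>Q\<close> the positive and negative parts of N + h, the
  identity N + h^+ + Q = P + h^- holds pointwise and contains no subtraction, so it can be
  integrated in \<open>ennreal\<close>. All integrals except those of \<open>N\<close> and
  \<open>P\<close> are finite, and the identity can be solved for the difference.\<close>

lemma ereal_integral_add:
  assumes N [measurable]: "N \<in> borel_measurable M" and h: "integrable M h"
    and f: "\<And>x. x \<in> space M \<Longrightarrow> f x = enn2ereal (N x) + ereal (h x)"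
  shows "ereal_integral M f = enn2ereal (\<integral>\<^sup>+x. N x \<partial>M) + ereal (\<integral>x. h x \<partial>M)"
proof -
  have [measurable]: "h \<in> borel_measurable M" using h by simp
  define P where "P x = e2ennreal (enn2ereal (N x) + ereal (h x))" for x
  define Q where "Q x = e2ennreal (- (enn2ereal (N x) + ereal (h x)))" for x
  have [measurable]: "P \<in> borel_measurable M" "Q \<in> borel_measurable M" unfolding P_def Q_def by measurable
  have eq: "N x + ennreal (h x) + Q x = P x + ennreal (- h x)" for x
  proof (cases "N x")
    case (real a)
    then have "P x = ennreal (a + h x)" "Q x = ennreal (- (a + h x))"
      by (auto simp: P_def Q_def enn2ereal_ennreal ennreal.abs_eq[symmetric] e2ennreal_ereal)
    then show ?thesis using real
      by (cases "h x \<ge> 0"; cases "a + h x \<ge> 0") (auto simp: ennreal_plus[symmetric] ennreal_neg simp del: ennreal_plus)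
  qed (simp add: P_def Q_def)
  have Qle: "Q x \<le> ennreal (- h x)" for x
  proof (cases "N x")
    case (real a)
    then show ?thesis by (auto simp: Q_def enn2ereal_ennreal e2ennreal_ereal intro!: ennreal_leI)
  qed (simp add: Q_def e2ennreal_neg)
  obtain a where a: "a \<ge> 0" "(\<integral>\<^sup>+x. ennreal (h x) \<partial>M) = ennreal a"
    using h by (cases "\<integral>\<^sup>+x. ennreal (h x) \<partial>M") (auto simp: real_integrable_def)
  obtain b where b: "b \<ge> 0" "(\<integral>\<^sup>+x. ennreal (- h x) \<partial>M) = ennreal b"
    using h by (cases "\<integral>\<^sup>+x. ennreal (- h x) \<partial>M") (auto simp: real_integrable_def)
  have "(\<integral>\<^sup>+x. Q x \<partial>M) \<le> ennreal b" unfolding b(2)[symmetric] by (intro nn_integral_mono Qle)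
  then obtain c where c: "c \<ge> 0" "(\<integral>\<^sup>+x. Q x \<partial>M) = ennreal c"
    by (cases "\<integral>\<^sup>+x. Q x \<partial>M") (auto simp: top_unique)
  have int: "(\<integral>\<^sup>+x. N x \<partial>M) + ennreal a + ennreal c = (\<integral>\<^sup>+x. P x \<partial>M) + ennreal b"
    unfolding a(2)[symmetric] b(2)[symmetric] c(2)[symmetric]
    by (simp add: nn_integral_add[symmetric] eq)
  have hi: "(\<integral>x. h x \<partial>M) = a - b" unfolding real_lebesgue_integral_def[OF h] a(2) b(2) using a b by simp
  have "ereal_integral M f = enn2ereal (\<integral>\<^sup>+x. P x \<partial>M) - enn2ereal (\<integral>\<^sup>+x. Q x \<partial>M)"
    unfolding ereal_integral_def P_def Q_def by (simp add: f cong: nn_integral_cong)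
  also have "\<dots> = enn2ereal (\<integral>\<^sup>+x. N x \<partial>M) + ereal (a - b)"
  proof (cases "\<integral>\<^sup>+x. N x \<partial>M")
    case (real d)
    obtain e where e: "e \<ge> 0" "(\<integral>\<^sup>+x. P x \<partial>M) = ennreal e"
      using int real a b c by (cases "\<integral>\<^sup>+x. P x \<partial>M") (auto simp: ennreal_plus[symmetric] simp del: ennreal_plus)
    have "d + a + c = e + b" using int real e a b c
      by (simp add: ennreal_plus[symmetric] del: ennreal_plus)
    then show ?thesis using real e c by (simp add: enn2ereal_ennreal)
  next
    case top
    then have "(\<integral>\<^sup>+x. P x \<partial>M) + ennreal b = \<top>" using int by (simp add: top_add)
    then have "(\<integral>\<^sup>+x. P x \<partial>M) = \<top>" by (simp only: ennreal_add_eq_top) simp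
    then show ?thesis using top c by (simp add: enn2ereal_ennreal)
  qed
  finally show ?thesis unfolding hi .
qed

subsection \<open>Poisson integrals and energies of measures\<close>

text \<open>Measures enter as laws of random variables, so that a measure on R^n x {0} can be used
  through the projection \<open>fst\<close>.\<close>

definition pot :: "nat \<Rightarrow> 'w measure \<Rightarrow> ('w \<Rightarrow> 'a::euclidean_space) \<Rightarrow> real \<Rightarrow> 'a \<Rightarrow> real" where
  "pot m M X s y = (\<integral>p. pois m (norm (y - X p)) s \<partial>M)"

text \<open>By the semigroup law this is, up to the constant half area, the L^2 product of the
  Poisson integrals of the two laws at any two positive heights with sum \<open>s\<close>.\<close>

definition phi :: "nat \<Rightarrow> 'w measure \<Rightarrow> ('w \<Rightarrow> 'a::euclidean_space) \<Rightarrow> 'v measure \<Rightarrow> ('v \<Rightarrow> 'a) \<Rightarrow> real \<Rightarrow> real" where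
  "phi m M X N Y s = (\<integral>q. \<integral>p. pois m (norm (X p - Y q)) s \<partial>M \<partial>N)"

text \<open>The real number \<open>newt m 0 0\<close> is 0 for m > 0 because 1 / 0 = 0; the infinite
  value on the diagonal has to be set separately.\<close>

definition newtE :: "nat \<Rightarrow> real \<Rightarrow> ennreal" where
  "newtE m r = (if r = 0 then \<infinity> else ennreal (newt m r 0))"

definition energy2 :: "nat \<Rightarrow> 'w measure \<Rightarrow> ('w \<Rightarrow> 'a::euclidean_space) \<Rightarrow> 'v measure \<Rightarrow> ('v \<Rightarrow> 'a) \<Rightarrow> ennreal" where
  "energy2 m M X N Y = (\<integral>\<^sup>+q. \<integral>\<^sup>+p. newtE m (norm (X p - Y q)) \<partial>M \<partial>N)"

lemma measurable_newtE [measurable]: "newtE m \<in> borel_measurable borel"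
  unfolding newtE_def by measurable

lemma newt_tendsto_0:
  assumes m: "m \<ge> 1"
  shows "(newt m r \<longlongrightarrow> 0) at_top"
proof (rule tendsto_sandwich[OF _ _ tendsto_const])
  show "eventually (\<lambda>s. newt m r s \<le> 1 / s ^ m) at_top"
    using eventually_gt_at_top[of 0] by eventually_elim (rule newt_le)
  show "((\<lambda>s::real. 1 / s ^ m) \<longlongrightarrow> 0) at_top"
    using m by (intro tendsto_divide_0[OF tendsto_const] filterlim_at_top_imp_at_infinity filterlim_pow_at_top filterlim_ident) auto
qed (simp add: newt_nonneg)

lemma nn_integral_pois_atLeast:
  assumes m: "m \<ge> 1" and h: "h > 0"
  shows "(\<integral>\<^sup>+s. ennreal (real m * pois m r s) * indicator {h..} s \<partial>lborel) = ennreal (newt m r h)"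
proof -
  have "(\<integral>\<^sup>+s. ennreal (real m * pois m r s) * indicator {h..} s \<partial>lborel) = ennreal (0 - (- newt m r h))"
  proof (rule nn_integral_FTC_atLeast)
    show "((\<lambda>s. - newt m r s) has_real_derivative real m * pois m r x) (at x)" if "h \<le> x" for x
      using DERIV_minus[OF newt_deriv[of x m r]] that h by simp
    show "((\<lambda>s. - newt m r s) \<longlongrightarrow> 0) at_top" using tendsto_minus[OF newt_tendsto_0[OF m, of r]] by simp
    show "0 \<le> real m * pois m r x" if "h \<le> x" for x using that h by (simp add: pois_nonneg)
  qed measurable
  then show ?thesis by simp
qed

text \<open>Monotone convergence along the heights 1 / (k + 1): there the integral is
  \<open>newt m r (1 / (k + 1))\<close>, which increases to the singular kernel, and to infinity
  when r = 0.\<close>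

lemma newtE_eq_nn_integral:
  assumes m: "m \<ge> 1"
  shows "newtE m r = (\<integral>\<^sup>+s. ennreal (real m * pois m r s) * indicator {0<..} s \<partial>lborel)"
proof -
  define I where "I k = (\<integral>\<^sup>+s. ennreal (real m * pois m r s) * indicator {1 / real (Suc k)..} s \<partial>lborel)" for k
  have I: "I k = ennreal (newt m r (1 / real (Suc k)))" for k
    unfolding I_def by (rule nn_integral_pois_atLeast[OF m]) simp
  have sup: "(SUP k. ennreal (real m * pois m r s) * indicator {1 / real (Suc k)..} s)
      = ennreal (real m * pois m r s) * indicator {0<..} s" for s
  proof (cases "s > 0")
    case True
    obtain k where k: "1 / real (Suc k) < s" using reals_Archimedean[OF True] by (auto simp: inverse_eq_divide)
    show ?thesis
    proof (rule antisym)
      show "(SUP k. ennreal (real m * pois m r s) * indicator {1 / real (Suc k)..} s) \<le> ennreal (real m * pois m r s) * indicator {0<..} s"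
        using True by (intro SUP_least) (auto simp: indicator_def)
      show "ennreal (real m * pois m r s) * indicator {0<..} s \<le> (SUP k. ennreal (real m * pois m r s) * indicator {1 / real (Suc k)..} s)"
        using True k by (intro SUP_upper2[of k]) (auto simp: indicator_def)
    qed
  next
    case False
    have "\<not> 1 / real (Suc k) \<le> s" for k using False by (smt (verit) divide_pos_pos of_nat_0_less_iff zero_less_Suc)
    then show ?thesis using False by (simp add: indicator_def)
  qed
  have inc: "incseq (\<lambda>k s. ennreal (real m * pois m r s) * indicator {1 / real (Suc k)..} s)"
    by (intro incseq_SucI le_funI mult_left_mono) (auto simp: indicator_def frac_le intro: order.trans[rotated])
  have "(\<integral>\<^sup>+s. ennreal (real m * pois m r s) * indicator {0<..} s \<partial>lborel) = (SUP k. I k)"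
    unfolding sup[symmetric] I_def by (rule nn_integral_monotone_convergence_SUP[OF inc]) measurable
  moreover have "I \<longlonglongrightarrow> (SUP k. I k)"
  proof (rule LIMSEQ_SUP)
    show "incseq I" unfolding I_def using inc by (intro incseq_SucI nn_integral_mono) (auto simp: incseq_Suc_iff le_fun_def)
  qed
  moreover have "I \<longlonglongrightarrow> newtE m r"
  proof (cases "r = 0")
    case False
    have "(\<lambda>k. 1 / real (Suc k)) \<longlonglongrightarrow> 0" using LIMSEQ_inverse_real_of_nat by (simp add: inverse_eq_divide)
    then have "(\<lambda>k. newt m r (1 / real (Suc k))) \<longlonglongrightarrow> newt m r 0"
      unfolding newt_def using False by (intro tendsto_intros) auto
    then show ?thesis unfolding I using False by (simp add: newtE_def newt_nonneg tendsto_ennrealI)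
  next
    case True
    have "newt m r (1 / real (Suc k)) = real (Suc k) ^ m" for k
      by (simp add: newt_def True power_divide real_sqrt_divide del: of_nat_Suc)
    moreover have "filterlim (\<lambda>k. real (Suc k) ^ m) at_top sequentially"
      using m by (intro filterlim_pow_at_top filterlim_compose[OF filterlim_real_sequentially filterlim_Suc]) auto
    ultimately show ?thesis unfolding I using True by (simp add: newtE_def ennreal_tendsto_top_eq_at_top)
  qed
  ultimately show ?thesis using LIMSEQ_unique by metis
qed

lemma pois_translate:
  fixes x y :: "'a::euclidean_space"
  assumes "s > 0" "u > 0" "DIM('a) = m + 1"
  shows "(\<integral>\<^sup>+z. ennreal (pois m (norm (z - x)) s * pois m (norm (z - y)) u) \<partial>lborel)
    = ennreal (sphere_area (m + 1) / 2 * pois m (norm (x - y)) (s + u))"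
proof -
  have "(\<integral>\<^sup>+z. ennreal (pois m (norm (z - x)) s * pois m (norm (z - y)) u) \<partial>lborel)
    = (\<integral>\<^sup>+z. ennreal (pois m (norm (z - x)) s * pois m (norm (z - y)) u) \<partial>distr lborel borel ((+) y))"
    by (simp only: lborel_distr_plus)
  also have "\<dots> = (\<integral>\<^sup>+z. ennreal (pois m (norm ((x - y) - z)) s * pois m (norm z) u) \<partial>lborel)"
    by (subst nn_integral_distr) (simp_all add: norm_minus_commute algebra_simps)
  also have "\<dots> = ennreal (sphere_area (m + 1) / 2 * pois m (norm (x - y)) (s + u))"
    by (rule pois_convolution[OF assms])
  finally show ?thesis .
qed

section \<open>Mutual energies of two random points\<close>

locale rv_pair = M: prob_space M + N: prob_space N for M :: "'w measure" and N :: "'v measure" +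
  fixes X :: "'w \<Rightarrow> 'a::euclidean_space" and Y :: "'v \<Rightarrow> 'a" and m :: nat
  assumes X [measurable]: "X \<in> borel_measurable M" and Y [measurable]: "Y \<in> borel_measurable N"
    and dim: "DIM('a) = m + 1" and m: "m \<ge> 1"
begin

lemma pair_integrable:
  fixes g :: "real \<Rightarrow> real"
  assumes [measurable]: "g \<in> borel_measurable borel" and bd: "\<And>p q. p \<in> space M \<Longrightarrow> q \<in> space N \<Longrightarrow> \<bar>g (norm (X p - Y q))\<bar> \<le> B"
  shows "q \<in> space N \<Longrightarrow> integrable M (\<lambda>p. g (norm (X p - Y q)))"
    and "integrable N (\<lambda>q. \<integral>p. g (norm (X p - Y q)) \<partial>M)"
    and "q \<in> space N \<Longrightarrow> \<bar>\<integral>p. g (norm (X p - Y q)) \<partial>M\<bar> \<le> B"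
    and "\<bar>\<integral>q. \<integral>p. g (norm (X p - Y q)) \<partial>M \<partial>N\<bar> \<le> B"
proof -
  show 1: "integrable M (\<lambda>p. g (norm (X p - Y q)))" if q: "q \<in> space N" for q
    by (rule M.integrable_const_bound[where B=B]) (use bd q in auto)
  show 2: "\<bar>\<integral>p. g (norm (X p - Y q)) \<partial>M\<bar> \<le> B" if q: "q \<in> space N" for q
  proof -
    have "\<bar>\<integral>p. g (norm (X p - Y q)) \<partial>M\<bar> \<le> (\<integral>p. B \<partial>M)"
      using 1[OF q] bd q by (intro order.trans[OF integral_abs_bound] integral_mono) auto
    then show ?thesis by (simp add: M.prob_space)
  qed
  show 3: "integrable N (\<lambda>q. \<integral>p. g (norm (X p - Y q)) \<partial>M)"
    by (rule N.integrable_const_bound[where B=B]) (use 2 in \<open>auto\<close>)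
  have "(\<integral>q. \<bar>\<integral>p. g (norm (X p - Y q)) \<partial>M\<bar> \<partial>N) \<le> (\<integral>q. B \<partial>N)"
    by (rule integral_mono[OF integrable_abs[OF 3] N.integrable_const]) (rule 2)
  from order.trans[OF integral_abs_bound this]
  have "\<bar>\<integral>q. \<integral>p. g (norm (X p - Y q)) \<partial>M \<partial>N\<bar> \<le> (\<integral>q. B \<partial>N)" .
  then show "\<bar>\<integral>q. \<integral>p. g (norm (X p - Y q)) \<partial>M \<partial>N\<bar> \<le> B" by (simp add: N.prob_space)
qed

lemma pair_nn_integral:
  fixes g :: "real \<Rightarrow> real"
  assumes [measurable]: "g \<in> borel_measurable borel" and nn: "\<And>r. 0 \<le> g r" and bd: "\<And>p q. p \<in> space M \<Longrightarrow> q \<in> space N \<Longrightarrow> g (norm (X p - Y q)) \<le> B"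
  shows "(\<integral>\<^sup>+q. \<integral>\<^sup>+p. ennreal (g (norm (X p - Y q))) \<partial>M \<partial>N) = ennreal (\<integral>q. \<integral>p. g (norm (X p - Y q)) \<partial>M \<partial>N)"
proof -
  have bd': "\<bar>g (norm (X p - Y q))\<bar> \<le> B" if "p \<in> space M" "q \<in> space N" for p q using bd[OF that] nn by simp
  note i = pair_integrable[of g B, OF _ bd']
  have "(\<integral>\<^sup>+p. ennreal (g (norm (X p - Y q))) \<partial>M) = ennreal (\<integral>p. g (norm (X p - Y q)) \<partial>M)" if "q \<in> space N" for q
    by (rule nn_integral_eq_integral) (use i(1)[OF _ _ _ that] nn in auto)
  then have "(\<integral>\<^sup>+q. \<integral>\<^sup>+p. ennreal (g (norm (X p - Y q))) \<partial>M \<partial>N) = (\<integral>\<^sup>+q. ennreal (\<integral>p. g (norm (X p - Y q)) \<partial>M) \<partial>N)"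
    by (rule nn_integral_cong)
  also have "\<dots> = ennreal (\<integral>q. \<integral>p. g (norm (X p - Y q)) \<partial>M \<partial>N)"
    by (rule nn_integral_eq_integral) (use i(2) nn in \<open>auto intro!: Bochner_Integration.integral_nonneg\<close>)
  finally show ?thesis .
qed

lemma pois_bd: "s > 0 \<Longrightarrow> \<bar>pois m r s\<bar> \<le> 1 / s ^ (m + 1)" "s > 0 \<Longrightarrow> pois m r s \<le> 1 / s ^ (m + 1)"
  using pois_le[of s m r] pois_nonneg[of s m r] by auto

lemma pot_integrable: "s > 0 \<Longrightarrow> integrable M (\<lambda>p. pois m (norm (y - X p)) s)"
  by (rule M.integrable_const_bound[where B="1 / s ^ (m + 1)"]) (use pois_bd in auto)

lemma pot_nn: "s > 0 \<Longrightarrow> (\<integral>\<^sup>+p. ennreal (pois m (norm (y - X p)) s) \<partial>M) = ennreal (pot m M X s y)"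
  unfolding pot_def by (rule nn_integral_eq_integral) (auto simp: pot_integrable pois_nonneg)

lemma pot_nonneg: "s \<ge> 0 \<Longrightarrow> pot m M X s y \<ge> 0"
  unfolding pot_def by (intro Bochner_Integration.integral_nonneg pois_nonneg)

lemma pot_measurable [measurable (raw)]:
  assumes [measurable]: "f \<in> borel_measurable L" "g \<in> borel_measurable L"
  shows "(\<lambda>z. pot m M X (f z) (g z)) \<in> borel_measurable L"
  unfolding pot_def by measurable

lemma phi_nn: assumes s: "s > 0"
  shows "(\<integral>\<^sup>+q. \<integral>\<^sup>+p. ennreal (pois m (norm (X p - Y q)) s) \<partial>M \<partial>N) = ennreal (phi m M X N Y s)"
  unfolding phi_def
  by (rule pair_nn_integral[where B="1 / s ^ (m + 1)"]) (use pois_bd(2)[OF s] pois_nonneg s in auto)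

lemma phi_bound: "s > 0 \<Longrightarrow> \<bar>phi m M X N Y s\<bar> \<le> 1 / s ^ (m + 1)"
  unfolding phi_def by (rule pair_integrable(4)) (use pois_bd(1) in auto)

lemma phi_nonneg: "s \<ge> 0 \<Longrightarrow> phi m M X N Y s \<ge> 0"
  unfolding phi_def by (intro Bochner_Integration.integral_nonneg pois_nonneg)

lemma phi_measurable [measurable]: "phi m M X N Y \<in> borel_measurable borel"
  unfolding phi_def[abs_def] by measurable

end

lemma (in rv_pair) N_pair: "rv_pair N N Y Y m"
  by unfold_locales (use Y dim m in auto)

lemma (in rv_pair) M_pair: "rv_pair M M X X m"
  by unfold_locales (use X dim m in auto)

context rv_pair
begin

lemmas pot_nonneg_N = rv_pair.pot_nonneg[OF N_pair]
lemmas pot_nn_N = rv_pair.pot_nn[OF N_pair]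
lemmas pot_measurable_N [measurable (raw)] = rv_pair.pot_measurable[OF N_pair]

text \<open>Tonelli moves the integral over \<open>y\<close> inside the two expectations, where the
  semigroup law applies pointwise.\<close>

lemma pot_convolution_nn:
  assumes s: "s > 0" and u: "u > 0"
  shows "(\<integral>\<^sup>+y. ennreal (pot m M X s y * pot m N Y u y) \<partial>lborel) = ennreal (sphere_area (m + 1) / 2 * phi m M X N Y (s + u))"
proof -
  have S: "sphere_area (m + 1) \<ge> 0" by (simp add: sphere_area_eq_ball_volume)
  have "(\<integral>\<^sup>+y. ennreal (pot m M X s y * pot m N Y u y) \<partial>lborel)
    = (\<integral>\<^sup>+y. (\<integral>\<^sup>+q. \<integral>\<^sup>+p. ennreal (pois m (norm (y - X p)) s * pois m (norm (y - Y q)) u) \<partial>M \<partial>N) \<partial>lborel)"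
  proof (rule nn_integral_cong)
    fix y :: 'a
    have "ennreal (pot m M X s y * pot m N Y u y) = ennreal (pot m M X s y) * (\<integral>\<^sup>+q. ennreal (pois m (norm (y - Y q)) u) \<partial>N)"
      using s u by (simp add: ennreal_mult pot_nonneg pot_nonneg_N pot_nn_N)
    also have "\<dots> = (\<integral>\<^sup>+q. ennreal (pot m M X s y) * ennreal (pois m (norm (y - Y q)) u) \<partial>N)"
      by (rule nn_integral_cmult[symmetric]) measurable
    also have "\<dots> = (\<integral>\<^sup>+q. \<integral>\<^sup>+p. ennreal (pois m (norm (y - X p)) s) * ennreal (pois m (norm (y - Y q)) u) \<partial>M \<partial>N)"
      unfolding pot_nn[OF s, symmetric] by (intro nn_integral_cong nn_integral_multc[symmetric]) measurable
    finally show "ennreal (pot m M X s y * pot m N Y u y) = (\<integral>\<^sup>+q. \<integral>\<^sup>+p. ennreal (pois m (norm (y - X p)) s * pois m (norm (y - Y q)) u) \<partial>M \<partial>N)"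
      using s u by (simp add: ennreal_mult pois_nonneg)
  qed
  also have "\<dots> = (\<integral>\<^sup>+q. (\<integral>\<^sup>+y. \<integral>\<^sup>+p. ennreal (pois m (norm (y - X p)) s * pois m (norm (y - Y q)) u) \<partial>M \<partial>lborel) \<partial>N)"
  proof -
    interpret pair_sigma_finite N "lborel :: 'a measure" ..
    show ?thesis by (rule Fubini') measurable
  qed
  also have "\<dots> = (\<integral>\<^sup>+q. \<integral>\<^sup>+p. (\<integral>\<^sup>+y. ennreal (pois m (norm (y - X p)) s * pois m (norm (y - Y q)) u) \<partial>lborel) \<partial>M \<partial>N)"
  proof -
    interpret pair_sigma_finite M "lborel :: 'a measure" ..
    show ?thesis by (rule nn_integral_cong, rule Fubini') measurable
  qed
  also have "\<dots> = (\<integral>\<^sup>+q. \<integral>\<^sup>+p. ennreal (sphere_area (m + 1) / 2) * ennreal (pois m (norm (X p - Y q)) (s + u)) \<partial>M \<partial>N)"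
  proof -
    have "ennreal (sphere_area (m + 1) / 2 * pois m r (s + u)) = ennreal (sphere_area (m + 1) / 2) * ennreal (pois m r (s + u))" for r
      using S s u by (intro ennreal_mult) (auto simp: pois_nonneg)
    then show ?thesis unfolding pois_translate[OF s u dim] by simp
  qed
  also have "\<dots> = ennreal (sphere_area (m + 1) / 2) * (\<integral>\<^sup>+q. \<integral>\<^sup>+p. ennreal (pois m (norm (X p - Y q)) (s + u)) \<partial>M \<partial>N)"
    by (simp add: nn_integral_cmult)
  also have "\<dots> = ennreal (sphere_area (m + 1) / 2) * ennreal (phi m M X N Y (s + u))" using s u by (simp add: phi_nn)
  also have "\<dots> = ennreal (sphere_area (m + 1) / 2 * phi m M X N Y (s + u))"
    using S s u by (intro ennreal_mult[symmetric]) (auto simp: phi_nonneg)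
  finally show ?thesis .
qed

lemma pot_convolution:
  assumes s: "s > 0" and u: "u > 0"
  shows "has_bochner_integral lborel (\<lambda>y. pot m M X s y * pot m N Y u y) (sphere_area (m + 1) / 2 * phi m M X N Y (s + u))"
proof (rule has_bochner_integral_nn_integral)
  show "(\<integral>\<^sup>+y. ennreal (pot m M X s y * pot m N Y u y) \<partial>lborel) = ennreal (sphere_area (m + 1) / 2 * phi m M X N Y (s + u))"
    by (rule pot_convolution_nn[OF s u])
qed (use s u in \<open>auto simp: pot_nonneg pot_nonneg_N phi_nonneg sphere_area_eq_ball_volume\<close>)

text \<open>Energies become integrals of \<open>phi\<close> over the height, so every inequality for
  \<open>phi\<close> valid at each height passes to the energies. Truncating the heights at
  \<open>h\<close> gives the energy of the bounded kernel \<open>newt m r h\<close> instead.\<close>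

lemma energy2_eq: "energy2 m M X N Y = (\<integral>\<^sup>+s. ennreal (real m * phi m M X N Y s) * indicator {0<..} s \<partial>lborel)"
proof -
  interpret P1: pair_sigma_finite M "lborel :: real measure" ..
  interpret P2: pair_sigma_finite N "lborel :: real measure" ..
  have "energy2 m M X N Y = (\<integral>\<^sup>+q. \<integral>\<^sup>+p. \<integral>\<^sup>+s. ennreal (real m * pois m (norm (X p - Y q)) s) * indicator {0<..} s \<partial>lborel \<partial>M \<partial>N)"
    unfolding energy2_def newtE_eq_nn_integral[OF m] ..
  also have "\<dots> = (\<integral>\<^sup>+q. \<integral>\<^sup>+s. \<integral>\<^sup>+p. ennreal (real m * pois m (norm (X p - Y q)) s) * indicator {0<..} s \<partial>M \<partial>lborel \<partial>N)"
    by (rule nn_integral_cong, rule P1.Fubini'[symmetric]) measurable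
  also have "\<dots> = (\<integral>\<^sup>+s. \<integral>\<^sup>+q. \<integral>\<^sup>+p. ennreal (real m * pois m (norm (X p - Y q)) s) * indicator {0<..} s \<partial>M \<partial>N \<partial>lborel)"
    by (rule P2.Fubini'[symmetric]) measurable
  also have "\<dots> = (\<integral>\<^sup>+s. ennreal (real m * phi m M X N Y s) * indicator {0<..} s \<partial>lborel)"
  proof (rule nn_integral_cong)
    fix s :: real
    show "(\<integral>\<^sup>+q. \<integral>\<^sup>+p. ennreal (real m * pois m (norm (X p - Y q)) s) * indicator {0<..} s \<partial>M \<partial>N)
      = ennreal (real m * phi m M X N Y s) * indicator {0<..} s"
    proof (cases "s > 0")
      case True
      have "(\<integral>\<^sup>+q. \<integral>\<^sup>+p. ennreal (real m * pois m (norm (X p - Y q)) s) \<partial>M \<partial>N)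
        = (\<integral>\<^sup>+q. \<integral>\<^sup>+p. ennreal (real m) * ennreal (pois m (norm (X p - Y q)) s) \<partial>M \<partial>N)"
        using True by (simp add: ennreal_mult pois_nonneg)
      also have "\<dots> = ennreal (real m) * ennreal (phi m M X N Y s)"
        by (simp add: nn_integral_cmult phi_nn[OF True, symmetric])
      finally show ?thesis using True by (simp add: ennreal_mult phi_nonneg)
    qed simp
  qed
  finally show ?thesis .
qed

lemma newt_double_integral:
  assumes h: "h > 0"
  shows "ennreal (\<integral>q. \<integral>p. newt m (norm (X p - Y q)) h \<partial>M \<partial>N) = (\<integral>\<^sup>+s. ennreal (real m * phi m M X N Y s) * indicator {h..} s \<partial>lborel)"
proof -
  interpret P1: pair_sigma_finite M "lborel :: real measure" ..
  interpret P2: pair_sigma_finite N "lborel :: real measure" ..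
  have "ennreal (\<integral>q. \<integral>p. newt m (norm (X p - Y q)) h \<partial>M \<partial>N) = (\<integral>\<^sup>+q. \<integral>\<^sup>+p. ennreal (newt m (norm (X p - Y q)) h) \<partial>M \<partial>N)"
    by (rule pair_nn_integral[symmetric, where B="1 / h ^ m"]) (use newt_le[OF h] newt_nonneg in auto)
  also have "\<dots> = (\<integral>\<^sup>+q. \<integral>\<^sup>+p. \<integral>\<^sup>+s. ennreal (real m * pois m (norm (X p - Y q)) s) * indicator {h..} s \<partial>lborel \<partial>M \<partial>N)"
    unfolding nn_integral_pois_atLeast[OF m h] ..
  also have "\<dots> = (\<integral>\<^sup>+q. \<integral>\<^sup>+s. \<integral>\<^sup>+p. ennreal (real m * pois m (norm (X p - Y q)) s) * indicator {h..} s \<partial>M \<partial>lborel \<partial>N)"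
    by (rule nn_integral_cong, rule P1.Fubini'[symmetric]) measurable
  also have "\<dots> = (\<integral>\<^sup>+s. \<integral>\<^sup>+q. \<integral>\<^sup>+p. ennreal (real m * pois m (norm (X p - Y q)) s) * indicator {h..} s \<partial>M \<partial>N \<partial>lborel)"
    by (rule P2.Fubini'[symmetric]) measurable
  also have "\<dots> = (\<integral>\<^sup>+s. ennreal (real m * phi m M X N Y s) * indicator {h..} s \<partial>lborel)"
  proof (rule nn_integral_cong)
    fix s :: real
    show "(\<integral>\<^sup>+q. \<integral>\<^sup>+p. ennreal (real m * pois m (norm (X p - Y q)) s) * indicator {h..} s \<partial>M \<partial>N)
      = ennreal (real m * phi m M X N Y s) * indicator {h..} s"
    proof (cases "s \<ge> h")
      case True
      then have s: "s > 0" using h by simp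
      have "(\<integral>\<^sup>+q. \<integral>\<^sup>+p. ennreal (real m * pois m (norm (X p - Y q)) s) \<partial>M \<partial>N)
        = (\<integral>\<^sup>+q. \<integral>\<^sup>+p. ennreal (real m) * ennreal (pois m (norm (X p - Y q)) s) \<partial>M \<partial>N)"
        using s by (simp add: ennreal_mult pois_nonneg)
      also have "\<dots> = ennreal (real m) * ennreal (phi m M X N Y s)"
        by (simp add: nn_integral_cmult phi_nn[OF s, symmetric])
      finally show ?thesis using True s by (simp add: ennreal_mult phi_nonneg)
    qed simp
  qed
  finally show ?thesis .
qed

end

section \<open>Positive definiteness of the energies and its equality case\<close>

lemma sphere_area_pos: "sphere_area n > 0"
  by (simp add: sphere_area_eq_ball_volume)

text \<open>Bounds the error of replacing a function with values in [0, 1] and Lipschitz constant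
  \<open>k\<close> by its Poisson average at height \<open>s\<close>. The type argument fixes the
  space of integration.\<close>

definition smear :: "'a::euclidean_space itself \<Rightarrow> nat \<Rightarrow> real \<Rightarrow> real \<Rightarrow> ennreal" where
  "smear _ m k s = (\<integral>\<^sup>+y. ennreal (min 1 (k * norm (y::'a)) * pois m (norm y) s) \<partial>lborel)"

context rv_pair
begin

lemma pair_dominated_convergence:
  fixes g :: "nat \<Rightarrow> real \<Rightarrow> real"
  assumes [measurable]: "\<And>n. g n \<in> borel_measurable borel" "h \<in> borel_measurable borel"
    and bd: "\<And>n p q. p \<in> space M \<Longrightarrow> q \<in> space N \<Longrightarrow> \<bar>g n (norm (X p - Y q))\<bar> \<le> B"
    and lim: "\<And>p q. p \<in> space M \<Longrightarrow> q \<in> space N \<Longrightarrow> (\<lambda>n. g n (norm (X p - Y q))) \<longlonglongrightarrow> h (norm (X p - Y q))"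
  shows "(\<lambda>n. \<integral>q. \<integral>p. g n (norm (X p - Y q)) \<partial>M \<partial>N) \<longlonglongrightarrow> (\<integral>q. \<integral>p. h (norm (X p - Y q)) \<partial>M \<partial>N)"
proof (rule integral_dominated_convergence[where w = "\<lambda>_. B"])
  show "AE q in N. (\<lambda>n. \<integral>p. g n (norm (X p - Y q)) \<partial>M) \<longlonglongrightarrow> (\<integral>p. h (norm (X p - Y q)) \<partial>M)"
  proof (rule AE_I2)
    fix q assume q: "q \<in> space N"
    show "(\<lambda>n. \<integral>p. g n (norm (X p - Y q)) \<partial>M) \<longlonglongrightarrow> (\<integral>p. h (norm (X p - Y q)) \<partial>M)"
      by (rule integral_dominated_convergence[where w = "\<lambda>_. B"]) (use bd lim q in auto)
  qed
  show "AE q in N. norm (\<integral>p. g n (norm (X p - Y q)) \<partial>M) \<le> B" for n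
    using pair_integrable(3)[of "g n" B] bd by auto
qed auto

text \<open>Heights are halved because a product of two Poisson integrals at height s / 2 integrates
  to \<open>phi\<close> at height \<open>s\<close>.\<close>

lemma pot_difference:
  assumes s: "s > 0"
  shows "has_bochner_integral lborel (\<lambda>y. (pot m M X (s / 2) y - pot m N Y (s / 2) y)\<^sup>2)
    (sphere_area (m + 1) / 2 * (phi m M X M X s + phi m N Y N Y s - 2 * phi m M X N Y s))"
proof -
  have s2: "s / 2 > 0" using s by simp
  have "has_bochner_integral lborel (\<lambda>y. pot m M X (s / 2) y * pot m M X (s / 2) y + pot m N Y (s / 2) y * pot m N Y (s / 2) y
       - 2 * (pot m M X (s / 2) y * pot m N Y (s / 2) y))
     (sphere_area (m + 1) / 2 * phi m M X M X (s / 2 + s / 2) + sphere_area (m + 1) / 2 * phi m N Y N Y (s / 2 + s / 2)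
       - 2 * (sphere_area (m + 1) / 2 * phi m M X N Y (s / 2 + s / 2)))"
    by (intro has_bochner_integral_diff has_bochner_integral_add has_bochner_integral_mult_right
        pot_convolution[OF s2 s2] rv_pair.pot_convolution[OF M_pair s2 s2] rv_pair.pot_convolution[OF N_pair s2 s2])
  then show ?thesis by (simp add: power2_eq_square algebra_simps)
qed

lemma phi_quadratic: "s > 0 \<Longrightarrow> 2 * phi m M X N Y s \<le> phi m M X M X s + phi m N Y N Y s"
proof -
  assume s: "s > 0"
  have "0 \<le> (\<integral>y. (pot m M X (s / 2) y - pot m N Y (s / 2) y)\<^sup>2 \<partial>lborel)" by simp
  also have "\<dots> = sphere_area (m + 1) / 2 * (phi m M X M X s + phi m N Y N Y s - 2 * phi m M X N Y s)"
    by (rule has_bochner_integral_integral_eq[OF pot_difference[OF s]])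
  finally show ?thesis using sphere_area_pos[of "m + 1"] by (simp add: zero_le_mult_iff)
qed

lemmas phi_nonneg_M = rv_pair.phi_nonneg[OF M_pair]
lemmas phi_nonneg_N = rv_pair.phi_nonneg[OF N_pair]
lemmas phi_measurable_M [measurable] = rv_pair.phi_measurable[OF M_pair]
lemmas phi_measurable_N [measurable] = rv_pair.phi_measurable[OF N_pair]

text \<open>The expansion of the square, integrated in \<open>ennreal\<close> with all terms
  nonnegative. The set \<open>A\<close> is {0<..} for the singular energy and {h..} for the kernel
  truncated at height h.\<close>

lemma phi_sum_nn:
  assumes A [measurable]: "A \<in> sets borel" and pos: "A \<subseteq> {0<..}"
  shows "(\<integral>\<^sup>+s. ennreal (real m * phi m M X M X s) * indicator A s \<partial>lborel) + (\<integral>\<^sup>+s. ennreal (real m * phi m N Y N Y s) * indicator A s \<partial>lborel)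
   = (\<integral>\<^sup>+s. ennreal (real m * (phi m M X M X s + phi m N Y N Y s - 2 * phi m M X N Y s)) * indicator A s \<partial>lborel)
     + 2 * (\<integral>\<^sup>+s. ennreal (real m * phi m M X N Y s) * indicator A s \<partial>lborel)"
proof -
  have "ennreal (real m * phi m M X M X s) * indicator A s + ennreal (real m * phi m N Y N Y s) * indicator A s
    = ennreal (real m * (phi m M X M X s + phi m N Y N Y s - 2 * phi m M X N Y s)) * indicator A s + 2 * (ennreal (real m * phi m M X N Y s) * indicator A s)" for s
  proof (cases "s \<in> A")
    case True
    then have s: "s > 0" using pos by auto
    have q: "phi m M X M X s + phi m N Y N Y s - 2 * phi m M X N Y s \<ge> 0" using phi_quadratic[OF s] by simp
    have n: "phi m M X M X s \<ge> 0" "phi m N Y N Y s \<ge> 0" "phi m M X N Y s \<ge> 0"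
      using s by (auto intro: phi_nonneg phi_nonneg_M phi_nonneg_N)
    have "ennreal (real m * phi m M X M X s) + ennreal (real m * phi m N Y N Y s) = ennreal (real m * phi m M X M X s + real m * phi m N Y N Y s)"
      using n by (intro ennreal_plus[symmetric]) auto
    also have "real m * phi m M X M X s + real m * phi m N Y N Y s = real m * (phi m M X M X s + phi m N Y N Y s - 2 * phi m M X N Y s) + 2 * (real m * phi m M X N Y s)"
      by (simp add: algebra_simps)
    also have "ennreal \<dots> = ennreal (real m * (phi m M X M X s + phi m N Y N Y s - 2 * phi m M X N Y s)) + ennreal (2 * (real m * phi m M X N Y s))"
      using n q by (intro ennreal_plus) auto
    also have "ennreal (2 * (real m * phi m M X N Y s)) = 2 * ennreal (real m * phi m M X N Y s)"
      using n by (subst ennreal_mult) auto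
    finally show ?thesis using True by simp
  qed simp
  note eq = this
  have "(\<integral>\<^sup>+s. ennreal (real m * phi m M X M X s) * indicator A s \<partial>lborel) + (\<integral>\<^sup>+s. ennreal (real m * phi m N Y N Y s) * indicator A s \<partial>lborel)
    = (\<integral>\<^sup>+s. ennreal (real m * phi m M X M X s) * indicator A s + ennreal (real m * phi m N Y N Y s) * indicator A s \<partial>lborel)"
    by (rule nn_integral_add[symmetric]) measurable
  also have "\<dots> = (\<integral>\<^sup>+s. ennreal (real m * (phi m M X M X s + phi m N Y N Y s - 2 * phi m M X N Y s)) * indicator A s + 2 * (ennreal (real m * phi m M X N Y s) * indicator A s) \<partial>lborel)"
    unfolding eq ..
  also have "\<dots> = (\<integral>\<^sup>+s. ennreal (real m * (phi m M X M X s + phi m N Y N Y s - 2 * phi m M X N Y s)) * indicator A s \<partial>lborel) + (\<integral>\<^sup>+s. 2 * (ennreal (real m * phi m M X N Y s) * indicator A s) \<partial>lborel)"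
    by (rule nn_integral_add) measurable
  also have "(\<integral>\<^sup>+s. 2 * (ennreal (real m * phi m M X N Y s) * indicator A s) \<partial>lborel) = 2 * (\<integral>\<^sup>+s. ennreal (real m * phi m M X N Y s) * indicator A s \<partial>lborel)"
    by (rule nn_integral_cmult) measurable
  finally show ?thesis .
qed

lemma energy2_quadratic: "2 * energy2 m M X N Y \<le> energy2 m M X M X + energy2 m N Y N Y"
  unfolding energy2_eq rv_pair.energy2_eq[OF M_pair] rv_pair.energy2_eq[OF N_pair]
  by (subst phi_sum_nn) auto

lemma newt_quadratic:
  assumes h: "h > 0"
  shows "2 * (\<integral>q. \<integral>p. newt m (norm (X p - Y q)) h \<partial>M \<partial>N) \<le>
     (\<integral>q. \<integral>p. newt m (norm (X p - X q)) h \<partial>M \<partial>M) + (\<integral>q. \<integral>p. newt m (norm (Y p - Y q)) h \<partial>N \<partial>N)"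
proof -
  have nn: "0 \<le> (\<integral>q. \<integral>p. newt m (norm (X p - Y q)) h \<partial>M \<partial>N)" "0 \<le> (\<integral>q. \<integral>p. newt m (norm (X p - X q)) h \<partial>M \<partial>M)"
     "0 \<le> (\<integral>q. \<integral>p. newt m (norm (Y p - Y q)) h \<partial>N \<partial>N)"
    by (auto intro!: Bochner_Integration.integral_nonneg simp: newt_nonneg)
  have "ennreal (2 * (\<integral>q. \<integral>p. newt m (norm (X p - Y q)) h \<partial>M \<partial>N)) = 2 * ennreal (\<integral>q. \<integral>p. newt m (norm (X p - Y q)) h \<partial>M \<partial>N)"
    using nn by (subst ennreal_mult) auto
  also have "\<dots> \<le> ennreal (\<integral>q. \<integral>p. newt m (norm (X p - X q)) h \<partial>M \<partial>M) + ennreal (\<integral>q. \<integral>p. newt m (norm (Y p - Y q)) h \<partial>N \<partial>N)"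
    unfolding newt_double_integral[OF h] rv_pair.newt_double_integral[OF M_pair h] rv_pair.newt_double_integral[OF N_pair h]
    by (subst phi_sum_nn) (use h in auto)
  also have "\<dots> = ennreal ((\<integral>q. \<integral>p. newt m (norm (X p - X q)) h \<partial>M \<partial>M) + (\<integral>q. \<integral>p. newt m (norm (Y p - Y q)) h \<partial>N \<partial>N))"
    using nn by (intro ennreal_plus[symmetric]) auto
  finally show ?thesis using nn by (subst (asm) ennreal_le_iff) auto
qed

text \<open>Each term and each partial sum is bounded, with terms of order j^(-2) after
  regularisation, so the double integral of \<open>stripT\<close> is a limit of finite sums of
  truncated energies, to which \<open>newt_quadratic\<close> applies.\<close>

lemma stripT_partial_limit:
  assumes t: "t > 0" and R: "\<And>p q. p \<in> space M \<Longrightarrow> q \<in> space N \<Longrightarrow> norm (X p - Y q) \<le> R"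
  shows "(\<lambda>n. 2 * (\<Sum>k<n. t * (\<integral>q. \<integral>p. newt m (norm (X p - Y q)) (2 * t * real (Suc k)) \<partial>M \<partial>N) - reg m / (2 * real (Suc k)))
      + reg m * (euler_mascheroni - ln (4 * t)))
    \<longlonglongrightarrow> (\<integral>q. \<integral>p. stripT m t (norm (X p - Y q)) \<partial>M \<partial>N)"
proof -
  have R0: "R \<ge> 0" using R M.not_empty N.not_empty by (meson all_not_in_conv norm_ge_zero order_trans)
  obtain C where C: "C \<ge> 0" "\<And>r k. \<bar>r\<bar> \<le> R \<Longrightarrow> \<bar>t * newt m r (2 * t * real (Suc k)) - reg m / (2 * real (Suc k))\<bar> \<le> C / (real (Suc k))\<^sup>2"
    using stripT_term_bound[OF m R0 t] by (metis order_refl)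
  define f where "f k r = t * newt m r (2 * t * real (Suc k)) - reg m / (2 * real (Suc k))" for k r
  define c where "c = reg m * (euler_mascheroni - ln (4 * t))"
  define g where "g n r = 2 * (\<Sum>k<n. f k r) + c" for n r
  define L where "L k = C / (real (Suc k))\<^sup>2" for k
  have L: "summable L" unfolding L_def by (rule summable_inverse_Suc_squares)
  have Ln: "L k \<ge> 0" for k using C(1) by (simp add: L_def)
  have fm [measurable]: "f k \<in> borel_measurable borel" for k unfolding f_def by measurable
  have fb: "\<bar>f k r\<bar> \<le> L k" if "\<bar>r\<bar> \<le> R" for k r using C(2)[OF that] by (simp add: f_def L_def)
  have gb: "\<bar>g n r\<bar> \<le> 2 * suminf L + \<bar>c\<bar>" if "\<bar>r\<bar> \<le> R" for n r
  proof -
    have "\<bar>\<Sum>k<n. f k r\<bar> \<le> (\<Sum>k<n. L k)" using fb[OF that] by (intro order.trans[OF sum_abs] sum_mono)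
    also have "\<dots> \<le> suminf L" by (rule sum_le_suminf[OF L]) (auto simp: Ln)
    finally show ?thesis unfolding g_def by linarith
  qed
  have lim: "(\<lambda>n. g n r) \<longlonglongrightarrow> stripT m t r" if "\<bar>r\<bar> \<le> R" for r
  proof -
    have "summable (\<lambda>k. f k r)" by (rule summable_comparison_test'[OF L, of 0]) (use fb[OF that] in auto)
    then have "(\<lambda>n. \<Sum>k<n. f k r) \<longlonglongrightarrow> (\<Sum>k. f k r)" by (rule summable_LIMSEQ)
    then show ?thesis unfolding g_def stripT_def f_def[symmetric] c_def[symmetric] by (intro tendsto_intros)
  qed
  have [measurable]: "g n \<in> borel_measurable borel" for n unfolding g_def by measurable
  have [measurable]: "stripT m t \<in> borel_measurable borel"
    by (rule borel_measurable_continuous_onI[OF continuous_stripT(1)[OF m t]])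
  have "(\<lambda>n. \<integral>q. \<integral>p. g n (norm (X p - Y q)) \<partial>M \<partial>N) \<longlonglongrightarrow> (\<integral>q. \<integral>p. stripT m t (norm (X p - Y q)) \<partial>M \<partial>N)"
    by (rule pair_dominated_convergence[where B = "2 * suminf L + \<bar>c\<bar>"]) (use gb lim R in auto)
  moreover have "(\<integral>q. \<integral>p. g n (norm (X p - Y q)) \<partial>M \<partial>N)
    = 2 * (\<Sum>k<n. t * (\<integral>q. \<integral>p. newt m (norm (X p - Y q)) (2 * t * real (Suc k)) \<partial>M \<partial>N) - reg m / (2 * real (Suc k))) + c" for n
  proof -
    have nb: "\<bar>newt m r (2 * t * real (Suc k))\<bar> \<le> 1 / (2 * t * real (Suc k)) ^ m" for r k
      using newt_le[of "2 * t * real (Suc k)" m r] newt_nonneg t by (simp del: of_nat_Suc)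
    note i = pair_integrable[of "\<lambda>r. newt m r (2 * t * real (Suc k))" "1 / (2 * t * real (Suc k)) ^ m" for k, OF _ nb]
    have "(\<integral>p. g n (norm (X p - Y q)) \<partial>M) = 2 * (\<Sum>k<n. t * (\<integral>p. newt m (norm (X p - Y q)) (2 * t * real (Suc k)) \<partial>M) - reg m / (2 * real (Suc k))) + c" if "q \<in> space N" for q
      unfolding g_def f_def using i(1)[OF _ that] by (simp add: M.prob_space del: of_nat_Suc)
    then have "(\<integral>q. \<integral>p. g n (norm (X p - Y q)) \<partial>M \<partial>N) = (\<integral>q. 2 * (\<Sum>k<n. t * (\<integral>p. newt m (norm (X p - Y q)) (2 * t * real (Suc k)) \<partial>M) - reg m / (2 * real (Suc k))) + c \<partial>N)"
      by (intro Bochner_Integration.integral_cong) auto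
    also have "\<dots> = 2 * (\<Sum>k<n. t * (\<integral>q. \<integral>p. newt m (norm (X p - Y q)) (2 * t * real (Suc k)) \<partial>M \<partial>N) - reg m / (2 * real (Suc k))) + c"
      using i(2) by (simp add: N.prob_space del: of_nat_Suc)
    finally show ?thesis .
  qed
  ultimately show ?thesis by (simp add: c_def)
qed

text \<open>Every image contributes a positive definite kernel. The regularising constants have the
  total weight 2 on both sides, since all measures have mass 1, and cancel in the partial
  sums.\<close>

lemma stripT_quadratic:
  assumes t: "t > 0" and R: "\<And>p. p \<in> space M \<Longrightarrow> norm (X p) \<le> R" "\<And>p. p \<in> space N \<Longrightarrow> norm (Y p) \<le> R"
  shows "2 * (\<integral>q. \<integral>p. stripT m t (norm (X p - Y q)) \<partial>M \<partial>N) \<le>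
     (\<integral>q. \<integral>p. stripT m t (norm (X p - X q)) \<partial>M \<partial>M) + (\<integral>q. \<integral>p. stripT m t (norm (Y p - Y q)) \<partial>N \<partial>N)"
proof -
  have R': "norm (x - y) \<le> 2 * R" if "norm x \<le> R" "norm y \<le> R" for x y :: 'a
    using norm_triangle_ineq4[of x y] that by linarith
  note l1 = stripT_partial_limit[OF t, of "2 * R"] and l2 = rv_pair.stripT_partial_limit[OF M_pair t, of "2 * R"]
    and l3 = rv_pair.stripT_partial_limit[OF N_pair t, of "2 * R"]
  show ?thesis
  proof (rule LIMSEQ_le[OF tendsto_mult[OF tendsto_const l1] tendsto_add[OF l2 l3]])
    define a where "a k = reg m / (2 * real (Suc k))" for k
    define F where "F k = (\<integral>q. \<integral>p. newt m (norm (X p - Y q)) (2 * t * real (Suc k)) \<partial>M \<partial>N)" for k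
    define F1 where "F1 k = (\<integral>q. \<integral>p. newt m (norm (X p - X q)) (2 * t * real (Suc k)) \<partial>M \<partial>M)" for k
    define F2 where "F2 k = (\<integral>q. \<integral>p. newt m (norm (Y p - Y q)) (2 * t * real (Suc k)) \<partial>N \<partial>N)" for k
    have F: "2 * F k \<le> F1 k + F2 k" for k unfolding F_def F1_def F2_def using t by (intro newt_quadratic) (auto simp del: of_nat_Suc)
    have "2 * (\<Sum>k<n. t * F k - a k) \<le> (\<Sum>k<n. t * F1 k - a k) + (\<Sum>k<n. t * F2 k - a k)" for n
    proof -
      have "t * (2 * F k) \<le> t * (F1 k + F2 k)" for k using F t by (intro mult_left_mono) auto
      then have "2 * (t * F k - a k) \<le> (t * F1 k - a k) + (t * F2 k - a k)" for k
        using t by (simp add: algebra_simps)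
      then show ?thesis unfolding sum_distrib_left sum.distrib[symmetric] by (intro sum_mono)
    qed
    then show "\<exists>N'. \<forall>n\<ge>N'. 2 * (2 * (\<Sum>k<n. t * F k - a k) + reg m * (euler_mascheroni - ln (4 * t)))
       \<le> 2 * (\<Sum>k<n. t * F1 k - a k) + reg m * (euler_mascheroni - ln (4 * t)) + (2 * (\<Sum>k<n. t * F2 k - a k) + reg m * (euler_mascheroni - ln (4 * t)))"
      by (intro exI[of _ 0] allI impI) (smt (verit, best))
  qed (use R R' in auto)
qed

text \<open>Equality in the quadratic inequality means that a nonnegative function of the height has
  integral zero. It vanishes at almost every height, hence at arbitrarily small ones, and there the
  squared difference of the Poisson integrals has integral zero.\<close>

lemma zero_energy_small_scale:
  assumes fin: "energy2 m M X M X < \<infinity>" "energy2 m N Y N Y < \<infinity>"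
    and le: "energy2 m M X M X + energy2 m N Y N Y \<le> 2 * energy2 m M X N Y" and e: "e > 0"
  obtains s where "0 < s" "s < e" "AE y in lborel. pot m M X s y = pot m N Y s y"
proof -
  define f where "f s = phi m M X M X s + phi m N Y N Y s - 2 * phi m M X N Y s" for s
  define I where "I = (\<integral>\<^sup>+s. ennreal (real m * f s) * indicator {0<..} s \<partial>lborel)"
  have "I + 2 * energy2 m M X N Y = energy2 m M X M X + energy2 m N Y N Y"
    unfolding energy2_eq rv_pair.energy2_eq[OF M_pair] rv_pair.energy2_eq[OF N_pair] I_def f_def
    by (subst phi_sum_nn) auto
  then have "I + 2 * energy2 m M X N Y \<le> 0 + 2 * energy2 m M X N Y" using le by simp
  moreover have "2 * energy2 m M X N Y < \<infinity>"
    by (rule le_less_trans[OF energy2_quadratic]) (use fin in auto)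
  ultimately have "I = 0" by (metis ennreal_add_left_cancel_le add.commute infinity_ennreal_def le_zero_eq less_irrefl)
  then have ae: "AE s in lborel. ennreal (real m * f s) * indicator {0<..} s = 0"
    unfolding I_def f_def by (subst (asm) nn_integral_0_iff_AE) auto
  have "\<exists>s. 0 < s \<and> s < e \<and> ennreal (real m * f s) * indicator {0<..} s = 0"
  proof (rule ccontr)
    assume no: "\<not> ?thesis"
    have "AE s in lborel. s \<notin> {0<..<e}" using ae by eventually_elim (use no in auto)
    moreover have "{x \<in> space lborel. \<not> x \<notin> {0<..<e}} = {0<..<e}" by auto
    ultimately have "emeasure lborel {0<..<e} = 0" using AE_iff_measurable[of "{0<..<e}" lborel "\<lambda>x. x \<notin> {0<..<e}"] by simp
    moreover have "emeasure lborel {0<..<e} = ennreal e" using e by simp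
    ultimately show False using e by simp
  qed
  then obtain s where s: "0 < s" "s < e" "ennreal (real m * f s) * indicator {0<..} s = 0" by blast
  have "f s \<ge> 0" unfolding f_def using phi_quadratic[OF s(1)] by simp
  then have f0: "f s = 0" using s m by (auto simp: ennreal_eq_0_iff mult_le_0_iff)
  have "AE y in lborel. (pot m M X (s / 2) y - pot m N Y (s / 2) y)\<^sup>2 = 0"
  proof (subst integral_nonneg_eq_0_iff_AE[symmetric])
    show "integrable lborel (\<lambda>y. (pot m M X (s / 2) y - pot m N Y (s / 2) y)\<^sup>2)"
      "(\<integral>y. (pot m M X (s / 2) y - pot m N Y (s / 2) y)\<^sup>2 \<partial>lborel) = 0"
      using pot_difference[OF s(1)] f0 by (auto simp: has_bochner_integral_iff f_def)
  qed auto
  then have "AE y in lborel. pot m M X (s / 2) y = pot m N Y (s / 2) y" by auto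
  then show thesis using s by (intro that[of "s / 2"]) auto
qed

text \<open>For |y| < d the weight is at most k d; for |y| >= d the kernel at height
  \<open>s\<close> is at most s C times the kernel at height 1. Both bounds have finite mass by
  \<open>pois_nn_integral\<close>, which replaces a separate estimate of the tail.\<close>

lemma smear_small:
  assumes k: "k > 0" and e: "e > 0"
  obtains s0 where "s0 > 0" "\<And>s. 0 < s \<Longrightarrow> s < s0 \<Longrightarrow> smear TYPE('a) m k s \<le> ennreal e"
proof -
  define S where "S = sphere_area (m + 1) / 2"
  have S: "S > 0" using sphere_area_pos[of "m + 1"] by (simp add: S_def)
  define d where "d = min 1 (e / (2 * k * S))"
  have d: "0 < d" "d \<le> 1" "k * d * S \<le> e / 2"
  proof -
    show "0 < d" "d \<le> 1" using k e S by (auto simp: d_def)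
    have "k * d * S \<le> k * (e / (2 * k * S)) * S" using k S by (intro mult_left_mono mult_right_mono) (auto simp: d_def)
    then show "k * d * S \<le> e / 2" using k S by simp
  qed
  \<comment> \<open>For r >= d and d <= 1 one has r^2 + 1 <= (2 / d^2) (r^2 + s^2); \<open>C\<close>
    is the power of this ratio that occurs in the kernel.\<close>
  define C where "C = (sqrt 2 / d) ^ (m + 2)"
  have C: "C > 0" using d by (simp add: C_def)
  define s0 where "s0 = min 1 (e / (2 * C * S))"
  show thesis
  proof (rule that[of s0])
    show "s0 > 0" using e C S by (simp add: s0_def)
    fix s assume s: "0 < s" "s < s0"
    have s1: "s < 1" and s2: "s * C * S \<le> e / 2"
    proof -
      show "s < 1" using s by (simp add: s0_def)
      have "s * C * S \<le> (e / (2 * C * S)) * C * S" using s C S by (intro mult_right_mono) (auto simp: s0_def)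
      then show "s * C * S \<le> e / 2" using C S by simp
    qed
    have pt: "min 1 (k * norm y) * pois m (norm y) s \<le> k * d * pois m (norm y) s + s * C * pois m (norm y) 1" for y :: 'a
    proof (cases "norm y < d")
      case True
      have "min 1 (k * norm y) * pois m (norm y) s \<le> k * d * pois m (norm y) s"
        using True k s by (intro mult_right_mono) (auto simp: pois_nonneg min_def intro: order.trans[OF _ mult_left_mono])
      then show ?thesis using s C pois_nonneg[of 1 m "norm y"] by (auto intro: add_increasing2)
    next
      case False
      define r where "r = norm y"
      have r: "d \<le> r" using False by (simp add: r_def)
      have "(1 + r\<^sup>2) * d\<^sup>2 \<le> 2 * r\<^sup>2"
      proof -
        have "d\<^sup>2 \<le> r\<^sup>2" "d\<^sup>2 \<le> 1" using r d by (auto intro: power_mono simp: power_le_one)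
        moreover have "r\<^sup>2 * d\<^sup>2 \<le> r\<^sup>2 * 1" using \<open>d\<^sup>2 \<le> 1\<close> by (intro mult_left_mono) auto
        ultimately show ?thesis by (simp add: algebra_simps)
      qed
      also have "\<dots> \<le> 2 * (r\<^sup>2 + s\<^sup>2)" by simp
      finally have "sqrt ((1 + r\<^sup>2) * d\<^sup>2) \<le> sqrt (2 * (r\<^sup>2 + s\<^sup>2))" by (rule real_sqrt_le_mono)
      then have "sqrt (r\<^sup>2 + 1\<^sup>2) * d \<le> sqrt 2 * sqrt (r\<^sup>2 + s\<^sup>2)"
        unfolding real_sqrt_mult using d by (simp add: add.commute)
      then have le: "sqrt (r\<^sup>2 + 1\<^sup>2) \<le> (sqrt 2 / d) * sqrt (r\<^sup>2 + s\<^sup>2)" using d by (simp add: field_simps)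
      have p: "sqrt (r\<^sup>2 + s\<^sup>2) > 0" "sqrt (r\<^sup>2 + 1\<^sup>2) > 0" using s by (auto simp: add_nonneg_pos)
      have "sqrt (r\<^sup>2 + 1\<^sup>2) ^ (m + 2) \<le> ((sqrt 2 / d) * sqrt (r\<^sup>2 + s\<^sup>2)) ^ (m + 2)"
        using le p by (intro power_mono) auto
      then have "sqrt (r\<^sup>2 + 1\<^sup>2) ^ (m + 2) \<le> C * sqrt (r\<^sup>2 + s\<^sup>2) ^ (m + 2)" unfolding power_mult_distrib C_def .
      then have "1 / sqrt (r\<^sup>2 + s\<^sup>2) ^ (m + 2) \<le> C / sqrt (r\<^sup>2 + 1\<^sup>2) ^ (m + 2)"
        using p by (simp add: divide_simps mult.commute)
      then have "s * (1 / sqrt (r\<^sup>2 + s\<^sup>2) ^ (m + 2)) \<le> s * (C / sqrt (r\<^sup>2 + 1\<^sup>2) ^ (m + 2))"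
        using s by (intro mult_left_mono) auto
      then have "pois m r s \<le> s * C * pois m r 1" by (simp add: pois_def)
      moreover have "min 1 (k * norm y) * pois m r s \<le> 1 * pois m r s" using s by (intro mult_right_mono) (auto simp: pois_nonneg)
      moreover have "0 \<le> k * d * pois m r s" using k d s by (simp add: pois_nonneg)
      ultimately show ?thesis unfolding r_def[symmetric] by linarith
    qed
    have "smear TYPE('a) m k s \<le> (\<integral>\<^sup>+(y::'a). ennreal (k * d) * ennreal (pois m (norm y) s) + ennreal (s * C) * ennreal (pois m (norm y) 1) \<partial>lborel)"
      unfolding smear_def
    proof (rule nn_integral_mono)
      fix y :: 'a
      have "ennreal (min 1 (k * norm y) * pois m (norm y) s) \<le> ennreal (k * d * pois m (norm y) s + s * C * pois m (norm y) 1)"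
        by (rule ennreal_leI[OF pt])
      also have "\<dots> = ennreal (k * d) * ennreal (pois m (norm y) s) + ennreal (s * C) * ennreal (pois m (norm y) 1)"
        using k d s C by (simp add: ennreal_plus ennreal_mult pois_nonneg)
      finally show "ennreal (min 1 (k * norm y) * pois m (norm y) s) \<le> ennreal (k * d) * ennreal (pois m (norm y) s) + ennreal (s * C) * ennreal (pois m (norm y) 1)" .
    qed
    also have "\<dots> = ennreal (k * d) * ennreal S + ennreal (s * C) * ennreal S"
      using pois_nn_integral[OF s(1) dim] pois_nn_integral[OF zero_less_one dim]
      by (simp add: nn_integral_add nn_integral_cmult S_def)
    also have "\<dots> = ennreal (k * d * S + s * C * S)" using k d s C S by (simp add: ennreal_plus ennreal_mult)
    also have "\<dots> \<le> ennreal e" using d s2 by (intro ennreal_leI) simp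
    finally show "smear TYPE('a) m k s \<le> ennreal e" .
  qed
qed

end

text \<open>Under the Poisson average \<open>f y\<close> and \<open>f x\<close> differ by at most
  min 1 (k |y - x|), and the average of this bound is \<open>smear\<close>, whatever the point x.
  Two inequalities take the place of one absolute value because the integrals are in
  \<open>ennreal\<close>.\<close>

lemma (in rv_pair) smear_bounds:
  fixes f :: "'a \<Rightarrow> real"
  assumes f [measurable]: "f \<in> borel_measurable borel" and f01: "\<And>x. 0 \<le> f x" "\<And>x. f x \<le> 1"
    and lip: "\<And>x y. \<bar>f x - f y\<bar> \<le> k * norm (x - y)" and k: "k > 0" and s: "s > 0"
  shows "(\<integral>\<^sup>+y. ennreal (f y) * ennreal (pot m M X s y) \<partial>lborel) \<le> ennreal (sphere_area (m + 1) / 2) * (\<integral>\<^sup>+p. ennreal (f (X p)) \<partial>M) + smear TYPE('a) m k s"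
    and "ennreal (sphere_area (m + 1) / 2) * (\<integral>\<^sup>+p. ennreal (f (X p)) \<partial>M) \<le> (\<integral>\<^sup>+y. ennreal (f y) * ennreal (pot m M X s y) \<partial>lborel) + smear TYPE('a) m k s"
proof -
  interpret P: pair_sigma_finite M "lborel :: 'a measure" ..
  define S where "S = sphere_area (m + 1) / 2"
  have "(\<integral>\<^sup>+y. ennreal (f y) * ennreal (pot m M X s y) \<partial>lborel) = (\<integral>\<^sup>+y. \<integral>\<^sup>+p. ennreal (f y) * ennreal (pois m (norm (y - X p)) s) \<partial>M \<partial>lborel)"
    unfolding pot_nn[OF s, symmetric] by (intro nn_integral_cong nn_integral_cmult[symmetric]) measurable
  also have "\<dots> = (\<integral>\<^sup>+p. \<integral>\<^sup>+y. ennreal (f y) * ennreal (pois m (norm (y - X p)) s) \<partial>lborel \<partial>M)"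
    by (rule P.Fubini') measurable
  finally have F: "(\<integral>\<^sup>+y. ennreal (f y) * ennreal (pot m M X s y) \<partial>lborel) = \<dots>" .
  have tr: "(\<integral>\<^sup>+y. ennreal (g (norm (y - x))) \<partial>lborel) = (\<integral>\<^sup>+y. ennreal (g (norm (y::'a))) \<partial>lborel)"
    if [measurable]: "g \<in> borel_measurable borel" for x :: 'a and g :: "real \<Rightarrow> real"
  proof -
    have "(\<integral>\<^sup>+y. ennreal (g (norm (y - x))) \<partial>lborel) = (\<integral>\<^sup>+y. ennreal (g (norm (y - x))) \<partial>distr lborel borel ((+) x))"
      by (simp only: lborel_distr_plus)
    also have "\<dots> = (\<integral>\<^sup>+y. ennreal (g (norm (y::'a))) \<partial>lborel)" by (subst nn_integral_distr) simp_all
    finally show ?thesis .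
  qed
  have p1: "(\<integral>\<^sup>+y. ennreal (pois m (norm (y - x)) s) \<partial>lborel) = ennreal S" for x :: 'a
    using pois_nn_integral[OF s dim] by (subst tr) (simp_all add: S_def)
  have p2: "(\<integral>\<^sup>+y. ennreal (min 1 (k * norm (y - x)) * pois m (norm (y - x)) s) \<partial>lborel) = smear TYPE('a) m k s" for x :: 'a
    unfolding smear_def by (rule tr[of "\<lambda>r. min 1 (k * r) * pois m r s"]) measurable
  have d: "\<bar>f y - f x\<bar> \<le> min 1 (k * norm (y - x))" for x y
    using lip[of y x] f01[of x] f01[of y] by auto
  have up: "(\<integral>\<^sup>+y. ennreal (f y) * ennreal (pois m (norm (y - x)) s) \<partial>lborel) \<le> ennreal S * ennreal (f x) + smear TYPE('a) m k s" for x
  proof -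
    have "ennreal (f y) * ennreal (pois m (norm (y - x)) s) \<le> ennreal (f x) * ennreal (pois m (norm (y - x)) s) + ennreal (min 1 (k * norm (y - x)) * pois m (norm (y - x)) s)" for y
    proof -
      have "f y * pois m (norm (y - x)) s \<le> (f x + min 1 (k * norm (y - x))) * pois m (norm (y - x)) s"
        using d[of y x] s by (intro mult_right_mono) (auto simp: pois_nonneg)
      then have "ennreal (f y * pois m (norm (y - x)) s) \<le> ennreal (f x * pois m (norm (y - x)) s + min 1 (k * norm (y - x)) * pois m (norm (y - x)) s)"
        by (intro ennreal_leI) (simp add: algebra_simps)
      then show ?thesis using f01 s k by (simp add: ennreal_plus ennreal_mult pois_nonneg)
    qed
    then have "(\<integral>\<^sup>+y. ennreal (f y) * ennreal (pois m (norm (y - x)) s) \<partial>lborel) \<le> (\<integral>\<^sup>+y. ennreal (f x) * ennreal (pois m (norm (y - x)) s) + ennreal (min 1 (k * norm (y - x)) * pois m (norm (y - x)) s) \<partial>lborel)"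
      by (intro nn_integral_mono)
    also have "\<dots> = ennreal (f x) * ennreal S + smear TYPE('a) m k s"
      by (subst nn_integral_add) (simp_all add: nn_integral_cmult p1 p2)
    finally show ?thesis by (simp add: mult.commute)
  qed
  have lo: "ennreal S * ennreal (f x) \<le> (\<integral>\<^sup>+y. ennreal (f y) * ennreal (pois m (norm (y - x)) s) \<partial>lborel) + smear TYPE('a) m k s" for x
  proof -
    have "ennreal (f x) * ennreal (pois m (norm (y - x)) s) \<le> ennreal (f y) * ennreal (pois m (norm (y - x)) s) + ennreal (min 1 (k * norm (y - x)) * pois m (norm (y - x)) s)" for y
    proof -
      have "f x * pois m (norm (y - x)) s \<le> (f y + min 1 (k * norm (y - x))) * pois m (norm (y - x)) s"
        using d[of y x] s by (intro mult_right_mono) (auto simp: pois_nonneg)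
      then have "ennreal (f x * pois m (norm (y - x)) s) \<le> ennreal (f y * pois m (norm (y - x)) s + min 1 (k * norm (y - x)) * pois m (norm (y - x)) s)"
        by (intro ennreal_leI) (simp add: algebra_simps)
      then show ?thesis using f01 s k by (simp add: ennreal_plus ennreal_mult pois_nonneg)
    qed
    then have "(\<integral>\<^sup>+y. ennreal (f x) * ennreal (pois m (norm (y - x)) s) \<partial>lborel) \<le> (\<integral>\<^sup>+y. ennreal (f y) * ennreal (pois m (norm (y - x)) s) + ennreal (min 1 (k * norm (y - x)) * pois m (norm (y - x)) s) \<partial>lborel)"
      by (intro nn_integral_mono)
    also have "\<dots> = (\<integral>\<^sup>+y. ennreal (f y) * ennreal (pois m (norm (y - x)) s) \<partial>lborel) + smear TYPE('a) m k s"
      by (subst nn_integral_add) (simp_all add: p2)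
    finally show ?thesis by (simp add: nn_integral_cmult p1 mult.commute)
  qed
  have "(\<integral>\<^sup>+y. ennreal (f y) * ennreal (pot m M X s y) \<partial>lborel) \<le> (\<integral>\<^sup>+p. ennreal S * ennreal (f (X p)) + smear TYPE('a) m k s \<partial>M)"
    unfolding F by (intro nn_integral_mono up)
  also have "\<dots> = ennreal S * (\<integral>\<^sup>+p. ennreal (f (X p)) \<partial>M) + smear TYPE('a) m k s"
    by (simp add: nn_integral_add nn_integral_cmult M.emeasure_space_1)
  finally show "(\<integral>\<^sup>+y. ennreal (f y) * ennreal (pot m M X s y) \<partial>lborel) \<le> ennreal (sphere_area (m + 1) / 2) * (\<integral>\<^sup>+p. ennreal (f (X p)) \<partial>M) + smear TYPE('a) m k s"
    by (simp only: S_def)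
  have "ennreal S * (\<integral>\<^sup>+p. ennreal (f (X p)) \<partial>M) = (\<integral>\<^sup>+p. ennreal S * ennreal (f (X p)) \<partial>M)"
    by (simp add: nn_integral_cmult)
  also have "\<dots> \<le> (\<integral>\<^sup>+p. (\<integral>\<^sup>+y. ennreal (f y) * ennreal (pois m (norm (y - X p)) s) \<partial>lborel) + smear TYPE('a) m k s \<partial>M)"
    by (intro nn_integral_mono lo)
  also have "\<dots> = (\<integral>\<^sup>+y. ennreal (f y) * ennreal (pot m M X s y) \<partial>lborel) + smear TYPE('a) m k s"
    unfolding F by (subst nn_integral_add) (simp_all add: M.emeasure_space_1)
  finally show "ennreal (sphere_area (m + 1) / 2) * (\<integral>\<^sup>+p. ennreal (f (X p)) \<partial>M) \<le> (\<integral>\<^sup>+y. ennreal (f y) * ennreal (pot m M X s y) \<partial>lborel) + smear TYPE('a) m k s"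
    by (simp only: S_def)
qed

text \<open>The strict part of convexity. Equality gives equal Poisson integrals at arbitrarily
  small heights, which determine the integrals of Lipschitz functions with values in [0, 1]. Cutoffs
  of the distance to a closed set decrease to its indicator, and the closed sets form an
  intersection stable generator.\<close>

lemma (in rv_pair) distr_eq:
  assumes fin: "energy2 m M X M X < \<infinity>" "energy2 m N Y N Y < \<infinity>"
    and le: "energy2 m M X M X + energy2 m N Y N Y \<le> 2 * energy2 m M X N Y"
  shows "distr M borel X = distr N borel Y"
proof -
  define S where "S = sphere_area (m + 1) / 2"
  have S: "S > 0" using sphere_area_pos[of "m + 1"] by (simp add: S_def)
  have test: "(\<integral>\<^sup>+p. ennreal (f (X p)) \<partial>M) = (\<integral>\<^sup>+q. ennreal (f (Y q)) \<partial>N)"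
    if f [measurable]: "f \<in> borel_measurable borel" and f01: "\<And>x. 0 \<le> f x" "\<And>x. f x \<le> 1"
      and lip: "\<And>x y. \<bar>f x - f y\<bar> \<le> k * norm (x - y)" and k: "k > 0" for f :: "'a \<Rightarrow> real" and k
  proof -
    define a where "a = (\<integral>\<^sup>+p. ennreal (f (X p)) \<partial>M)"
    define b where "b = (\<integral>\<^sup>+q. ennreal (f (Y q)) \<partial>N)"
    have ab: "ennreal S * a \<le> ennreal S * b + ennreal e \<and> ennreal S * b \<le> ennreal S * a + ennreal e" if e: "e > 0" for e
    proof -
      have "e / 2 > 0" using e by simp
      from smear_small[OF k this] obtain s0 where s0: "s0 > 0" "\<And>s. 0 < s \<Longrightarrow> s < s0 \<Longrightarrow> smear TYPE('a) m k s \<le> ennreal (e / 2)" by blast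
      from zero_energy_small_scale[OF fin le s0(1)] obtain s where s: "0 < s" "s < s0" "AE y in lborel. pot m M X s y = pot m N Y s y" by blast
      define F where "F = (\<integral>\<^sup>+y. ennreal (f y) * ennreal (pot m M X s y) \<partial>lborel)"
      have F': "F = (\<integral>\<^sup>+y. ennreal (f y) * ennreal (pot m N Y s y) \<partial>lborel)"
        unfolding F_def by (rule nn_integral_cong_AE) (use s(3) in auto)
      note 1 = smear_bounds[OF f f01 lip k s(1), folded S_def a_def F_def]
      note 2 = rv_pair.smear_bounds[OF N_pair f f01 lip k s(1), folded S_def b_def F']
      note sm = s0(2)[OF s(1,2)]
      have ee: "ennreal e = ennreal (e / 2) + ennreal (e / 2)" using e by (subst ennreal_plus[symmetric]) auto
      have "ennreal S * a \<le> F + ennreal (e / 2)" "ennreal S * b \<le> F + ennreal (e / 2)"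
        "F \<le> ennreal S * b + ennreal (e / 2)" "F \<le> ennreal S * a + ennreal (e / 2)"
        by (rule order.trans[OF 1(2) add_left_mono[OF sm]] order.trans[OF 2(2) add_left_mono[OF sm]]
            order.trans[OF 2(1) add_left_mono[OF sm]] order.trans[OF 1(1) add_left_mono[OF sm]])+
      note h = this
      show ?thesis unfolding ee add.assoc[symmetric]
        using order.trans[OF h(1) add_right_mono[OF h(3)]] order.trans[OF h(2) add_right_mono[OF h(4)]] by blast
    qed
    have "ennreal S * a \<le> ennreal S * b" by (rule ennreal_le_epsilon) (use ab in auto)
    moreover have "ennreal S * b \<le> ennreal S * a" by (rule ennreal_le_epsilon) (use ab in auto)
    ultimately have "ennreal S * a = ennreal S * b" by simp
    then show ?thesis using S by (simp add: ennreal_mult_cancel_left a_def b_def)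
  qed
  have cl: "emeasure (distr M borel X) C = emeasure (distr N borel Y) C" if C: "closed C" for C
  proof (cases "C = {}")
    case False
    define f where "f k x = max 0 (1 - real (Suc k) * infdist x C)" for k x
    have fm [measurable]: "f k \<in> borel_measurable borel" for k
      unfolding f_def by (intro borel_measurable_continuous_onI continuous_intros)
    have f01: "0 \<le> f k x" "f k x \<le> 1" for k x by (auto simp: f_def infdist_nonneg)
    have lip: "\<bar>f k x - f k y\<bar> \<le> real (Suc k) * norm (x - y)" for k x y
    proof -
      have "\<bar>infdist x C - infdist y C\<bar> \<le> norm (x - y)"
        using infdist_triangle_abs[of x C y] by (simp add: dist_norm)
      then have "real (Suc k) * \<bar>infdist x C - infdist y C\<bar> \<le> real (Suc k) * norm (x - y)" by (intro mult_left_mono) auto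
      moreover have "\<bar>f k x - f k y\<bar> \<le> \<bar>real (Suc k) * infdist x C - real (Suc k) * infdist y C\<bar>" unfolding f_def by linarith
      moreover have "\<bar>real (Suc k) * infdist x C - real (Suc k) * infdist y C\<bar> = real (Suc k) * \<bar>infdist x C - infdist y C\<bar>"
        unfolding right_diff_distrib[symmetric] abs_mult by simp
      ultimately show ?thesis by linarith
    qed
    have lim: "(\<lambda>k. ennreal (f k x)) \<longlonglongrightarrow> indicator C x" for x
    proof (cases "x \<in> C")
      case True
      then show ?thesis by (simp add: f_def)
    next
      case nC: False
      then have pos: "infdist x C > 0" using C False in_closed_iff_infdist_zero[OF C False, of x] infdist_nonneg[of x C] by (simp add: less_le)
      obtain n where n: "1 / infdist x C < real n" using reals_Archimedean2 by blast
      have "eventually (\<lambda>k. ennreal (f k x) = 0) sequentially"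
        using eventually_ge_at_top[of n]
      proof eventually_elim
        case (elim k)
        then have "1 / infdist x C \<le> real (Suc k)" using n by simp
        then have "1 \<le> real (Suc k) * infdist x C" using pos by (simp add: divide_le_eq)
        then show ?case by (simp add: f_def)
      qed
      then show ?thesis using nC by (simp add: tendsto_eventually)
    qed
    have Cm [measurable]: "C \<in> sets borel" using C by simp
    have "(\<lambda>k. \<integral>\<^sup>+p. ennreal (f k (X p)) \<partial>M) \<longlonglongrightarrow> (\<integral>\<^sup>+p. indicator C (X p) \<partial>M)"
      by (rule nn_integral_dominated_convergence[where w = "\<lambda>_. 1"]) (use lim f01 in \<open>auto simp: M.emeasure_space_1\<close>)
    moreover have "(\<lambda>k. \<integral>\<^sup>+p. ennreal (f k (Y p)) \<partial>N) \<longlonglongrightarrow> (\<integral>\<^sup>+p. indicator C (Y p) \<partial>N)"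
      by (rule nn_integral_dominated_convergence[where w = "\<lambda>_. 1"]) (use lim f01 in \<open>auto simp: N.emeasure_space_1\<close>)
    moreover have "(\<integral>\<^sup>+p. ennreal (f k (X p)) \<partial>M) = (\<integral>\<^sup>+p. ennreal (f k (Y p)) \<partial>N)" for k
      by (rule test[OF fm f01 lip]) auto
    ultimately have "(\<integral>\<^sup>+p. indicator C (X p) \<partial>M) = (\<integral>\<^sup>+p. indicator C (Y p) \<partial>N)"
      using LIMSEQ_unique by auto
    moreover have "emeasure (distr M borel X) C = (\<integral>\<^sup>+p. indicator C (X p) \<partial>M)"
      using nn_integral_distr[OF X, of "indicator C"] by simp
    moreover have "emeasure (distr N borel Y) C = (\<integral>\<^sup>+p. indicator C (Y p) \<partial>N)"
      using nn_integral_distr[OF Y, of "indicator C"] by simp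
    ultimately show ?thesis by simp
  qed simp
  show ?thesis
  proof (rule measure_eqI_generator_eq[where \<Omega> = UNIV and E = "Collect closed" and A = "\<lambda>_. UNIV"])
    show "Int_stable (Collect closed)" by (auto simp: Int_stable_def)
    show "sets (distr M borel X) = sigma_sets UNIV (Collect closed)" "sets (distr N borel Y) = sigma_sets UNIV (Collect closed)"
      by (simp_all add: borel_eq_closed sets_measure_of)
    show "emeasure (distr M borel X) UNIV \<noteq> \<infinity>" using M.emeasure_space_1 by (simp add: emeasure_distr)
  qed (use cl in auto)
qed

lemma (in rv_pair) energy2_commute: "energy2 m N Y M X = energy2 m M X N Y"
proof -
  interpret pair_sigma_finite M N ..
  have "energy2 m N Y M X = (\<integral>\<^sup>+p. \<integral>\<^sup>+q. newtE m (norm (X p - Y q)) \<partial>N \<partial>M)"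
    by (simp add: energy2_def norm_minus_commute)
  also have "\<dots> = energy2 m M X N Y" unfolding energy2_def by (rule Fubini'[symmetric]) measurable
  finally show ?thesis .
qed

section \<open>Truncated energies, mixtures of measures, and H_t\<close>

lemma nn_integral_pos_le:
  fixes f :: "real \<Rightarrow> ennreal"
  assumes [measurable]: "f \<in> borel_measurable borel"
    and le: "\<And>h. h > 0 \<Longrightarrow> (\<integral>\<^sup>+s. f s * indicator {h..} s \<partial>lborel) \<le> c"
  shows "(\<integral>\<^sup>+s. f s * indicator {0<..} s \<partial>lborel) \<le> c"
proof -
  have inc: "incseq (\<lambda>k s. f s * indicator {1 / real (Suc k)..} s)"
    by (intro incseq_SucI le_funI mult_left_mono) (auto simp: indicator_def frac_le intro: order.trans[rotated])
  have sup: "(SUP k. f s * indicator {1 / real (Suc k)..} s) = f s * indicator {0<..} s" for s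
  proof (cases "s > 0")
    case True
    obtain k where k: "1 / real (Suc k) < s" using reals_Archimedean[OF True] by (auto simp: inverse_eq_divide)
    show ?thesis
    proof (rule antisym)
      show "(SUP k. f s * indicator {1 / real (Suc k)..} s) \<le> f s * indicator {0<..} s"
        using True by (intro SUP_least) (auto simp: indicator_def)
      show "f s * indicator {0<..} s \<le> (SUP k. f s * indicator {1 / real (Suc k)..} s)"
        using True k by (intro SUP_upper2[of k]) (auto simp: indicator_def)
    qed
  next
    case False
    have "\<not> 1 / real (Suc k) \<le> s" for k using False by (smt (verit) divide_pos_pos of_nat_0_less_iff zero_less_Suc)
    then show ?thesis using False by (simp add: indicator_def)
  qed
  have "(\<integral>\<^sup>+s. f s * indicator {0<..} s \<partial>lborel) = (SUP k. \<integral>\<^sup>+s. f s * indicator {1 / real (Suc k)..} s \<partial>lborel)"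
    unfolding sup[symmetric] by (rule nn_integral_monotone_convergence_SUP[OF inc]) measurable
  also have "\<dots> \<le> c" by (intro SUP_least le) simp
  finally show ?thesis .
qed

text \<open>The singular energy is the increasing limit of the truncated ones as h decreases to 0,
  so a bound uniform in \<open>h\<close> suffices. The truncated kernels are continuous, which is
  how the energy of a weak limit gets controlled.\<close>

lemma (in rv_pair) energy2_le:
  assumes "\<And>h. h > 0 \<Longrightarrow> (\<integral>q. \<integral>p. newt m (norm (X p - Y q)) h \<partial>M \<partial>N) \<le> c"
  shows "energy2 m M X N Y \<le> ennreal c"
  unfolding energy2_eq
proof (rule nn_integral_pos_le)
  fix h :: real assume h: "h > 0"
  show "(\<integral>\<^sup>+s. ennreal (real m * phi m M X N Y s) * indicator {h..} s \<partial>lborel) \<le> ennreal c"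
    unfolding newt_double_integral[OF h, symmetric] by (intro ennreal_leI assms h)
qed measurable

lemma (in rv_pair) newt_le_energy2:
  assumes h: "h > 0"
  shows "ennreal (\<integral>q. \<integral>p. newt m (norm (X p - Y q)) h \<partial>M \<partial>N) \<le> energy2 m M X N Y"
  unfolding energy2_eq newt_double_integral[OF h]
  by (intro nn_integral_mono mult_left_mono) (use h in \<open>auto simp: indicator_def\<close>)

text \<open>The average of two measures, built as a fair Bernoulli choice followed by a draw. The
  formulas carry the factor 2 on the left so that no division in \<open>ennreal\<close>
  occurs.\<close>

lemma borel_prob_mixture:
  fixes K :: "'b::topological_space set"
  assumes mu: "\<mu> \<in> borel_prob_measures K" and nu: "\<nu> \<in> borel_prob_measures K"
  obtains \<rho> where "\<rho> \<in> borel_prob_measures K"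
    "\<And>f. f \<in> borel_measurable (restrict_space borel K) \<Longrightarrow> 2 * (\<integral>\<^sup>+x. f x \<partial>\<rho>) = (\<integral>\<^sup>+x. f x \<partial>\<mu>) + (\<integral>\<^sup>+x. f x \<partial>\<nu>)"
    "\<And>f :: 'b \<Rightarrow> real. f \<in> borel_measurable (restrict_space borel K) \<Longrightarrow> (\<exists>B. \<forall>x\<in>K. \<bar>f x\<bar> \<le> B) \<Longrightarrow> 2 * (\<integral>x. f x \<partial>\<rho>) = (\<integral>x. f x \<partial>\<mu>) + (\<integral>x. f x \<partial>\<nu>)"
proof -
  note dm = borel_prob_measuresD[OF mu] and dn = borel_prob_measuresD[OF nu]
  interpret m: prob_space \<mu> by (rule dm)
  interpret n: prob_space \<nu> by (rule dn)
  define B where "B = restrict_space borel K"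
  define k where "k b = (if b then \<mu> else \<nu>)" for b
  define P where "P = measure_pmf (bernoulli_pmf (1/2))"
  have k: "k \<in> measurable P (subprob_algebra B)"
    unfolding P_def k_def B_def
    by (simp add: measurable_def space_subprob_algebra dm dn m.subprob_space_axioms n.subprob_space_axioms)
  define \<rho> where "\<rho> = P \<bind> k"
  have sets: "sets \<rho> = sets B" unfolding \<rho>_def
    by (rule sets_bind) (auto simp: k_def B_def dm dn P_def)
  have nn: "2 * (\<integral>\<^sup>+x. f x \<partial>\<rho>) = (\<integral>\<^sup>+x. f x \<partial>\<mu>) + (\<integral>\<^sup>+x. f x \<partial>\<nu>)" if "f \<in> borel_measurable (restrict_space borel K)" for f
  proof -
    have "(\<integral>\<^sup>+x. f x \<partial>\<rho>) = (\<integral>\<^sup>+b. \<integral>\<^sup>+x. f x \<partial>k b \<partial>P)" unfolding \<rho>_def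
      by (rule nn_integral_bind[OF _ k]) (use that in \<open>simp add: B_def\<close>)
    also have "\<dots> = ennreal (1/2) * (\<integral>\<^sup>+x. f x \<partial>\<mu>) + ennreal (1/2) * (\<integral>\<^sup>+x. f x \<partial>\<nu>)"
      unfolding P_def by (simp add: nn_integral_bernoulli_pmf k_def mult.commute)
    also have "2 * \<dots> = (2 * ennreal (1/2)) * (\<integral>\<^sup>+x. f x \<partial>\<mu>) + (2 * ennreal (1/2)) * (\<integral>\<^sup>+x. f x \<partial>\<nu>)"
      by (simp add: distrib_left mult.assoc)
    also have "2 * ennreal (1/2) = 1"
    proof -
      have "2 * ennreal (1/2) = ennreal 2 * ennreal (1/2)" by simp
      also have "\<dots> = ennreal (2 * (1/2))" by (rule ennreal_mult[symmetric]) auto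
      finally show ?thesis by simp
    qed
    finally show ?thesis by simp
  qed
  have rp: "prob_space \<rho>"
  proof
    have "2 * (\<integral>\<^sup>+x. 1 \<partial>\<rho>) = (\<integral>\<^sup>+x. 1 \<partial>\<mu>) + (\<integral>\<^sup>+x. 1 \<partial>\<nu>)" by (rule nn) simp
    then have "2 * emeasure \<rho> (space \<rho>) = 2 * 1" by (simp add: m.emeasure_space_1 n.emeasure_space_1)
    then show "emeasure \<rho> (space \<rho>) = 1" by (subst (asm) ennreal_mult_cancel_left) auto
  qed
  then have rho: "\<rho> \<in> borel_prob_measures K" using sets by (simp add: borel_prob_measures_def B_def)
  interpret r: prob_space \<rho> by (rule rp)
  have re: "2 * (\<integral>x. f x \<partial>\<rho>) = (\<integral>x. f x \<partial>\<mu>) + (\<integral>x. f x \<partial>\<nu>)"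
    if fm: "f \<in> borel_measurable (restrict_space borel K)" and bd: "\<exists>B. \<forall>x\<in>K. \<bar>f x\<bar> \<le> B" for f :: "'b \<Rightarrow> real"
  proof -
    obtain C where C: "\<And>x. x \<in> K \<Longrightarrow> \<bar>f x\<bar> \<le> C" using bd by blast
    have [measurable]: "f \<in> borel_measurable L" if "L \<in> borel_prob_measures K" for L
      using fm measurable_cong_sets[OF borel_prob_measuresD(2)[OF that] refl] by blast
    note [measurable] = this[OF mu] this[OF nu] this[OF rho]
    define g where "g x = f x + C" for x
    have gn: "(\<integral>\<^sup>+x. ennreal (g x) \<partial>L) = ennreal ((\<integral>x. f x \<partial>L) + C) \<and> 0 \<le> (\<integral>x. f x \<partial>L) + C" if L: "L \<in> borel_prob_measures K" for L
    proof -
      interpret L: prob_space L by (rule borel_prob_measuresD[OF L])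
      have i: "integrable L f" by (rule L.integrable_const_bound[where B=C])
         (use C fm measurable_cong_sets[OF borel_prob_measuresD(2)[OF L] refl] in \<open>auto simp: borel_prob_measuresD(3)[OF L]\<close>)
      have e: "(\<integral>x. g x \<partial>L) = (\<integral>x. f x \<partial>L) + C" unfolding g_def using i by (simp add: L.prob_space)
      have g0: "AE x in L. 0 \<le> g x" using C by (auto simp: g_def borel_prob_measuresD(3)[OF L] abs_le_iff intro!: AE_I2) (smt (verit) C)
      have "(\<integral>\<^sup>+x. ennreal (g x) \<partial>L) = ennreal (\<integral>x. g x \<partial>L)"
        by (rule nn_integral_eq_integral) (use i g0 in \<open>auto simp: g_def\<close>)
      then show ?thesis using e integral_nonneg_AE[OF g0] by simp
    qed
    have "2 * (\<integral>\<^sup>+x. ennreal (g x) \<partial>\<rho>) = (\<integral>\<^sup>+x. ennreal (g x) \<partial>\<mu>) + (\<integral>\<^sup>+x. ennreal (g x) \<partial>\<nu>)"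
      by (rule nn) (use fm in \<open>simp add: g_def\<close>)
    then have e: "2 * ennreal ((\<integral>x. f x \<partial>\<rho>) + C) = ennreal ((\<integral>x. f x \<partial>\<mu>) + C) + ennreal ((\<integral>x. f x \<partial>\<nu>) + C)"
      using gn[OF mu] gn[OF nu] gn[OF rho] by simp
    have "ennreal (2 * ((\<integral>x. f x \<partial>\<rho>) + C)) = ennreal 2 * ennreal ((\<integral>x. f x \<partial>\<rho>) + C)"
      using gn[OF rho] by (intro ennreal_mult) auto
    also have "\<dots> = ennreal (((\<integral>x. f x \<partial>\<mu>) + C) + ((\<integral>x. f x \<partial>\<nu>) + C))"
      using e gn[OF mu] gn[OF nu] by (subst ennreal_plus) auto
    finally have "2 * ((\<integral>x. f x \<partial>\<rho>) + C) = ((\<integral>x. f x \<partial>\<mu>) + C) + ((\<integral>x. f x \<partial>\<nu>) + C)"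
      using gn[OF mu] gn[OF nu] gn[OF rho] by (subst (asm) ennreal_inj) auto
    then show ?thesis by simp
  qed
  show thesis by (rule that[OF rho nn re])
qed

text \<open>H_t itself: by \<open>stripK_zero\<close> it is the regular part of the kernel on the
  plane. Its derivative in t, \<open>stripH'\<close>, follows the quotient rule.\<close>

definition stripH :: "nat \<Rightarrow> real \<Rightarrow> real \<Rightarrow> real" where
  "stripH m t r = stripT m t r / t"

definition stripH' :: "nat \<Rightarrow> real \<Rightarrow> real \<Rightarrow> real" where
  "stripH' m t r = stripT' m t r / t - stripT m t r / t\<^sup>2"

lemma stripH_bounds:
  assumes m: "m \<ge> 1" and R: "R \<ge> 0" and ab: "0 < a" "a \<le> b"
  obtains C where "C \<ge> 0"
    "\<And>s t r. \<lbrakk>s \<in> {a..b}; t \<in> {a..b}; \<bar>r\<bar> \<le> R\<rbrakk> \<Longrightarrow> \<bar>stripH m s r - stripH m t r - (s - t) * stripH' m t r\<bar> \<le> C * (s - t)\<^sup>2"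
    "\<And>s t r. \<lbrakk>s \<in> {a..b}; t \<in> {a..b}; \<bar>r\<bar> \<le> R\<rbrakk> \<Longrightarrow> \<bar>stripH' m s r - stripH' m t r\<bar> \<le> C * \<bar>s - t\<bar>"
    "\<And>t r. \<lbrakk>t \<in> {a..b}; \<bar>r\<bar> \<le> R\<rbrakk> \<Longrightarrow> \<bar>stripH m t r\<bar> \<le> C"
    "\<And>t r. \<lbrakk>t \<in> {a..b}; \<bar>r\<bar> \<le> R\<rbrakk> \<Longrightarrow> \<bar>stripH' m t r\<bar> \<le> C"
    "\<And>t r. \<lbrakk>t \<in> {a..b}; \<bar>r\<bar> \<le> R\<rbrakk> \<Longrightarrow> \<bar>stripT' m t r\<bar> \<le> C"
    "\<And>t r. \<lbrakk>t \<in> {a..b}; \<bar>r\<bar> \<le> R\<rbrakk> \<Longrightarrow> \<bar>stripT m t r\<bar> \<le> C"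
proof -
  obtain C where C: "C \<ge> 0"
    "\<And>s t r. \<lbrakk>s \<in> {a..b}; t \<in> {a..b}; \<bar>r\<bar> \<le> R\<rbrakk> \<Longrightarrow> \<bar>stripT m s r - stripT m t r - (s - t) * stripT' m t r\<bar> \<le> C * (s - t)\<^sup>2"
    "\<And>s t r. \<lbrakk>s \<in> {a..b}; t \<in> {a..b}; \<bar>r\<bar> \<le> R\<rbrakk> \<Longrightarrow> \<bar>stripT' m s r - stripT' m t r\<bar> \<le> C * \<bar>s - t\<bar>"
    "\<And>t r. \<lbrakk>t \<in> {a..b}; \<bar>r\<bar> \<le> R\<rbrakk> \<Longrightarrow> \<bar>stripT m t r\<bar> \<le> C"
    "\<And>t r. \<lbrakk>t \<in> {a..b}; \<bar>r\<bar> \<le> R\<rbrakk> \<Longrightarrow> \<bar>stripT' m t r\<bar> \<le> C"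
    using stripT_bounds[OF m R ab] by blast
  define D where "D = 1 / a"
  have D: "D > 0" using ab by (simp add: D_def)
  define C1 where "C1 = C * (D + D\<^sup>2 + D ^ 3)"
  define C2 where "C2 = C * D + C * D\<^sup>2 + (C + C * (b - a)) * D\<^sup>2 + C * (2 * b * D ^ 4)"
  define C3 where "C3 = C * D + C * D\<^sup>2 + C"
  have pos: "0 \<le> C1" "0 \<le> C2" "0 \<le> C3" using C(1) D ab by (auto simp: C1_def C2_def C3_def)
  have inv: "0 < 1 / x" "1 / x \<le> D" if "x \<in> {a..b}" for x using that ab by (auto simp: D_def frac_le)
  show thesis
  proof (rule that[of "C1 + C2 + C3"])
    fix s t r :: real assume h: "s \<in> {a..b}" "t \<in> {a..b}" "\<bar>r\<bar> \<le> R"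
    have st: "s > 0" "t > 0" using h ab by auto
    \<comment> \<open>In terms of the inverses the only relation needed is p - q = - (s - t) p q,
      and the remainder of the quotient becomes a polynomial estimate.\<close>
    define p where "p = 1 / s" define q where "q = 1 / t"
    have pq: "0 < p" "p \<le> D" "0 < q" "q \<le> D" unfolding p_def q_def using inv h by auto
    have ps: "p * s = 1" "q * t = 1" using st by (auto simp: p_def q_def)
    have pmq: "p - q = - (s - t) * (p * q)"
    proof -
      have "(s - t) * (p * q) = (p * s) * q - (q * t) * p" by (simp add: algebra_simps)
      then have "(s - t) * (p * q) = q - p" using ps by simp
      then show ?thesis unfolding mult_minus_left by linarith
    qed
    have qmp: "q - p = (s - t) * (p * q)" using pmq unfolding mult_minus_left by linarith
    have H: "stripH m s r = stripT m s r * p" "stripH m t r = stripT m t r * q"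
      "stripH' m t r = stripT' m t r * q - stripT m t r * q\<^sup>2" "stripH' m s r = stripT' m s r * p - stripT m s r * p\<^sup>2"
      by (auto simp: stripH_def stripH'_def p_def q_def power_divide)
    have pp: "p * q \<le> D\<^sup>2" "p * q\<^sup>2 \<le> D ^ 3" "p\<^sup>2 \<le> D\<^sup>2"
      using pq by (auto simp: power2_eq_square power3_eq_cube mult.assoc[symmetric] intro!: mult_mono)
    define T where "T = stripT m t r" define T1 where "T1 = stripT' m t r"
    define S where "S = stripT m s r" define S1 where "S1 = stripT' m s r"
    note b2 = C(2)[OF h, folded T_def T1_def S_def] and b3 = C(3)[OF h, folded T1_def S1_def]
      and bT = C(4)[OF h(2,3), folded T_def] and bT1 = C(5)[OF h(2,3), folded T1_def]
    have "stripH m s r - stripH m t r - (s - t) * stripH' m t r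
      = (S - T - (s - t) * T1) * p + ((s - t) * T1 * (p - q) + T * ((p - q) + (s - t) * q\<^sup>2))"
      unfolding H T_def[symmetric] T1_def[symmetric] S_def[symmetric] by (simp add: algebra_simps)
    also have "(p - q) + (s - t) * q\<^sup>2 = (s - t) * q * (q - p)" unfolding pmq by (simp add: algebra_simps power2_eq_square)
    also have "\<dots> = (s - t)\<^sup>2 * (p * q\<^sup>2)" unfolding qmp by (simp add: power2_eq_square algebra_simps)
    also have "(s - t) * T1 * (p - q) = - ((s - t)\<^sup>2 * (T1 * (p * q)))" unfolding pmq by (simp add: power2_eq_square algebra_simps)
    also have "\<bar>(S - T - (s - t) * T1) * p + (- ((s - t)\<^sup>2 * (T1 * (p * q))) + T * ((s - t)\<^sup>2 * (p * q\<^sup>2)))\<bar>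
      \<le> C * (s - t)\<^sup>2 * D + ((s - t)\<^sup>2 * (C * D\<^sup>2) + C * ((s - t)\<^sup>2 * D ^ 3))"
    proof (intro order.trans[OF abs_triangle_ineq] add_mono)
      show "\<bar>(S - T - (s - t) * T1) * p\<bar> \<le> C * (s - t)\<^sup>2 * D"
        unfolding abs_mult using b2 pq C(1) by (intro mult_mono) auto
      show "\<bar>- ((s - t)\<^sup>2 * (T1 * (p * q)))\<bar> \<le> (s - t)\<^sup>2 * (C * D\<^sup>2)"
        unfolding abs_minus_cancel abs_mult using bT1 pp pq C(1) by (intro mult_mono) (auto simp: abs_mult)
      show "\<bar>T * ((s - t)\<^sup>2 * (p * q\<^sup>2))\<bar> \<le> C * ((s - t)\<^sup>2 * D ^ 3)"
        unfolding abs_mult using bT pp pq C(1) by (intro mult_mono) (auto simp: abs_mult)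
    qed
    also have "\<dots> = C1 * (s - t)\<^sup>2" by (simp add: C1_def algebra_simps)
    also have "\<dots> \<le> (C1 + C2 + C3) * (s - t)\<^sup>2" using pos by (intro mult_right_mono) auto
    finally show "\<bar>stripH m s r - stripH m t r - (s - t) * stripH' m t r\<bar> \<le> (C1 + C2 + C3) * (s - t)\<^sup>2" .
    have ST: "\<bar>S - T\<bar> \<le> (C + C * (b - a)) * \<bar>s - t\<bar>"
    proof -
      have "\<bar>S - T\<bar> \<le> \<bar>S - T - (s - t) * T1\<bar> + \<bar>(s - t) * T1\<bar>" by linarith
      also have "\<dots> \<le> C * (s - t)\<^sup>2 + \<bar>s - t\<bar> * C" using b2 bT1 by (intro add_mono) (auto simp: abs_mult intro!: mult_left_mono)
      also have "(s - t)\<^sup>2 = \<bar>s - t\<bar> * \<bar>s - t\<bar>" by (simp add: power2_eq_square)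
      also have "C * (\<bar>s - t\<bar> * \<bar>s - t\<bar>) \<le> C * (\<bar>s - t\<bar> * (b - a))" using h C(1) by (intro mult_left_mono) auto
      finally show ?thesis by (simp add: algebra_simps)
    qed
    have p2q2: "\<bar>p\<^sup>2 - q\<^sup>2\<bar> \<le> 2 * b * D ^ 4 * \<bar>s - t\<bar>"
    proof -
      have "p\<^sup>2 - q\<^sup>2 = (p - q) * (p + q)" by (simp add: power2_eq_square algebra_simps)
      moreover have "p + q = (s + t) * (p * q)"
      proof -
        have "(s + t) * (p * q) = (p * s) * q + (q * t) * p" by (simp add: algebra_simps)
        then show ?thesis using ps by simp
      qed
      ultimately have "\<bar>p\<^sup>2 - q\<^sup>2\<bar> = \<bar>s - t\<bar> * (p * q) * ((s + t) * (p * q))" using pmq pq st by (simp add: abs_mult)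
      also have "\<dots> \<le> \<bar>s - t\<bar> * D\<^sup>2 * ((2 * b) * D\<^sup>2)" using pp pq h st by (intro mult_mono) auto
      also have "\<dots> = 2 * b * D ^ 4 * \<bar>s - t\<bar>" by (simp add: power2_eq_square power4_eq_xxxx)
      finally show ?thesis .
    qed
    have "stripH' m s r - stripH' m t r = (S1 - T1) * p + (T1 * (p - q) + (- ((S - T) * p\<^sup>2) + - (T * (p\<^sup>2 - q\<^sup>2))))"
      unfolding H T_def[symmetric] T1_def[symmetric] S_def[symmetric] S1_def[symmetric] by (simp add: algebra_simps)
    also have "\<bar>\<dots>\<bar> \<le> C * \<bar>s - t\<bar> * D + (C * (\<bar>s - t\<bar> * D\<^sup>2) + ((C + C * (b - a)) * \<bar>s - t\<bar> * D\<^sup>2 + C * (2 * b * D ^ 4 * \<bar>s - t\<bar>)))"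
    proof (intro order.trans[OF abs_triangle_ineq] add_mono)
      show "\<bar>(S1 - T1) * p\<bar> \<le> C * \<bar>s - t\<bar> * D" unfolding abs_mult using b3 pq C(1) by (intro mult_mono) auto
      have "\<bar>p - q\<bar> \<le> \<bar>s - t\<bar> * D\<^sup>2" unfolding pmq using pp pq by (simp add: abs_mult mult_left_mono abs_minus_commute[of t s])
      then show "\<bar>T1 * (p - q)\<bar> \<le> C * (\<bar>s - t\<bar> * D\<^sup>2)" unfolding abs_mult using bT1 C(1) by (intro mult_mono) auto
      show "\<bar>- ((S - T) * p\<^sup>2)\<bar> \<le> (C + C * (b - a)) * \<bar>s - t\<bar> * D\<^sup>2"
        unfolding abs_minus_cancel abs_mult using ST pp C(1) ab by (intro mult_mono) auto
      show "\<bar>- (T * (p\<^sup>2 - q\<^sup>2))\<bar> \<le> C * (2 * b * D ^ 4 * \<bar>s - t\<bar>)"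
        unfolding abs_minus_cancel abs_mult using bT p2q2 C(1) by (intro mult_mono) auto
    qed
    also have "\<dots> = C2 * \<bar>s - t\<bar>" by (simp add: C2_def algebra_simps)
    also have "\<dots> \<le> (C1 + C2 + C3) * \<bar>s - t\<bar>" using pos by (intro mult_right_mono) auto
    finally show "\<bar>stripH' m s r - stripH' m t r\<bar> \<le> (C1 + C2 + C3) * \<bar>s - t\<bar>" .
  next
    fix t r :: real assume h: "t \<in> {a..b}" "\<bar>r\<bar> \<le> R"
    define q where "q = 1 / t"
    have q: "0 < q" "q \<le> D" unfolding q_def using inv h by auto
    have q2: "q\<^sup>2 \<le> D\<^sup>2" using q by (intro power_mono) auto
    have H: "stripH m t r = stripT m t r * q" "stripH' m t r = stripT' m t r * q - stripT m t r * q\<^sup>2"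
      by (auto simp: stripH_def stripH'_def q_def power_divide)
    have 1: "\<bar>stripT m t r * q\<bar> \<le> C * D" "\<bar>stripT' m t r * q\<bar> \<le> C * D" "\<bar>stripT m t r * q\<^sup>2\<bar> \<le> C * D\<^sup>2"
      unfolding abs_mult using C(1) C(4)[OF h] C(5)[OF h] q q2 by (auto intro!: mult_mono)
    have 2: "0 \<le> C * D" "0 \<le> C * D\<^sup>2" using C(1) D by auto
    show "\<bar>stripH m t r\<bar> \<le> C1 + C2 + C3" "\<bar>stripH' m t r\<bar> \<le> C1 + C2 + C3"
      unfolding H using 1 2 pos C(1) by (auto simp: C3_def)
    show "\<bar>stripT' m t r\<bar> \<le> C1 + C2 + C3" "\<bar>stripT m t r\<bar> \<le> C1 + C2 + C3"
      using C(1) C(4)[OF h] C(5)[OF h] 2 pos unfolding C3_def by linarith+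
  qed (use pos in auto)
qed

lemma continuous_stripH:
  assumes "m \<ge> 1" "t > 0"
  shows "continuous_on UNIV (stripH m t)" "continuous_on UNIV (stripH' m t)"
  unfolding stripH_def[abs_def] stripH'_def[abs_def] using assms
  by (auto intro!: continuous_intros continuous_stripT)

subsection \<open>Minimisers and the derivative of the energy\<close>

text \<open>The assumption \<open>finite_energy\<close> concerns the singular energy alone and does
  not mention t: H_t is bounded on \<open>K\<close>, so the measures of finite strip energy are the
  same for every t.\<close>

locale flat_set =
  fixes K :: "('a::euclidean_space \<times> real) set" and m :: nat
  assumes compact_K: "compact K" and flat: "\<And>p. p \<in> K \<Longrightarrow> snd p = 0"
    and dim: "DIM('a) = m + 1" and m: "m \<ge> 1"
    and finite_energy: "\<exists>\<mu>\<in>borel_prob_measures K. energy2 m \<mu> fst \<mu> fst < \<infinity>"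
begin

abbreviation "E2 \<mu> \<equiv> energy2 m \<mu> fst \<mu> fst"

definition Ad :: "('a \<times> real) measure set" where
  "Ad = {\<mu> \<in> borel_prob_measures K. E2 \<mu> < \<infinity>}"

definition dbl :: "(real \<Rightarrow> real) \<Rightarrow> ('a \<times> real) measure \<Rightarrow> real" where
  "dbl g \<mu> = (\<integral>q. \<integral>p. g (norm (fst p - fst q)) \<partial>\<mu> \<partial>\<mu>)"

text \<open>On \<open>Ad\<close> this is the strip energy as a real number; the minimisation can
  then use real arithmetic.\<close>

definition J :: "real \<Rightarrow> ('a \<times> real) measure \<Rightarrow> real" where
  "J t \<mu> = enn2real (E2 \<mu>) + dbl (stripH m t) \<mu>"

definition V :: "real \<Rightarrow> real" where
  "V t = (INF \<mu>\<in>Ad. J t \<mu>)"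

lemma Ad_bpm: "\<mu> \<in> Ad \<Longrightarrow> \<mu> \<in> borel_prob_measures K" by (simp add: Ad_def)
lemma Ad_fin: "\<mu> \<in> Ad \<Longrightarrow> E2 \<mu> = ennreal (enn2real (E2 \<mu>))" by (simp add: Ad_def)
lemma Ad_nonempty: "Ad \<noteq> {}" using finite_energy by (auto simp: Ad_def)

lemma rv_pair: "\<mu> \<in> borel_prob_measures K \<Longrightarrow> \<nu> \<in> borel_prob_measures K \<Longrightarrow> rv_pair \<mu> \<nu> fst fst m"
  by (intro rv_pair.intro rv_pair_axioms.intro)
     (use dim m in \<open>auto intro!: borel_prob_measuresD(1) measurable_borel_prob_measures borel_measurable_continuous_onI continuous_intros\<close>)

definition R :: real where "R = (SOME R. R > 0 \<and> (\<forall>p\<in>K. norm (fst p) \<le> R))"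

lemma R: "R > 0" "p \<in> K \<Longrightarrow> norm (fst p) \<le> R"
proof -
  have "bounded (fst ` K)" using compact_K by (intro compact_imp_bounded compact_continuous_image continuous_intros)
  then have "\<exists>R>0. \<forall>p\<in>K. norm (fst p) \<le> R" by (auto simp: bounded_pos)
  then have "\<exists>R. R > 0 \<and> (\<forall>p\<in>K. norm (fst p) \<le> R)" by blast
  from someI_ex[OF this] have "R > 0 \<and> (\<forall>p\<in>K. norm (fst p) \<le> R)" unfolding R_def .
  then show "R > 0" "p \<in> K \<Longrightarrow> norm (fst p) \<le> R" by auto
qed

lemma diam: "p \<in> K \<Longrightarrow> q \<in> K \<Longrightarrow> \<bar>norm (fst p - fst q)\<bar> \<le> 2 * R"
  using R(2)[of p] R(2)[of q] norm_triangle_ineq4[of "fst p" "fst q"] by simp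

lemma dbl_bound:
  assumes "\<mu> \<in> borel_prob_measures K" "continuous_on UNIV g" "\<And>r. \<bar>r\<bar> \<le> 2 * R \<Longrightarrow> \<bar>g r\<bar> \<le> B"
  shows "\<bar>dbl g \<mu>\<bar> \<le> B"
proof -
  interpret rv_pair \<mu> \<mu> fst fst m by (rule rv_pair[OF assms(1,1)])
  show ?thesis unfolding dbl_def
    by (rule pair_integrable(4)) (use assms(2,3) diam borel_prob_measuresD(3)[OF assms(1)] in \<open>auto intro: borel_measurable_continuous_onI\<close>)
qed

lemma dbl_linear:
  assumes mu: "\<mu> \<in> borel_prob_measures K" and c: "continuous_on UNIV f" "continuous_on UNIV g"
  shows "dbl (\<lambda>r. a * f r + b * g r) \<mu> = a * dbl f \<mu> + b * dbl g \<mu>"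
proof -
  interpret rv_pair \<mu> \<mu> fst fst m by (rule rv_pair[OF mu mu])
  note sp = borel_prob_measuresD(3)[OF mu]
  have i: "(\<forall>q\<in>K. integrable \<mu> (\<lambda>p. h (norm (fst p - fst q)))) \<and> integrable \<mu> (\<lambda>q. \<integral>p. h (norm (fst p - fst q)) \<partial>\<mu>)"
    if h: "continuous_on UNIV h" for h :: "real \<Rightarrow> real"
  proof -
    have "compact (h ` {-2 * R..2 * R})" by (intro compact_continuous_image continuous_on_subset[OF h]) auto
    then obtain B where B: "\<And>r. r \<in> {-2 * R..2 * R} \<Longrightarrow> \<bar>h r\<bar> \<le> B" using compact_imp_bounded by (force simp: bounded_iff)
    have hm: "h \<in> borel_measurable borel" by (rule borel_measurable_continuous_onI[OF h])
    have hb: "\<bar>h (norm (fst p - fst q))\<bar> \<le> B" if "p \<in> space \<mu>" "q \<in> space \<mu>" for p q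
    proof -
      have "\<bar>norm (fst p - fst q)\<bar> \<le> 2 * R" using diam that sp by auto
      then show ?thesis by (intro B, unfold atLeastAtMost_iff, linarith)
    qed
    show ?thesis using pair_integrable(1,2)[OF hm hb] sp by auto
  qed
  have "(\<integral>q. \<integral>p. a * f (norm (fst p - fst q)) + b * g (norm (fst p - fst q)) \<partial>\<mu> \<partial>\<mu>)
     = (\<integral>q. a * (\<integral>p. f (norm (fst p - fst q)) \<partial>\<mu>) + b * (\<integral>p. g (norm (fst p - fst q)) \<partial>\<mu>) \<partial>\<mu>)"
    by (rule Bochner_Integration.integral_cong) (use i[OF c(1)] i[OF c(2)] sp in auto)
  also have "\<dots> = a * dbl f \<mu> + b * dbl g \<mu>" unfolding dbl_def using i[OF c(1)] i[OF c(2)] by simp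
  finally show ?thesis by (simp add: dbl_def)
qed

lemma stripH_dbl_bounds:
  assumes ab: "0 < a" "a \<le> b"
  obtains C where "C \<ge> 0"
    "\<And>s t \<mu>. \<lbrakk>s \<in> {a..b}; t \<in> {a..b}; \<mu> \<in> borel_prob_measures K\<rbrakk> \<Longrightarrow> \<bar>dbl (stripH m s) \<mu> - dbl (stripH m t) \<mu> - (s - t) * dbl (stripH' m t) \<mu>\<bar> \<le> C * (s - t)\<^sup>2"
    "\<And>s t \<mu>. \<lbrakk>s \<in> {a..b}; t \<in> {a..b}; \<mu> \<in> borel_prob_measures K\<rbrakk> \<Longrightarrow> \<bar>dbl (stripH' m s) \<mu> - dbl (stripH' m t) \<mu>\<bar> \<le> C * \<bar>s - t\<bar>"
    "\<And>t \<mu>. \<lbrakk>t \<in> {a..b}; \<mu> \<in> borel_prob_measures K\<rbrakk> \<Longrightarrow> \<bar>dbl (stripH m t) \<mu>\<bar> \<le> C"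
    "\<And>t \<mu>. \<lbrakk>t \<in> {a..b}; \<mu> \<in> borel_prob_measures K\<rbrakk> \<Longrightarrow> \<bar>dbl (stripH' m t) \<mu>\<bar> \<le> C"
proof -
  have R2: "2 * R \<ge> 0" using R(1) by simp
  obtain C where C: "C \<ge> 0"
    "\<And>s t r. \<lbrakk>s \<in> {a..b}; t \<in> {a..b}; \<bar>r\<bar> \<le> 2 * R\<rbrakk> \<Longrightarrow> \<bar>stripH m s r - stripH m t r - (s - t) * stripH' m t r\<bar> \<le> C * (s - t)\<^sup>2"
    "\<And>s t r. \<lbrakk>s \<in> {a..b}; t \<in> {a..b}; \<bar>r\<bar> \<le> 2 * R\<rbrakk> \<Longrightarrow> \<bar>stripH' m s r - stripH' m t r\<bar> \<le> C * \<bar>s - t\<bar>"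
    "\<And>t r. \<lbrakk>t \<in> {a..b}; \<bar>r\<bar> \<le> 2 * R\<rbrakk> \<Longrightarrow> \<bar>stripH m t r\<bar> \<le> C"
    "\<And>t r. \<lbrakk>t \<in> {a..b}; \<bar>r\<bar> \<le> 2 * R\<rbrakk> \<Longrightarrow> \<bar>stripH' m t r\<bar> \<le> C"
    "\<And>t r. \<lbrakk>t \<in> {a..b}; \<bar>r\<bar> \<le> 2 * R\<rbrakk> \<Longrightarrow> \<bar>stripT' m t r\<bar> \<le> C"
    "\<And>t r. \<lbrakk>t \<in> {a..b}; \<bar>r\<bar> \<le> 2 * R\<rbrakk> \<Longrightarrow> \<bar>stripT m t r\<bar> \<le> C"
    using stripH_bounds[OF m R2 ab] by blast
  have c: "continuous_on UNIV (stripH m t)" "continuous_on UNIV (stripH' m t)" if "t \<in> {a..b}" for t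
    using continuous_stripH[OF m, of t] that ab by auto
  show thesis
  proof (rule that[OF C(1)])
    fix s t \<mu> assume h: "s \<in> {a..b}" "t \<in> {a..b}" and mu: "\<mu> \<in> borel_prob_measures K"
    have "dbl (\<lambda>r. 1 * (1 * stripH m s r + (-1) * stripH m t r) + (- (s - t)) * stripH' m t r) \<mu>
        = 1 * dbl (\<lambda>r. 1 * stripH m s r + (-1) * stripH m t r) \<mu> + (- (s - t)) * dbl (stripH' m t) \<mu>"
      by (rule dbl_linear[OF mu]) (intro continuous_intros c h)+
    also have "dbl (\<lambda>r. 1 * stripH m s r + (-1) * stripH m t r) \<mu> = 1 * dbl (stripH m s) \<mu> + (-1) * dbl (stripH m t) \<mu>"
      by (rule dbl_linear[OF mu]) (intro c h)+
    finally have eq: "dbl (\<lambda>r. 1 * (1 * stripH m s r + (-1) * stripH m t r) + (- (s - t)) * stripH' m t r) \<mu>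
       = 1 * (1 * dbl (stripH m s) \<mu> + (-1) * dbl (stripH m t) \<mu>) + (- (s - t)) * dbl (stripH' m t) \<mu>" .
    have "dbl (stripH m s) \<mu> - dbl (stripH m t) \<mu> - (s - t) * dbl (stripH' m t) \<mu>
       = dbl (\<lambda>r. 1 * (1 * stripH m s r + (-1) * stripH m t r) + (- (s - t)) * stripH' m t r) \<mu>"
      unfolding eq by (simp add: algebra_simps)
    also have "\<bar>\<dots>\<bar> \<le> C * (s - t)\<^sup>2"
    proof (rule dbl_bound[OF mu])
      show "continuous_on UNIV (\<lambda>r. 1 * (1 * stripH m s r + (-1) * stripH m t r) + (- (s - t)) * stripH' m t r)"
        by (intro continuous_intros c h)
      fix r assume r: "\<bar>r\<bar> \<le> 2 * R"
      have "1 * (1 * stripH m s r + (-1) * stripH m t r) + (- (s - t)) * stripH' m t r = stripH m s r - stripH m t r - (s - t) * stripH' m t r"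
        by (simp add: algebra_simps)
      then show "\<bar>1 * (1 * stripH m s r + (-1) * stripH m t r) + (- (s - t)) * stripH' m t r\<bar> \<le> C * (s - t)\<^sup>2"
        using C(2)[OF h r] by simp
    qed
    finally show "\<bar>dbl (stripH m s) \<mu> - dbl (stripH m t) \<mu> - (s - t) * dbl (stripH' m t) \<mu>\<bar> \<le> C * (s - t)\<^sup>2" .
    have "dbl (\<lambda>r. 1 * stripH' m s r + (-1) * stripH' m t r) \<mu> = 1 * dbl (stripH' m s) \<mu> + (-1) * dbl (stripH' m t) \<mu>"
      by (rule dbl_linear[OF mu]) (intro c h)+
    moreover have "\<bar>dbl (\<lambda>r. 1 * stripH' m s r + (-1) * stripH' m t r) \<mu>\<bar> \<le> C * \<bar>s - t\<bar>"
      by (rule dbl_bound[OF mu]) (use C(3)[OF h] in \<open>auto intro!: continuous_intros c h\<close>)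
    ultimately show "\<bar>dbl (stripH' m s) \<mu> - dbl (stripH' m t) \<mu>\<bar> \<le> C * \<bar>s - t\<bar>" by simp
  next
    fix t \<mu> assume h: "t \<in> {a..b}" and mu: "\<mu> \<in> borel_prob_measures K"
    show "\<bar>dbl (stripH m t) \<mu>\<bar> \<le> C" "\<bar>dbl (stripH' m t) \<mu>\<bar> \<le> C"
      using dbl_bound[OF mu c(1)[OF h] C(4)[OF h]] dbl_bound[OF mu c(2)[OF h] C(5)[OF h]] by auto
  qed
qed

text \<open>A chosen constant for \<open>stripH_dbl_bounds\<close>, so that its estimates can be
  cited as facts. It depends on the interval and not on the measure.\<close>

definition HB :: "real \<Rightarrow> real \<Rightarrow> real" where
  "HB a b = (SOME C. C \<ge> 0 \<and>
    (\<forall>s\<in>{a..b}. \<forall>t\<in>{a..b}. \<forall>\<mu>\<in>borel_prob_measures K.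
       \<bar>dbl (stripH m s) \<mu> - dbl (stripH m t) \<mu> - (s - t) * dbl (stripH' m t) \<mu>\<bar> \<le> C * (s - t)\<^sup>2 \<and>
       \<bar>dbl (stripH' m s) \<mu> - dbl (stripH' m t) \<mu>\<bar> \<le> C * \<bar>s - t\<bar> \<and>
       \<bar>dbl (stripH m t) \<mu>\<bar> \<le> C \<and> \<bar>dbl (stripH' m t) \<mu>\<bar> \<le> C))"

lemma HB:
  assumes ab: "0 < a" "a \<le> b"
  shows "HB a b \<ge> 0"
    "\<lbrakk>s \<in> {a..b}; t \<in> {a..b}; \<mu> \<in> borel_prob_measures K\<rbrakk> \<Longrightarrow> \<bar>dbl (stripH m s) \<mu> - dbl (stripH m t) \<mu> - (s - t) * dbl (stripH' m t) \<mu>\<bar> \<le> HB a b * (s - t)\<^sup>2"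
    "\<lbrakk>s \<in> {a..b}; t \<in> {a..b}; \<mu> \<in> borel_prob_measures K\<rbrakk> \<Longrightarrow> \<bar>dbl (stripH' m s) \<mu> - dbl (stripH' m t) \<mu>\<bar> \<le> HB a b * \<bar>s - t\<bar>"
    "\<lbrakk>t \<in> {a..b}; \<mu> \<in> borel_prob_measures K\<rbrakk> \<Longrightarrow> \<bar>dbl (stripH m t) \<mu>\<bar> \<le> HB a b"
    "\<lbrakk>t \<in> {a..b}; \<mu> \<in> borel_prob_measures K\<rbrakk> \<Longrightarrow> \<bar>dbl (stripH' m t) \<mu>\<bar> \<le> HB a b"
proof -
  have "\<exists>C. C \<ge> 0 \<and>
    (\<forall>s\<in>{a..b}. \<forall>t\<in>{a..b}. \<forall>\<mu>\<in>borel_prob_measures K.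
       \<bar>dbl (stripH m s) \<mu> - dbl (stripH m t) \<mu> - (s - t) * dbl (stripH' m t) \<mu>\<bar> \<le> C * (s - t)\<^sup>2 \<and>
       \<bar>dbl (stripH' m s) \<mu> - dbl (stripH' m t) \<mu>\<bar> \<le> C * \<bar>s - t\<bar> \<and>
       \<bar>dbl (stripH m t) \<mu>\<bar> \<le> C \<and> \<bar>dbl (stripH' m t) \<mu>\<bar> \<le> C)"
    by (rule stripH_dbl_bounds[OF ab], rule exI, intro conjI ballI) assumption+
  note h = someI_ex[OF this, folded HB_def]
  show "HB a b \<ge> 0" using h by (rule conjunct1)
  note h2 = conjunct2[OF h, rule_format]
  show "\<lbrakk>s \<in> {a..b}; t \<in> {a..b}; \<mu> \<in> borel_prob_measures K\<rbrakk> \<Longrightarrow> \<bar>dbl (stripH m s) \<mu> - dbl (stripH m t) \<mu> - (s - t) * dbl (stripH' m t) \<mu>\<bar> \<le> HB a b * (s - t)\<^sup>2"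
    using h2[of s t \<mu>] by linarith
  show "\<lbrakk>s \<in> {a..b}; t \<in> {a..b}; \<mu> \<in> borel_prob_measures K\<rbrakk> \<Longrightarrow> \<bar>dbl (stripH' m s) \<mu> - dbl (stripH' m t) \<mu>\<bar> \<le> HB a b * \<bar>s - t\<bar>"
    using h2[of s t \<mu>] by linarith
  show "\<lbrakk>t \<in> {a..b}; \<mu> \<in> borel_prob_measures K\<rbrakk> \<Longrightarrow> \<bar>dbl (stripH m t) \<mu>\<bar> \<le> HB a b"
    using h2[of t t \<mu>] by linarith
  show "\<lbrakk>t \<in> {a..b}; \<mu> \<in> borel_prob_measures K\<rbrakk> \<Longrightarrow> \<bar>dbl (stripH' m t) \<mu>\<bar> \<le> HB a b"
    using h2[of t t \<mu>] by linarith
qed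

section \<open>Existence and uniqueness of the minimiser\<close>

lemma V_le: assumes "t > 0" "\<mu> \<in> Ad" shows "V t \<le> J t \<mu>"
proof -
  define C where "C = HB t t"
  note C = HB(4)[OF assms(1) order_refl, folded C_def]
  have "- C \<le> J t \<mu>" if "\<mu> \<in> Ad" for \<mu>
  proof -
    have "\<bar>dbl (stripH m t) \<mu>\<bar> \<le> C" by (rule C[OF _ Ad_bpm[OF that]]) simp
    moreover have "enn2real (E2 \<mu>) \<ge> 0" by (rule enn2real_nonneg)
    ultimately show ?thesis unfolding J_def by linarith
  qed
  then have "bdd_below (J t ` Ad)" by (auto intro!: bdd_belowI[of _ "- C"])
  then show ?thesis unfolding V_def using assms(2) by (rule cINF_lower)
qed

text \<open>Weak compactness with lower semicontinuity, for a parameter \<open>s i\<close> that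
  moves along with the measures. A constant parameter and a minimising sequence give existence;
  minimisers at parameters tending to \<open>t\<close> give continuity of the minimiser.\<close>

lemma minimizing_limit:
  assumes mu: "\<And>i::nat. \<mu> i \<in> Ad" and s: "s \<longlonglongrightarrow> t" and sp: "\<And>i. s i \<in> {a..b}" and ab: "0 < a" "a \<le> b"
    and le: "\<And>i. J (s i) (\<mu> i) \<le> c i" and c: "c \<longlonglongrightarrow> d"
  obtains r \<nu> where "strict_mono (r :: nat \<Rightarrow> nat)" "\<nu> \<in> Ad" "J t \<nu> \<le> d"
    "\<And>g. continuous_on UNIV g \<Longrightarrow> (\<lambda>i. dbl g (\<mu> (r i))) \<longlonglongrightarrow> dbl g \<nu>"
proof (rule weak_compactness[OF compact_K Ad_bpm[OF mu]])
  fix r \<nu>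
  assume r: "strict_mono (r :: nat \<Rightarrow> nat)" "\<nu> \<in> borel_prob_measures K"
    "\<And>g :: 'a \<times> real \<Rightarrow> 'a \<times> real \<Rightarrow> real. continuous_on UNIV (\<lambda>(x, y). g x y) \<Longrightarrow>
       (\<lambda>i. LINT y|\<mu> (r i). LINT x|\<mu> (r i). g x y) \<longlonglongrightarrow> (LINT y|\<nu>. LINT x|\<nu>. g x y)"
  have wk: "(\<lambda>i. dbl g (\<mu> (r i))) \<longlonglongrightarrow> dbl g \<nu>" if g: "continuous_on UNIV g" for g
    unfolding dbl_def
  proof (rule r(3))
    have "continuous_on UNIV (\<lambda>z :: ('a \<times> real) \<times> ('a \<times> real). norm (fst (fst z) - fst (snd z)))" by (intro continuous_intros)
    from continuous_on_compose2[OF g this]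
    show "continuous_on UNIV (\<lambda>(x :: 'a \<times> real, y :: 'a \<times> real). g (norm (fst x - fst y)))" by (simp add: case_prod_beta')
  qed
  have t: "t \<in> {a..b}" by (rule closed_sequentially[OF closed_atLeastAtMost _ s]) (use sp in auto)
  then have t0: "t > 0" using ab by auto
  define C where "C = HB a b"
  note C = HB(1,2,5)[OF ab, folded C_def]
  have sr: "(\<lambda>i. s (r i)) \<longlonglongrightarrow> t" and cr: "(\<lambda>i. c (r i)) \<longlonglongrightarrow> d"
    using LIMSEQ_subseq_LIMSEQ[OF s r(1)] LIMSEQ_subseq_LIMSEQ[OF c r(1)] by (simp_all add: o_def)
  have diff: "(\<lambda>i. dbl (stripH m (s (r i))) (\<mu> (r i)) - dbl (stripH m t) (\<mu> (r i))) \<longlonglongrightarrow> 0"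
  proof (rule Lim_null_comparison)
    show "eventually (\<lambda>i. norm (dbl (stripH m (s (r i))) (\<mu> (r i)) - dbl (stripH m t) (\<mu> (r i))) \<le> C * (s (r i) - t)\<^sup>2 + \<bar>s (r i) - t\<bar> * C) sequentially"
    proof (intro always_eventually allI)
      fix i
      have "\<bar>(s (r i) - t) * dbl (stripH' m t) (\<mu> (r i))\<bar> \<le> \<bar>s (r i) - t\<bar> * C"
        unfolding abs_mult using C(3)[OF t Ad_bpm[OF mu]] by (intro mult_left_mono) auto
      then show "norm (dbl (stripH m (s (r i))) (\<mu> (r i)) - dbl (stripH m t) (\<mu> (r i))) \<le> C * (s (r i) - t)\<^sup>2 + \<bar>s (r i) - t\<bar> * C"
        using C(2)[OF sp t Ad_bpm[OF mu], of "r i" "r i"] unfolding real_norm_def by linarith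
    qed
    have "(\<lambda>i. C * (s (r i) - t)\<^sup>2 + \<bar>s (r i) - t\<bar> * C) \<longlonglongrightarrow> C * (t - t)\<^sup>2 + \<bar>t - t\<bar> * C"
      by (intro tendsto_intros sr)
    then show "(\<lambda>i. C * (s (r i) - t)\<^sup>2 + \<bar>s (r i) - t\<bar> * C) \<longlonglongrightarrow> 0" by simp
  qed
  have wH: "(\<lambda>i. dbl (stripH m t) (\<mu> (r i))) \<longlonglongrightarrow> dbl (stripH m t) \<nu>"
    by (rule wk[OF continuous_stripH(1)[OF m t0]])
  \<comment> \<open>\<open>e i\<close> bounds the singular energy of the i-th measure and converges,
    because the regular part does. The truncated energies lie below it and pass to the weak limit,
    uniformly in the truncation.\<close>
  define e where "e i = c (r i) - dbl (stripH m (s (r i))) (\<mu> (r i))" for i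
  have "(\<lambda>i. c (r i) - (dbl (stripH m (s (r i))) (\<mu> (r i)) - dbl (stripH m t) (\<mu> (r i))) - dbl (stripH m t) (\<mu> (r i))) \<longlonglongrightarrow> d - 0 - dbl (stripH m t) \<nu>"
    by (intro tendsto_intros cr diff wH)
  then have elim: "e \<longlonglongrightarrow> d - dbl (stripH m t) \<nu>" by (simp add: e_def[abs_def])
  have Ee: "E2 (\<mu> (r i)) \<le> ennreal (e i)" "0 \<le> e i" for i
  proof -
    have n: "enn2real (E2 (\<mu> (r i))) \<le> e i" using le[of "r i"] by (simp add: J_def e_def)
    then show "E2 (\<mu> (r i)) \<le> ennreal (e i)" using Ad_fin[OF mu[of "r i"]] by (metis ennreal_leI)
    show "0 \<le> e i" using n enn2real_nonneg order_trans by blast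
  qed
  interpret n: rv_pair \<nu> \<nu> fst fst m by (rule rv_pair[OF r(2) r(2)])
  have "E2 \<nu> \<le> ennreal (d - dbl (stripH m t) \<nu>)"
  proof (rule n.energy2_le)
    fix h :: real assume h: "h > 0"
    have "(\<lambda>i. dbl (\<lambda>x. newt m x h) (\<mu> (r i))) \<longlonglongrightarrow> dbl (\<lambda>x. newt m x h) \<nu>"
      by (rule wk) (use h in \<open>auto intro: continuous_newt\<close>)
    moreover have "dbl (\<lambda>x. newt m x h) (\<mu> (r i)) \<le> e i" for i
    proof -
      interpret q: rv_pair "\<mu> (r i)" "\<mu> (r i)" fst fst m by (rule rv_pair[OF Ad_bpm[OF mu] Ad_bpm[OF mu]])
      have "ennreal (dbl (\<lambda>x. newt m x h) (\<mu> (r i))) \<le> ennreal (e i)"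
        unfolding dbl_def by (rule order.trans[OF q.newt_le_energy2[OF h] Ee(1)])
      then show ?thesis using Ee(2) by (simp add: ennreal_le_iff)
    qed
    ultimately have "dbl (\<lambda>x. newt m x h) \<nu> \<le> d - dbl (stripH m t) \<nu>"
      by (intro LIMSEQ_le[OF _ elim]) auto
    then show "(\<integral>q. \<integral>p. newt m (norm (fst p - fst q)) h \<partial>\<nu> \<partial>\<nu>) \<le> d - dbl (stripH m t) \<nu>" by (simp add: dbl_def)
  qed
  moreover have "0 \<le> d - dbl (stripH m t) \<nu>" by (rule LIMSEQ_le_const[OF elim]) (use Ee(2) in auto)
  ultimately have "\<nu> \<in> Ad" "J t \<nu> \<le> d"
  proof -
    assume a: "E2 \<nu> \<le> ennreal (d - dbl (stripH m t) \<nu>)" "0 \<le> d - dbl (stripH m t) \<nu>"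
    show "\<nu> \<in> Ad" using a r(2) by (auto simp: Ad_def intro: le_less_trans)
    show "J t \<nu> \<le> d" using enn2real_mono[OF a(1)] a(2) by (simp add: J_def)
  qed
  then show thesis by (rule that[OF r(1) _ _ wk])
qed

lemma minimizer_exists: assumes t: "t > 0" shows "\<exists>\<mu>\<in>Ad. J t \<mu> = V t"
proof -
  have "\<exists>\<mu>\<in>Ad. J t \<mu> < V t + 1 / real (Suc i)" for i
  proof -
    have "(INF \<mu>\<in>Ad. J t \<mu>) < V t + 1 / real (Suc i)" by (simp add: V_def)
    then show ?thesis using V_le[OF t] Ad_nonempty by (subst (asm) cINF_less_iff) (auto intro!: bdd_belowI)
  qed
  then obtain \<mu> where mu: "\<And>i. \<mu> i \<in> Ad" "\<And>i. J t (\<mu> i) < V t + 1 / real (Suc i)" by metis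
  have c: "(\<lambda>i. V t + 1 / real (Suc i)) \<longlonglongrightarrow> V t + 0"
    using LIMSEQ_inverse_real_of_nat by (intro tendsto_intros) (simp add: inverse_eq_divide)
  obtain \<nu> where "\<nu> \<in> Ad" "J t \<nu> \<le> V t + 0"
    by (rule minimizing_limit[of \<mu> "\<lambda>_. t" t t t, OF mu(1) tendsto_const _ t order_refl less_imp_le[OF mu(2)] c]) auto
  then show ?thesis using V_le[OF t, of \<nu>] by (intro bexI[of _ \<nu>]) auto
qed

text \<open>The midpoint \<open>\<rho>\<close> of two minimisers is compared with them. The regular
  part is convex by \<open>stripT_quadratic\<close>, so minimality leaves no room in the quadratic
  inequality of the singular part, and its equality case identifies the projections to R^n.\<close>

lemma minimizer_unique:
  assumes t: "t > 0" and mu: "\<mu> \<in> Ad" "J t \<mu> = V t" and nu: "\<nu> \<in> Ad" "J t \<nu> = V t"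
  shows "\<mu> = \<nu>"
proof -
  note bm = Ad_bpm[OF mu(1)] and bn = Ad_bpm[OF nu(1)]
  interpret rv_pair \<mu> \<nu> fst fst m by (rule rv_pair[OF bm bn])
  interpret MM: rv_pair \<mu> \<mu> fst fst m by (rule rv_pair[OF bm bm])
  interpret NN: rv_pair \<nu> \<nu> fst fst m by (rule rv_pair[OF bn bn])
  obtain \<rho> where rho: "\<rho> \<in> borel_prob_measures K"
    "\<And>f. f \<in> borel_measurable (restrict_space borel K) \<Longrightarrow> 2 * (\<integral>\<^sup>+x. f x \<partial>\<rho>) = (\<integral>\<^sup>+x. f x \<partial>\<mu>) + (\<integral>\<^sup>+x. f x \<partial>\<nu>)"
    "\<And>f :: 'a \<times> real \<Rightarrow> real. f \<in> borel_measurable (restrict_space borel K) \<Longrightarrow> (\<exists>B. \<forall>x\<in>K. \<bar>f x\<bar> \<le> B) \<Longrightarrow> 2 * (\<integral>x. f x \<partial>\<rho>) = (\<integral>x. f x \<partial>\<mu>) + (\<integral>x. f x \<partial>\<nu>)"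
    using borel_prob_mixture[OF bm bn] by blast
  interpret RR: rv_pair \<rho> \<rho> fst fst m by (rule rv_pair[OF rho(1) rho(1)])
  have sp: "space \<mu> = K" "space \<nu> = K" "space \<rho> = K" using borel_prob_measuresD(3) bm bn rho(1) by auto
  have fstm [measurable]: "fst \<in> borel_measurable (restrict_space borel K)"
    by (intro measurable_restrict_space1 borel_measurable_continuous_onI continuous_intros)
  define e where "e \<sigma> \<tau> = energy2 m \<sigma> fst \<tau> (fst :: 'a \<times> real \<Rightarrow> 'a)" for \<sigma> \<tau> :: "('a \<times> real) measure"
  have meas: "(\<lambda>q. \<integral>\<^sup>+p. newtE m (norm (fst p - fst q)) \<partial>\<sigma>) \<in> borel_measurable (restrict_space borel K)"
    if "\<sigma> \<in> borel_prob_measures K" for \<sigma>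
  proof -
    interpret s: rv_pair \<sigma> \<sigma> fst fst m by (rule rv_pair[OF that that])
    show ?thesis by measurable
  qed
  have e2: "4 * e \<rho> \<rho> = (e \<mu> \<mu> + e \<nu> \<mu>) + (e \<mu> \<nu> + e \<nu> \<nu>)"
  proof -
    have in2: "2 * (\<integral>\<^sup>+p. newtE m (norm (fst p - fst q)) \<partial>\<rho>) = (\<integral>\<^sup>+p. newtE m (norm (fst p - fst q)) \<partial>\<mu>) + (\<integral>\<^sup>+p. newtE m (norm (fst p - fst q)) \<partial>\<nu>)" for q :: "'a \<times> real"
      by (rule rho(2)) measurable
    have "2 * e \<rho> \<sigma> = e \<mu> \<sigma> + e \<nu> \<sigma>" if s: "\<sigma> \<in> borel_prob_measures K" for \<sigma>
    proof -
      have mc: "f \<in> borel_measurable (restrict_space borel K) \<Longrightarrow> f \<in> borel_measurable \<sigma>" for f :: "'a \<times> real \<Rightarrow> ennreal"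
        using measurable_cong_sets[OF borel_prob_measuresD(2)[OF s] refl] by blast
      have "2 * e \<rho> \<sigma> = (\<integral>\<^sup>+q. 2 * (\<integral>\<^sup>+p. newtE m (norm (fst p - fst q)) \<partial>\<rho>) \<partial>\<sigma>)"
        unfolding e_def energy2_def by (rule nn_integral_cmult[symmetric]) (rule mc[OF meas[OF rho(1)]])
      also have "\<dots> = e \<mu> \<sigma> + e \<nu> \<sigma>"
        unfolding in2 e_def energy2_def by (rule nn_integral_add) (rule mc[OF meas[OF bm]] mc[OF meas[OF bn]])+
      finally show ?thesis .
    qed
    note l = this[OF bm] this[OF bn]
    have "2 * e \<rho> \<rho> = e \<rho> \<mu> + e \<rho> \<nu>" unfolding e_def energy2_def by (rule rho(2)[OF meas[OF rho(1)]])
    then have "4 * e \<rho> \<rho> = 2 * e \<rho> \<mu> + 2 * e \<rho> \<nu>"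
      by (metis distrib_left mult.assoc mult_2 numeral_Bit0 one_add_one)
    then show ?thesis unfolding l .
  qed
  define g where "g = stripH m t"
  have gc: "continuous_on UNIV g" unfolding g_def by (rule continuous_stripH(1)[OF m t])
  have gm [measurable]: "g \<in> borel_measurable borel" by (rule borel_measurable_continuous_onI[OF gc])
  have "compact (g ` {-2 * R..2 * R})" by (intro compact_continuous_image continuous_on_subset[OF gc]) auto
  then obtain B where B: "\<And>r. r \<in> {-2 * R..2 * R} \<Longrightarrow> \<bar>g r\<bar> \<le> B" using compact_imp_bounded by (force simp: bounded_iff)
  have gb: "\<bar>g (norm (fst p - fst q))\<bar> \<le> B" if "p \<in> K" "q \<in> K" for p q
    using diam[OF that] by (intro B, unfold atLeastAtMost_iff, linarith)
  define b where "b \<sigma> \<tau> = (\<integral>q. \<integral>p. g (norm (fst p - fst q)) \<partial>\<sigma> \<partial>\<tau>)" for \<sigma> \<tau> :: "('a \<times> real) measure"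
  have b2: "4 * b \<rho> \<rho> = (b \<mu> \<mu> + b \<nu> \<mu>) + (b \<mu> \<nu> + b \<nu> \<nu>)"
  proof -
    have meas: "(\<lambda>q. \<integral>p. g (norm (fst p - fst q)) \<partial>\<sigma>) \<in> borel_measurable (restrict_space borel K)" "\<exists>B. \<forall>q\<in>K. \<bar>\<integral>p. g (norm (fst p - fst q)) \<partial>\<sigma>\<bar> \<le> B"
      if "\<sigma> \<in> borel_prob_measures K" for \<sigma>
    proof -
      interpret s: rv_pair \<sigma> \<sigma> fst fst m by (rule rv_pair[OF that that])
      show "(\<lambda>q. \<integral>p. g (norm (fst p - fst q)) \<partial>\<sigma>) \<in> borel_measurable (restrict_space borel K)" by measurable
      show "\<exists>B. \<forall>q\<in>K. \<bar>\<integral>p. g (norm (fst p - fst q)) \<partial>\<sigma>\<bar> \<le> B"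
        by (intro exI[of _ B] ballI s.pair_integrable(3)[of g B] gm) (use gb borel_prob_measuresD(3)[OF that] in simp_all)
    qed
    have in2: "2 * (\<integral>p. g (norm (fst p - fst q)) \<partial>\<rho>) = (\<integral>p. g (norm (fst p - fst q)) \<partial>\<mu>) + (\<integral>p. g (norm (fst p - fst q)) \<partial>\<nu>)" if "q \<in> K" for q
    proof (rule rho(3))
      show "(\<lambda>p. g (norm (fst p - fst q))) \<in> borel_measurable (restrict_space borel K)" by measurable
      show "\<exists>B. \<forall>p\<in>K. \<bar>g (norm (fst p - fst q))\<bar> \<le> B" by (intro exI[of _ B] ballI gb that)
    qed
    have l: "2 * b \<rho> \<sigma> = b \<mu> \<sigma> + b \<nu> \<sigma>" if s: "\<sigma> \<in> borel_prob_measures K" for \<sigma>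
    proof -
      have i: "integrable \<sigma> (\<lambda>q. \<integral>p. g (norm (fst p - fst q)) \<partial>\<tau>)" if "\<tau> \<in> borel_prob_measures K" for \<tau>
      proof -
        interpret s: rv_pair \<tau> \<sigma> fst fst m by (rule rv_pair[OF that s])
        show ?thesis by (rule s.pair_integrable(2)[of g B]) (use gm gb borel_prob_measuresD(3)[OF that] borel_prob_measuresD(3)[OF s] in auto)
      qed
      have "2 * b \<rho> \<sigma> = (\<integral>q. 2 * (\<integral>p. g (norm (fst p - fst q)) \<partial>\<rho>) \<partial>\<sigma>)" by (simp add: b_def)
      also have "\<dots> = (\<integral>q. (\<integral>p. g (norm (fst p - fst q)) \<partial>\<mu>) + (\<integral>p. g (norm (fst p - fst q)) \<partial>\<nu>) \<partial>\<sigma>)"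
        by (rule Bochner_Integration.integral_cong) (use in2 borel_prob_measuresD(3)[OF s] in auto)
      also have "\<dots> = b \<mu> \<sigma> + b \<nu> \<sigma>" unfolding b_def by (rule Bochner_Integration.integral_add[OF i[OF bm] i[OF bn]])
      finally show ?thesis .
    qed
    have "2 * b \<rho> \<rho> = b \<rho> \<mu> + b \<rho> \<nu>" unfolding b_def by (rule rho(3)[OF meas[OF rho(1)]])
    then show ?thesis using l[OF bm] l[OF bn] by linarith
  qed
  have bq: "2 * b \<mu> \<nu> \<le> b \<mu> \<mu> + b \<nu> \<nu>" "2 * b \<nu> \<mu> \<le> b \<mu> \<mu> + b \<nu> \<nu>"
  proof -
    have bT: "b \<sigma> \<tau> = (\<integral>q. \<integral>p. stripT m t (norm (fst p - fst q)) \<partial>\<sigma> \<partial>\<tau>) / t" for \<sigma> \<tau> by (simp add: b_def g_def stripH_def)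
    have R': "norm (fst p) \<le> R" if "p \<in> space \<mu> \<or> p \<in> space \<nu>" for p using that R(2) sp by auto
    have "(2 * (\<integral>q. \<integral>p. stripT m t (norm (fst p - fst q)) \<partial>\<mu> \<partial>\<nu>)) / t \<le> ((\<integral>q. \<integral>p. stripT m t (norm (fst p - fst q)) \<partial>\<mu> \<partial>\<mu>) + (\<integral>q. \<integral>p. stripT m t (norm (fst p - fst q)) \<partial>\<nu> \<partial>\<nu>)) / t"
      by (intro divide_right_mono stripT_quadratic[OF t, of R] R') (use t in auto)
    then show "2 * b \<mu> \<nu> \<le> b \<mu> \<mu> + b \<nu> \<nu>" unfolding bT by (simp add: add_divide_distrib)
    interpret S: rv_pair \<nu> \<mu> fst fst m by (rule rv_pair[OF bn bm])
    have "(2 * (\<integral>q. \<integral>p. stripT m t (norm (fst p - fst q)) \<partial>\<nu> \<partial>\<mu>)) / t \<le> ((\<integral>q. \<integral>p. stripT m t (norm (fst p - fst q)) \<partial>\<nu> \<partial>\<nu>) + (\<integral>q. \<integral>p. stripT m t (norm (fst p - fst q)) \<partial>\<mu> \<partial>\<mu>)) / t"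
      by (intro divide_right_mono S.stripT_quadratic[OF t, of R] R') (use t in auto)
    then show "2 * b \<nu> \<mu> \<le> b \<mu> \<mu> + b \<nu> \<nu>" unfolding bT by (simp add: add_divide_distrib)
  qed
  have ecom: "e \<nu> \<mu> = e \<mu> \<nu>" unfolding e_def by (rule energy2_commute)
  have efin: "e \<mu> \<mu> < \<infinity>" "e \<nu> \<nu> < \<infinity>" using mu nu by (auto simp: Ad_def e_def)
  have "2 * e \<mu> \<nu> < \<infinity>" by (rule le_less_trans[OF energy2_quadratic[folded e_def]]) (use efin in auto)
  then have emn: "e \<mu> \<nu> < \<infinity>" by (cases "e \<mu> \<nu>") (auto simp: ennreal_mult_top)
  obtain x where x: "x \<ge> 0" "e \<mu> \<mu> = ennreal x" using efin(1) by (cases "e \<mu> \<mu>") auto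
  obtain y where y: "y \<ge> 0" "e \<nu> \<nu> = ennreal y" using efin(2) by (cases "e \<nu> \<nu>") auto
  obtain w where w: "w \<ge> 0" "e \<mu> \<nu> = ennreal w" using emn by (cases "e \<mu> \<nu>") auto
  have e4: "4 * e \<rho> \<rho> = ennreal ((x + w) + (w + y))"
    unfolding e2 ecom x(2) y(2) w(2) using x(1) y(1) w(1) by (simp only: ennreal_plus add_nonneg_nonneg)
  then have "e \<rho> \<rho> < \<infinity>" by (cases "e \<rho> \<rho>") (auto simp: ennreal_mult_top)
  then have rAd: "\<rho> \<in> Ad" using rho(1) by (simp add: Ad_def e_def)
  obtain z where z: "z \<ge> 0" "e \<rho> \<rho> = ennreal z" using \<open>e \<rho> \<rho> < \<infinity>\<close> by (cases "e \<rho> \<rho>") auto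
  have "ennreal (4 * z) = ennreal ((x + w) + (w + y))"
    using e4 z ennreal_mult[of 4 z] by simp
  then have zz: "4 * z = (x + w) + (w + y)" using x y w z by (subst (asm) ennreal_inj) auto
  have J: "J t \<mu> = x + b \<mu> \<mu>" "J t \<nu> = y + b \<nu> \<nu>" "J t \<rho> = z + b \<rho> \<rho>"
    using x y z by (auto simp: J_def dbl_def e_def b_def g_def)
  have "V t \<le> z + b \<rho> \<rho>" using V_le[OF t rAd] J by simp
  \<comment> \<open>Four times the minimum is 2 (x + b \<mu> \<mu>) + 2 (y + b \<nu> \<nu>), and by
    minimality at most 4 (z + b \<rho> \<rho>), which by \<open>zz\<close>, \<open>b2\<close> and
    \<open>bq\<close> is at most x + y + 2 w + 2 (b \<mu> \<mu> + b \<nu> \<nu>).\<close>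
  then have "x + y \<le> 2 * w" using zz J mu nu b2 bq by linarith
  then have "e \<mu> \<mu> + e \<nu> \<nu> \<le> ennreal (2 * w)" unfolding x(2) y(2) using x y by (simp add: ennreal_plus[symmetric] ennreal_leI del: ennreal_plus)
  also have "ennreal (2 * w) = 2 * e \<mu> \<nu>" unfolding w(2) using w by (subst ennreal_mult) auto
  finally have d: "distr \<mu> borel fst = distr \<nu> borel (fst :: _ \<Rightarrow> 'a)"
    using efin unfolding e_def by (intro distr_eq)
  show ?thesis
  proof (rule measure_eqI)
    show "sets \<mu> = sets \<nu>" using borel_prob_measuresD(2)[OF bm] borel_prob_measuresD(2)[OF bn] by simp
    fix A assume A: "A \<in> sets \<mu>"
    then obtain A' where A': "A' \<in> sets borel" "A = A' \<inter> K"
      unfolding borel_prob_measuresD(2)[OF bm] sets_restrict_space by auto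
    \<comment> \<open>Since \<open>K\<close> lies in the plane, each Borel subset of it is the
      preimage in \<open>K\<close> of a slice under \<open>fst\<close>, and equality of the
      projections gives equality of the measures.\<close>
    define C where "C = {x. (x, 0) \<in> A'}"
    have Cm: "C \<in> sets borel"
    proof -
      have "(\<lambda>x::'a. (x, 0::real)) \<in> borel_measurable borel" by (intro borel_measurable_continuous_onI continuous_intros)
      from measurable_sets[OF this A'(1)] show ?thesis by (simp add: C_def vimage_def)
    qed
    have AC: "A = fst -` C \<inter> K" using flat by (auto simp: A'(2) C_def) (metis prod.collapse)+
    have "emeasure \<mu> A = emeasure (distr \<mu> borel fst) C" using Cm AC sp by (simp add: emeasure_distr)
    also have "\<dots> = emeasure \<nu> A" unfolding d using Cm AC sp by (simp add: emeasure_distr)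
    finally show "emeasure \<mu> A = emeasure \<nu> A" .
  qed
qed

section \<open>Continuity of the minimiser and the derivative of the minimum\<close>

definition opt :: "real \<Rightarrow> ('a \<times> real) measure" where
  "opt t = (THE \<mu>. \<mu> \<in> Ad \<and> J t \<mu> = V t)"

lemma opt: assumes "t > 0" shows "opt t \<in> Ad" "J t (opt t) = V t" "\<And>\<mu>. \<mu> \<in> Ad \<Longrightarrow> J t \<mu> = V t \<Longrightarrow> \<mu> = opt t"
proof -
  have "\<exists>!\<mu>. \<mu> \<in> Ad \<and> J t \<mu> = V t"
    using minimizer_exists[OF assms] minimizer_unique[OF assms] by blast
  from theI'[OF this] show "opt t \<in> Ad" "J t (opt t) = V t" by (auto simp: opt_def)
  then show "\<And>\<mu>. \<mu> \<in> Ad \<Longrightarrow> J t \<mu> = V t \<Longrightarrow> \<mu> = opt t" using minimizer_unique[OF assms] by blast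
qed

text \<open>If continuity failed along some s_i tending to t, a weak limit of the minimisers at s_i
  would be admissible with energy at most the minimum at t. Uniqueness makes it the minimiser at t,
  a contradiction.\<close>

lemma opt_continuous:
  assumes t: "t > 0" and g: "continuous_on UNIV g"
  shows "((\<lambda>s. dbl g (opt s)) \<longlongrightarrow> dbl g (opt t)) (at t)"
proof (rule ccontr)
  assume "\<not> ?thesis"
  then obtain e where e0: "e > 0" "\<not> (\<exists>d>0. \<forall>s. s \<noteq> t \<and> norm (s - t) < d \<longrightarrow> norm (dbl g (opt s) - dbl g (opt t)) < e)"
    unfolding LIM_eq by blast
  have e2: "\<exists>s. s \<noteq> t \<and> \<bar>s - t\<bar> < d \<and> \<bar>dbl g (opt s) - dbl g (opt t)\<bar> \<ge> e" if "d > 0" for d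
    using e0 that unfolding real_norm_def not_less[symmetric] by blast
  note e = e0(1) e2
  have "\<exists>s. \<bar>s - t\<bar> < min (t / 2) (1 / real (Suc i)) \<and> \<bar>dbl g (opt s) - dbl g (opt t)\<bar> \<ge> e" for i
    using e(2)[of "min (t / 2) (1 / real (Suc i))"] t by auto
  then obtain s where s: "\<And>i. \<bar>s i - t\<bar> < min (t / 2) (1 / real (Suc i))" "\<And>i. \<bar>dbl g (opt (s i)) - dbl g (opt t)\<bar> \<ge> e" by metis
  have sp: "s i \<in> {t / 2..2 * t}" for i using s(1)[of i] t unfolding min_less_iff_conj atLeastAtMost_iff by linarith
  have s0: "s i > 0" for i using sp[of i] t by auto
  have lim: "s \<longlonglongrightarrow> t"
  proof (rule LIMSEQ_I)
    fix x :: real assume "x > 0"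
    then obtain n where n: "1 / real (Suc n) < x" using reals_Archimedean by (auto simp: inverse_eq_divide)
    show "\<exists>no. \<forall>k\<ge>no. norm (s k - t) < x"
    proof (intro exI allI impI)
      fix k assume "k \<ge> n"
      then have "1 / real (Suc k) \<le> 1 / real (Suc n)" by (simp add: frac_le)
      then show "norm (s k - t) < x" using s(1)[of k] n by simp
    qed
  qed
  have ab: "0 < t / 2" "t / 2 \<le> 2 * t" using t by auto
  \<comment> \<open>The fixed competitor \<open>opt t\<close> bounds the minimum at
    \<open>s i\<close> from above, and its energy converges to the minimum at t.\<close>
  define c where "c i = J (s i) (opt t)" for i
  have cl: "c \<longlonglongrightarrow> J t (opt t)"
  proof -
    define C where "C = HB (t / 2) (2 * t)"
    note C = HB(1,2)[OF ab, folded C_def]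
    have tt: "t \<in> {t / 2..2 * t}" using t by auto
    have "(\<lambda>i. c i - J t (opt t) - (s i - t) * dbl (stripH' m t) (opt t)) \<longlonglongrightarrow> 0"
    proof (rule Lim_null_comparison)
      show "eventually (\<lambda>i. norm (c i - J t (opt t) - (s i - t) * dbl (stripH' m t) (opt t)) \<le> C * (s i - t)\<^sup>2) sequentially"
        using C(2)[OF sp tt Ad_bpm[OF opt(1)[OF t]]] by (simp add: c_def J_def)
      have "(\<lambda>i. C * (s i - t)\<^sup>2) \<longlonglongrightarrow> C * (t - t)\<^sup>2" by (intro tendsto_intros lim)
      then show "(\<lambda>i. C * (s i - t)\<^sup>2) \<longlonglongrightarrow> 0" by simp
    qed
    moreover have "(\<lambda>i. (s i - t) * dbl (stripH' m t) (opt t)) \<longlonglongrightarrow> (t - t) * dbl (stripH' m t) (opt t)" by (intro tendsto_intros lim)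
    ultimately have "(\<lambda>i. (c i - J t (opt t) - (s i - t) * dbl (stripH' m t) (opt t)) + (s i - t) * dbl (stripH' m t) (opt t) + J t (opt t)) \<longlonglongrightarrow> 0 + (t - t) * dbl (stripH' m t) (opt t) + J t (opt t)"
      by (intro tendsto_add tendsto_const)
    then show ?thesis by simp
  qed
  have le: "J (s i) (opt (s i)) \<le> c i" for i
    unfolding c_def using opt(2)[OF s0] V_le[OF s0 opt(1)[OF t]] by simp
  obtain r \<nu> where r: "strict_mono (r :: nat \<Rightarrow> nat)" "\<nu> \<in> Ad" "J t \<nu> \<le> J t (opt t)"
    "\<And>g. continuous_on UNIV g \<Longrightarrow> (\<lambda>i. dbl g (opt (s (r i)))) \<longlonglongrightarrow> dbl g \<nu>"
    using minimizing_limit[of "\<lambda>i. opt (s i)", OF opt(1)[OF s0] lim sp ab le cl] by blast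
  have "\<nu> = opt t" using V_le[OF t r(2)] r(3) opt(2)[OF t] by (intro opt(3)[OF t r(2)]) simp
  then have "(\<lambda>i. dbl g (opt (s (r i)))) \<longlonglongrightarrow> dbl g (opt t)" using r(4)[OF g] by simp
  from LIMSEQ_D[OF this e(1)] obtain n where "norm (dbl g (opt (s (r n))) - dbl g (opt t)) < e" by auto
  then show False using s(2)[of "r n"] by simp
qed

text \<open>Testing the minimum at s with \<open>opt t\<close>, and the minimum at t with
  \<open>opt s\<close>, confines V s - V t, up to C (s - t)^2, between s - t times the derivative of
  the kernel integrated against \<open>opt s\<close> and the same against \<open>opt t\<close>. The
  two integrals merge by \<open>opt_continuous\<close>.\<close>

lemma V_deriv: assumes t: "t > 0" shows "(V has_real_derivative dbl (stripH' m t) (opt t)) (at t)"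
proof -
  define D where "D = dbl (stripH' m t) (opt t)"
  have ab: "0 < t / 2" "t / 2 \<le> 2 * t" using t by auto
  have tt: "t \<in> {t / 2..2 * t}" using t by auto
  define C where "C = HB (t / 2) (2 * t)"
  note C = HB(1,2)[OF ab, folded C_def]
  have est: "\<bar>V s - V t - (s - t) * D\<bar> \<le> \<bar>s - t\<bar> * \<bar>dbl (stripH' m t) (opt s) - D\<bar> + C * (s - t)\<^sup>2" if s: "s \<in> {t / 2..2 * t}" for s
  proof -
    have s0: "s > 0" using s t by auto
    have up: "V s \<le> V t + (s - t) * D + C * (s - t)\<^sup>2"
      using V_le[OF s0 opt(1)[OF t]] C(2)[OF s tt Ad_bpm[OF opt(1)[OF t]]] opt(2)[OF t] unfolding J_def D_def by linarith
    have lo: "V s \<ge> V t + (s - t) * dbl (stripH' m t) (opt s) - C * (s - t)\<^sup>2"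
      using V_le[OF t opt(1)[OF s0]] C(2)[OF s tt Ad_bpm[OF opt(1)[OF s0]]] opt(2)[OF s0] unfolding J_def by linarith
    have "(s - t) * dbl (stripH' m t) (opt s) = (s - t) * D + (s - t) * (dbl (stripH' m t) (opt s) - D)" by (simp add: algebra_simps)
    moreover have "\<bar>(s - t) * (dbl (stripH' m t) (opt s) - D)\<bar> = \<bar>s - t\<bar> * \<bar>dbl (stripH' m t) (opt s) - D\<bar>" by (rule abs_mult)
    ultimately show ?thesis using up lo by linarith
  qed
  have "((\<lambda>s. (V s - V t) / (s - t) - D) \<longlongrightarrow> 0) (at t)"
  proof (rule Lim_null_comparison)
    have "eventually (\<lambda>s. s \<in> {t / 2<..<2 * t}) (at t)" using t by (intro eventually_at_in_open') auto
    moreover have "eventually (\<lambda>s. s \<noteq> t) (at t)" by (simp add: eventually_at_filter)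
    ultimately show "eventually (\<lambda>s. norm ((V s - V t) / (s - t) - D) \<le> \<bar>dbl (stripH' m t) (opt s) - D\<bar> + C * \<bar>s - t\<bar>) (at t)"
    proof eventually_elim
      case (elim s)
      have "(V s - V t) / (s - t) - D = (V s - V t - (s - t) * D) / (s - t)" using elim by (simp add: field_simps)
      also have "\<bar>\<dots>\<bar> \<le> (\<bar>s - t\<bar> * \<bar>dbl (stripH' m t) (opt s) - D\<bar> + C * (s - t)\<^sup>2) / \<bar>s - t\<bar>"
        unfolding abs_divide using est[of s] elim by (intro divide_right_mono) auto
      also have "\<dots> = \<bar>dbl (stripH' m t) (opt s) - D\<bar> + C * \<bar>s - t\<bar>"
      proof -
        have "(a * b + C * a\<^sup>2) / a = b + C * a" if "a \<noteq> 0" for a b :: real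
          using that by (simp add: add_divide_distrib power2_eq_square)
        from this[of "\<bar>s - t\<bar>"] show ?thesis using elim by simp
      qed
      finally show ?case by simp
    qed
    have "((\<lambda>s. \<bar>dbl (stripH' m t) (opt s) - D\<bar> + C * \<bar>s - t\<bar>) \<longlongrightarrow> \<bar>D - D\<bar> + C * \<bar>t - t\<bar>) (at t)"
      unfolding D_def by (intro tendsto_intros opt_continuous[OF t continuous_stripH(2)[OF m t]])
    then show "((\<lambda>s. \<bar>dbl (stripH' m t) (opt s) - D\<bar> + C * \<bar>s - t\<bar>) \<longlongrightarrow> 0) (at t)" by simp
  qed
  then have "((\<lambda>s. (V s - V t) / (s - t)) \<longlongrightarrow> D) (at t)" by (simp add: LIM_zero_iff)
  then show ?thesis unfolding has_field_derivative_iff D_def .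
qed

lemma V'_continuous: "continuous_on {0<..} (\<lambda>t. dbl (stripH' m t) (opt t))"
proof (rule continuous_at_imp_continuous_on, rule ballI)
  fix t :: real assume "t \<in> {0<..}"
  then have t: "t > 0" by simp
  have ab: "0 < t / 2" "t / 2 \<le> 2 * t" using t by auto
  have tt: "t \<in> {t / 2..2 * t}" using t by auto
  define C where "C = HB (t / 2) (2 * t)"
  note C = HB(1,3)[OF ab, folded C_def]
  have "((\<lambda>s. dbl (stripH' m s) (opt s) - dbl (stripH' m t) (opt s)) \<longlongrightarrow> 0) (at t)"
  proof (rule Lim_null_comparison)
    have "eventually (\<lambda>s. s \<in> {t / 2<..<2 * t}) (at t)" using t by (intro eventually_at_in_open') auto
    then show "eventually (\<lambda>s. norm (dbl (stripH' m s) (opt s) - dbl (stripH' m t) (opt s)) \<le> C * \<bar>s - t\<bar>) (at t)"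
    proof eventually_elim
      case (elim s)
      then have "s > 0" using t by auto
      then show ?case using C(2)[of s t "opt s"] elim tt Ad_bpm[OF opt(1)] by auto
    qed
    have "((\<lambda>s. C * \<bar>s - t\<bar>) \<longlongrightarrow> C * \<bar>t - t\<bar>) (at t)" by (intro tendsto_intros)
    then show "((\<lambda>s. C * \<bar>s - t\<bar>) \<longlongrightarrow> 0) (at t)" by simp
  qed
  from tendsto_add[OF this opt_continuous[OF t continuous_stripH(2)[OF m t]]]
  show "isCont (\<lambda>t. dbl (stripH' m t) (opt t)) t" by (simp add: isCont_def)
qed

end

subsection \<open>The Dirichlet integral of the vertical derivative\<close>

locale strip_rv = rv_pair M M X X m for M :: "'w measure" and X :: "'w \<Rightarrow> 'a::euclidean_space" and m :: nat +
  fixes t R :: real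
  assumes t: "t > 0" and R: "\<And>p. p \<in> space M \<Longrightarrow> norm (X p) \<le> R"
    and fin: "energy2 m M X M X < \<infinity>"
begin

abbreviation "S \<equiv> sphere_area (m + 1) / 2"
abbreviation "ph \<equiv> phi m M X M X"
abbreviation "pt \<equiv> pot m M X"

lemma S: "S > 0" using sphere_area_pos[of "m + 1"] by simp

lemma diam: "p \<in> space M \<Longrightarrow> q \<in> space M \<Longrightarrow> \<bar>norm (X p - X q)\<bar> \<le> 2 * R"
  using R[of p] R[of q] norm_triangle_ineq4[of "X p" "X q"] by simp

lemma R0: "2 * R \<ge> 0" using M.not_empty R norm_ge_zero order_trans by (metis ex_in_conv mult_nonneg_nonneg zero_le_numeral)

text \<open>The integral of m \<open>phi\<close> over heights beyond \<open>h\<close>. At h = 0 the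
  singular energy has to be put in by hand, since \<open>newt\<close> at height 0 takes the value 0
  on the diagonal.\<close>

definition F :: "real \<Rightarrow> real" where
  "F h = (if h = 0 then enn2real (energy2 m M X M X) else \<integral>q. \<integral>p. newt m (norm (X p - X q)) h \<partial>M \<partial>M)"

lemma F_nn: assumes "h \<ge> 0"
  shows "(\<integral>\<^sup>+s. ennreal (real m * ph s) * indicator {h<..} s \<partial>lborel) = ennreal (F h)" "F h \<ge> 0"
proof -
  show "F h \<ge> 0" unfolding F_def by (auto intro!: Bochner_Integration.integral_nonneg newt_nonneg)
  show "(\<integral>\<^sup>+s. ennreal (real m * ph s) * indicator {h<..} s \<partial>lborel) = ennreal (F h)"
  proof (cases "h = 0")
    case True
    then show ?thesis using fin by (simp add: F_def energy2_eq[symmetric])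
  next
    case False
    then have h: "h > 0" using assms by simp
    have "AE s in lborel. s \<noteq> h" by (rule AE_lborel_singleton)
    then have "(\<integral>\<^sup>+s. ennreal (real m * ph s) * indicator {h<..} s \<partial>lborel) = (\<integral>\<^sup>+s. ennreal (real m * ph s) * indicator {h..} s \<partial>lborel)"
      by (intro nn_integral_cong_AE) (auto simp: indicator_def)
    then show ?thesis using False newt_double_integral[OF h] by (simp add: F_def)
  qed
qed

lemma F_interval: assumes "0 \<le> a" "a < b"
  shows "(\<integral>\<^sup>+s. ennreal (real m * ph s) * indicator {a<..<b} s \<partial>lborel) = ennreal (F a - F b)" "F b \<le> F a"
proof -
  have ae: "AE s in lborel. s \<noteq> b" by (rule AE_lborel_singleton)
  have "ennreal (F a) = (\<integral>\<^sup>+s. ennreal (real m * ph s) * indicator {a<..<b} s + ennreal (real m * ph s) * indicator {b<..} s \<partial>lborel)"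
    unfolding F_nn(1)[OF assms(1), symmetric] using ae assms
    by (intro nn_integral_cong_AE) (auto simp: indicator_def)
  also have "\<dots> = (\<integral>\<^sup>+s. ennreal (real m * ph s) * indicator {a<..<b} s \<partial>lborel) + ennreal (F b)"
    using assms by (subst nn_integral_add) (simp_all add: F_nn(1))
  finally have eq: "ennreal (F a) = (\<integral>\<^sup>+s. ennreal (real m * ph s) * indicator {a<..<b} s \<partial>lborel) + ennreal (F b)" .
  have nb: "F a \<ge> 0" "F b \<ge> 0" using assms by (auto intro: F_nn(2))
  obtain x where x: "x \<ge> 0" "(\<integral>\<^sup>+s. ennreal (real m * ph s) * indicator {a<..<b} s \<partial>lborel) = ennreal x"
    using eq by (cases "\<integral>\<^sup>+s. ennreal (real m * ph s) * indicator {a<..<b} s \<partial>lborel") auto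
  have "F a = x + F b" using eq x nb by (simp add: ennreal_plus[symmetric] del: ennreal_plus)
  then show "(\<integral>\<^sup>+s. ennreal (real m * ph s) * indicator {a<..<b} s \<partial>lborel) = ennreal (F a - F b)" "F b \<le> F a"
    using x by auto
qed

text \<open>The substitution s = a' + c z maps (0, t) onto (a, a + 2t) in either direction; the 2 in
  the denominator is its Jacobian. The sign + arises from two heights of the form 2tj + z, the sign
  - from two of the form 2tj - z.\<close>

lemma ph_affine:
  assumes "0 \<le> a" and c: "c = 2 \<or> c = -2" and ab: "a = (if c = 2 then a' else a' - 2 * t)"
  shows "has_bochner_integral lborel (\<lambda>z. indicator {0<..<t} z * ph (a' + c * z)) ((F a - F (a + 2 * t)) / (2 * real m))"
proof (rule has_bochner_integral_nn_integral)
  have m0: "real m > 0" using m by simp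
  have "2 * (real m * (\<integral>\<^sup>+z. ennreal (indicator {0<..<t} z * ph (a' + c * z)) \<partial>lborel))
     = 2 * (\<integral>\<^sup>+z. ennreal (real m) * ennreal (indicator {0<..<t} z * ph (a' + c * z)) \<partial>lborel)"
    by (subst nn_integral_cmult) (auto simp: ennreal_of_nat_eq_real_of_nat)
  also have "(\<integral>\<^sup>+z. ennreal (real m) * ennreal (indicator {0<..<t} z * ph (a' + c * z)) \<partial>lborel)
    = (\<integral>\<^sup>+z. ennreal (real m * ph (a' + c * z)) * indicator {a<..<a + 2 * t} (a' + c * z) \<partial>lborel)"
    using c ab assms(1) by (intro nn_integral_cong) (auto simp: indicator_def ennreal_mult phi_nonneg)
  also have "2 * \<dots> = ennreal \<bar>c\<bar> * \<dots>" using c by auto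
  also have "\<dots> = (\<integral>\<^sup>+s. ennreal (real m * ph s) * indicator {a<..<a + 2 * t} s \<partial>lborel)"
    using c by (intro nn_integral_real_affine[symmetric]) auto
  also have "\<dots> = ennreal (F a - F (a + 2 * t))" using assms(1) t by (intro F_interval) auto
  finally have eq: "2 * (real m * (\<integral>\<^sup>+z. ennreal (indicator {0<..<t} z * ph (a' + c * z)) \<partial>lborel)) = ennreal (F a - F (a + 2 * t))" .
  have le: "F (a + 2 * t) \<le> F a" using assms(1) t by (intro F_interval) auto
  have "ennreal (2 * real m) * (\<integral>\<^sup>+z. ennreal (indicator {0<..<t} z * ph (a' + c * z)) \<partial>lborel) = ennreal (2 * real m) * ennreal ((F a - F (a + 2 * t)) / (2 * real m))"
  proof -
    have "ennreal (2 * real m) = 2 * ennreal (real m)" by (subst ennreal_mult) simp_all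
    then have "ennreal (2 * real m) * (\<integral>\<^sup>+z. ennreal (indicator {0<..<t} z * ph (a' + c * z)) \<partial>lborel) = ennreal (F a - F (a + 2 * t))"
      using eq by (simp only: mult.assoc)
    also have "\<dots> = ennreal ((2 * real m) * ((F a - F (a + 2 * t)) / (2 * real m)))" using m0 by simp
    also have "\<dots> = ennreal (2 * real m) * ennreal ((F a - F (a + 2 * t)) / (2 * real m))" using m0 le by (intro ennreal_mult) auto
    finally show ?thesis .
  qed
  then show "(\<integral>\<^sup>+z. ennreal (indicator {0<..<t} z * ph (a' + c * z)) \<partial>lborel) = ennreal ((F a - F (a + 2 * t)) / (2 * real m))"
    using m0 by (subst (asm) ennreal_mult_cancel_left) auto
  show "AE z in lborel. 0 \<le> indicator {0<..<t} z * ph (a' + c * z)"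
    using c ab assms(1) by (intro AE_I2) (auto simp: indicator_def intro!: phi_nonneg)
  show "0 \<le> (F a - F (a + 2 * t)) / (2 * real m)" using le by simp
qed measurable

text \<open>The two images next to 2tj are kept together. Separately their L^2 norms are bounded
  only by multiples of j^(-(m+1)/2), which is not summable for m = 1; the difference gains a factor
  1/j. For j = 0 there is just the source itself.\<close>

definition dl :: "nat \<Rightarrow> 'a \<Rightarrow> real \<Rightarrow> real" where
  "dl j y z = pt (2 * t * real j + z) y - (if j = 0 then 0 else pt (2 * t * real j - z) y)"

text \<open>Both heights 2tj + z and 2tj - z are at least tj, so \<open>pois_lipschitz\<close> at
  height tj applies: its constant is a Poisson kernel at height tj divided by tj, and this division
  is the gained factor.\<close>

definition dm :: "nat \<Rightarrow> 'a \<Rightarrow> real \<Rightarrow> real" where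
  "dm j y z = (if j = 0 then pt z y else 2 * real (m + 3) / real j * pt (t * real j) y)"

lemma tj: "j \<noteq> 0 \<Longrightarrow> t * real j \<ge> t" "j \<noteq> 0 \<Longrightarrow> t * real j > 0"
  using t mult_left_mono[of 1 "real j" t] by auto

lemma pois_diff_bound:
  assumes z: "0 < z" "z < t" and j: "j \<noteq> 0"
  shows "\<bar>pois m r (2 * t * real j + z) - pois m r (2 * t * real j - z)\<bar> \<le> 2 * real (m + 3) / real j * pois m r (t * real j)"
proof -
  have "2 * t * real j = t * real j + t * real j" by simp
  then have "\<bar>pois m r (2 * t * real j + z) - pois m r (2 * t * real j - z)\<bar> \<le> real (m + 3) / sqrt (r\<^sup>2 + (t * real j)\<^sup>2) ^ (m + 2) * \<bar>(2 * t * real j + z) - (2 * t * real j - z)\<bar>"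
    using z tj[OF j] by (intro pois_lipschitz) linarith+
  also have "\<dots> = real (m + 3) * (2 * z) / sqrt (r\<^sup>2 + (t * real j)\<^sup>2) ^ (m + 2)" using z by simp
  also have "\<dots> \<le> real (m + 3) * (2 * t) / sqrt (r\<^sup>2 + (t * real j)\<^sup>2) ^ (m + 2)" using z by (intro divide_right_mono mult_left_mono) auto
  also have "\<dots> = 2 * real (m + 3) / real j * pois m r (t * real j)" using j t by (simp add: pois_def)
  finally show ?thesis .
qed

lemma dl_bound: assumes z: "0 < z" "z < t" shows "\<bar>dl j y z\<bar> \<le> dm j y z"
proof (cases "j = 0")
  case True
  then show ?thesis using z by (simp add: dl_def dm_def pot_nonneg)
next
  case False
  have pos: "2 * t * real j + z > 0" "2 * t * real j - z > 0" using z tj[OF False] by linarith+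
  have "dl j y z = (\<integral>p. pois m (norm (y - X p)) (2 * t * real j + z) - pois m (norm (y - X p)) (2 * t * real j - z) \<partial>M)"
    unfolding dl_def pot_def using False by (simp add: Bochner_Integration.integral_diff[OF pot_integrable[OF pos(1)] pot_integrable[OF pos(2)]])
  also have "\<bar>\<dots>\<bar> \<le> (\<integral>p. 2 * real (m + 3) / real j * pois m (norm (y - X p)) (t * real j) \<partial>M)"
    by (rule order.trans[OF integral_abs_bound], rule integral_mono)
       (use pois_diff_bound[OF z False] pot_integrable tj(2)[OF False] pos in \<open>auto intro!: integrable_mult_right integrable_abs Bochner_Integration.integrable_diff\<close>)
  also have "\<dots> = dm j y z" using False by (simp add: dm_def pot_def)
  finally show ?thesis .
qed

lemma pt_le: "s > 0 \<Longrightarrow> pt s y \<le> 1 / s ^ (m + 1)"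
proof -
  assume s: "s > 0"
  have "pt s y \<le> (\<integral>p. 1 / s ^ (m + 1) \<partial>M)" unfolding pot_def
    using pot_integrable[OF s] pois_bd(2)[OF s] by (intro integral_mono) auto
  then show ?thesis by (simp add: M.prob_space)
qed

lemma dm_nonneg: "z > 0 \<Longrightarrow> dm j y z \<ge> 0"
  using t by (simp add: dm_def pot_nonneg)

lemma dm_summable: assumes z: "z > 0" shows "summable (\<lambda>j. dm j y z)"
proof -
  have "dm (Suc k) y z \<le> 2 * real (m + 3) / t ^ (m + 1) / (real (Suc k))\<^sup>2" for k
  proof -
    define j where "j = real (Suc k)"
    have j: "j \<ge> 1" by (simp add: j_def)
    have "dm (Suc k) y z = 2 * real (m + 3) / j * pt (t * j) y" by (simp add: dm_def j_def)
    also have "\<dots> \<le> 2 * real (m + 3) / j * (1 / (t * j) ^ (m + 1))"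
      using j t by (intro mult_left_mono pt_le) auto
    also have "\<dots> = 2 * real (m + 3) / t ^ (m + 1) * (1 / j ^ (m + 2))" using j t by (simp add: power_mult_distrib)
    also have "\<dots> \<le> 2 * real (m + 3) / t ^ (m + 1) * (1 / j\<^sup>2)"
      using j t by (intro mult_left_mono divide_left_mono power_increasing mult_pos_pos zero_less_power) auto
    finally show ?thesis by (simp add: j_def)
  qed
  then have "summable (\<lambda>k. dm (Suc k) y z)"
    by (intro summable_comparison_test'[OF summable_inverse_Suc_squares[of "2 * real (m + 3) / t ^ (m + 1)"], of 0])
      (simp only: real_norm_def abs_of_nonneg[OF dm_nonneg[OF z]])
  then show ?thesis using summable_Suc_iff[of "\<lambda>j. dm j y z"] by (simp only:)
qed

text \<open>Four products of Poisson integrals. In the two mixed ones z cancels from the sum of the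
  heights, which leaves 2t(i + k). The \<open>of_bool\<close> factors remove the products that are
  absent for index 0.\<close>

lemma dl_integrable:
  assumes "0 < z" "z < t"
  shows "has_bochner_integral lborel (\<lambda>y. dl i y z * dl k y z)
    (S * (ph (2 * t * real (i + k) + 2 * z) - (of_bool (i \<noteq> 0) + of_bool (k \<noteq> 0)) * ph (2 * t * real (i + k))
      + of_bool (i \<noteq> 0 \<and> k \<noteq> 0) * ph (2 * t * real (i + k) - 2 * z)))"
proof -
  have p: "2 * t * real j + z > 0" for j using assms t by (simp add: add_nonneg_pos)
  have q: "2 * t * real j - z > 0" if "j \<noteq> 0" for j using tj[OF that] assms by linarith
  have e: "2 * t * real i + z + (2 * t * real k + z) = 2 * t * real (i + k) + 2 * z"
    "2 * t * real i + z + (2 * t * real k - z) = 2 * t * real (i + k)"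
    "2 * t * real i - z + (2 * t * real k + z) = 2 * t * real (i + k)"
    "2 * t * real i - z + (2 * t * real k - z) = 2 * t * real (i + k) - 2 * z" by (simp_all add: algebra_simps)
  define u where "u = of_bool (i \<noteq> 0) * (1::real)"
  define v where "v = of_bool (k \<noteq> 0) * (1::real)"
  have pp: "has_bochner_integral lborel (\<lambda>y. pt (2 * t * real i + z) y * pt (2 * t * real k + z) y) (S * ph (2 * t * real (i + k) + 2 * z))"
    using pot_convolution[OF p p, of i k] unfolding e .
  have pq: "has_bochner_integral lborel (\<lambda>y. v * (pt (2 * t * real i + z) y * pt (2 * t * real k - z) y)) (v * (S * ph (2 * t * real (i + k))))"
  proof (cases "k = 0")
    case False
    then show ?thesis using pot_convolution[OF p[of i] q[of k]] unfolding e by (simp add: v_def)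
  qed (simp add: v_def has_bochner_integral_zero)
  have qp: "has_bochner_integral lborel (\<lambda>y. u * (pt (2 * t * real i - z) y * pt (2 * t * real k + z) y)) (u * (S * ph (2 * t * real (i + k))))"
  proof (cases "i = 0")
    case False
    then show ?thesis using pot_convolution[OF q[of i] p[of k]] unfolding e by (simp add: u_def)
  qed (simp add: u_def has_bochner_integral_zero)
  have qq: "has_bochner_integral lborel (\<lambda>y. (u * v) * (pt (2 * t * real i - z) y * pt (2 * t * real k - z) y)) ((u * v) * (S * ph (2 * t * real (i + k) - 2 * z)))"
  proof (cases "i = 0 \<or> k = 0")
    case False
    then show ?thesis using pot_convolution[OF q[of i] q[of k]] unfolding e by (simp add: u_def v_def)
  qed (auto simp add: u_def v_def has_bochner_integral_zero)
  have "has_bochner_integral lborel (\<lambda>y. pt (2 * t * real i + z) y * pt (2 * t * real k + z) y - v * (pt (2 * t * real i + z) y * pt (2 * t * real k - z) y)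
     - u * (pt (2 * t * real i - z) y * pt (2 * t * real k + z) y) + (u * v) * (pt (2 * t * real i - z) y * pt (2 * t * real k - z) y))
     (S * ph (2 * t * real (i + k) + 2 * z) - v * (S * ph (2 * t * real (i + k))) - u * (S * ph (2 * t * real (i + k))) + (u * v) * (S * ph (2 * t * real (i + k) - 2 * z)))"
    by (intro has_bochner_integral_add has_bochner_integral_diff pp pq qp qq)
  moreover have "dl i y z * dl k y z = pt (2 * t * real i + z) y * pt (2 * t * real k + z) y - v * (pt (2 * t * real i + z) y * pt (2 * t * real k - z) y)
     - u * (pt (2 * t * real i - z) y * pt (2 * t * real k + z) y) + (u * v) * (pt (2 * t * real i - z) y * pt (2 * t * real k - z) y)" for y
    by (simp add: dl_def u_def v_def algebra_simps)
  moreover have "S * ph (2 * t * real (i + k) + 2 * z) - v * (S * ph (2 * t * real (i + k))) - u * (S * ph (2 * t * real (i + k))) + (u * v) * (S * ph (2 * t * real (i + k) - 2 * z))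
    = S * (ph (2 * t * real (i + k) + 2 * z) - (of_bool (i \<noteq> 0) + of_bool (k \<noteq> 0)) * ph (2 * t * real (i + k))
      + of_bool (i \<noteq> 0 \<and> k \<noteq> 0) * ph (2 * t * real (i + k) - 2 * z))"
    by (simp add: u_def v_def algebra_simps)
  ultimately show ?thesis by (simp only:)
qed

lemma dl_measurable [measurable]: "(\<lambda>x. dl j (fst x) (snd x)) \<in> borel_measurable (borel \<Otimes>\<^sub>M borel)"
  unfolding dl_def by measurable

lemma dm_measurable [measurable]: "(\<lambda>x. dm j (fst x) (snd x)) \<in> borel_measurable (borel \<Otimes>\<^sub>M borel)"
  unfolding dm_def by measurable

text \<open>Gives the products of the majorants L^1 norms with summable weights j^(-2) in each
  index. Only i = k = 0 reaches down to the plane, and there finiteness of the singular energy is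
  used; all other pairs stay at heights at least t(i + k).\<close>

lemma dm_conv:
  obtains c where "c \<ge> 0" "\<And>i k. (\<integral>\<^sup>+x. ennreal (indicator {0<..<t} (snd x) * (dm i (fst x) (snd x) * dm k (fst x) (snd x))) \<partial>(lborel \<Otimes>\<^sub>M lborel :: ('a \<times> real) measure))
     \<le> ennreal (c * ((if i = 0 then 1 else 1 / (real i)\<^sup>2) * (if k = 0 then 1 else 1 / (real k)\<^sup>2)))"
proof -
  define C where "C = 2 * real (m + 3)"
  have C: "C \<ge> 1" by (simp add: C_def)
  define c where "c = S * (2 * (F 0 / real m)) + t * (C * C * (S * (1 / t ^ (m + 1))))"
  have m0: "real m > 0" using m by simp
  have c0: "0 \<le> S * (2 * (F 0 / real m))" "0 \<le> t * (C * C * (S * (1 / t ^ (m + 1))))"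
    using S F_nn(2)[of 0] t C m0 by (auto intro!: mult_nonneg_nonneg divide_nonneg_nonneg)
  then have c: "c \<ge> 0" by (simp add: c_def)
  show thesis
  proof (rule that[OF c])
    fix i k :: nat
    define w where "w j = (if j = 0 then 1 else C / real j)" for j :: nat
    define a where "a j z = (if j = 0 then z else t * real j)" for j :: nat and z :: real
    have dma: "dm j y z = w j * pt (a j z) y" for j y z by (simp add: dm_def w_def a_def C_def)
    have w: "w j > 0" for j using C by (simp add: w_def)
    have a: "a j z > 0" if "z > 0" for j z using that t by (simp add: a_def)
    have inner: "(\<integral>\<^sup>+y. ennreal (indicator {0<..<t} z * (dm i y z * dm k y z)) \<partial>lborel) = ennreal (indicator {0<..<t} z * (w i * w k * (S * ph (a i z + a k z))))" for z
    proof (cases "z \<in> {0<..<t}")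
      case True
      then have z: "z > 0" by simp
      have "ennreal (dm i y z * dm k y z) = ennreal (w i * w k) * ennreal (pt (a i z) y * pt (a k z) y)" for y
        using w[of i] w[of k] a[OF z] unfolding dma by (subst ennreal_mult[symmetric]) (auto simp: pot_nonneg less_imp_le mult_ac)
      then have "(\<integral>\<^sup>+y. ennreal (dm i y z * dm k y z) \<partial>lborel) = ennreal (w i * w k) * ennreal (S * ph (a i z + a k z))"
        using pot_convolution_nn[OF a[OF z] a[OF z], of i k] by (simp add: nn_integral_cmult)
      also have "\<dots> = ennreal (w i * w k * (S * ph (a i z + a k z)))"
      proof (intro ennreal_mult[symmetric] mult_nonneg_nonneg phi_nonneg)
        show "0 \<le> a i z + a k z" using a[OF z, of i] a[OF z, of k] by simp
      qed (use w[of i] w[of k] S in auto)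
      finally show ?thesis using True by simp
    qed simp
    have "(\<integral>\<^sup>+x. ennreal (indicator {0<..<t} (snd x) * (dm i (fst x) (snd x) * dm k (fst x) (snd x))) \<partial>(lborel \<Otimes>\<^sub>M lborel :: ('a \<times> real) measure))
      = (\<integral>\<^sup>+z. \<integral>\<^sup>+y. ennreal (indicator {0<..<t} z * (dm i y z * dm k y z)) \<partial>lborel \<partial>lborel)"
      by (subst lborel_pair.nn_integral_snd[symmetric]) (auto simp: case_prod_beta')
    also have "\<dots> = (\<integral>\<^sup>+z. ennreal (indicator {0<..<t} z * (w i * w k * (S * ph (a i z + a k z)))) \<partial>lborel)"
      unfolding inner ..
    also have "\<dots> \<le> ennreal (c * ((if i = 0 then 1 else 1 / (real i)\<^sup>2) * (if k = 0 then 1 else 1 / (real k)\<^sup>2)))"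
    proof (cases "i = 0 \<and> k = 0")
      case True
      \<comment> \<open>Two sources at height z give \<open>phi\<close> at height 2z; this returns
        it to height z, whose integral over z is bounded by F 0 / m.\<close>
      have ph2: "ph (z + z) \<le> 2 * ph z" if z: "z > 0" for z
      proof -
        have pz: "pois m r (z + z) \<le> 2 * pois m r z" for r
        proof -
          have "sqrt (r\<^sup>2 + z\<^sup>2) \<le> sqrt (r\<^sup>2 + (z + z)\<^sup>2)" using z by (intro real_sqrt_le_mono add_left_mono power_mono) auto
          moreover have "0 < sqrt (r\<^sup>2 + z\<^sup>2)" using z by (simp add: add_nonneg_pos)
          moreover from calculation have "0 < sqrt (r\<^sup>2 + (z + z)\<^sup>2)" by linarith
          ultimately have "(z + z) / sqrt (r\<^sup>2 + (z + z)\<^sup>2) ^ (m + 2) \<le> (z + z) / sqrt (r\<^sup>2 + z\<^sup>2) ^ (m + 2)"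
            using z by (intro divide_left_mono power_mono mult_pos_pos zero_less_power) linarith+
          then show ?thesis by (simp add: pois_def)
        qed
        have zz: "z + z > 0" using z by simp
        note i1 = pair_integrable[of "\<lambda>r. pois m r (z + z)" "1 / (z + z) ^ (m + 1)", OF _ pois_bd(1)[OF zz]]
        note i2 = pair_integrable[of "\<lambda>r. pois m r z" "1 / z ^ (m + 1)", OF _ pois_bd(1)[OF z]]
        have "ph (z + z) \<le> (\<integral>q. 2 * (\<integral>p. pois m (norm (X p - X q)) z \<partial>M) \<partial>M)"
          unfolding phi_def
        proof (rule integral_mono)
          fix q assume q: "q \<in> space M"
          have "(\<integral>p. pois m (norm (X p - X q)) (z + z) \<partial>M) \<le> (\<integral>p. 2 * pois m (norm (X p - X q)) z \<partial>M)"
            using i1(1)[OF _ q] i2(1)[OF _ q] pz by (intro integral_mono) auto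
          then show "(\<integral>p. pois m (norm (X p - X q)) (z + z) \<partial>M) \<le> 2 * (\<integral>p. pois m (norm (X p - X q)) z \<partial>M)" by simp
        qed (use i1(2) i2(2) in auto)
        then show ?thesis by (simp add: phi_def)
      qed
      have "(\<integral>\<^sup>+z. ennreal (indicator {0<..<t} z * (w i * w k * (S * ph (a i z + a k z)))) \<partial>lborel)
        \<le> (\<integral>\<^sup>+z. ennreal (S * 2 / real m) * (ennreal (real m * ph z) * indicator {0<..} z) \<partial>lborel)"
      proof (rule nn_integral_mono)
        fix z :: real
        show "ennreal (indicator {0<..<t} z * (w i * w k * (S * ph (a i z + a k z)))) \<le> ennreal (S * 2 / real m) * (ennreal (real m * ph z) * indicator {0<..} z)"
        proof (cases "z \<in> {0<..<t}")
          case z: True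
          have "S * ph (z + z) \<le> S * (2 * ph z)" using ph2 z S by (intro mult_left_mono) auto
          also have "\<dots> = (S * 2 / real m) * (real m * ph z)" using m0 by simp
          finally have "ennreal (S * ph (z + z)) \<le> ennreal ((S * 2 / real m) * (real m * ph z))" by (rule ennreal_leI)
          also have "\<dots> = ennreal (S * 2 / real m) * ennreal (real m * ph z)"
            using S m0 z by (intro ennreal_mult) (auto intro!: mult_nonneg_nonneg divide_nonneg_nonneg phi_nonneg)
          finally show ?thesis using z True by (simp add: w_def a_def)
        qed simp
      qed
      also have "\<dots> = ennreal (S * 2 / real m) * ennreal (F 0)"
        by (subst nn_integral_cmult) (auto simp: F_nn(1))
      also have "\<dots> = ennreal (S * (2 * (F 0 / real m)))"
        using S m0 F_nn(2)[of 0] by (subst ennreal_mult[symmetric]) (auto simp: field_simps)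
      also have "\<dots> \<le> ennreal c" using c0 by (intro ennreal_leI) (simp add: c_def)
      finally show ?thesis using True by simp
    next
      case False
      have ij: "real i + real k \<ge> 1" using False by auto
      \<comment> \<open>If both indices are positive, (i + k)^2 >= i k raises the weights 1/i and
        1/k to squares. If one vanishes, i + k is the other one.\<close>
      have jk: "w i * w k / (real i + real k)\<^sup>2 \<le> C * C * ((if i = 0 then 1 else 1 / (real i)\<^sup>2) * (if k = 0 then 1 else 1 / (real k)\<^sup>2))"
      proof (cases "i = 0 \<or> k = 0")
        case True
        define j where "j = real i + real k"
        have "j \<ge> 1" using ij by (simp add: j_def)
        then have "C / j / j\<^sup>2 \<le> C * C * (1 / j\<^sup>2)"
        proof -
          have "C / j \<le> C / 1" using \<open>j \<ge> 1\<close> C by (intro divide_left_mono) auto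
          also have "\<dots> \<le> C * C" using C mult_left_mono[of 1 C C] by simp
          finally have "C / j / j\<^sup>2 \<le> C * C / j\<^sup>2" by (rule divide_right_mono) simp
          then show ?thesis by (simp only: times_divide_eq_right mult_1_right)
        qed
        then show ?thesis using True False by (auto simp: w_def j_def)
      next
        case nz: False
        then have "real i > 0" "real k > 0" by auto
        then have "(real i + real k)\<^sup>2 \<ge> real i * real k" by (simp add: power2_eq_square algebra_simps)
        then have "(C * C / (real i * real k)) / (real i + real k)\<^sup>2 \<le> (C * C / (real i * real k)) / (real i * real k)"
          using \<open>real i > 0\<close> \<open>real k > 0\<close> by (intro divide_left_mono) auto
        then show ?thesis using nz by (simp add: w_def power2_eq_square mult_ac)
      qed
      have bnd: "indicator {0<..<t} z * (w i * w k * (S * ph (a i z + a k z))) \<le>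
         indicator {0<..<t} z * (C * C * (S * (1 / t ^ (m + 1))) * ((if i = 0 then 1 else 1 / (real i)\<^sup>2) * (if k = 0 then 1 else 1 / (real k)\<^sup>2)))" for z
      proof (cases "z \<in> {0<..<t}")
        case z: True
        define j where "j = real i + real k"
        have j: "j \<ge> 1" using ij by (simp add: j_def)
        have "t * j \<le> a i z + a k z" using z False by (auto simp: a_def j_def algebra_simps)
        moreover have tj0: "t * j > 0" using t j by simp
        ultimately have "ph (a i z + a k z) \<le> 1 / (t * j) ^ (m + 1)"
        proof -
          assume le: "t * j \<le> a i z + a k z"
          have "ph (a i z + a k z) \<le> 1 / (a i z + a k z) ^ (m + 1)" using phi_bound[of "a i z + a k z"] le tj0 by auto
          also have "\<dots> \<le> 1 / (t * j) ^ (m + 1)" using le tj0 zero_less_power[OF tj0, of "m + 1"] zero_less_power[of "a i z + a k z" "m + 1"]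
            by (intro divide_left_mono power_mono mult_pos_pos[of "_ ^ _" "_ ^ _"]) linarith+
          finally show ?thesis .
        qed
        also have "\<dots> = 1 / t ^ (m + 1) * (1 / j ^ (m + 1))" by (simp add: power_mult_distrib)
        also have "\<dots> \<le> 1 / t ^ (m + 1) * (1 / j\<^sup>2)"
          using j t m by (intro mult_left_mono divide_left_mono power_increasing mult_pos_pos zero_less_power) auto
        finally have "w i * w k * (S * ph (a i z + a k z)) \<le> w i * w k * (S * (1 / t ^ (m + 1) * (1 / j\<^sup>2)))"
          using w[of i] w[of k] S by (intro mult_left_mono) auto
        also have "\<dots> = (S * (1 / t ^ (m + 1))) * (w i * w k / j\<^sup>2)" by (simp add: field_simps)
        also have "\<dots> \<le> (S * (1 / t ^ (m + 1))) * (C * C * ((if i = 0 then 1 else 1 / (real i)\<^sup>2) * (if k = 0 then 1 else 1 / (real k)\<^sup>2)))"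
          unfolding j_def using S t by (intro mult_left_mono jk) auto
        finally show ?thesis using z by (simp add: mult_ac)
      qed simp
      define B where "B = C * C * (S * (1 / t ^ (m + 1))) * ((if i = 0 then 1 else 1 / (real i)\<^sup>2) * (if k = 0 then 1 else 1 / (real k)\<^sup>2))"
      have B0: "B \<ge> 0" unfolding B_def using C S t by (intro mult_nonneg_nonneg) auto
      have "(\<integral>\<^sup>+z. ennreal (indicator {0<..<t} z * (w i * w k * (S * ph (a i z + a k z)))) \<partial>lborel) \<le> (\<integral>\<^sup>+z. ennreal B * indicator {0<..<t} z \<partial>lborel)"
      proof (rule nn_integral_mono)
        fix z :: real
        show "ennreal (indicator {0<..<t} z * (w i * w k * (S * ph (a i z + a k z)))) \<le> ennreal B * indicator {0<..<t} z"
          using ennreal_leI[OF bnd[of z, folded B_def]] by (cases "z \<in> {0<..<t}") auto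
      qed
      also have "\<dots> = ennreal (t * B)" using t B0 by (simp add: nn_integral_cmult ennreal_mult mult.commute)
      also have "\<dots> \<le> ennreal (c * ((if i = 0 then 1 else 1 / (real i)\<^sup>2) * (if k = 0 then 1 else 1 / (real k)\<^sup>2)))"
      proof (rule ennreal_leI)
        define E where "E = (if i = 0 then 1 else 1 / (real i)\<^sup>2) * (if k = 0 then 1 else 1 / (real k)\<^sup>2 :: real)"
        have "E \<ge> 0" by (simp add: E_def)
        then have "t * (C * C * (S * (1 / t ^ (m + 1)))) * E \<le> c * E" using c0 by (intro mult_right_mono) (simp add: c_def)
        then show "t * B \<le> c * ((if i = 0 then 1 else 1 / (real i)\<^sup>2) * (if k = 0 then 1 else 1 / (real k)\<^sup>2))"
          unfolding B_def E_def[symmetric] by (simp only: mult.assoc)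
      qed
      finally show ?thesis .
    qed
    finally show "(\<integral>\<^sup>+x. ennreal (indicator {0<..<t} (snd x) * (dm i (fst x) (snd x) * dm k (fst x) (snd x))) \<partial>(lborel \<Otimes>\<^sub>M lborel :: ('a \<times> real) measure))
     \<le> ennreal (c * ((if i = 0 then 1 else 1 / (real i)\<^sup>2) * (if k = 0 then 1 else 1 / (real k)\<^sup>2)))" .
  qed
qed

end

section \<open>Integration of the Cauchy product and its telescoping\<close>

context strip_rv begin

abbreviation "L \<equiv> (lborel \<Otimes>\<^sub>M lborel :: ('a \<times> real) measure)"

lemma dl_product_bound:
  obtains c where "c \<ge> 0" "\<And>i k. integrable L (\<lambda>x. indicator {0<..<t} (snd x) * (dl i (fst x) (snd x) * dl k (fst x) (snd x)))"
    "\<And>i k. (\<integral>x. \<bar>indicator {0<..<t} (snd x) * (dl i (fst x) (snd x) * dl k (fst x) (snd x))\<bar> \<partial>L)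
     \<le> c * ((if i = 0 then 1 else 1 / (real i)\<^sup>2) * (if k = 0 then 1 else 1 / (real k)\<^sup>2))"
proof (rule dm_conv)
  fix c assume c: "c \<ge> 0" and bd: "\<And>i k. (\<integral>\<^sup>+x. ennreal (indicator {0<..<t} (snd x) * (dm i (fst x) (snd x) * dm k (fst x) (snd x))) \<partial>L)
     \<le> ennreal (c * ((if i = 0 then 1 else 1 / (real i)\<^sup>2) * (if k = 0 then 1 else 1 / (real k)\<^sup>2)))"
  show thesis
  proof (rule that[OF c])
    fix i k :: nat
    define b where "b = c * ((if i = 0 then 1 else 1 / (real i)\<^sup>2) * (if k = 0 then 1 else 1 / (real k)\<^sup>2))"
    have b: "b \<ge> 0" using c by (simp add: b_def)
    have "\<bar>indicator {0<..<t} z * (dl i y z * dl k y z)\<bar> \<le> indicator {0<..<t} z * (dm i y z * dm k y z)" for y z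
      using dl_bound[of z i y] dl_bound[of z k y] by (auto simp: indicator_def abs_mult intro!: mult_mono)
    then have le: "(\<integral>\<^sup>+x. ennreal \<bar>indicator {0<..<t} (snd x) * (dl i (fst x) (snd x) * dl k (fst x) (snd x))\<bar> \<partial>L) \<le> ennreal b"
      unfolding b_def by (intro order.trans[OF nn_integral_mono bd] ennreal_leI)
    show "integrable L (\<lambda>x. indicator {0<..<t} (snd x) * (dl i (fst x) (snd x) * dl k (fst x) (snd x)))"
      by (rule integrableI_bounded) (use le in \<open>auto intro: le_less_trans\<close>)
    have "(\<integral>x. \<bar>indicator {0<..<t} (snd x) * (dl i (fst x) (snd x) * dl k (fst x) (snd x))\<bar> \<partial>L)
       = enn2real (\<integral>\<^sup>+x. ennreal \<bar>indicator {0<..<t} (snd x) * (dl i (fst x) (snd x) * dl k (fst x) (snd x))\<bar> \<partial>L)"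
      by (rule integral_eq_nn_integral) auto
    also have "\<dots> \<le> b" using le b by (rule enn2real_leI[rotated])
    finally show "(\<integral>x. \<bar>indicator {0<..<t} (snd x) * (dl i (fst x) (snd x) * dl k (fst x) (snd x))\<bar> \<partial>L)
     \<le> c * ((if i = 0 then 1 else 1 / (real i)\<^sup>2) * (if k = 0 then 1 else 1 / (real k)\<^sup>2))" unfolding b_def .
  qed
qed

text \<open>Integrated over 0 < z < t, the outer heights run through the two intervals of length 2t
  on either side of 2t(i + k) and give differences of \<open>F\<close>. The mixed products are
  constant in z and give t times \<open>phi\<close>.\<close>

lemma dl_product_integral:
  "(\<integral>x. indicator {0<..<t} (snd x) * (dl i (fst x) (snd x) * dl k (fst x) (snd x)) \<partial>L)
   = S / (2 * real m) * (F (2 * t * real (i + k)) - F (2 * t * real (Suc (i + k)))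
     - (of_bool (i \<noteq> 0) + of_bool (k \<noteq> 0)) * (2 * real m * t * ph (2 * t * real (i + k)))
     + of_bool (i \<noteq> 0 \<and> k \<noteq> 0) * (F (2 * t * real (i + k - 1)) - F (2 * t * real (i + k))))"
proof -
  define a where "a = 2 * t * real (i + k)"
  have a0: "a \<ge> 0" using t by (simp add: a_def)
  have aS: "2 * t * real (Suc (i + k)) = a + 2 * t" by (simp add: a_def algebra_simps)
  define u v where "u = (of_bool (i \<noteq> 0) + of_bool (k \<noteq> 0) :: real)" and "v = (of_bool (i \<noteq> 0 \<and> k \<noteq> 0) :: real)"
  \<comment> \<open>For i + k = 0 the natural subtraction truncates, but the coefficient
    \<open>v\<close> of this term is then zero.\<close>
  define b where "b = 2 * t * real (i + k - 1)"
  have int: "integrable L (\<lambda>x. indicator {0<..<t} (snd x) * (dl i (fst x) (snd x) * dl k (fst x) (snd x)))"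
    by (rule dl_product_bound)
  have m0: "real m > 0" using m by simp
  have "(\<integral>x. indicator {0<..<t} (snd x) * (dl i (fst x) (snd x) * dl k (fst x) (snd x)) \<partial>L)
    = (\<integral>z. \<integral>y. indicator {0<..<t} z * (dl i y z * dl k y z) \<partial>lborel \<partial>lborel)"
    using lborel_pair.integral_snd[of "\<lambda>y z. indicator {0<..<t} z * (dl i y z * dl k y z)"] int by (simp add: case_prod_beta')
  also have "\<dots> = (\<integral>z. S * (indicator {0<..<t} z * ph (a + 2 * z)) - S * u * (ph a * indicator {0<..<t} z) + S * (v * (indicator {0<..<t} z * ph (a + (-2) * z))) \<partial>lborel)"
  proof (rule Bochner_Integration.integral_cong[OF refl])
    fix z :: real
    show "(\<integral>y. indicator {0<..<t} z * (dl i y z * dl k y z) \<partial>lborel) = S * (indicator {0<..<t} z * ph (a + 2 * z)) - S * u * (ph a * indicator {0<..<t} z) + S * (v * (indicator {0<..<t} z * ph (a + (-2) * z)))"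
    proof (cases "z \<in> {0<..<t}")
      case True
      then have "(\<integral>y. dl i y z * dl k y z \<partial>lborel) = S * (ph (a + 2 * z) - u * ph a + v * ph (a - 2 * z))"
        using has_bochner_integral_integral_eq[OF dl_integrable[of z i k]] unfolding a_def u_def v_def by simp
      then show ?thesis using True by (simp add: algebra_simps)
    qed simp
  qed
  also have "\<dots> = S * ((F a - F (a + 2 * t)) / (2 * real m)) - S * u * (ph a * t) + S * (v * ((F b - F a) / (2 * real m)))"
  proof -
    have h1: "has_bochner_integral lborel (\<lambda>z. indicator {0<..<t} z * ph (a + 2 * z)) ((F a - F (a + 2 * t)) / (2 * real m))"
      using a0 by (intro ph_affine) auto
    have h2: "has_bochner_integral lborel (indicator {0<..<t} :: real \<Rightarrow> real) t"
      using has_bochner_integral_real_indicator[of "{0<..<t}" lborel] t by simp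
    have h3: "has_bochner_integral lborel (\<lambda>z. v * (indicator {0<..<t} z * ph (a + (-2) * z))) (v * ((F b - F a) / (2 * real m)))"
    proof (cases "v = 0")
      case False
      then have ik: "i \<noteq> 0" "k \<noteq> 0" by (auto simp: v_def)
      then have "real (i + k - 1) = real (i + k) - 1" by (subst of_nat_diff) auto
      then have ba: "b = a - 2 * t" unfolding a_def b_def by (simp only:) (simp add: algebra_simps)
      have b0: "b \<ge> 0" using t by (simp add: b_def)
      have "has_bochner_integral lborel (\<lambda>z. indicator {0<..<t} z * ph (a + (-2) * z)) ((F b - F (b + 2 * t)) / (2 * real m))"
        using b0 ba by (intro ph_affine) auto
      then show ?thesis using ba by (intro has_bochner_integral_mult_right) simp
    qed (simp add: has_bochner_integral_zero)
    show ?thesis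
      by (rule has_bochner_integral_integral_eq, intro has_bochner_integral_add has_bochner_integral_diff has_bochner_integral_mult_right h1 h2 h3)
  qed
  also have "\<dots> = S / (2 * real m) * (F a - F (a + 2 * t) - u * (2 * real m * t * ph a) + v * (F b - F a))"
    using m0 by (simp add: field_simps)
  finally show ?thesis unfolding aS unfolding a_def b_def u_def v_def .
qed

text \<open>The integral of the p-th coefficient of the squared series. For p > 0, all p + 1 pairs
  with i + k = p share the difference of \<open>F\<close> above 2tp, p - 1 of them have both indices
  nonzero and add the difference below it, and the mixed products occur 2p times.\<close>

definition cval :: "nat \<Rightarrow> real" where
  "cval p = S / (2 * real m) * (if p = 0 then F 0 - F (2 * t) else 2 * F (2 * t * real p) - (real p + 1) * F (2 * t * real (Suc p))
     + (real p - 1) * F (2 * t * real (p - 1)) - 2 * (real p * (2 * real m * t * ph (2 * t * real p))))"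

lemma dl_cauchy_integral:
  "(\<Sum>i\<le>p. \<integral>x. indicator {0<..<t} (snd x) * (dl i (fst x) (snd x) * dl (p - i) (fst x) (snd x)) \<partial>L) = cval p"
proof (cases "p = 0")
  case True
  then show ?thesis by (simp add: cval_def dl_product_integral)
next
  case False
  have e1: "(\<Sum>i\<le>p. of_bool (i \<noteq> 0) :: real) = real p" by (induction p) auto
  have e2: "(\<Sum>i\<le>p. of_bool (p - i \<noteq> 0) :: real) = real p"
    by (subst lessThan_Suc_atMost[symmetric]) (simp add: sum.lessThan_Suc)
  define A B D where "A = F (2 * t * real p) - F (2 * t * real (Suc p))" and "B = 2 * real m * t * ph (2 * t * real p)"
    and "D = F (2 * t * real (p - 1)) - F (2 * t * real p)"
  have "(\<Sum>i\<le>p. \<integral>x. indicator {0<..<t} (snd x) * (dl i (fst x) (snd x) * dl (p - i) (fst x) (snd x)) \<partial>L)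
    = (\<Sum>i\<le>p. S / (2 * real m) * (A - (of_bool (i \<noteq> 0) + of_bool (p - i \<noteq> 0)) * B + (of_bool (i \<noteq> 0) + of_bool (p - i \<noteq> 0) - 1) * D))"
  proof (rule sum.cong[OF refl])
    fix i assume "i \<in> {..p}"
    then have ip: "i + (p - i) = p" by simp
    \<comment> \<open>For p > 0 the indices i and p - i do not both vanish, so the conjunction is
      the sum of the two indicators minus one.\<close>
    have b: "(of_bool (i \<noteq> 0 \<and> p - i \<noteq> 0) :: real) = of_bool (i \<noteq> 0) + of_bool (p - i \<noteq> 0) - 1" using False by auto
    show "(\<integral>x. indicator {0<..<t} (snd x) * (dl i (fst x) (snd x) * dl (p - i) (fst x) (snd x)) \<partial>L)
      = S / (2 * real m) * (A - (of_bool (i \<noteq> 0) + of_bool (p - i \<noteq> 0)) * B + (of_bool (i \<noteq> 0) + of_bool (p - i \<noteq> 0) - 1) * D)"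
      unfolding dl_product_integral[of i "p - i"] ip b A_def B_def D_def ..
  qed
  also have "\<dots> = S / (2 * real m) * (\<Sum>i\<le>p. A - (of_bool (i \<noteq> 0) + of_bool (p - i \<noteq> 0)) * B + (of_bool (i \<noteq> 0) + of_bool (p - i \<noteq> 0) - 1) * D)"
    by (rule sum_distrib_left[symmetric])
  also have "(\<Sum>i\<le>p. A - (of_bool (i \<noteq> 0) + of_bool (p - i \<noteq> 0)) * B + (of_bool (i \<noteq> 0) + of_bool (p - i \<noteq> 0) - 1) * D)
     = (real p + 1) * A - ((\<Sum>i\<le>p. of_bool (i \<noteq> 0)) + (\<Sum>i\<le>p. of_bool (p - i \<noteq> 0))) * B + ((\<Sum>i\<le>p. of_bool (i \<noteq> 0)) + (\<Sum>i\<le>p. of_bool (p - i \<noteq> 0)) - (real p + 1)) * D"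
    by (simp only: sum.distrib sum_subtractf sum_distrib_right[symmetric] sum_constant card_atMost of_nat_Suc mult_1_right add.commute[of 1])
  also have "\<dots> = (real p + 1) * A - (real p + real p) * B + (real p + real p - (real p + 1)) * D" unfolding e1 e2 ..
  also have "S / (2 * real m) * \<dots> = cval p" using False
    by (simp add: cval_def A_def B_def D_def algebra_simps del: of_nat_Suc)
  finally show ?thesis .
qed

text \<open>The value F(2tp) with p > 0 receives 2 from its own coefficient and -p and +p from its
  two neighbours, and F(0) is counted once. At the upper end the neighbours are missing, which
  leaves the two boundary terms.\<close>

lemma cval_partial:
  "(\<Sum>p<Suc n. cval p) = S / (2 * real m) * (F 0 + 2 * (\<Sum>k<n. F (2 * t * real (Suc k)) - 2 * t * real (Suc k) * (real m * ph (2 * t * real (Suc k))))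
     - real n * F (2 * t * real n) - real (Suc n) * F (2 * t * real (Suc n)))"
proof (induction n)
  case (Suc n)
  define s where "s = (\<Sum>k<n. F (2 * t * real (Suc k)) - 2 * t * real (Suc k) * (real m * ph (2 * t * real (Suc k))))"
  define q where "q = 2 * t * real (Suc n)"
  have c: "cval (Suc n) = S / (2 * real m) * (2 * F q - (real (Suc n) + 1) * F (2 * t * real (Suc (Suc n))) + (real (Suc n) - 1) * F (2 * t * real n) - 2 * (q * (real m * ph q)))"
    by (simp add: cval_def q_def mult_ac del: of_nat_Suc)
  have "(\<Sum>p<Suc (Suc n). cval p) = (\<Sum>p<Suc n. cval p) + cval (Suc n)" by (rule sum.lessThan_Suc)
  also have "\<dots> = S / (2 * real m) * ((F 0 + 2 * s - real n * F (2 * t * real n) - real (Suc n) * F q)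
     + (2 * F q - (real (Suc n) + 1) * F (2 * t * real (Suc (Suc n))) + (real (Suc n) - 1) * F (2 * t * real n) - 2 * (q * (real m * ph q))))"
    unfolding Suc.IH c s_def q_def by (rule distrib_left[symmetric])
  also have "(F 0 + 2 * s - real n * F (2 * t * real n) - real (Suc n) * F q)
     + (2 * F q - (real (Suc n) + 1) * F (2 * t * real (Suc (Suc n))) + (real (Suc n) - 1) * F (2 * t * real n) - 2 * (q * (real m * ph q)))
    = F 0 + 2 * (s + (F q - q * (real m * ph q))) - real (Suc n) * F q - real (Suc (Suc n)) * F (2 * t * real (Suc (Suc n)))"
  proof -
    define w where "w = F (2 * t * real (Suc (Suc n)))"
    have r: "real (Suc n) = real n + 1" "real (Suc (Suc n)) = real n + 2" by simp_all
    show ?thesis unfolding w_def[symmetric] r by (simp add: algebra_simps)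
  qed
  also have "s + (F q - q * (real m * ph q)) = (\<Sum>k<Suc n. F (2 * t * real (Suc k)) - 2 * t * real (Suc k) * (real m * ph (2 * t * real (Suc k))))"
    by (simp only: sum.lessThan_Suc s_def q_def)
  finally show ?case unfolding q_def .
qed (simp add: cval_def)

lemma F_enewt: assumes s: "s > 0"
  shows "F s - s * (real m * ph s) = (\<integral>q. \<integral>p. enewt m (norm (X p - X q)) s \<partial>M \<partial>M)"
proof -
  have nb: "\<bar>newt m r s\<bar> \<le> 1 / s ^ m" for r using newt_le[OF s] newt_nonneg[of m r s] by simp
  note i1 = pair_integrable[of "\<lambda>r. newt m r s", OF _ nb]
  note i2 = pair_integrable[of "\<lambda>r. pois m r s", OF _ pois_bd(1)[OF s]]
  have "(\<integral>q. \<integral>p. enewt m (norm (X p - X q)) s \<partial>M \<partial>M) = (\<integral>q. (\<integral>p. newt m (norm (X p - X q)) s \<partial>M) - s * (real m * (\<integral>p. pois m (norm (X p - X q)) s \<partial>M)) \<partial>M)"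
    unfolding enewt_def using i1(1) i2(1) by (intro Bochner_Integration.integral_cong refl) simp
  also have "\<dots> = F s - s * (real m * ph s)" using i1(2) i2(2) s by (simp add: F_def phi_def)
  finally show ?thesis by simp
qed

text \<open>The limit of the boundary terms of \<open>cval_partial\<close>. It vanishes for m >= 2;
  for m = 1 the kernel at height s is 1/s up to an error of order s^(-2), uniformly on the bounded
  range of distances.\<close>

lemma newt_double_limit: "(\<lambda>n. real n * F (2 * t * real n)) \<longlonglongrightarrow> reg m / (2 * t)"
proof (rule LIMSEQ_offset[where k = 1])
  define s where "s n = 2 * t * real (Suc n)" for n
  have s: "s n > 0" "s n \<ge> 2 * t" for n using t by (auto simp: s_def)
  obtain C where C: "C \<ge> 0" "\<And>r s z. \<lbrakk>0 \<le> r; r \<le> 2 * R; 2 * t \<le> s; \<bar>z\<bar> \<le> 0; \<bar>z\<bar> \<le> s / 2\<rbrakk> \<Longrightarrow> \<bar>newt m r (s + z) - reg m / s\<bar> \<le> C / s\<^sup>2"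
    using newt_reg_bound[of m "2 * t" "2 * R" 0] m t R0 by (metis mult_pos_pos order_refl zero_less_numeral)
  have b: "\<bar>real (Suc n) * newt m r (s n) - reg m / (2 * t)\<bar> \<le> C / (4 * t\<^sup>2) / real (Suc n)" if r: "0 \<le> r" "r \<le> 2 * R" for r n
  proof -
    have "real (Suc n) * newt m r (s n) - reg m / (2 * t) = real (Suc n) * (newt m r (s n) - reg m / s n)"
      using t by (simp add: s_def right_diff_distrib del: of_nat_Suc)
    also have "\<bar>\<dots>\<bar> \<le> real (Suc n) * (C / (s n)\<^sup>2)"
      unfolding abs_mult using C(2)[OF r s(2)[of n], of 0] s[of n] by (intro mult_mono) auto
    also have "\<dots> = C / (4 * t\<^sup>2) / real (Suc n)" using t by (simp add: s_def power2_eq_square field_simps del: of_nat_Suc)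
    finally show ?thesis .
  qed
  have "(\<lambda>n. \<integral>q. \<integral>p. real (Suc n) * newt m (norm (X p - X q)) (s n) \<partial>M \<partial>M) \<longlonglongrightarrow> (\<integral>q. \<integral>p. (\<lambda>_. reg m / (2 * t)) (norm (X p - X q)) \<partial>M \<partial>M)"
  proof (rule pair_dominated_convergence[where B = "C / (4 * t\<^sup>2) + \<bar>reg m / (2 * t)\<bar>"])
    fix p q assume pq: "p \<in> space M" "q \<in> space M"
    have r: "0 \<le> norm (X p - X q)" "norm (X p - X q) \<le> 2 * R" using diam[OF pq] by auto
    show "(\<lambda>n. real (Suc n) * newt m (norm (X p - X q)) (s n)) \<longlonglongrightarrow> reg m / (2 * t)"
    proof (rule Lim_transform[OF tendsto_const], rule tendsto_0_le[where K = 1])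
      show "(\<lambda>n. C / (4 * t\<^sup>2) / real (Suc n)) \<longlonglongrightarrow> 0" by (rule LIMSEQ_Suc[OF lim_const_over_n])
    qed (use b[OF r] C(1) in \<open>auto simp: abs_minus_commute simp del: of_nat_Suc\<close>)
    fix n
    have "C / (4 * t\<^sup>2) / real (Suc n) \<le> C / (4 * t\<^sup>2) / 1" using C(1) by (intro divide_left_mono) auto
    then show "\<bar>real (Suc n) * newt m (norm (X p - X q)) (s n)\<bar> \<le> C / (4 * t\<^sup>2) + \<bar>reg m / (2 * t)\<bar>" using b[OF r, of n] by linarith
  qed measurable
  then have "(\<lambda>n. real (Suc n) * F (s n)) \<longlonglongrightarrow> reg m / (2 * t)"
    using s by (simp add: F_def M.prob_space order_less_imp_not_eq2 del: of_nat_Suc)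
  then show "(\<lambda>n. real (n + 1) * F (2 * t * real (n + 1))) \<longlonglongrightarrow> reg m / (2 * t)" by (simp add: s_def)
qed

text \<open>The extra reg m / (2t) undoes the term -reg m / t which the logarithm contributes to
  \<open>stripT'\<close>.\<close>

lemma enewt_double_series:
  "(\<lambda>n. \<Sum>k<n. \<integral>q. \<integral>p. enewt m (norm (X p - X q)) (2 * t * real (Suc k)) \<partial>M \<partial>M) \<longlonglongrightarrow>
    (\<integral>q. \<integral>p. stripT' m t (norm (X p - X q)) \<partial>M \<partial>M) / 2 + reg m / (2 * t)"
proof -
  obtain C where C: "C \<ge> 0" "\<And>r k. \<bar>r\<bar> \<le> 2 * R \<Longrightarrow> \<bar>enewt m r (2 * t * real (Suc k))\<bar> \<le> C / (real (Suc k))\<^sup>2"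
    using stripT_term_bound[OF m R0 t] by (metis order_refl)
  define e where "e k r = enewt m r (2 * t * real (Suc k))" for k r
  have [measurable]: "e k \<in> borel_measurable borel" for k unfolding e_def enewt_def by measurable
  have eb: "\<bar>e k (norm (X p - X q))\<bar> \<le> C / (real (Suc k))\<^sup>2" if "p \<in> space M" "q \<in> space M" for k p q
    using C(2)[OF diam[OF that]] by (simp add: e_def del: of_nat_Suc)
  define B where "B = (\<Sum>k. C / (real (Suc k))\<^sup>2)"
  have sb: "\<bar>\<Sum>k<n. e k (norm (X p - X q))\<bar> \<le> B" if "p \<in> space M" "q \<in> space M" for n p q
    unfolding B_def using eb[OF that] C(1)
    by (intro order.trans[OF sum_abs] order.trans[OF sum_mono sum_le_suminf[OF summable_inverse_Suc_squares]]) (auto simp del: of_nat_Suc)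
  have es: "summable (\<lambda>k. e k r)" for r unfolding e_def using enewt_summable[OF m t] .
  have lim: "(\<lambda>n. \<Sum>k<n. e k r) \<longlonglongrightarrow> (\<Sum>k. e k r)" for r by (rule summable_LIMSEQ[OF es])
  have Sb: "\<bar>\<Sum>k. e k (norm (X p - X q))\<bar> \<le> B" if "p \<in> space M" "q \<in> space M" for p q
    by (rule LIMSEQ_le_const2[OF tendsto_rabs[OF lim]]) (use sb[OF that] in auto)
  define I where "I = (\<integral>q. \<integral>p. (\<Sum>k. e k (norm (X p - X q))) \<partial>M \<partial>M)"
  have "(\<lambda>n. \<integral>q. \<integral>p. (\<Sum>k<n. e k (norm (X p - X q))) \<partial>M \<partial>M) \<longlonglongrightarrow> I"
    unfolding I_def
    by (rule pair_dominated_convergence[where B = B and g = "\<lambda>n r. \<Sum>k<n. e k r" and h = "\<lambda>r. \<Sum>k. e k r"]) (use sb lim in auto)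
  moreover have "(\<integral>q. \<integral>p. (\<Sum>k<n. e k (norm (X p - X q))) \<partial>M \<partial>M) = (\<Sum>k<n. \<integral>q. \<integral>p. e k (norm (X p - X q)) \<partial>M \<partial>M)" for n
  proof -
    note i = pair_integrable[of "e _", OF _ eb]
    have "(\<integral>q. \<integral>p. (\<Sum>k<n. e k (norm (X p - X q))) \<partial>M \<partial>M) = (\<integral>q. (\<Sum>k<n. \<integral>p. e k (norm (X p - X q)) \<partial>M) \<partial>M)"
      using i(1) by (intro Bochner_Integration.integral_cong refl Bochner_Integration.integral_sum) auto
    also have "\<dots> = (\<Sum>k<n. \<integral>q. \<integral>p. e k (norm (X p - X q)) \<partial>M \<partial>M)"
      using i(2) by (intro Bochner_Integration.integral_sum) auto
    finally show ?thesis .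
  qed
  ultimately have lim': "(\<lambda>n. \<Sum>k<n. \<integral>q. \<integral>p. e k (norm (X p - X q)) \<partial>M \<partial>M) \<longlonglongrightarrow> I" by (simp only:)
  have "(\<integral>q. \<integral>p. stripT' m t (norm (X p - X q)) \<partial>M \<partial>M) = 2 * I - reg m / t"
  proof -
    note i = pair_integrable[of "\<lambda>r. \<Sum>k. e k r", OF _ Sb]
    have "(\<integral>q. \<integral>p. stripT' m t (norm (X p - X q)) \<partial>M \<partial>M) = (\<integral>q. 2 * (\<integral>p. (\<Sum>k. e k (norm (X p - X q))) \<partial>M) - reg m / t \<partial>M)"
      unfolding stripT'_def e_def[symmetric] using i(1) by (intro Bochner_Integration.integral_cong refl) (simp add: M.prob_space)
    also have "\<dots> = 2 * I - reg m / t" unfolding I_def using i(2) by (simp add: M.prob_space)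
    finally show ?thesis .
  qed
  then have "I = (\<integral>q. \<integral>p. stripT' m t (norm (X p - X q)) \<partial>M \<partial>M) / 2 + reg m / (2 * t)" using t by (simp add: field_simps)
  with lim' show ?thesis unfolding e_def by (simp only:)
qed

text \<open>For 0 < z < t, -m times this is the vertical derivative of the potential.\<close>

definition W :: "'a \<Rightarrow> real \<Rightarrow> real" where "W y z = (\<Sum>j. dl j y z)"

lemma dl_summable: "0 < z \<Longrightarrow> z < t \<Longrightarrow> summable (\<lambda>j. \<bar>dl j y z\<bar>)"
  by (rule summable_comparison_test'[OF dm_summable, of _ 0]) (use dl_bound in auto)

text \<open>The square is expanded as the Cauchy product of the series with itself.
  \<open>dl_product_bound\<close> makes the L^1 norms of its coefficients summable, so sum and
  integral can be exchanged, and the value is the limit of the telescoped sums.\<close>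

lemma W_square_integral:
  "has_bochner_integral L (\<lambda>x. indicator {0<..<t} (snd x) * (W (fst x) (snd x))\<^sup>2)
    (S / (2 * real m) * (enn2real (energy2 m M X M X) + (\<integral>q. \<integral>p. stripT' m t (norm (X p - X q)) \<partial>M \<partial>M)))"
proof -
  define g where "g i k x = indicator {0<..<t} (snd x) * (dl i (fst x) (snd x) * dl k (fst x) (snd x))" for i k and x :: "'a \<times> real"
  define c where "c p x = (\<Sum>i\<le>p. g i (p - i) x)" for p x
  define u where "u i = (if i = 0 then 1 else 1 / (real i)\<^sup>2)" for i
  obtain B where B: "B \<ge> 0" "\<And>i k. integrable L (g i k)" "\<And>i k. (\<integral>x. \<bar>g i k x\<bar> \<partial>L) \<le> B * (u i * u k)"
    unfolding g_def u_def by (rule dl_product_bound) (assumption | blast)+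
  have us: "summable (\<lambda>i. \<bar>u i\<bar>)"
    using summable_Suc_iff[of "\<lambda>i. \<bar>u i\<bar>"] summable_inverse_Suc_squares[of 1] by (simp add: u_def)
  have ints: "integrable L (c p)" for p unfolding c_def[abs_def] using B(2) by simp
  have cs: "(\<lambda>p. c p x) sums (indicator {0<..<t} (snd x) * (W (fst x) (snd x))\<^sup>2)" "summable (\<lambda>p. \<bar>c p x\<bar>)" for x
  proof -
    obtain y z where x: "x = (y, z)" by force
    have "(\<lambda>p. c p x) sums (indicator {0<..<t} (snd x) * (W (fst x) (snd x))\<^sup>2) \<and> summable (\<lambda>p. \<bar>c p x\<bar>)"
    proof (cases "z \<in> {0<..<t}")
      case True
      then have s: "summable (\<lambda>j. norm (dl j y z))" "summable (\<lambda>j. norm \<bar>dl j y z\<bar>)" using dl_summable by auto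
      have cx: "c p x = (\<Sum>i\<le>p. dl i y z * dl (p - i) y z)" for p using True by (simp add: c_def g_def x)
      have "\<bar>c p x\<bar> \<le> (\<Sum>i\<le>p. \<bar>dl i y z\<bar> * \<bar>dl (p - i) y z\<bar>)" for p
        unfolding cx by (rule order.trans[OF sum_abs]) (simp add: abs_mult)
      then have "summable (\<lambda>p. \<bar>c p x\<bar>)"
        by (intro summable_comparison_test'[OF summable_Cauchy_product[OF s(2,2)], of 0]) auto
      moreover have "(\<lambda>p. c p x) sums (W y z)\<^sup>2"
        unfolding cx W_def power2_eq_square by (rule Cauchy_product_sums[OF s(1,1)])
      ultimately show ?thesis using True by (simp add: x)
    qed (simp add: x c_def g_def)
    then show "(\<lambda>p. c p x) sums (indicator {0<..<t} (snd x) * (W (fst x) (snd x))\<^sup>2)" "summable (\<lambda>p. \<bar>c p x\<bar>)" by auto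
  qed
  have "summable (\<lambda>p. \<Sum>i\<le>p. u i * u (p - i))" by (rule summable_Cauchy_product) (use us in auto)
  then have bs: "summable (\<lambda>p. B * (\<Sum>i\<le>p. u i * u (p - i)))" by (rule summable_mult)
  have "(\<integral>x. norm (c p x) \<partial>L) \<le> B * (\<Sum>i\<le>p. u i * u (p - i))" for p
  proof -
    have "(\<integral>x. norm (c p x) \<partial>L) \<le> (\<integral>x. (\<Sum>i\<le>p. \<bar>g i (p - i) x\<bar>) \<partial>L)"
      using B(2) ints unfolding c_def by (intro integral_mono) (auto intro!: Bochner_Integration.integrable_sum)
    also have "\<dots> = (\<Sum>i\<le>p. \<integral>x. \<bar>g i (p - i) x\<bar> \<partial>L)" using B(2) by (intro Bochner_Integration.integral_sum) auto
    also have "\<dots> \<le> (\<Sum>i\<le>p. B * (u i * u (p - i)))" by (intro sum_mono B(3))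
    finally show ?thesis by (simp only: sum_distrib_left)
  qed
  then have ns: "summable (\<lambda>p. \<integral>x. norm (c p x) \<partial>L)"
    by (intro summable_comparison_test'[OF bs, of 0]) auto
  have ae: "AE x in L. summable (\<lambda>p. norm (c p x))" using cs(2) by simp
  have Weq: "(\<Sum>p. c p x) = indicator {0<..<t} (snd x) * (W (fst x) (snd x))\<^sup>2" for x using sums_unique[OF cs(1)] by simp
  have int: "integrable L (\<lambda>x. indicator {0<..<t} (snd x) * (W (fst x) (snd x))\<^sup>2)"
    using integrable_suminf[OF ints ae ns] unfolding Weq .
  have "(\<lambda>p. integral\<^sup>L L (c p)) sums (\<integral>x. indicator {0<..<t} (snd x) * (W (fst x) (snd x))\<^sup>2 \<partial>L)"
    using sums_integral[OF ints ae ns] unfolding Weq .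
  moreover have "integral\<^sup>L L (c p) = cval p" for p
  proof -
    have "integral\<^sup>L L (c p) = (\<Sum>i\<le>p. integral\<^sup>L L (g i (p - i)))" unfolding c_def using B(2) by (intro Bochner_Integration.integral_sum) auto
    then show ?thesis using dl_cauchy_integral[of p] unfolding g_def by (simp only:)
  qed
  ultimately have "(\<lambda>n. \<Sum>p<n. cval p) \<longlonglongrightarrow> (\<integral>x. indicator {0<..<t} (snd x) * (W (fst x) (snd x))\<^sup>2 \<partial>L)"
    by (simp add: sums_def)
  then have l1: "(\<lambda>n. \<Sum>p<Suc n. cval p) \<longlonglongrightarrow> (\<integral>x. indicator {0<..<t} (snd x) * (W (fst x) (snd x))\<^sup>2 \<partial>L)"
    by (rule LIMSEQ_Suc)
  define I where "I = (\<integral>q. \<integral>p. stripT' m t (norm (X p - X q)) \<partial>M \<partial>M)"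
  have "F (2 * t * real (Suc k)) - 2 * t * real (Suc k) * (real m * ph (2 * t * real (Suc k))) = (\<integral>q. \<integral>p. enewt m (norm (X p - X q)) (2 * t * real (Suc k)) \<partial>M \<partial>M)" for k
    using t by (intro F_enewt) auto
  \<comment> \<open>The two boundary terms tend to reg m / (2t) each; together they cancel the
    excess reg m / t from twice the series of \<open>enewt\<close>.\<close>
  then have "(\<lambda>n. \<Sum>p<Suc n. cval p) \<longlonglongrightarrow> S / (2 * real m) * (F 0 + 2 * (I / 2 + reg m / (2 * t)) - reg m / (2 * t) - reg m / (2 * t))"
    unfolding cval_partial I_def using enewt_double_series newt_double_limit LIMSEQ_Suc[OF newt_double_limit]
    by (intro tendsto_intros) (simp_all only:)
  with l1 have "(\<integral>x. indicator {0<..<t} (snd x) * (W (fst x) (snd x))\<^sup>2 \<partial>L) = S / (2 * real m) * (F 0 + 2 * (I / 2 + reg m / (2 * t)) - reg m / (2 * t) - reg m / (2 * t))"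
    by (rule LIMSEQ_unique)
  also have "\<dots> = S / (2 * real m) * (enn2real (energy2 m M X M X) + I)" by (simp add: F_def)
  finally show ?thesis using int unfolding I_def has_bochner_integral_iff by blast
qed

text \<open>The differences of paired images are of order j^(-2) uniformly in the point, so the sum
  over images and the expectation can be exchanged.\<close>

lemma W_eq: assumes z: "0 < z" "z < t"
  shows "W y z = (\<integral>p. stripV m t z (norm (y - X p)) \<partial>M)" "integrable M (\<lambda>p. stripV m t z (norm (y - X p)))"
proof -
  obtain C where C: "C \<ge> 0" "\<And>z w r k. \<lbrakk>\<bar>z\<bar> \<le> t; \<bar>w\<bar> \<le> t\<rbrakk> \<Longrightarrow> \<bar>pois m r (2 * t * real (Suc k) + z) - pois m r (2 * t * real (Suc k) + w)\<bar> \<le> C / (real (Suc k))\<^sup>2 * \<bar>z - w\<bar>"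
    using stripK_term_bound[OF m order_refl t] by metis
  define d where "d k p = pois m (norm (y - X p)) (2 * t * real (Suc k) + z) - pois m (norm (y - X p)) (2 * t * real (Suc k) - z)" for k p
  have pos: "2 * t * real (Suc k) + z > 0" "2 * t * real (Suc k) - z > 0" for k
  proof -
    have "2 * t * real (Suc k) = 2 * (t * real (Suc k))" by (simp only: mult.assoc)
    moreover have "t * real (Suc k) \<ge> t" "t * real (Suc k) > 0" using tj[of "Suc k"] by blast+
    ultimately show "2 * t * real (Suc k) + z > 0" "2 * t * real (Suc k) - z > 0" using z by linarith+
  qed
  have db: "\<bar>d k p\<bar> \<le> C * (2 * t) / (real (Suc k))\<^sup>2" for k p
  proof -
    have "\<bar>d k p\<bar> \<le> C / (real (Suc k))\<^sup>2 * \<bar>z - (- z)\<bar>"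
      using C(2)[of z "- z" "norm (y - X p)" k] z by (simp add: d_def del: of_nat_Suc)
    also have "\<dots> \<le> C / (real (Suc k))\<^sup>2 * (2 * t)" using z C(1) by (intro mult_left_mono) auto
    finally show ?thesis by (simp del: of_nat_Suc)
  qed
  have di: "integrable M (d k)" for k unfolding d_def[abs_def] using pos by (intro Bochner_Integration.integrable_diff pot_integrable)
  have s1: "summable (\<lambda>k. norm (d k p))" for p
    by (rule summable_comparison_test'[OF summable_inverse_Suc_squares[of "C * (2 * t)"], of 0]) (use db in auto)
  have "(\<integral>p. norm (d k p) \<partial>M) \<le> C * (2 * t) / (real (Suc k))\<^sup>2" for k
  proof -
    have "(\<integral>p. norm (d k p) \<partial>M) \<le> (\<integral>p. C * (2 * t) / (real (Suc k))\<^sup>2 \<partial>M)"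
      using di db by (intro integral_mono) (auto simp del: of_nat_Suc)
    then show ?thesis by (simp add: M.prob_space del: of_nat_Suc)
  qed
  then have s2: "summable (\<lambda>k. \<integral>p. norm (d k p) \<partial>M)"
    by (intro summable_comparison_test'[OF summable_inverse_Suc_squares[of "C * (2 * t)"], of 0]) auto
  have ae: "AE p in M. summable (\<lambda>k. norm (d k p))" using s1 by simp
  have int: "integrable M (\<lambda>p. \<Sum>k. d k p)" by (rule integrable_suminf[OF di ae s2])
  have V: "stripV m t z (norm (y - X p)) = pois m (norm (y - X p)) z + (\<Sum>k. d k p)" for p
    by (simp only: stripV_def d_def)
  show "integrable M (\<lambda>p. stripV m t z (norm (y - X p)))" unfolding V using int pot_integrable[OF z(1)] by simp
  have "W y z = (\<Sum>j. dl (Suc j) y z) + dl 0 y z"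
    unfolding W_def using suminf_split_head[OF summable_rabs_cancel[OF dl_summable[OF z]]] by simp
  also have "(\<lambda>k. dl (Suc k) y z) = (\<lambda>k. \<integral>p. d k p \<partial>M)"
    unfolding dl_def pot_def d_def by (rule ext) (simp add: Bochner_Integration.integral_diff[OF pot_integrable[OF pos(1)] pot_integrable[OF pos(2)]] del: of_nat_Suc)
  also have "(\<Sum>k. \<integral>p. d k p \<partial>M) = (\<integral>p. (\<Sum>k. d k p) \<partial>M)" by (rule integral_suminf[OF di ae s2, symmetric])
  also have "dl 0 y z = (\<integral>p. pois m (norm (y - X p)) z \<partial>M)" by (simp add: dl_def pot_def)
  finally show "W y z = (\<integral>p. stripV m t z (norm (y - X p)) \<partial>M)"
    unfolding V using int pot_integrable[OF z(1)] by simp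
qed

end

subsection \<open>The strip energy\<close>

text \<open>The derivative \<open>dz\<close> of the potential is identified only off a null set.
  Completeness of Lebesgue measure makes this enough for measurability as well.\<close>

lemma has_bochner_integral_completion_AE:
  fixes f h :: "'a \<Rightarrow> real"
  assumes h: "has_bochner_integral M h I" and ae: "AE x in M. f x = h x"
  shows "has_bochner_integral (completion M) f I"
proof -
  have hM: "h \<in> borel_measurable M" "integrable M h" "integral\<^sup>L M h = I"
    using h by (auto simp: has_bochner_integral_iff)
  have hc [measurable]: "h \<in> borel_measurable (completion M)" using hM(1) by (rule measurable_completion)
  have "f \<in> borel_measurable (completion M)"
  proof (rule measurableI)
    fix A :: "real set" assume [measurable]: "A \<in> sets borel"
    have [measurable]: "Measurable.pred (completion M) (\<lambda>x. f x \<noteq> h x \<and> f x \<notin> A)"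
      by (rule sets_completion_AE) (use ae in eventually_elim, simp)
    have [measurable]: "Measurable.pred (completion M) (\<lambda>x. f x \<noteq> h x \<and> f x \<in> A)"
      by (rule sets_completion_AE) (use ae in eventually_elim, simp)
    have "Measurable.pred (completion M) (\<lambda>x. h x \<in> A \<and> \<not> (f x \<noteq> h x \<and> f x \<notin> A) \<or> (f x \<noteq> h x \<and> f x \<in> A))"
      by measurable
    also have "(\<lambda>x. h x \<in> A \<and> \<not> (f x \<noteq> h x \<and> f x \<notin> A) \<or> (f x \<noteq> h x \<and> f x \<in> A)) = (\<lambda>x. f x \<in> A)" by auto
    finally show "f -` A \<inter> space (completion M) \<in> sets (completion M)"
      by (simp add: pred_def vimage_def Int_def conj_commute)
  qed simp
  moreover have "has_bochner_integral (completion M) h I"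
    unfolding has_bochner_integral_iff using hM by (simp add: integrable_completion integral_completion)
  ultimately show ?thesis
    using has_bochner_integral_cong_AE[OF _ hc AE_completion[OF ae]] by blast
qed

text \<open>Transfers the integral over the upper half of the strip to the lower half, where the
  potential is the mirror image.\<close>

lemma has_bochner_integral_reflect:
  fixes f :: "'a::euclidean_space \<times> real \<Rightarrow> real"
  assumes f: "has_bochner_integral (lborel \<Otimes>\<^sub>M lborel) f I" and nn: "\<And>x. f x \<ge> 0"
  shows "has_bochner_integral (lborel \<Otimes>\<^sub>M lborel) (\<lambda>x. f (fst x, - snd x)) I"
proof (rule has_bochner_integral_nn_integral)
  have [measurable]: "f \<in> borel_measurable (lborel \<Otimes>\<^sub>M lborel)" using f by (auto simp: has_bochner_integral_iff)
  have fb [measurable]: "f \<in> borel_measurable (borel \<Otimes>\<^sub>M borel)"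
    using \<open>f \<in> borel_measurable (lborel \<Otimes>\<^sub>M lborel)\<close> by simp
  show "(\<lambda>x. f (fst x, - snd x)) \<in> borel_measurable (lborel \<Otimes>\<^sub>M lborel)" by measurable
  show "0 \<le> I" using f nn by (auto simp: has_bochner_integral_iff intro!: Bochner_Integration.integral_nonneg)
  have "(\<integral>\<^sup>+x. ennreal (f (fst x, - snd x)) \<partial>(lborel \<Otimes>\<^sub>M lborel)) = (\<integral>\<^sup>+z. \<integral>\<^sup>+y. ennreal (f (y, - z)) \<partial>lborel \<partial>lborel)"
    by (subst lborel_pair.nn_integral_snd[symmetric]) (auto simp: case_prod_beta')
  also have "\<dots> = (\<integral>\<^sup>+z. \<integral>\<^sup>+y. ennreal (f (y, z)) \<partial>lborel \<partial>lborel)"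
    using nn_integral_real_affine[of "\<lambda>z. \<integral>\<^sup>+y. ennreal (f (y, z)) \<partial>lborel" "-1" 0] by simp
  also have "\<dots> = (\<integral>\<^sup>+x. ennreal (f x) \<partial>(lborel \<Otimes>\<^sub>M lborel))"
    by (subst lborel_pair.nn_integral_snd[symmetric]) (auto simp: case_prod_beta')
  also have "\<dots> = ennreal I"
    using f nn by (subst nn_integral_eq_integral) (auto simp: has_bochner_integral_iff)
  finally show "(\<integral>\<^sup>+x. ennreal (f (fst x, - snd x)) \<partial>(lborel \<Otimes>\<^sub>M lborel)) = ennreal I" .
qed (use nn in auto)

text \<open>On the plane the kernel is a nonnegative singular part plus a part bounded on
  \<open>K\<close>, so both nested extended integrals split by \<open>ereal_integral_add\<close> and
  \<infinity> - \<infinity> does not arise.\<close>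

lemma measure_energy_eq:
  fixes K :: "((real^'n) \<times> real) set"
  assumes n: "CARD('n) = m + 1" and m: "m \<ge> 1" and t: "t > 0" and K: "compact K" and flat: "\<And>p. p \<in> K \<Longrightarrow> snd p = 0"
    and mu: "\<mu> \<in> borel_prob_measures K"
  shows "measure_energy t \<mu> = enn2ereal (energy2 m \<mu> fst \<mu> fst) + ereal (\<integral>q. \<integral>p. stripH m t (norm (fst p - fst q)) \<partial>\<mu> \<partial>\<mu>)"
proof -
  interpret rv_pair \<mu> \<mu> fst fst m
    by (intro rv_pair.intro rv_pair_axioms.intro)
      (use n m mu in \<open>auto intro!: borel_prob_measuresD(1) measurable_borel_prob_measures borel_measurable_continuous_onI continuous_intros\<close>)
  have sp: "space \<mu> = K" by (rule borel_prob_measuresD(3)[OF mu])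
  have "bounded (fst ` K)" using K by (intro compact_imp_bounded compact_continuous_image continuous_intros)
  then obtain R where R: "R > 0" "\<And>p. p \<in> K \<Longrightarrow> norm (fst p) \<le> R" by (auto simp: bounded_pos)
  have "2 * R \<ge> 0" using R(1) by simp
  then obtain C where C: "\<And>s r. \<lbrakk>s \<in> {t..t}; \<bar>r\<bar> \<le> 2 * R\<rbrakk> \<Longrightarrow> \<bar>stripH m s r\<bar> \<le> C"
    using stripH_bounds[OF m _ t order_refl] by metis
  have hb: "\<bar>stripH m t (norm (fst p - fst q))\<bar> \<le> C" if "p \<in> space \<mu>" "q \<in> space \<mu>" for p q
    using that R(2)[of p] R(2)[of q] norm_triangle_ineq4[of "fst p" "fst q"] by (intro C) (auto simp: sp)
  have [measurable]: "stripH m t \<in> borel_measurable borel"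
    by (rule borel_measurable_continuous_onI[OF continuous_stripH(1)[OF m t]])
  note i = pair_integrable[of "stripH m t", OF _ hb]
  have ker: "strip_kernel t p q = enn2ereal (newtE m (norm (fst p - fst q))) + ereal (stripH m t (norm (fst p - fst q)))"
    if "p \<in> K" "q \<in> K" for p q
  proof -
    have z: "snd p = 0" "snd q = 0" using flat that by auto
    then have pq: "p = q \<longleftrightarrow> fst p = fst q" by (simp add: prod_eq_iff)
    have "strip_kernel t p q = (if p = q then \<infinity> else ereal (newt m (norm (fst p - fst q)) 0 + stripK m t 0 (norm (fst p - fst q))))"
      using strip_kernel_eq[OF n m, of p t q] t z by simp
    then show ?thesis
      by (simp add: pq newtE_def stripK_zero[OF t m] stripH_def enn2ereal_ennreal newt_nonneg)
  qed
  have inner: "ereal_integral \<mu> (\<lambda>p. strip_kernel t p q) = enn2ereal (\<integral>\<^sup>+p. newtE m (norm (fst p - fst q)) \<partial>\<mu>) + ereal (\<integral>p. stripH m t (norm (fst p - fst q)) \<partial>\<mu>)"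
    if q: "q \<in> space \<mu>" for q
  proof (rule ereal_integral_add)
    show "integrable \<mu> (\<lambda>p. stripH m t (norm (fst p - fst q)))" by (rule i(1)[OF _ _ _ q]) auto
    show "strip_kernel t p q = enn2ereal (newtE m (norm (fst p - fst q))) + ereal (stripH m t (norm (fst p - fst q)))"
      if "p \<in> space \<mu>" for p using ker that q by (simp add: sp)
  qed measurable
  show ?thesis unfolding measure_energy_def energy2_def
  proof (rule ereal_integral_add)
    show "integrable \<mu> (\<lambda>q. \<integral>p. stripH m t (norm (fst p - fst q)) \<partial>\<mu>)" by (rule i(2)) auto
  qed (use inner in measurable)
qed

section \<open>Strip energy and equilibrium measure in terms of V and opt\<close>

locale strip_set = flat_set K m for K :: "((real^'n) \<times> real) set" and m
begin

lemma card: "CARD('n) = m + 1" using dim by simp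

text \<open>Interpreting \<open>strip_rv\<close> below brings in another fact named
  \<open>R\<close>; the bound on \<open>K\<close> stays accessible under this name.\<close>

lemmas radius = R

lemma energy_Ad: "t > 0 \<Longrightarrow> \<mu> \<in> Ad \<Longrightarrow> measure_energy t \<mu> = ereal (J t \<mu>)"
proof -
  assume t: "t > 0" and mu: "\<mu> \<in> Ad"
  have "enn2ereal (E2 \<mu>) = ereal (enn2real (E2 \<mu>))"
    using Ad_fin[OF mu] enn2ereal_ennreal[of "enn2real (E2 \<mu>)"] by simp
  then show ?thesis
    using measure_energy_eq[OF card m t compact_K flat Ad_bpm[OF mu]] by (simp add: J_def dbl_def)
qed

lemma energy_not_Ad: "t > 0 \<Longrightarrow> \<mu> \<in> borel_prob_measures K \<Longrightarrow> \<mu> \<notin> Ad \<Longrightarrow> measure_energy t \<mu> = \<infinity>"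
  using measure_energy_eq[OF card m _ compact_K flat, of t \<mu>] by (simp add: Ad_def less_top[symmetric])

lemma strip_energy_eq: assumes t: "t > 0" shows "strip_energy t K = ereal (V t)"
  unfolding strip_energy_def
proof (rule antisym)
  show "(INF \<mu>\<in>borel_prob_measures K. measure_energy t \<mu>) \<le> ereal (V t)"
    using INF_lower[OF Ad_bpm[OF opt(1)[OF t]], of "measure_energy t"] energy_Ad[OF t opt(1)[OF t]] opt(2)[OF t] by simp
  show "ereal (V t) \<le> (INF \<mu>\<in>borel_prob_measures K. measure_energy t \<mu>)"
  proof (rule INF_greatest)
    fix \<mu> assume "\<mu> \<in> borel_prob_measures K"
    then show "ereal (V t) \<le> measure_energy t \<mu>"
      using energy_not_Ad[OF t, of \<mu>] energy_Ad[OF t, of \<mu>] V_le[OF t, of \<mu>] by (cases "\<mu> \<in> Ad") auto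
  qed
qed

lemma strip_energy_transform:
  assumes t: "t > 0" and d: "((\<lambda>s. h s (V s)) has_real_derivative D) (at t)"
  shows "((\<lambda>s. h s (real_of_ereal (strip_energy s K))) has_real_derivative D) (at t)"
proof (rule has_field_derivative_transform_within_open[OF d])
  show "open {0::real<..}" "t \<in> {0<..}" using t by simp_all
  show "h s (V s) = h s (real_of_ereal (strip_energy s K))" if "s \<in> {0<..}" for s
    using strip_energy_eq[of s] that by simp
qed

lemma is_equilibrium_iff: assumes t: "t > 0" shows "is_equilibrium_measure t K \<mu> \<longleftrightarrow> \<mu> = opt t"
proof
  assume h: "is_equilibrium_measure t K \<mu>"
  then have b: "\<mu> \<in> borel_prob_measures K" "measure_energy t \<mu> = ereal (V t)"
    by (auto simp: is_equilibrium_measure_def strip_energy_eq[OF t])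
  then have "\<mu> \<in> Ad" using energy_not_Ad[OF t b(1)] by auto
  with b show "\<mu> = opt t" using energy_Ad[OF t] opt(3)[OF t] by auto
next
  assume "\<mu> = opt t"
  then show "is_equilibrium_measure t K \<mu>"
    using Ad_bpm[OF opt(1)[OF t]] energy_Ad[OF t opt(1)[OF t]] opt(2)[OF t]
    by (simp add: is_equilibrium_measure_def strip_energy_eq[OF t])
qed

lemma equilibrium_measure_eq: "t > 0 \<Longrightarrow> equilibrium_measure t K = opt t"
  unfolding equilibrium_measure_def by (rule the_equality) (simp_all add: is_equilibrium_iff)

section \<open>The equilibrium potential off the plane\<close>

context
  fixes t :: real assumes t: "t > 0"
begin

interpretation strip_rv "opt t" fst m t R
proof (rule strip_rv.intro[OF rv_pair strip_rv_axioms.intro])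
  show "opt t \<in> borel_prob_measures K" "opt t \<in> borel_prob_measures K" using Ad_bpm[OF opt(1)[OF t]] by auto
  show "t > 0" by (rule t)
  show "energy2 m (opt t) fst (opt t) fst < \<infinity>" using opt(1)[OF t] by (simp add: Ad_def)
  show "norm (fst p) \<le> R" if "p \<in> space (opt t)" for p
    using that R(2) borel_prob_measuresD(3)[OF Ad_bpm[OF opt(1)[OF t]]] by simp
qed

definition upot :: "real^'n \<Rightarrow> real \<Rightarrow> real" where
  "upot y s = (\<integral>q. newt m (norm (y - fst q)) s + stripK m t s (norm (y - fst q)) \<partial>opt t)"

lemma dist_bound: "q \<in> space (opt t) \<Longrightarrow> \<bar>norm (y - fst q)\<bar> \<le> norm y + R"
  using norm_triangle_ineq4[of y "fst q"] borel_prob_measuresD(3)[OF Ad_bpm[OF opt(1)[OF t]]] radius(2)[of q] by simp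

lemma upot_integrable:
  assumes "0 < \<bar>s\<bar>" "\<bar>s\<bar> < t"
  shows "integrable (opt t) (\<lambda>q. newt m (norm (y - fst q)) s)" "integrable (opt t) (\<lambda>q. stripK m t s (norm (y - fst q)))"
proof -
  have "norm y + R \<ge> 0" using radius(1) norm_ge_zero[of y] by linarith
  then obtain C where C: "\<And>z r. \<lbrakk>\<bar>z\<bar> \<le> t; \<bar>r\<bar> \<le> norm y + R\<rbrakk> \<Longrightarrow> \<bar>stripK m t z r\<bar> \<le> C"
    using stripK_props[OF m _ t] by metis
  show "integrable (opt t) (\<lambda>q. newt m (norm (y - fst q)) s)"
    using newt_le[OF assms(1), of m] by (intro M.integrable_const_bound[where B = "1 / \<bar>s\<bar> ^ m"]) (auto simp: newt_nonneg newt_abs)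
  show "integrable (opt t) (\<lambda>q. stripK m t s (norm (y - fst q)))"
  proof (rule M.integrable_const_bound[where B = C])
    show "AE q in opt t. norm (stripK m t s (norm (y - fst q))) \<le> C" using C[of s] assms dist_bound[of _ y] by simp
  qed (unfold stripK_def, measurable)
qed

lemma equilibrium_potential_eq:
  assumes "0 < \<bar>s\<bar>" "\<bar>s\<bar> < t"
  shows "equilibrium_potential t K (y, s) = ereal (upot y s)"
proof -
  \<comment> \<open>Off the plane the kernel takes no infinite value, so the nonnegative summand in
    \<open>ereal_integral_add\<close> is zero.\<close>
  have "ereal_integral (opt t) (\<lambda>q. strip_kernel t (y, s) q) = enn2ereal (\<integral>\<^sup>+q. 0 \<partial>opt t) + ereal (upot y s)"
    unfolding upot_def
  proof (rule ereal_integral_add)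
    fix q assume "q \<in> space (opt t)"
    then have q: "snd q = 0" using borel_prob_measuresD(3)[OF Ad_bpm[OF opt(1)[OF t]]] flat by simp
    with assms have "(y, s) \<noteq> q" by auto
    then show "strip_kernel t (y, s) q = enn2ereal 0 + ereal (newt m (norm (y - fst q)) s + stripK m t s (norm (y - fst q)))"
      using strip_kernel_eq[OF card m, of "(y, s)" t q] assms(2) q by (simp add: zero_ennreal.rep_eq)
  qed (use upot_integrable[OF assms] in auto)
  then show ?thesis by (simp add: equilibrium_potential_def equilibrium_measure_eq[OF t] zero_ennreal.rep_eq)
qed

lemma upot_even: "upot y (- s) = upot y s"
  by (simp add: upot_def stripK_def newt_abs add.commute)

text \<open>Differentiation under the integral by means of remainders: the singular kernel has a
  uniform second order remainder at heights above z / 2, the images have one throughout the strip by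
  \<open>stripK_props\<close>, and both are integrated against the probability measure.\<close>

lemma upot_deriv:
  assumes z: "0 < z" "z < t"
  shows "(upot y has_real_derivative - real m * W y z) (at z)"
proof -
  have R': "norm y + R \<ge> 0" using radius(1) norm_ge_zero[of y] by linarith
  obtain C where C: "C \<ge> 0"
    "\<And>z w r. \<lbrakk>\<bar>z\<bar> < t; \<bar>w\<bar> < t; \<bar>r\<bar> \<le> norm y + R\<rbrakk> \<Longrightarrow>
       \<bar>stripK m t w r - stripK m t z r - (w - z) * (- real m * (stripV m t z r - pois m r z))\<bar> \<le> C * (w - z)\<^sup>2"
    using stripK_props[OF m R' t] by metis
  \<comment> \<open>Keeps \<open>w\<close> above z / 2, away from the singularity, and below
    t.\<close>
  define d where "d = min (z / 2) (t - z)"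
  define D where "D = real m * (real (m + 3) / (z / 2) ^ (m + 2))"
  show ?thesis
  proof (rule deriv_from_remainder[where C = "D + C"])
  show "d > 0" using z by (simp add: d_def)
  fix w assume "\<bar>w - z\<bar> < d"
  then have "\<bar>w - z\<bar> < z / 2" "\<bar>w - z\<bar> < t - z" by (auto simp: d_def)
  then have wz: "z / 2 < w" "w < t" "0 < w" using z by linarith+
  have newt_rem: "\<bar>newt m r w - newt m r z - (w - z) * (- real m * pois m r z)\<bar> \<le> D * (w - z)\<^sup>2" for r
  proof (rule lipschitz_remainder[where S = "{z / 2..}"])
    show "(newt m r has_real_derivative - real m * pois m r x) (at x)" if "x \<in> {z / 2..}" for x
      using that z by (intro newt_deriv) auto
    fix a b assume ab: "a \<in> {z / 2..}" "b \<in> {z / 2..}"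
    have "\<bar>- real m * pois m r a - - real m * pois m r b\<bar> = real m * \<bar>pois m r a - pois m r b\<bar>"
    proof -
      have "- real m * pois m r a - - real m * pois m r b = - (real m * (pois m r a - pois m r b))" by (simp add: algebra_simps)
      then show ?thesis by (simp add: abs_mult)
    qed
    also have "\<dots> \<le> real m * (real (m + 3) / sqrt (r\<^sup>2 + (z / 2)\<^sup>2) ^ (m + 2) * \<bar>a - b\<bar>)"
      using ab z by (intro mult_left_mono pois_lipschitz) auto
    also have "\<dots> \<le> real m * (real (m + 3) / (z / 2) ^ (m + 2) * \<bar>a - b\<bar>)"
    proof (intro mult_left_mono mult_right_mono divide_left_mono power_mono sqrt_ge_right)
      have "0 < z / 2" using z by simp
      moreover have "0 < sqrt (r\<^sup>2 + (z / 2)\<^sup>2)" using sqrt_ge_right[of "z / 2" r] \<open>0 < z / 2\<close> by linarith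
      ultimately show "0 < sqrt (r\<^sup>2 + (z / 2)\<^sup>2) ^ (m + 2) * (z / 2) ^ (m + 2)"
        by (intro mult_pos_pos zero_less_power)
    qed (use z in auto)
    finally show "\<bar>- real m * pois m r a - - real m * pois m r b\<bar> \<le> D * \<bar>a - b\<bar>" by (simp only: D_def mult.assoc)
  qed (use z wz in auto)
  define f where "f s q = newt m (norm (y - fst q)) s + stripK m t s (norm (y - fst q))" for s and q :: "(real^'n) \<times> real"
  define v where "v q = stripV m t z (norm (y - fst q))" for q :: "(real^'n) \<times> real"
  have fi: "integrable (opt t) (f w)" "integrable (opt t) (f z)" unfolding f_def using upot_integrable[of w y] upot_integrable[of z y] z wz by auto
  have vi: "integrable (opt t) v" unfolding v_def by (rule W_eq(2)[OF z])
  have Wv: "W y z = (\<integral>q. v q \<partial>opt t)" unfolding v_def by (rule W_eq(1)[OF z])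
  have "upot y w - upot y z - (w - z) * (- real m * W y z) = (\<integral>q. f w q - f z q - (w - z) * (- real m * v q) \<partial>opt t)"
    unfolding upot_def f_def[symmetric] Wv using fi vi by simp
  also have "\<bar>\<dots>\<bar> \<le> (\<integral>q. (D + C) * (w - z)\<^sup>2 \<partial>opt t)"
  proof (rule order.trans[OF integral_abs_bound], rule integral_mono)
    fix q assume q: "q \<in> space (opt t)"
    define r where "r = norm (y - fst q)"
    have rr: "\<bar>r\<bar> \<le> norm y + R" using dist_bound[OF q] by (simp add: r_def)
    have "f w q - f z q - (w - z) * (- real m * v q) = (newt m r w - newt m r z - (w - z) * (- real m * pois m r z))
       + (stripK m t w r - stripK m t z r - (w - z) * (- real m * (stripV m t z r - pois m r z)))"
      unfolding f_def v_def r_def[symmetric] by (simp add: algebra_simps)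
    also have "\<bar>\<dots>\<bar> \<le> D * (w - z)\<^sup>2 + C * (w - z)\<^sup>2"
      using z wz rr by (intro order.trans[OF abs_triangle_ineq] add_mono newt_rem C(2)) auto
    finally show "\<bar>f w q - f z q - (w - z) * (- real m * v q)\<bar> \<le> (D + C) * (w - z)\<^sup>2" by (simp add: distrib_right)
  qed (use fi vi in auto)
  finally show "\<bar>upot y w - upot y z - (w - z) * (- real m * W y z)\<bar> \<le> (D + C) * (w - z)\<^sup>2" by (simp add: M.prob_space)
  qed
qed

lemma dz_equilibrium_potential:
  assumes z: "0 < z" "z < t"
  shows "dz (equilibrium_potential t K) (y, z) = - real m * W y z" "dz (equilibrium_potential t K) (y, - z) = real m * W y z"
proof -
  have eq: "upot y s = real_of_ereal (equilibrium_potential t K (y, s))" if "0 < \<bar>s\<bar>" "\<bar>s\<bar> < t" for s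
    using equilibrium_potential_eq[OF that] by simp
  have "((\<lambda>s. real_of_ereal (equilibrium_potential t K (y, s))) has_real_derivative - real m * W y z) (at z)"
    by (rule has_field_derivative_transform_within_open[OF upot_deriv[OF z], of "{0<..<t}"]) (use z eq in auto)
  then show "dz (equilibrium_potential t K) (y, z) = - real m * W y z" by (simp add: dz_def DERIV_imp_deriv)
  have "(upot y has_real_derivative - real m * W y z) (at (- (- z)))" using upot_deriv[OF z] by simp
  then have "((\<lambda>s. upot y (- s)) has_real_derivative - (- real m * W y z)) (at (- z))" by (subst (asm) DERIV_mirror)
  then have u: "(upot y has_real_derivative real m * W y z) (at (- z))" by (simp add: upot_even)
  have "((\<lambda>s. real_of_ereal (equilibrium_potential t K (y, s))) has_real_derivative real m * W y z) (at (- z))"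
    by (rule has_field_derivative_transform_within_open[OF u, of "{-t<..<0}"]) (use z eq in auto)
  then show "dz (equilibrium_potential t K) (y, - z) = real m * W y z" by (simp add: dz_def DERIV_imp_deriv)
qed

text \<open>The two halves of the strip contribute equally and the plane z = 0 is a null set. The
  constant is 2 m^2 S / (2m) = m S, where S is half of the sphere area.\<close>

lemma strip_integral:
  "has_bochner_integral lebesgue (\<lambda>p. indicator (strip t) p *\<^sub>R (dz (equilibrium_potential t K) p)\<^sup>2)
     (real m * sphere_area (m + 1) / 2 * (enn2real (E2 (opt t)) + dbl (stripT' m t) (opt t)))"
proof -
  define E where "E = enn2real (E2 (opt t)) + dbl (stripT' m t) (opt t)"
  define f where "f x = indicator {0<..<t} (snd x) * (W (fst x) (snd x))\<^sup>2" for x :: "(real^'n) \<times> real"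
  have f: "has_bochner_integral (lborel \<Otimes>\<^sub>M lborel) f (S / (2 * real m) * E)"
    unfolding f_def E_def dbl_def by (rule W_square_integral)
  have fr: "has_bochner_integral (lborel \<Otimes>\<^sub>M lborel) (\<lambda>x. f (fst x, - snd x)) (S / (2 * real m) * E)"
    by (rule has_bochner_integral_reflect[OF f]) (simp add: f_def)
  have "has_bochner_integral (lborel \<Otimes>\<^sub>M lborel) (\<lambda>x. (real m)\<^sup>2 * (f x + f (fst x, - snd x))) ((real m)\<^sup>2 * (S / (2 * real m) * E + S / (2 * real m) * E))"
    by (intro has_bochner_integral_mult_right has_bochner_integral_add f fr)
  also have "(real m)\<^sup>2 * (S / (2 * real m) * E + S / (2 * real m) * E) = real m * sphere_area (m + 1) / 2 * E"
    using m by (simp add: power2_eq_square field_simps)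
  finally have h: "has_bochner_integral lborel (\<lambda>x. (real m)\<^sup>2 * (f x + f (fst x, - snd x))) (real m * sphere_area (m + 1) / 2 * E)"
    by (simp only: lborel_prod)
  have "AE x in lborel \<Otimes>\<^sub>M lborel. snd (x :: (real^'n) \<times> real) \<noteq> 0"
  proof (rule lborel_pair.AE_pair_measure)
    show "{x \<in> space (lborel \<Otimes>\<^sub>M lborel). snd (x :: (real^'n) \<times> real) \<noteq> 0} \<in> sets (lborel \<Otimes>\<^sub>M lborel)" by measurable
  qed (use AE_lborel_singleton in auto)
  then have nz: "AE x in lborel. snd (x :: (real^'n) \<times> real) \<noteq> 0" by (simp only: lborel_prod)
  have "AE x in lborel. indicator (strip t) x *\<^sub>R (dz (equilibrium_potential t K) x)\<^sup>2 = (real m)\<^sup>2 * (f x + f (fst x, - snd x))"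
    using nz
  proof eventually_elim
    case (elim x)
    obtain y z where x: "x = (y, z)" by force
    consider "0 < z" "z < t" | "z < 0" "- t < z" | "z \<ge> t" | "z \<le> - t" using elim x by fastforce
    then show ?case
    proof cases
      case 1
      then show ?thesis using dz_equilibrium_potential(1)[OF 1, of y] by (simp add: x f_def strip_def power_mult_distrib)
    next
      case 2
      then show ?thesis using dz_equilibrium_potential(2)[of "- z" y] by (simp add: x f_def strip_def power_mult_distrib)
    qed (use t in \<open>auto simp: x f_def strip_def\<close>)
  qed
  from has_bochner_integral_completion_AE[OF h this] show ?thesis unfolding E_def .
qed

end

text \<open>The product rule gives V + t V'. Since \<open>stripT'\<close> equals
  \<open>stripH\<close> + t \<open>stripH'\<close>, the regular parts combine and the singular
  energy remains once.\<close>

lemma tV_deriv: assumes t: "t > 0"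
  shows "((\<lambda>s. s * V s) has_real_derivative enn2real (E2 (opt t)) + dbl (stripT' m t) (opt t)) (at t)"
proof -
  have "((\<lambda>s. s * V s) has_real_derivative 1 * V t + dbl (stripH' m t) (opt t) * t) (at t)"
    by (rule DERIV_mult[OF DERIV_ident V_deriv[OF t]])
  moreover have "1 * V t + dbl (stripH' m t) (opt t) * t = enn2real (E2 (opt t)) + dbl (stripT' m t) (opt t)"
  proof -
    have "stripT' m t = (\<lambda>r. 1 * stripH m t r + t * stripH' m t r)"
      using t by (auto simp: stripH_def stripH'_def field_simps power2_eq_square)
    then have "dbl (stripT' m t) (opt t) = 1 * dbl (stripH m t) (opt t) + t * dbl (stripH' m t) (opt t)"
      using dbl_linear[OF Ad_bpm[OF opt(1)[OF t]] continuous_stripH[OF m t], of 1 t] by simp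
    then show ?thesis using opt(2)[OF t] by (simp add: J_def)
  qed
  ultimately show ?thesis by (simp only:)
qed

end

theorem theorem3p1:
  fixes K\<^sub>0 :: "(real^'n) set" and K :: "((real^'n) \<times> real) set"
  assumes "CARD('n) \<ge> 2"
    and "compact K\<^sub>0" and "K = K\<^sub>0 \<times> {0}"
    and "\<exists>t>0. \<bar>strip_energy t K\<bar> \<noteq> \<infinity>"
  shows "(\<forall>t>0. \<bar>strip_energy t K\<bar> \<noteq> \<infinity>)
    \<and> (\<lambda>t. real_of_ereal (strip_energy t K)) C1_differentiable_on {0<..}
    \<and> (\<forall>t>0. (\<exists>!\<mu>. is_equilibrium_measure t K \<mu>)
          \<and> set_integrable lebesgue (strip t) (\<lambda>p. (dz (equilibrium_potential t K) p)\<^sup>2)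
          \<and> ((\<lambda>s. s * real_of_ereal (strip_energy s K)) has_real_derivative
               2 * (1 / ((real CARD('n) - 1) * sphere_area CARD('n)))
                 * (LINT p:strip t|lebesgue. (dz (equilibrium_potential t K) p)\<^sup>2)) (at t))"
proof -
  define m where "m = CARD('n) - 1"
  have n: "CARD('n) = m + 1" and m: "m \<ge> 1" using assms(1) by (auto simp: m_def)
  have K: "compact K" unfolding assms(3) by (rule compact_Times[OF assms(2)]) simp
  have flat: "snd p = 0" if "p \<in> K" for p using that unfolding assms(3) by (rule mem_Times_iff[THEN iffD1, THEN conjunct2, THEN singletonD])
  \<comment> \<open>If every measure had infinite singular energy, all strip energies would be
    infinite for every t, because the regular part is finite. This also excludes the empty set,
    whose infimum is infinite.\<close>
  have ex: "\<exists>\<mu>\<in>borel_prob_measures K. energy2 m \<mu> fst \<mu> fst < \<infinity>"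
  proof (rule ccontr)
    assume inf: "\<not> ?thesis"
    obtain t where t: "t > 0" "\<bar>strip_energy t K\<bar> \<noteq> \<infinity>" using assms(4) by (elim exE conjE)
    have "measure_energy t \<mu> = \<infinity>" if mu: "\<mu> \<in> borel_prob_measures K" for \<mu>
    proof -
      have "energy2 m \<mu> fst \<mu> fst = \<infinity>" using inf mu by (metis infinity_ennreal_def less_top)
      moreover have "measure_energy t \<mu> = enn2ereal (energy2 m \<mu> fst \<mu> fst) + ereal (\<integral>q. \<integral>p. stripH m t (norm (fst p - fst q)) \<partial>\<mu> \<partial>\<mu>)"
        by (rule measure_energy_eq[OF n m t(1) K flat mu])
      ultimately show ?thesis by simp
    qed
    then have "strip_energy t K \<ge> \<infinity>" unfolding strip_energy_def by (intro INF_greatest) simp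
    then show False using t(2) by simp
  qed
  have ss: "strip_set K m"
  proof (rule strip_set.intro, rule flat_set.intro)
    show "DIM(real^'n) = m + 1" using n by simp
  qed (rule K flat m ex; assumption)+
  interpret strip_set K m by (rule ss)
  show ?thesis
  proof (intro conjI allI impI)
    show "\<bar>strip_energy t K\<bar> \<noteq> \<infinity>" if "t > 0" for t using strip_energy_eq[OF that] by simp
    show "(\<lambda>t. real_of_ereal (strip_energy t K)) C1_differentiable_on {0<..}"
      unfolding C1_differentiable_on_def
    proof (rule exI[of _ "\<lambda>t. dbl (stripH' m t) (opt t)"], rule conjI, rule ballI)
      fix t :: real assume "t \<in> {0<..}"
      then have t: "t > 0" by simp
      show "((\<lambda>t. real_of_ereal (strip_energy t K)) has_vector_derivative dbl (stripH' m t) (opt t)) (at t)"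
        unfolding has_real_derivative_iff_has_vector_derivative[symmetric]
        by (rule strip_energy_transform[OF t, where h = "\<lambda>s v. v", OF V_deriv[OF t]])
    qed (rule V'_continuous)
    fix t :: real assume t: "t > 0"
    show "\<exists>!\<mu>. is_equilibrium_measure t K \<mu>" by (simp add: is_equilibrium_iff[OF t])
    show "set_integrable lebesgue (strip t) (\<lambda>p. (dz (equilibrium_potential t K) p)\<^sup>2)"
      using strip_integral[OF t] by (simp add: set_integrable_def has_bochner_integral_iff)
    have lint: "(LINT p:strip t|lebesgue. (dz (equilibrium_potential t K) p)\<^sup>2)
      = real m * sphere_area (m + 1) / 2 * (enn2real (E2 (opt t)) + dbl (stripT' m t) (opt t))"
      using strip_integral[OF t] by (simp add: set_lebesgue_integral_def has_bochner_integral_iff)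
    \<comment> \<open>The constant 2 a_n is the inverse of m |S^n| / 2, the factor in
      \<open>strip_integral\<close>.\<close>
    have e: "2 * (1 / ((real CARD('n) - 1) * sphere_area CARD('n))) * (LINT p:strip t|lebesgue. (dz (equilibrium_potential t K) p)\<^sup>2)
      = enn2real (E2 (opt t)) + dbl (stripT' m t) (opt t)"
      unfolding lint n using m sphere_area_pos[of "m + 1"] by simp
    show "((\<lambda>s. s * real_of_ereal (strip_energy s K)) has_real_derivative
               2 * (1 / ((real CARD('n) - 1) * sphere_area CARD('n)))
                 * (LINT p:strip t|lebesgue. (dz (equilibrium_potential t K) p)\<^sup>2)) (at t)"
      unfolding e
      by (rule strip_energy_transform[OF t, where h = "\<lambda>s v. s * v", OF tV_deriv[OF t]])
  qed
qed

end
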